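(* There exists a smooth divergence-free vector field $u_0\in H^1_x(\mathbf{R}^3)$, $u_0:\mathbf{R}^3\to\mathbf{R}^3$, such that for every $T>0$ there does not exist any smooth finite energy solution $(u,p,u_0,0,T)$ to the Navier-Stokes system with initial velocity $u_0$ and zero forcing term.
   Context: A smooth finite energy solution $(u,p,u_0,0,T)$ with $0<T<\infty$ consists of a smooth divergence-free $u_0\in L^2_x(\mathbf{R}^3)$ and functions $u:[0,T]\times\mathbf{R}^3\to\mathbf{R}^3$, $p:[0,T]\times\mathbf{R}^3\to\mathbf{R}$ that are smooth on $[0,T]\times\mathbf{R}^3$ (including at the initial time $t=0$), obey $\partial_tu+(u\cdot\nabla)u=\Delta u-\nabla p$ and $\nabla\cdot u=0$ on $[0,T]\times\mathbf{R}^3$, satisfy $u(0,x)=u_0(x)$ for all $x\in\mathbf{R}^3$, and satisfy $\|u\|_{L^\infty_tL^2_x([0,T]\times\mathbf{R}^3)}<\infty$. *)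

theory Defs
  imports "HOL-Analysis.Analysis"
begin

text \<open>
  \<open>Ck_on k S f\<close>: \<open>f\<close> is \<open>k\<close> times continuously differentiable on \<open>S\<close>, with derivatives taken
  relative to \<open>S\<close>. It is used for \<open>S = UNIV\<close> and for slabs \<open>{0..T} \<times> UNIV\<close> with \<open>T > 0\<close>, where
  the relative derivative is unique; at the faces \<open>t = 0\<close> and \<open>t = T\<close> it is one-sided in time, so
  smoothness on a slab is smoothness up to and including its boundary. Values outside \<open>S\<close>
  play no role.
\<close>

primrec Ck_on ::
  "nat \<Rightarrow> 'a::real_normed_vector set \<Rightarrow> ('a \<Rightarrow> 'b::real_normed_vector) \<Rightarrow> bool" where
  "Ck_on 0 S f \<longleftrightarrow> continuous_on S f"
| "Ck_on (Suc k) S f \<longleftrightarrow>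
     f differentiable_on S \<and> (\<forall>v. Ck_on k S (\<lambda>x. frechet_derivative f (at x within S) v))"

definition smooth_on ::
  "'a::real_normed_vector set \<Rightarrow> ('a \<Rightarrow> 'b::real_normed_vector) \<Rightarrow> bool" where
  "smooth_on S f \<longleftrightarrow> (\<forall>k. Ck_on k S f)"

definition partial :: "'n \<Rightarrow> (real^'n::finite \<Rightarrow> 'b::real_normed_vector) \<Rightarrow> real^'n \<Rightarrow> 'b" where
  "partial i f x = frechet_derivative f (at x) (axis i 1)"

definition gradient :: "(real^'n::finite \<Rightarrow> real) \<Rightarrow> real^'n \<Rightarrow> real^'n" where
  "gradient f x = (\<chi> i. partial i f x)"

definition divergence :: "(real^'n::finite \<Rightarrow> real^'n) \<Rightarrow> real^'n \<Rightarrow> real" where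
  "divergence v x = (\<Sum>i\<in>UNIV. partial i (\<lambda>y. v y $ i) x)"

definition laplacian :: "(real^'n::finite \<Rightarrow> 'b::real_normed_vector) \<Rightarrow> real^'n \<Rightarrow> 'b" where
  "laplacian f x = (\<Sum>i\<in>UNIV. partial i (partial i f) x)"

definition advection ::
  "(real^'n::finite \<Rightarrow> real^'n) \<Rightarrow> (real^'n \<Rightarrow> 'b::real_normed_vector) \<Rightarrow> real^'n \<Rightarrow> 'b" where
  "advection v f x = (\<Sum>i\<in>UNIV. (v x $ i) *\<^sub>R partial i f x)"

definition divergence_free :: "(real^'n::finite \<Rightarrow> real^'n) \<Rightarrow> bool" where
  "divergence_free v \<longleftrightarrow> (\<forall>x. divergence v x = 0)"

definition in_L2 :: "('a::euclidean_space \<Rightarrow> 'b::euclidean_space) \<Rightarrow> bool" where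
  "in_L2 f \<longleftrightarrow> f \<in> borel_measurable lebesgue \<and> integrable lebesgue (\<lambda>x. (norm (f x))\<^sup>2)"

text \<open>Only meaningful for functions satisfying \<^const>\<open>in_L2\<close>.\<close>

definition L2_norm :: "('a::euclidean_space \<Rightarrow> 'b::euclidean_space) \<Rightarrow> real" where
  "L2_norm f = sqrt (\<integral>x. (norm (f x))\<^sup>2 \<partial>lebesgue)"

definition test_function :: "('a::euclidean_space \<Rightarrow> real) \<Rightarrow> bool" where
  "test_function \<phi> \<longleftrightarrow> smooth_on UNIV \<phi> \<and> compact (closure {x. \<phi> x \<noteq> 0})"

text \<open>
  \<open>g\<close> is the \<open>i\<close>-th weak partial derivative of \<open>f\<close>. It is used for \<open>f\<close> and \<open>g\<close> in \<open>L\<^sup>2\<close>, so that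
  both integrands are integrable.
\<close>

definition weak_partial ::
  "'n \<Rightarrow> (real^'n::finite \<Rightarrow> 'b::euclidean_space) \<Rightarrow> (real^'n \<Rightarrow> 'b) \<Rightarrow> bool" where
  "weak_partial i f g \<longleftrightarrow>
     (\<forall>\<phi>. test_function \<phi> \<longrightarrow>
        (\<integral>x. partial i \<phi> x *\<^sub>R f x \<partial>lebesgue) = - (\<integral>x. \<phi> x *\<^sub>R g x \<partial>lebesgue))"

definition in_H1 :: "(real^'n::finite \<Rightarrow> 'b::euclidean_space) \<Rightarrow> bool" where
  "in_H1 f \<longleftrightarrow> in_L2 f \<and> (\<forall>i. \<exists>g. in_L2 g \<and> weak_partial i f g)"

text \<open>
  Finiteness of the \<open>L\<^sup>\<infinity>\<^sub>t L\<^sup>2\<^sub>x\<close> norm on \<open>[0,T] \<times> \<real>\<^sup>n\<close>: the essential supremum over \<open>t\<close>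
  of the \<open>L\<^sup>2\<close> norm in \<open>x\<close> is finite.
\<close>

definition finite_Linf_L2 ::
  "real \<Rightarrow> (real \<Rightarrow> 'a::euclidean_space \<Rightarrow> 'b::euclidean_space) \<Rightarrow> bool" where
  "finite_Linf_L2 T u \<longleftrightarrow>
     (\<exists>C. AE t in lebesgue_on {0..T}. in_L2 (u t) \<and> L2_norm (u t) \<le> C)"

text \<open>
  Smooth finite energy solution \<open>(u, p, u0, 0, T)\<close> of the Navier-Stokes system with unit viscosity
  and zero forcing. The functions \<open>u\<close> and \<open>p\<close> are total, but only their values for
  \<open>t \<in> {0..T}\<close> matter; the time derivative is one-sided at \<open>t = 0\<close> and \<open>t = T\<close>.
\<close>

definition smooth_finite_energy_solution ::
  "(real \<Rightarrow> real^3 \<Rightarrow> real^3) \<Rightarrow> (real \<Rightarrow> real^3 \<Rightarrow> real) \<Rightarrow> (real^3 \<Rightarrow> real^3) \<Rightarrow> real \<Rightarrow> bool" where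
  "smooth_finite_energy_solution u p u0 T \<longleftrightarrow>
     0 < T \<and>
     smooth_on UNIV u0 \<and> divergence_free u0 \<and> in_L2 u0 \<and>
     smooth_on ({0..T} \<times> UNIV) (\<lambda>(t, x). u t x) \<and>
     smooth_on ({0..T} \<times> UNIV) (\<lambda>(t, x). p t x) \<and>
     (\<forall>t\<in>{0..T}. \<forall>x.
        vector_derivative (\<lambda>s. u s x) (at t within {0..T}) + advection (u t) (u t) x
          = laplacian (u t) x - gradient (p t) x) \<and>
     (\<forall>t\<in>{0..T}. divergence_free (u t)) \<and>
     (\<forall>x. u 0 x = u0 x) \<and>
     finite_Linf_L2 T u"

end

theory Submission
  imports Defs
begin

text \<open>
 Let \<open>q(t)\<close> be the mean of \<open>-\<partial>\<^sub>1 p(t)\<close> against \<open>-\<Delta>\<Phi>\<close>, where \<open>\<Phi>\<close> is a regularised Newton potential. Finite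
 energy determines the pressure gradient nonlocally by the velocity, \<open>q = \<integral> u\<^sub>a u\<^sub>b \<partial>\<^sub>a\<partial>\<^sub>b\<partial>\<^sub>1\<Phi>\<close>, and
 smoothness up to \<open>t = 0\<close> forces \<open>q(0) - 2 q(t) + q(2t) = O(t\<^sup>2)\<close>. Adding to the datum a far away
 divergence-free packet \<open>b\<close> of frequency \<open>N\<close> and size \<open>\<epsilon>/N\<close> breaks this with constant \<open>n\<close>: at times
 \<open>t \<sim> N\<^sup>-\<^sup>2\<close> the flow is \<open>V + exp(-N\<^sup>2t) b\<close> up to \<open>O(N\<^sup>-\<^sup>2)\<close> in \<open>L\<^sup>2\<close>, so \<open>b\<close> contributes a second difference
 of order \<open>\<epsilon>\<^sup>2 N\<^sup>-\<^sup>2\<close>, while \<open>n t\<^sup>2\<close> is of order \<open>N\<^sup>-\<^sup>4\<close> and the interaction with the old datum \<open>V\<close> of order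
 \<open>N\<^sup>-\<^sup>3\<close>. The sum of such packets, one for each \<open>n\<close>, locally finite and small in \<open>H\<^sup>1\<close>, is the datum.

 The comparison of the flow with \<open>V + exp(-N\<^sup>2t) b\<close> is weak-strong uniqueness. It needs the energy
 inequality, which is not part of the definition of a finite energy solution. It follows from the
 local energy identity on large balls: there the pressure is bounded through the Newton potential of
 the stress, and the cubic terms through \<open>L\<^sup>4\<close> bounds that are absorbed by the dissipation on
 slightly larger balls.
\<close>

section \<open>Differential calculus\<close>

text \<open>The second time derivative of \<open>q\<close> at 0 sees a packet of frequency
  \<open>N\<close> and size \<open>\<epsilon>/N\<close> with weight \<open>\<epsilon>^2 N^2\<close>,
  while the H^1 norm of the packet is only of order \<open>\<epsilon>\<close>. Packets that are
  small in H^1 can therefore destroy the regularity of the pressure at \<open>t = 0\<close>,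
  although the datum is smooth near every point: they act from far away through the nonlocal kernel.
  The constant in \<open>O(t^2)\<close> belongs to an unknown solution, so no single packet is
  decisive. Each refutation is made stable instead: it excludes every solution whose datum lies
  within an L^2 distance \<open>\<delta>\<close> of the current field, and the later packets are
  kept below that distance. This forces all constants to be chosen before the solution, and explains
  why several lemmas are existential statements that quantify over all solutions. The time scale
  \<open>N^-2\<close> is the one on which the damping of the packet is visible while the comparison
  error is still \<open>O(t)\<close>. The pressure bounds rest on potentials regularised at two
  scales: their difference has bounded support and is a legitimate test function, and in L^2 its
  Hessian is controlled by its Laplacian.\<close>

abbreviation total :: "('i::finite \<Rightarrow> 'a::comm_monoid_add) \<Rightarrow> 'a" (binder "\<Oplus>" 10) where
 "total f \<equiv> sum f UNIV"

lemmas cont_borel = borel_measurable_continuous_onI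

abbreviation Ck :: "nat \<Rightarrow> ('a::real_normed_vector \<Rightarrow> 'b::real_normed_vector) \<Rightarrow> bool" where
 "Ck k \<equiv> Ck_on k UNIV"

abbreviation cont :: "('a::topological_space \<Rightarrow> 'b::topological_space) \<Rightarrow> bool" where
 "cont \<equiv> continuous_on UNIV"

abbreviation integ :: "('a::euclidean_space \<Rightarrow> 'b::{banach, second_countable_topology}) \<Rightarrow> bool" where
 "integ \<equiv> integrable lborel"

abbreviation pd :: "'n \<Rightarrow> (real^'n::finite \<Rightarrow> 'b::real_normed_vector) \<Rightarrow> real^'n \<Rightarrow> 'b" where
 "pd \<equiv> partial"

abbreviation lap :: "(real^'n::finite \<Rightarrow> 'b::real_normed_vector) \<Rightarrow> real^'n \<Rightarrow> 'b" where
 "lap \<equiv> laplacian"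

section \<open>Functions of class \<open>Ck\<close> and their closure properties\<close>

lemma Ck_on_cong:
 assumes "\<And>x. x \<in> S \<Longrightarrow> f x = g x"
 shows "Ck_on k S f \<longleftrightarrow> Ck_on k S g"
 using assms
proof (induction k arbitrary: f g)
 case 0
 have "continuous_on S f \<longleftrightarrow> continuous_on S g"
  by (rule continuous_on_cong) (use 0 in auto)
 then show ?case by simp
next
 case (Suc k)
 have fr: "frechet_derivative f (at x within S) = frechet_derivative g (at x within S)"
  and df: "f differentiable (at x within S) \<longleftrightarrow> g differentiable (at x within S)"
  if "x \<in> S" for x
 proof -
  have "(f has_derivative D) (at x within S) \<longleftrightarrow> (g has_derivative D) (at x within S)" for D
   using has_derivative_transform[OF that, of g f D] has_derivative_transform[OF that, of f g D]
    Suc.prems by metis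
  then show "frechet_derivative f (at x within S) = frechet_derivative g (at x within S)"
   "f differentiable (at x within S) \<longleftrightarrow> g differentiable (at x within S)"
   by (simp_all add: frechet_derivative_def differentiable_def)
 qed
 have "Ck_on k S (\<lambda>x. frechet_derivative f (at x within S) v) \<longleftrightarrow>
   Ck_on k S (\<lambda>x. frechet_derivative g (at x within S) v)" for v
  by (rule Suc.IH) (simp add: fr)
 moreover have "f differentiable_on S \<longleftrightarrow> g differentiable_on S"
  using df by (auto simp: differentiable_on_def)
 ultimately show ?case unfolding Ck_on.simps by blast
qed

lemma Ck_on_SucD: "Ck_on (Suc k) S f \<Longrightarrow> Ck_on k S f"
proof (induction k arbitrary: f)
 case 0
 then show ?case by (simp add: differentiable_imp_continuous_on)
next
 case (Suc k)
 from Suc.prems have "f differentiable_on S"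
  "\<forall>v. Ck_on (Suc k) S (\<lambda>x. frechet_derivative f (at x within S) v)"
  unfolding Ck_on.simps(2)[of "Suc k"] by blast+
 with Suc.IH show ?case unfolding Ck_on.simps(2)[of k] by blast
qed

lemma Ck_on_mono: "Ck_on k S f \<Longrightarrow> j \<le> k \<Longrightarrow> Ck_on j S f"
proof (induction k)
 case (Suc k)
 then show ?case using Ck_on_SucD[of k S f] by (cases "j = Suc k") auto
qed simp

lemma Ck_cont: "Ck_on k S f \<Longrightarrow> continuous_on S f"
 using Ck_on_mono[of k S f 0] by simp

text \<open>Lets an induction on the order exhibit a derivative \<open>f'\<close> explicitly. On the
  whole space the derivative is unique, so any such \<open>f'\<close> agrees with
  \<open>frechet_derivative\<close>.\<close>

lemma Ck_Suc_iff:
 "Ck (Suc k) f \<longleftrightarrow>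
  (\<exists>f'. (\<forall>x. (f has_derivative f' x) (at x)) \<and> (\<forall>v. Ck k (\<lambda>x. f' x v)))"
proof
 assume "Ck (Suc k) f"
 then show "\<exists>f'. (\<forall>x. (f has_derivative f' x) (at x)) \<and> (\<forall>v. Ck k (\<lambda>x. f' x v))"
  by (intro exI[of _ "\<lambda>x. frechet_derivative f (at x)"])
   (auto simp: differentiable_on_def frechet_derivative_works)
next
 assume "\<exists>f'. (\<forall>x. (f has_derivative f' x) (at x)) \<and> (\<forall>v. Ck k (\<lambda>x. f' x v))"
 then obtain f' where f': "\<And>x. (f has_derivative f' x) (at x)" "\<And>v. Ck k (\<lambda>x. f' x v)"
  by blast
 have "frechet_derivative f (at x) = f' x" for x
  using frechet_derivative_at[OF f'(1)] by simp
 then show "Ck (Suc k) f"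
  using f' by (auto simp: differentiable_on_def differentiable_def)
qed

lemma Ck_const [intro, simp]: "Ck k (\<lambda>x. c)"
proof (induction k arbitrary: c)
 case (Suc k)
 show ?case unfolding Ck_Suc_iff
  by (rule exI[of _ "\<lambda>x v. 0"]) (auto simp: Suc)
qed simp

lemma Ck_linear_comp:
 assumes L: "bounded_linear L" and "Ck k f"
 shows "Ck k (\<lambda>x. L (f x))"
 using assms(2)
proof (induction k arbitrary: f)
 case 0
 then show ?case using bounded_linear.continuous_on[OF L] by simp
next
 case (Suc k)
 obtain f' where f': "\<And>x. (f has_derivative f' x) (at x)"
  "\<And>v. Ck k (\<lambda>x. f' x v)" using Suc.prems unfolding Ck_Suc_iff by blast
 show ?case unfolding Ck_Suc_iff
  using bounded_linear.has_derivative[OF L f'(1)] Suc.IH[OF f'(2)]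
  by (intro exI[of _ "\<lambda>x v. L (f' x v)"]) auto
qed

lemma Ck_add [intro]:
 assumes "Ck k f" "Ck k g"
 shows "Ck k (\<lambda>x. f x + g x)"
 using assms
proof (induction k arbitrary: f g)
 case 0
 then show ?case by (auto intro: continuous_intros)
next
 case (Suc k)
 obtain f' where f': "\<And>x. (f has_derivative f' x) (at x)"
  "\<And>v. Ck k (\<lambda>x. f' x v)" using Suc.prems(1) unfolding Ck_Suc_iff by blast
 obtain g' where g': "\<And>x. (g has_derivative g' x) (at x)"
  "\<And>v. Ck k (\<lambda>x. g' x v)" using Suc.prems(2) unfolding Ck_Suc_iff by blast
 show ?case unfolding Ck_Suc_iff
  using has_derivative_add[OF f'(1) g'(1)] Suc.IH[OF f'(2) g'(2)]
  by (intro exI[of _ "\<lambda>x v. f' x v + g' x v"]) auto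
qed

lemma Ck_sum [intro]:
 assumes "\<And>i. i \<in> I \<Longrightarrow> Ck k (f i)"
 shows "Ck k (\<lambda>x. \<Sum>i\<in>I. f i x)"
 using assms by (induction I rule: infinite_finite_induct) auto

text \<open>The product rule mixes each factor with the derivative of the other, so the induction
  must generalise over both and lower the order of the undifferentiated one.\<close>

lemma Ck_bilinear:
 assumes B: "bounded_bilinear bil" and "Ck k f" "Ck k g"
 shows "Ck k (\<lambda>x. bil (f x) (g x))"
 using assms(2,3)
proof (induction k arbitrary: f g)
 case 0
 then show ?case using bounded_bilinear.continuous_on[OF B] by simp
next
 case (Suc k)
 obtain f' where f': "\<And>x. (f has_derivative f' x) (at x)"
  "\<And>v. Ck k (\<lambda>x. f' x v)" using Suc.prems(1) unfolding Ck_Suc_iff by blast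
 obtain g' where g': "\<And>x. (g has_derivative g' x) (at x)"
  "\<And>v. Ck k (\<lambda>x. g' x v)" using Suc.prems(2) unfolding Ck_Suc_iff by blast
 show ?case unfolding Ck_Suc_iff
  using bounded_bilinear.FDERIV[OF B f'(1) g'(1)] Suc.IH f'(2) g'(2)
   Ck_on_SucD[OF Suc.prems(1)] Ck_on_SucD[OF Suc.prems(2)]
  by (intro exI[of _ "\<lambda>x v. bil (f x) (g' x v) + bil (f' x v) (g x)"]) (auto intro!: Ck_add)
qed

lemma Ck_mult [intro]:
 fixes f g :: "'a::real_normed_vector \<Rightarrow> 'b::real_normed_algebra"
 shows "Ck k f \<Longrightarrow> Ck k g \<Longrightarrow> Ck k (\<lambda>x. f x * g x)"
 by (rule Ck_bilinear[OF bounded_bilinear_mult])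

lemma Ck_scaleR [intro]:
 "Ck k f \<Longrightarrow> Ck k g \<Longrightarrow> Ck k (\<lambda>x. f x *\<^sub>R g x)"
 by (rule Ck_bilinear[OF bounded_bilinear_scaleR])

lemma Ck_minus [intro]: "Ck k f \<Longrightarrow> Ck k (\<lambda>x. - f x)"
 by (rule Ck_linear_comp[OF bounded_linear_minus[OF bounded_linear_ident]])

lemma Ck_diff [intro]:
 "Ck k f \<Longrightarrow> Ck k g \<Longrightarrow> Ck k (\<lambda>x. f x - g x)"
 using Ck_add[of k f "\<lambda>x. - g x"] by auto

lemma Ck_power [intro]:
 fixes f :: "'a::real_normed_vector \<Rightarrow> 'b::real_normed_field"
 shows "Ck k f \<Longrightarrow> Ck k (\<lambda>x. f x ^ n)"
 by (induction n) auto

lemma Ck_ident [intro, simp]: "Ck k (\<lambda>x. x)"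
proof (cases k)
 case (Suc j)
 show ?thesis unfolding Suc Ck_Suc_iff
  by (rule exI[of _ "\<lambda>x v. v"]) auto
qed simp

lemma Ck_nth [intro]:
 fixes f :: "'a::real_normed_vector \<Rightarrow> real^'n"
 shows "Ck k f \<Longrightarrow> Ck k (\<lambda>x. f x $ i)"
 by (rule Ck_linear_comp[OF bounded_linear_vec_nth])

lemma Ck_vec [intro]:
 fixes f :: "'n::finite \<Rightarrow> 'a::real_normed_vector \<Rightarrow> real"
 assumes "\<And>i. Ck k (f i)"
 shows "Ck k (\<lambda>x. \<chi> i. f i x)"
proof -
 have "(\<lambda>x. \<chi> i. f i x) = (\<lambda>x. \<Oplus>i. f i x *\<^sub>R axis i 1)"
  by (auto simp: fun_eq_iff vec_eq_iff axis_def if_distrib[where f="\<lambda>z. _ * z"] cong: if_cong)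
 then show ?thesis using Ck_sum[OF Ck_scaleR[OF assms Ck_const]] by simp
qed

lemma Ck_comp_affine:
 assumes L: "bounded_linear L" and "Ck k g"
 shows "Ck k (\<lambda>x. g (c + L x))"
 using assms(2)
proof (induction k arbitrary: g)
 case 0
 have "cont (\<lambda>x. c + L x)"
  by (intro continuous_intros bounded_linear.continuous_on[OF L])
 from continuous_on_compose2[of UNIV g, OF _ this] 0 show ?case by simp
next
 case (Suc k)
 obtain g' where g': "\<And>x. (g has_derivative g' x) (at x)"
  "\<And>v. Ck k (\<lambda>x. g' x v)" using Suc.prems unfolding Ck_Suc_iff by blast
 have "((\<lambda>x. c + L x) has_derivative L) (at x)" for x
  using has_derivative_add[OF has_derivative_const[of c] bounded_linear_imp_has_derivative[OF L]] by simp
 then have "((\<lambda>x. g (c + L x)) has_derivative (\<lambda>v. g' (c + L x) (L v))) (at x)" for x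
  by (rule has_derivative_compose) (rule g'(1))
 with Suc.IH[OF g'(2)] show ?case unfolding Ck_Suc_iff
  by (intro exI[of _ "\<lambda>x v. g' (c + L x) (L v)"]) blast
qed

lemma Ck_comp_real:
 fixes g :: "real \<Rightarrow> 'b::real_normed_vector" and f :: "'a::real_normed_vector \<Rightarrow> real"
 assumes "Ck k g" "Ck k f"
 shows "Ck k (\<lambda>x. g (f x))"
 using assms
proof (induction k arbitrary: g f)
 case 0
 with continuous_on_compose2[of UNIV g UNIV f] show ?case by simp
next
 case (Suc k)
 obtain g' where g': "\<And>x. (g has_derivative g' x) (at x)"
  "\<And>v. Ck k (\<lambda>x. g' x v)" using Suc.prems(1) unfolding Ck_Suc_iff by blast
 obtain f' where f': "\<And>x. (f has_derivative f' x) (at x)"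
  "\<And>v. Ck k (\<lambda>x. f' x v)" using Suc.prems(2) unfolding Ck_Suc_iff by blast
 have eq: "g' y r = r *\<^sub>R g' y 1" for y r
  using linear_cmul[OF has_derivative_linear[OF g'(1)[of y]], of r 1] by (simp only: real_scaleR_def mult_1_right)
 have "((\<lambda>x. g (f x)) has_derivative (\<lambda>v. f' x v *\<^sub>R g' (f x) 1)) (at x)" for x
 proof -
  have "((\<lambda>x. g (f x)) has_derivative (\<lambda>v. g' (f x) (f' x v))) (at x)"
   by (rule has_derivative_compose[OF f'(1) g'(1)])
  moreover have "(\<lambda>v. g' (f x) (f' x v)) = (\<lambda>v. f' x v *\<^sub>R g' (f x) 1)"
   by (rule ext) (rule eq)
  ultimately show ?thesis by (simp only:)
 qed
 moreover have "Ck k (\<lambda>x. f' x v *\<^sub>R g' (f x) 1)" for v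
  by (rule Ck_scaleR[OF f'(2) Suc.IH[OF g'(2) Ck_on_SucD[OF Suc.prems(2)]]])
 ultimately show ?case unfolding Ck_Suc_iff
  by (intro exI[of _ "\<lambda>x v. f' x v *\<^sub>R g' (f x) 1"]) blast
qed

lemma Ck_comp_scale:
 assumes "Ck k g"
 shows "Ck k (\<lambda>x. g (r *\<^sub>R (x - c)))"
 using Ck_comp_affine[OF bounded_linear_scaleR_right assms, of "- (r *\<^sub>R c)" r]
 by (simp add: algebra_simps)

text \<open>Meant for profiles with an explicit tower of derivatives, such as \<open>gam\<close>,
  \<open>flat\<close> and the trigonometric functions: differentiating the general member
  \<open>D j\<close> once settles all orders.\<close>

lemma Ck_real_derivI:
 assumes "\<And>j x. j < k \<Longrightarrow> (D j has_real_derivative D (Suc j) x) (at x)"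
  "cont (D k)"
 shows "Ck k (D 0)"
 using assms
proof (induction k arbitrary: D)
 case (Suc k)
 have "Ck k (D (Suc 0))"
  using Suc.IH[of "\<lambda>j. D (Suc j)"] Suc.prems by auto
 then show ?case unfolding Ck_Suc_iff
  using Suc.prems(1)[of 0]
  by (intro exI[of _ "\<lambda>x v. D (Suc 0) x * v"]) (auto simp: has_field_derivative_def intro!: Ck_mult)
qed simp

text \<open>The initial datum is an infinite sum that agrees near each point with one of its finite
  stages; this transfers the smoothness of the stages to it.\<close>

lemma Ck_on_local:
 assumes "\<And>x. \<exists>S. open S \<and> x \<in> S \<and> (\<exists>g. Ck k g \<and> (\<forall>y\<in>S. f y = g y))"
 shows "Ck k f"
 using assms
proof (induction k arbitrary: f)
 case 0
 have "isCont f x" for x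
 proof -
  obtain S g where S: "open S" "x \<in> S" "Ck 0 g" "\<forall>y\<in>S. f y = g y"
   using 0[of x] by blast
  then have "isCont g x" by (simp add: continuous_on_eq_continuous_at)
  moreover have "eventually (\<lambda>y. f y = g y) (nhds x)"
   using S unfolding eventually_nhds by blast
  ultimately show ?thesis
   using isCont_cong[of f g x] by blast
 qed
 then show ?case by (simp add: continuous_on_eq_continuous_at)
next
 case (Suc k)
 have loc: "(f has_derivative frechet_derivative f (at x)) (at x) \<and>
   (\<exists>S. open S \<and> x \<in> S \<and> (\<exists>g. Ck k g \<and> (\<forall>y\<in>S. frechet_derivative f (at y) v = g y)))" for x v
 proof -
  obtain S g where S: "open S" "x \<in> S" "Ck (Suc k) g" "\<forall>y\<in>S. f y = g y"
   using Suc.prems[of x] by blast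
  obtain g' where g': "\<And>y. (g has_derivative g' y) (at y)" "\<And>v. Ck k (\<lambda>y. g' y v)"
   using S(3) unfolding Ck_Suc_iff by blast
  have d: "(f has_derivative g' y) (at y)" if "y \<in> S" for y
   by (rule has_derivative_transform_within_open[OF g'(1) S(1) that]) (use S(4) in simp)
  have eq: "frechet_derivative f (at y) = g' y" if "y \<in> S" for y
   using frechet_derivative_at[OF d[OF that]] by simp
  show ?thesis
  proof (intro conjI exI[of _ S] exI[of _ "\<lambda>y. g' y v"] ballI)
   show "(f has_derivative frechet_derivative f (at x)) (at x)"
    using d[OF S(2)] by (simp only: eq[OF S(2)])
   show "frechet_derivative f (at y) v = g' y v" if "y \<in> S" for y
    by (simp only: eq[OF that])
  qed (rule S(1) S(2) g'(2))+
 qed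
 have "Ck k (\<lambda>x. frechet_derivative f (at x) v)" for v
  by (rule Suc.IH) (rule conjunct2[OF loc])
 with loc show ?case unfolding Ck_Suc_iff
  by (intro exI[of _ "\<lambda>x. frechet_derivative f (at x)"] conjI allI) (rule conjunct1[OF loc])
qed

section \<open>Partial derivatives\<close>

lemma partial_eq: "(f has_derivative f') (at x) \<Longrightarrow> pd i f x = f' (axis i 1)"
 unfolding partial_def using frechet_derivative_at by metis

lemma Ck_has_derivative:
 "Ck k f \<Longrightarrow> 0 < k \<Longrightarrow> (f has_derivative frechet_derivative f (at x)) (at x)"
 by (cases k) (auto simp: differentiable_on_def frechet_derivative_works)

lemma Ck_partial: "Ck (Suc k) f \<Longrightarrow> Ck k (pd i f)"
 unfolding partial_def[abs_def] by simp

lemma cont_partial: "Ck 1 f \<Longrightarrow> cont (pd i f)"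
 using Ck_cont[OF Ck_partial[of 0]] by simp

lemma frechet_eq_partial:
 fixes f :: "real^'n::finite \<Rightarrow> 'b::real_normed_vector"
 assumes "(f has_derivative f') (at x)"
 shows "f' v = (\<Oplus>i. v $ i *\<^sub>R pd i f x)"
proof -
 interpret linear f' using assms has_derivative_linear by blast
 have "f' v = f' (\<Oplus>i. v $ i *\<^sub>R axis i 1)"
  by (simp add: basis_expansion flip: scalar_mult_eq_scaleR)
 also have "\<dots> = (\<Oplus>i. v $ i *\<^sub>R pd i f x)"
  by (simp add: sum scaleR partial_eq[OF assms])
 finally show ?thesis .
qed

lemma has_derivative_partial:
 fixes f :: "real^'n::finite \<Rightarrow> 'b::real_normed_vector"
 assumes "Ck k f" "0 < k"
 shows "(f has_derivative (\<lambda>v. \<Oplus>i. v $ i *\<^sub>R pd i f x)) (at x)"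
proof -
 have "(f has_derivative frechet_derivative f (at x)) (at x)"
  using Ck_has_derivative[OF assms] .
 moreover from frechet_eq_partial[OF this]
 have "frechet_derivative f (at x) = (\<lambda>v. \<Oplus>i. v $ i *\<^sub>R pd i f x)" ..
 ultimately show ?thesis by simp
qed

context
 fixes f g :: "real^'n::finite \<Rightarrow> real"
 assumes f: "Ck 1 f" and g: "Ck 1 g"
begin

lemma partial_add: "pd i (\<lambda>x. f x + g x) = (\<lambda>x. pd i f x + pd i g x)"
 by (intro ext, subst partial_eq[OF has_derivative_add[OF Ck_has_derivative[OF f] Ck_has_derivative[OF g]]])
  (simp_all add: partial_def)

lemma partial_diff: "pd i (\<lambda>x. f x - g x) = (\<lambda>x. pd i f x - pd i g x)"
 by (intro ext, subst partial_eq[OF has_derivative_diff[OF Ck_has_derivative[OF f] Ck_has_derivative[OF g]]])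
  (simp_all add: partial_def)

lemma partial_mult: "pd i (\<lambda>x. f x * g x) = (\<lambda>x. f x * pd i g x + pd i f x * g x)"
 by (intro ext, subst partial_eq[OF has_derivative_mult[OF Ck_has_derivative[OF f] Ck_has_derivative[OF g]]])
  (simp_all add: partial_def)

end

lemma partial_const [simp]: "pd i (\<lambda>x. c) = (\<lambda>x. 0)"
 by (intro ext, subst partial_eq[OF has_derivative_const]) simp

lemma partial_linear_comp:
 assumes "bounded_linear L" "Ck 1 f"
 shows "pd i (\<lambda>x. L (f x)) = (\<lambda>x. L (pd i f x))"
 by (intro ext, subst partial_eq[OF bounded_linear.has_derivative[OF assms(1) Ck_has_derivative[OF assms(2)]]])
  (simp_all add: partial_def)

lemma partial_minus: "Ck 1 f \<Longrightarrow> pd i (\<lambda>x. - f x) = (\<lambda>x. - pd i f x)"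
 by (rule partial_linear_comp[OF bounded_linear_minus[OF bounded_linear_ident]])

lemma partial_cmult:
 fixes f :: "real^'n::finite \<Rightarrow> real"
 shows "Ck 1 f \<Longrightarrow> pd i (\<lambda>x. c * f x) = (\<lambda>x. c * pd i f x)"
 by (rule partial_linear_comp[OF bounded_linear_mult_right])

lemma partial_nth:
 fixes f :: "real^'n::finite \<Rightarrow> real^'m"
 shows "Ck 1 f \<Longrightarrow> pd i (\<lambda>x. f x $ j) = (\<lambda>x. pd i f x $ j)"
 by (rule partial_linear_comp[OF bounded_linear_vec_nth])

lemma partial_sum:
 fixes f :: "'b \<Rightarrow> real^'n::finite \<Rightarrow> real"
 assumes "\<And>j. j \<in> J \<Longrightarrow> Ck 1 (f j)"
 shows "pd i (\<lambda>x. \<Sum>j\<in>J. f j x) = (\<lambda>x. \<Sum>j\<in>J. pd i (f j) x)"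
 using assms
proof (induction J rule: infinite_finite_induct)
 case (insert j J)
 then have "Ck 1 (\<lambda>x. \<Sum>j\<in>J. f j x)" by (intro Ck_sum) auto
 with insert show ?case by (simp add: partial_add)
qed auto

lemma partial_scale:
 fixes f :: "real^'n::finite \<Rightarrow> real"
 assumes "Ck 1 f"
 shows "pd i (\<lambda>x. f (r *\<^sub>R (x - c))) = (\<lambda>x. r * pd i f (r *\<^sub>R (x - c)))"
proof
 fix x
 have d: "((\<lambda>x. r *\<^sub>R (x - c)) has_derivative (\<lambda>v. r *\<^sub>R v)) (at x)"
  by (auto intro!: derivative_eq_intros)
 have D: "(f has_derivative frechet_derivative f (at (r *\<^sub>R (x - c)))) (at (r *\<^sub>R (x - c)))"
  using Ck_has_derivative[OF assms] by simp
 have "pd i (\<lambda>x. f (r *\<^sub>R (x - c))) x = frechet_derivative f (at (r *\<^sub>R (x - c))) (r *\<^sub>R axis i 1)"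
  using partial_eq[OF has_derivative_compose[OF d D]] .
 also have "\<dots> = r * pd i f (r *\<^sub>R (x - c))"
  using linear_cmul[OF has_derivative_linear[OF D]] by (simp add: partial_def)
 finally show "pd i (\<lambda>x. f (r *\<^sub>R (x - c))) x = r * pd i f (r *\<^sub>R (x - c))" .
qed

lemma partial_coord: "pd i (\<lambda>x. x $ j) = (\<lambda>x. if i = j then 1 else 0 :: real)"
 by (intro ext, subst partial_eq[OF bounded_linear_imp_has_derivative[OF bounded_linear_vec_nth]])
  (simp add: axis_def)

lemma partial_comp_real:
 fixes f :: "real^'n::finite \<Rightarrow> real"
 assumes "\<And>s. (g has_real_derivative g' s) (at s)" "Ck 1 f"
 shows "pd i (\<lambda>x. g (f x)) = (\<lambda>x. g' (f x) * pd i f x)"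
 by (intro ext, subst partial_eq[OF has_derivative_compose[OF Ck_has_derivative[OF assms(2)]
    assms(1)[unfolded has_field_derivative_def]]]) (simp_all add: partial_def)

lemma partial_cong_open:
 assumes "open S" "x \<in> S" "\<And>y. y \<in> S \<Longrightarrow> f y = g y"
 shows "pd i f x = pd i g x"
proof -
 have "(f has_derivative D) (at x) \<longleftrightarrow> (g has_derivative D) (at x)" for D
  using assms has_derivative_transform_within_open[of f D x UNIV S g]
   has_derivative_transform_within_open[of g D x UNIV S f] by auto
 then show ?thesis by (simp add: partial_def frechet_derivative_def)
qed

declare Ck_on.simps(2) [simp del]

section \<open>Bounded support and integration\<close>

text \<open>Asking that the set of nonzero values be bounded avoids the closure in the usual
  definition; in Euclidean space it is the same as compact support.\<close>

definition bsupp :: "('a::real_normed_vector \<Rightarrow> 'b::zero) \<Rightarrow> bool" where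
 "bsupp f \<longleftrightarrow> bounded {x. f x \<noteq> 0}"

lemma bsupp_subset: "bsupp f \<Longrightarrow> (\<And>x. f x = 0 \<Longrightarrow> g x = 0) \<Longrightarrow> bsupp g"
 unfolding bsupp_def by (rule bounded_subset) auto

lemma bsuppI: "(\<And>x. R < norm x \<Longrightarrow> f x = 0) \<Longrightarrow> bsupp f"
 unfolding bsupp_def by (rule bounded_subset[of "cball 0 R"]) (auto simp: not_less[symmetric])

lemma bsuppE:
 assumes "bsupp f" obtains R where "0 < R" "\<And>x. R < norm x \<Longrightarrow> f x = 0"
proof -
 obtain R where R: "0 < R" "\<forall>x\<in>{x. f x \<noteq> 0}. norm x \<le> R"
  using assms unfolding bsupp_def bounded_pos by auto
 then show ?thesis by (intro that[of R]) (auto simp: not_le[symmetric])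
qed

lemma bsupp_mult1 [intro]: "bsupp f \<Longrightarrow> bsupp (\<lambda>x. f x * (g x::real))"
 by (erule bsupp_subset) simp

lemma bsupp_mult2 [intro]: "bsupp g \<Longrightarrow> bsupp (\<lambda>x. f x * (g x::real))"
 by (erule bsupp_subset) simp

lemma bsupp_add [intro]:
 fixes f g :: "'a::real_normed_vector \<Rightarrow> 'b::monoid_add"
 assumes "bsupp f" "bsupp g" shows "bsupp (\<lambda>x. f x + g x)"
 unfolding bsupp_def
 by (rule bounded_subset[of "{x. f x \<noteq> 0} \<union> {x. g x \<noteq> 0}"])
  (use assms in \<open>auto simp: bsupp_def\<close>)

lemma bsupp_zero [simp, intro]: "bsupp (\<lambda>x. 0)"
 by (simp add: bsupp_def)

lemma bsupp_sum [intro]: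
 fixes f :: "'i \<Rightarrow> 'a::real_normed_vector \<Rightarrow> 'b::comm_monoid_add"
 shows "(\<And>i. i \<in> I \<Longrightarrow> bsupp (f i)) \<Longrightarrow> bsupp (\<lambda>x. \<Sum>i\<in>I. f i x)"
 by (induction I rule: infinite_finite_induct) auto

lemma bsupp_minus [intro]: "bsupp f \<Longrightarrow> bsupp (\<lambda>x. - f x :: 'b::group_add)"
 by (erule bsupp_subset) simp

lemma bsupp_diff [intro]: "bsupp f \<Longrightarrow> bsupp g \<Longrightarrow> bsupp (\<lambda>x. f x - g x :: 'b::group_add)"
 using bsupp_add[of f "\<lambda>x. - g x"] by auto

lemma bsupp_power [intro]: "bsupp f \<Longrightarrow> 0 < n \<Longrightarrow> bsupp (\<lambda>x. (f x :: real) ^ n)"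
 by (erule bsupp_subset) simp

lemma bsupp_scale:
 fixes f :: "'a::real_normed_vector \<Rightarrow> 'b::zero"
 assumes "bsupp f" "r \<noteq> (0::real)" shows "bsupp (\<lambda>x. f (r *\<^sub>R (x - c)))"
proof -
 obtain R where R: "0 < R" "\<And>x. R < norm x \<Longrightarrow> f x = 0" using bsuppE[OF assms(1)] by blast
 show ?thesis
 proof (rule bsuppI[of "R / \<bar>r\<bar> + norm c"])
  fix x :: 'a assume "R / \<bar>r\<bar> + norm c < norm x"
  then have "R / \<bar>r\<bar> < norm (x - c)" using norm_triangle_ineq2[of x c] by linarith
  then have "R < norm (r *\<^sub>R (x - c))" unfolding norm_scaleR using assms(2) by (simp add: field_simps)
  then show "f (r *\<^sub>R (x - c)) = 0" by (rule R(2))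
 qed
qed

lemma bsupp_partial [intro]:
 fixes f :: "real^'n::finite \<Rightarrow> 'b::real_normed_vector"
 assumes "bsupp f" shows "bsupp (pd i f)"
proof -
 obtain R where R: "0 < R" "\<And>x. R < norm x \<Longrightarrow> f x = 0" using bsuppE[OF assms] by blast
 show ?thesis
 proof (rule bsuppI[of R])
  fix x :: "real^'n" assume "R < norm x"
  then have "pd i f x = pd i (\<lambda>x. 0) x"
   by (intro partial_cong_open[of "- cball 0 R"]) (auto intro: R(2))
  then show "pd i f x = 0" by simp
 qed
qed

section \<open>Integrals of continuous functions of bounded support\<close>

lemma integrable_cs [intro]:
 fixes f :: "'a::euclidean_space \<Rightarrow> real"
 assumes "cont f" "bsupp f"
 shows "integ f"
proof -
 obtain R where R: "\<And>x. R < norm x \<Longrightarrow> f x = 0" using bsuppE[OF assms(2)] by blast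
 have "integ (\<lambda>x. indicator (cball 0 R) x *\<^sub>R f x)"
  by (intro borel_integrable_compact continuous_on_subset[OF assms(1)]) auto
 moreover have "(\<lambda>x. indicator (cball 0 R) x *\<^sub>R f x) = f"
  using R by (auto simp: fun_eq_iff indicator_def not_le)
 ultimately show ?thesis by simp
qed

text \<open>Bridge from the Lebesgue integral over the whole space to the gauge integral over a box,
  to which the theorems on integrals with a parameter apply.\<close>

lemma integral_cs_cbox:
 fixes f :: "'a::euclidean_space \<Rightarrow> real"
 assumes "cont f" "\<And>x. x \<notin> cbox a b \<Longrightarrow> f x = 0"
 shows "(LBINT x. f x) = integral (cbox a b) f"
proof -
 have "bsupp f" unfolding bsupp_def
  by (rule bounded_subset[OF bounded_cbox[of a b]]) (use assms(2) in auto)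
 then have "(f has_integral (LBINT x. f x)) UNIV"
  by (intro has_integral_integral_lborel integrable_cs assms(1))
 then have "(f has_integral (LBINT x. f x)) (cbox a b)"
  using has_integral_restrict_UNIV[of "cbox a b" f] assms(2)
  by (smt (verit) has_integral_cong has_integral_on_superset subset_UNIV has_integral_eq_rhs has_integral_spike_set_eq has_integral_is_0 has_integral_restrict_UNIV has_integral_eq)
 then show ?thesis by (simp add: integral_unique)
qed

lemma cbox_cover:
 fixes R :: real
 obtains a b :: "'a::euclidean_space" where "cball 0 R \<subseteq> cbox a b"
 using bounded_subset_cbox_symmetric[OF bounded_cball] by blast

text \<open>The common support radius \<open>R\<close> reduces everything to one box.
  Differentiation relative to a convex set \<open>U\<close> covers the one-sided time derivatives at
  the ends of \<open>{0..T}\<close>.\<close>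

lemma leibniz_lborel:
 fixes f :: "real \<Rightarrow> 'a::euclidean_space \<Rightarrow> real"
 assumes d: "\<And>s x. s \<in> U \<Longrightarrow> ((\<lambda>s. f s x) has_real_derivative f' s x) (at s within U)"
  and c: "\<And>s. s \<in> U \<Longrightarrow> cont (f s)"
  and c': "continuous_on (U \<times> UNIV) (\<lambda>(s, x). f' s x)"
  and R: "\<And>s x. s \<in> U \<Longrightarrow> R < norm x \<Longrightarrow> f s x = 0 \<and> f' s x = 0"
  and U: "t \<in> U" "convex U"
 shows "((\<lambda>s. LBINT x. f s x) has_real_derivative (LBINT x. f' t x)) (at t within U)"
proof -
 obtain a b :: 'a where ab: "cball 0 R \<subseteq> cbox a b" by (rule cbox_cover)
 have out: "f s x = 0 \<and> f' s x = 0" if "x \<notin> cbox a b" "s \<in> U" for s x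
  using that ab R[of s x] by (cases "R < norm x") (auto simp: subset_iff)
 have f'c: "cont (f' s)" if "s \<in> U" for s
 proof -
  have "cont (\<lambda>x::'a. (s, x))" by (intro continuous_intros)
  from continuous_on_compose2[OF c' this] that show ?thesis by auto
 qed
 have eq: "(LBINT x. f s x) = integral (cbox a b) (f s)" if "s \<in> U" for s
  using integral_cs_cbox[OF c[OF that], of a b] out that by blast
 have eq': "(LBINT x. f' s x) = integral (cbox a b) (f' s)" if "s \<in> U" for s
  using integral_cs_cbox[OF f'c[OF that], of a b] out that by blast
 have "((\<lambda>s. integral (cbox a b) (f s)) has_real_derivative integral (cbox a b) (f' t)) (at t within U)"
 proof (rule leibniz_rule_field_derivative[OF _ _ _ U])
  show "f s integrable_on cbox a b" if "s \<in> U" for s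
   using c[OF that] by (intro integrable_continuous) (auto intro: continuous_on_subset)
  show "continuous_on (U \<times> cbox a b) (\<lambda>(x, t). f' x t)"
   using c' by (rule continuous_on_subset) auto
 qed (rule d)
 then show ?thesis
  unfolding eq'[OF U(1)]
  by (rule has_field_derivative_transform_within[OF _ zero_less_one U(1)]) (simp add: eq)
qed

lemma integral_translate:
 fixes f :: "'a::euclidean_space \<Rightarrow> real"
 assumes "f \<in> borel_measurable borel"
 shows "(LBINT x. f (c + x)) = (LBINT x. f x)"
 by (subst (2) lborel_distr_plus[of c, symmetric], subst integral_distr) (use assms in auto)

lemma integral_scale_reflect:
 fixes f :: "'a::euclidean_space \<Rightarrow> real"
 assumes "f \<in> borel_measurable borel" "c \<noteq> 0"
 shows "(LBINT x. f x) = \<bar>c\<bar> ^ DIM('a) * (LBINT x. f (t + c *\<^sub>R x))"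
proof -
 have "(LBINT x. f x) = (\<integral>x. f x \<partial>density (distr lborel borel (\<lambda>x. t + c *\<^sub>R x)) (\<lambda>_. \<bar>c\<bar>^DIM('a)))"
  using lborel_affine[OF assms(2), of t] by simp
 also have "\<dots> = (\<integral>x. \<bar>c\<bar>^DIM('a) * f x \<partial>distr lborel borel (\<lambda>x. t + c *\<^sub>R x))"
  using assms(1) by (subst integral_density) auto
 also have "\<dots> = \<bar>c\<bar> ^ DIM('a) * (LBINT x. f (t + c *\<^sub>R x))"
  using assms(1) by (subst integral_distr) auto
 finally show ?thesis .
qed

lemma partial_line:
 fixes f :: "real^'n::finite \<Rightarrow> real"
 assumes "Ck 1 f"
 shows "((\<lambda>s. f (x + s *\<^sub>R axis i 1)) has_real_derivative pd i f (x + s *\<^sub>R axis i 1)) (at s within U)"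
proof -
 have l: "((\<lambda>s. x + s *\<^sub>R axis i 1) has_derivative (\<lambda>h. h *\<^sub>R axis i 1)) (at s)"
  by (auto intro!: derivative_eq_intros)
 have D: "(f has_derivative frechet_derivative f (at (x + s *\<^sub>R axis i 1))) (at (x + s *\<^sub>R axis i 1))"
  by (rule Ck_has_derivative[OF assms]) simp
 have "((\<lambda>s. f (x + s *\<^sub>R axis i 1)) has_derivative
   (\<lambda>h. frechet_derivative f (at (x + s *\<^sub>R axis i 1)) (h *\<^sub>R axis i 1))) (at s)"
  by (rule has_derivative_compose[OF l D])
 moreover have "frechet_derivative f (at (x + s *\<^sub>R axis i 1)) (h *\<^sub>R axis i 1)
   = pd i f (x + s *\<^sub>R axis i 1) * h" for h
  using linear_cmul[OF has_derivative_linear[OF D]] by (simp add: partial_def)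
 ultimately have "((\<lambda>s. f (x + s *\<^sub>R axis i 1)) has_real_derivative pd i f (x + s *\<^sub>R axis i 1)) (at s)"
  unfolding has_field_derivative_def by (simp only:)
 then show ?thesis by (rule has_field_derivative_at_within)
qed

text \<open>The integral of a translate of \<open>f\<close> along the axis does not depend on the
  shift, and its derivative at shift 0 is the integral of \<open>pd i f\<close>.\<close>

lemma integral_partial:
 fixes f :: "real^'n::finite \<Rightarrow> real"
 assumes f: "Ck 1 f" and b: "bsupp f"
 shows "(LBINT x. pd i f x) = 0"
proof -
 obtain R where R: "0 < R" "\<And>x. R < norm x \<Longrightarrow> f x = 0" using bsuppE[OF b] by blast
 obtain R' where R': "0 < R'" "\<And>x. R' < norm x \<Longrightarrow> pd i f x = 0" using bsuppE[OF bsupp_partial[OF b, of i]] by blast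
 have c: "cont f" "cont (pd i f)"
  using Ck_cont[OF f] Ck_partial[of 0 f i] f by auto
 have sh: "continuous_on S (\<lambda>z. snd z + fst z *\<^sub>R axis i (1::real))" for S :: "(real \<times> (real^'n)) set"
  by (intro continuous_intros)
 \<comment> \<open>Shifts between -1 and 1 enlarge the support radius by at most 1, so one radius
   serves all of them.\<close>
 have "((\<lambda>s. LBINT x. f (x + s *\<^sub>R axis i 1)) has_real_derivative
   (LBINT x. pd i f (x + 0 *\<^sub>R axis i 1))) (at 0 within {-1<..<1})"
 proof (rule leibniz_lborel[where R = "R + R' + 1"])
  show "cont (\<lambda>x. f (x + s *\<^sub>R axis i 1))" for s
   by (rule continuous_on_compose2[OF c(1)]) (auto intro!: continuous_intros)
  show "continuous_on ({- 1<..<1} \<times> UNIV) (\<lambda>(s, x). pd i f (x + s *\<^sub>R axis i 1))"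
   unfolding split_beta by (rule continuous_on_compose2[OF c(2) sh]) auto
  fix s :: real and x :: "real^'n" assume s: "s \<in> {-1<..<1}" and x: "R + R' + 1 < norm x"
  have "norm (x + s *\<^sub>R axis i 1) \<ge> norm x - norm (s *\<^sub>R (axis i 1 :: real^'n))"
   by (rule norm_diff_ineq)
  moreover have "norm (s *\<^sub>R (axis i 1 :: real^'n)) < 1" using s by (auto simp: abs_less_iff)
  ultimately have "norm (x + s *\<^sub>R axis i 1) > R + R'" using x by linarith
  then show "f (x + s *\<^sub>R axis i 1) = 0 \<and> pd i f (x + s *\<^sub>R axis i 1) = 0"
   using R R' by auto
 qed (use partial_line[OF f] in auto)
 moreover have "(LBINT x. f (x + s *\<^sub>R axis i 1)) = (LBINT x. f x)" for s
  using integral_translate[of f "s *\<^sub>R axis i 1"] cont_borel[OF c(1)]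
  by (simp add: add.commute)
 ultimately have "((\<lambda>s. LBINT x. f x) has_real_derivative (LBINT x. pd i f x)) (at (0::real))"
  by (simp add: at_within_open[of 0 "{-1<..<1}"])
 then show ?thesis by (metis DERIV_const DERIV_unique)
qed

lemma integral_by_parts:
 fixes f g :: "real^'n::finite \<Rightarrow> real"
 assumes f: "Ck 1 f" and g: "Ck 1 g" and b: "bsupp f \<or> bsupp g"
 shows "(LBINT x. f x * pd i g x) = - (LBINT x. pd i f x * g x)"
proof -
 have c: "cont f" "cont (pd i f)" "cont g" "cont (pd i g)"
  using Ck_cont[OF f] Ck_partial[of 0 f i] f Ck_cont[OF g] Ck_partial[of 0 g i] g by auto
 have "(LBINT x. pd i (\<lambda>x. f x * g x) x) = 0"
  by (rule integral_partial) (use f g b in auto)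
 moreover have "integ (\<lambda>x. f x * pd i g x)" "integ (\<lambda>x. pd i f x * g x)"
  using b c by (auto intro!: integrable_cs continuous_intros)
 ultimately show ?thesis by (simp add: partial_mult[OF f g])
qed

text \<open>The increment of \<open>f\<close> along \<open>?e\<close> is an integral of
  \<open>pd i f\<close>. Differentiating it along \<open>?g\<close> gives the increment of
  \<open>pd j f\<close> as an integral of \<open>pd j (pd i f)\<close>, and differentiating that
  along \<open>?e\<close> exchanges the order.\<close>

lemma partial_commute:
 fixes f :: "real^'n::finite \<Rightarrow> real"
 assumes f: "Ck 2 f"
 shows "pd i (pd j f) = pd j (pd i f)"
proof
 fix x
 let ?e = "axis i (1::real) :: real^'n" and ?g = "axis j (1::real) :: real^'n"
 have f2: "Ck_on (Suc (Suc 0)) UNIV f" using f by (simp only: numeral_2_eq_2)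
 have f1: "Ck 1 f" using Ck_on_SucD[OF f2] by simp
 have fj: "Ck 1 (pd j f)" and fi: "Ck 1 (pd i f)"
  using Ck_partial[OF f2] by simp_all
 have cji: "cont (pd j (pd i f))"
  using Ck_partial[of 0 "pd i f" j] fi by simp
 have ci: "cont (pd i f)" using Ck_cont[OF fi] .
 have sq: "pd j f (x + s *\<^sub>R ?e) - pd j f x
   = integral (cbox 0 s) (\<lambda>r. pd j (pd i f) (x + r *\<^sub>R ?e))" if s: "0 \<le> s" for s
 proof -
  have "((\<lambda>t. integral (cbox 0 s) (\<lambda>r. pd i f ((x + r *\<^sub>R ?e) + t *\<^sub>R ?g))) has_real_derivative
    integral (cbox 0 s) (\<lambda>r. pd j (pd i f) ((x + r *\<^sub>R ?e) + 0 *\<^sub>R ?g))) (at 0 within UNIV)"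
  proof (rule leibniz_rule_field_derivative)
   show "(\<lambda>r. pd i f (x + r *\<^sub>R ?e + t *\<^sub>R ?g)) integrable_on cbox 0 s" for t
    by (intro integrable_continuous continuous_on_compose2[OF ci]) (auto intro!: continuous_intros)
   show "continuous_on (UNIV \<times> cbox 0 s) (\<lambda>(t, r). pd j (pd i f) (x + r *\<^sub>R ?e + t *\<^sub>R ?g))"
    unfolding split_beta by (intro continuous_on_compose2[OF cji]) (auto intro!: continuous_intros)
  qed (use partial_line[OF fi] in auto)
  moreover have "integral (cbox 0 s) (\<lambda>r. pd i f ((x + r *\<^sub>R ?e) + t *\<^sub>R ?g))
    = f (x + s *\<^sub>R ?e + t *\<^sub>R ?g) - f (x + t *\<^sub>R ?g)" for t
  proof -
   have "((\<lambda>r. pd i f ((x + t *\<^sub>R ?g) + r *\<^sub>R ?e)) has_integral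
     (f ((x + t *\<^sub>R ?g) + s *\<^sub>R ?e) - f ((x + t *\<^sub>R ?g) + 0 *\<^sub>R ?e))) {0..s}"
    using partial_line[OF f1]
    by (intro fundamental_theorem_of_calculus[OF s]) (auto simp: has_real_derivative_iff_has_vector_derivative)
   then show ?thesis by (simp add: integral_unique add.assoc add.left_commute add.commute)
  qed
  ultimately have "((\<lambda>t. f (x + s *\<^sub>R ?e + t *\<^sub>R ?g) - f (x + t *\<^sub>R ?g)) has_real_derivative
    integral (cbox 0 s) (\<lambda>r. pd j (pd i f) (x + r *\<^sub>R ?e))) (at 0)"
   by simp
  moreover have "((\<lambda>t. f (x + s *\<^sub>R ?e + t *\<^sub>R ?g) - f (x + t *\<^sub>R ?g)) has_real_derivative
    pd j f (x + s *\<^sub>R ?e + 0 *\<^sub>R ?g) - pd j f (x + 0 *\<^sub>R ?g)) (at 0)"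
   by (intro DERIV_diff partial_line[OF f1])
  ultimately show ?thesis using DERIV_unique by fastforce
 qed
 \<comment> \<open>The formula \<open>sq\<close> is established for \<open>0 \<le> s\<close>, hence
   the two derivatives at 0 are compared from the right.\<close>
 have "((\<lambda>s. integral {0..s} (\<lambda>r. pd j (pd i f) (x + r *\<^sub>R ?e))) has_real_derivative
   pd j (pd i f) (x + 0 *\<^sub>R ?e)) (at 0 within {0..1})"
  by (rule integral_has_real_derivative) (auto intro!: continuous_on_compose2[OF cji] continuous_intros)
 then have "((\<lambda>s. pd j f (x + s *\<^sub>R ?e) - pd j f x) has_real_derivative
   pd j (pd i f) x) (at 0 within {0..1})"
  using has_field_derivative_transform_within[of
    "\<lambda>s. integral {0..s} (\<lambda>r. pd j (pd i f) (x + r *\<^sub>R ?e))" _ 0 "{0..1}" 1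
    "\<lambda>s. pd j f (x + s *\<^sub>R ?e) - pd j f x"] sq by simp
 moreover have "((\<lambda>s. pd j f (x + s *\<^sub>R ?e) - pd j f x) has_real_derivative
   pd i (pd j f) (x + 0 *\<^sub>R ?e) - 0) (at 0 within {0..1})"
  by (intro DERIV_diff partial_line[OF fj] DERIV_const)
 ultimately show "pd i (pd j f) x = pd j (pd i f) x"
  using has_real_derivative_iff_has_vector_derivative vector_derivative_unique_within[of 0 "{0..1::real}"]
  by (metis (no_types, lifting) at_within_Icc_at_right diff_zero scaleR_zero_left add.right_neutral trivial_limit_at_right_real zero_less_one)
qed

lemma fubini_cs:
 fixes K :: "'a::euclidean_space \<Rightarrow> 'b::euclidean_space \<Rightarrow> real"
 assumes "cont (\<lambda>(x, y). K x y)" "\<And>x y. K x y \<noteq> 0 \<Longrightarrow> norm x \<le> R \<and> norm y \<le> R"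
 shows "(LBINT y. (LBINT x. K x y)) = (LBINT x. (LBINT y. K x y))"
proof (rule lborel_pair.Fubini_integral)
 have "bsupp (\<lambda>(x, y). K x y)"
  unfolding bsupp_def
  by (rule bounded_subset[of "cball 0 R \<times> cball 0 R"]) (use assms(2) in \<open>auto intro: bounded_Times\<close>)
 then show "integrable (lborel \<Otimes>\<^sub>M lborel) (\<lambda>(x, y). K x y)"
  unfolding lborel_prod using assms(1) by (rule integrable_cs[rotated])
qed

lemma integral_Cauchy_Schwarz:
 fixes f g :: "'a \<Rightarrow> real"
 assumes [measurable]: "f \<in> borel_measurable M" "g \<in> borel_measurable M"
  and i: "integrable M (\<lambda>x. (f x)^2)" "integrable M (\<lambda>x. (g x)^2)"
 shows "integrable M (\<lambda>x. f x * g x)" "\<bar>\<integral>x. f x * g x \<partial>M\<bar> \<le> sqrt (\<integral>x. (f x)^2 \<partial>M) * sqrt (\<integral>x. (g x)^2 \<partial>M)"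
proof -
 have b: "\<bar>f x * g x\<bar> \<le> (f x)^2 + (g x)^2" for x
 proof -
  have "2 * (\<bar>f x\<bar> * \<bar>g x\<bar>) \<le> \<bar>f x\<bar>\<^sup>2 + \<bar>g x\<bar>\<^sup>2"
   using zero_le_power2[of "\<bar>f x\<bar> - \<bar>g x\<bar>"] by (simp add: power2_eq_square algebra_simps)
  moreover have "0 \<le> \<bar>f x\<bar> * \<bar>g x\<bar>" by simp
  ultimately show ?thesis unfolding abs_mult power2_abs by linarith
 qed
 show fg: "integrable M (\<lambda>x. f x * g x)"
  by (rule Bochner_Integration.integrable_bound[OF Bochner_Integration.integrable_add[OF i]]) (use b in \<open>auto intro!: AE_I2\<close>)
 let ?F = "\<integral>x. (f x)^2 \<partial>M" and ?G = "\<integral>x. (g x)^2 \<partial>M" and ?H = "\<integral>x. f x * g x \<partial>M"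
 have FG: "0 \<le> ?F" "0 \<le> ?G" by simp_all
 have q: "0 \<le> a^2 * ?F + 2 * a * b * ?H + b^2 * ?G" for a b
 proof -
  have "0 \<le> (\<integral>x. (a * f x + b * g x)^2 \<partial>M)" by simp
  also have "\<dots> = (\<integral>x. a^2 * (f x)^2 + 2 * a * b * (f x * g x) + b^2 * (g x)^2 \<partial>M)"
   by (simp add: power2_eq_square algebra_simps)
  also have "\<dots> = a^2 * ?F + 2 * a * b * ?H + b^2 * ?G" using i fg by simp
  finally show ?thesis .
 qed
 have "?H^2 \<le> ?F * ?G"
 proof (cases "?G = 0")
  case True
  have "?H = 0"
  proof (rule ccontr)
   assume H: "?H \<noteq> 0"
   define c where "c = - (?F + 1) / ?H"
   have "0 \<le> 1^2 * ?F + 2 * 1 * c * ?H + c^2 * ?G" by (rule q)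
   moreover have "c * ?H = - (?F + 1)" using H by (simp add: c_def)
   ultimately have "0 \<le> - ?F - 2" using True by simp
   with FG(1) show False by linarith
  qed
  then show ?thesis using FG by simp
 next
  case False
  then have G: "0 < ?G" using FG by linarith
  have "0 \<le> ?G^2 * ?F + 2 * ?G * (- ?H) * ?H + (- ?H)^2 * ?G" by (rule q)
  then have "0 \<le> ?G * (?F * ?G - ?H\<^sup>2)" by (simp add: power2_eq_square algebra_simps)
  then have "0 \<le> ?F * ?G - ?H\<^sup>2" using G by (simp only: zero_le_mult_iff) auto
  then show ?thesis by linarith
 qed
 then show "\<bar>?H\<bar> \<le> sqrt ?F * sqrt ?G"
  by (metis real_sqrt_abs real_sqrt_le_iff real_sqrt_mult)
qed

section \<open>Convolution\<close>

definition conv :: "('a::euclidean_space \<Rightarrow> real) \<Rightarrow> ('a \<Rightarrow> real) \<Rightarrow> 'a \<Rightarrow> real" where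
 "conv k h x = (LBINT y. k (x - y) * h y)"

lemma conv_commute:
 assumes [measurable]: "k \<in> borel_measurable borel" "h \<in> borel_measurable borel"
 shows "conv k h = conv h k"
proof
 fix x
 show "conv k h x = conv h k x"
  unfolding conv_def
  by (subst integral_scale_reflect[where c="-1" and t=x]) (auto simp: mult.commute)
qed

lemma bsupp_conv:
 assumes "bsupp k" "bsupp h" shows "bsupp (conv k h)"
proof -
 obtain R where R: "\<And>x. R < norm x \<Longrightarrow> k x = 0" using bsuppE[OF assms(1)] by blast
 obtain R' where R': "\<And>x. R' < norm x \<Longrightarrow> h x = 0" using bsuppE[OF assms(2)] by blast
 show ?thesis
 proof (rule bsuppI[of "R + R'"])
  fix x :: 'a assume x: "R + R' < norm x"
  have "k (x - y) * h y = 0" for y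
  proof (cases "R' < norm y")
   case False
   then have "R < norm (x - y)" using x norm_triangle_ineq2[of x y] by linarith
   then show ?thesis by (simp add: R)
  qed (simp add: R')
  then have "(\<lambda>y. k (x - y) * h y) = (\<lambda>y. 0)" by (rule ext)
  then show "conv k h x = 0" unfolding conv_def by simp
 qed
qed

text \<open>The box depends on \<open>h\<close> alone, so a kernel and all its partial derivatives
  can be integrated over the same box.\<close>

lemma conv_cbox:
 fixes k h :: "'a::euclidean_space \<Rightarrow> real"
 assumes "cont h" "bsupp h"
 obtains a b where "\<And>k. cont k \<Longrightarrow> conv k h = (\<lambda>x. integral (cbox a b) (\<lambda>y. k (x - y) * h y))"
  "\<And>k x. cont k \<Longrightarrow> cont (\<lambda>y. k (x - y) * h y)"
proof -
 obtain R where R: "\<And>x. R < norm x \<Longrightarrow> h x = 0" using bsuppE[OF assms(2)] by blast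
 obtain a b :: 'a where ab: "cball 0 R \<subseteq> cbox a b" by (rule cbox_cover)
 have out: "h x = 0" if "x \<notin> cbox a b" for x
  using that ab R[of x] by (cases "R < norm x") (auto simp: subset_iff)
 have c: "cont (\<lambda>y. k (x - y) * h y)" if "cont k" for k :: "'a \<Rightarrow> real" and x
  by (intro continuous_intros continuous_on_compose2[OF that] assms(1)) auto
 show thesis
 proof (rule that[of a b])
  fix k :: "'a \<Rightarrow> real" assume "cont k"
  then show "conv k h = (\<lambda>x. integral (cbox a b) (\<lambda>y. k (x - y) * h y))"
   unfolding conv_def by (intro ext integral_cs_cbox c) (simp_all add: out)
 qed (rule c)
qed

lemma conv_continuous:
 assumes k: "cont k" and t: "cont h" "bsupp h"
 shows "cont (conv k h)"
proof -
 obtain a b where ab: "\<And>k. cont k \<Longrightarrow> conv k h = (\<lambda>x. integral (cbox a b) (\<lambda>y. k (x - y) * h y))"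
  by (rule conv_cbox[OF t], rule that)
 have "continuous_on (UNIV \<times> cbox a b) (\<lambda>z. k (fst z - snd z) * h (snd z))"
  by (intro continuous_intros continuous_on_compose2[OF k] continuous_on_compose2[OF t(1)]) auto
 then show ?thesis unfolding ab[OF k]
  by (intro integral_continuous_on_param) (simp add: split_beta)
qed

lemma conv_has_derivative:
 fixes k h :: "real^'n::finite \<Rightarrow> real"
 assumes k: "Ck 1 k" and t: "cont h" "bsupp h"
 shows "(conv k h has_derivative (\<lambda>v. \<Oplus>i. v $ i * conv (pd i k) h x)) (at x)"
proof -
 obtain a b where ab: "\<And>k. cont k \<Longrightarrow> conv k h = (\<lambda>x. integral (cbox a b) (\<lambda>y. k (x - y) * h y))"
   "\<And>k x. cont k \<Longrightarrow> cont (\<lambda>y. k (x - y) * h y)"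
  by (rule conv_cbox[OF t], rule that)
 have kc: "cont k" "\<And>i. cont (pd i k)"
  using Ck_cont[OF k] Ck_partial[of 0 k] k by auto
 \<comment> \<open>The Leibniz rule for vector parameters expects a continuous integrand of bounded
   linear maps; \<open>D\<close> is the gradient of the integrand in this form.\<close>
 define D where "D x y = (\<Oplus>i. (pd i k (x - y) * h y) *\<^sub>R blinfun_inner_right (axis i (1::real) :: real^'n))" for x y
 have Dc: "continuous_on S (\<lambda>z. D (fst z) (snd z))" for S
  unfolding D_def
  by (intro continuous_intros continuous_on_compose2[OF kc(2)] continuous_on_compose2[OF t(1)]) auto
 have Da: "blinfun_apply (D x y) v = (\<Oplus>i. v $ i * (pd i k (x - y) * h y))" for x y v
  by (simp add: D_def blinfun.sum_left blinfun.scaleR_left inner_axis' mult.commute)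
 have "((\<lambda>x. integral (cbox a b) (\<lambda>y. k (x - y) * h y)) has_derivative
   blinfun_apply (integral (cbox a b) (D x))) (at x within UNIV)"
 proof (rule leibniz_rule)
  show "((\<lambda>x. k (x - y) * h y) has_derivative blinfun_apply (D x y)) (at x within UNIV)" for x y
  proof -
   have "((\<lambda>x. x - y) has_derivative (\<lambda>v. v)) (at x)" by (auto intro!: derivative_eq_intros)
   from has_derivative_compose[OF this has_derivative_partial[OF k]]
   have "((\<lambda>x. k (x - y) * h y) has_derivative (\<lambda>v. (\<Oplus>i. v $ i *\<^sub>R pd i k (x - y)) * h y)) (at x)"
    by (intro has_derivative_mult_left) auto
   moreover have "(\<lambda>v. (\<Oplus>i. v $ i *\<^sub>R pd i k (x - y)) * h y) = blinfun_apply (D x y)"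
    unfolding fun_eq_iff Da by (simp add: sum_distrib_right mult.assoc)
   ultimately show ?thesis by simp
  qed
  show "(\<lambda>y. k (x - y) * h y) integrable_on cbox a b" for x
   using ab(2)[OF kc(1)] by (intro integrable_continuous) (auto intro: continuous_on_subset)
  show "continuous_on (UNIV \<times> cbox a b) (\<lambda>(x, y). D x y)"
   using Dc by (simp add: split_beta)
 qed auto
 moreover have "blinfun_apply (integral (cbox a b) (D x)) = (\<lambda>v. \<Oplus>i. v $ i * conv (pd i k) h x)"
 proof
  fix v
  have Di: "D x integrable_on cbox a b"
  proof (rule integrable_continuous)
   have "continuous_on (cbox a b) (\<lambda>y. (x, y))" by (intro continuous_intros)
   then show "continuous_on (cbox a b) (D x)"
    using continuous_on_compose2[OF Dc[of UNIV], of "cbox a b" "\<lambda>y. (x, y)"] by (simp only: fst_conv snd_conv subset_UNIV)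
  qed
  have "blinfun_apply (integral (cbox a b) (D x)) v = integral (cbox a b) (\<lambda>y. blinfun_apply (D x y) v)"
   by (rule blinfun_apply_integral[OF Di])
  also have "\<dots> = (\<Oplus>i. integral (cbox a b) (\<lambda>y. v $ i * (pd i k (x - y) * h y)))"
   unfolding Da
   by (intro integral_sum) (auto intro!: integrable_continuous continuous_on_subset[OF ab(2)[OF kc(2)]] continuous_intros)
  also have "\<dots> = (\<Oplus>i. v $ i * conv (pd i k) h x)"
   unfolding ab(1)[OF kc(2)] by simp
  finally show "blinfun_apply (integral (cbox a b) (D x)) v = (\<Oplus>i. v $ i * conv (pd i k) h x)" .
 qed
 ultimately show ?thesis unfolding ab(1)[OF kc(1)] by simp
qed

lemma partial_conv:
 fixes k h :: "real^'n::finite \<Rightarrow> real"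
 assumes "Ck 1 k" "cont h" "bsupp h"
 shows "pd i (conv k h) = conv (pd i k) h"
 by (rule ext, subst partial_eq[OF conv_has_derivative[OF assms]])
  (simp add: axis_def if_distrib[where f="\<lambda>z. z * _"] cong: if_cong)

lemma Ck_conv:
 fixes k h :: "real^'n::finite \<Rightarrow> real"
 assumes "Ck n k" and t: "cont h" "bsupp h"
 shows "Ck n (conv k h)"
 using assms(1)
proof (induction n arbitrary: k)
 case 0
 then show ?case using conv_continuous[OF _ t] by simp
next
 case (Suc n)
 have k1: "Ck 1 k" using Ck_on_mono[OF Suc.prems, of 1] by simp
 have "Ck n (\<lambda>x. \<Oplus>i. v $ i * conv (pd i k) h x)" for v
  by (intro Ck_sum Ck_mult Ck_const Suc.IH Ck_partial[OF Suc.prems])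
 with conv_has_derivative[OF k1 t] show ?case unfolding Ck_Suc_iff
  by (intro exI[of _ "\<lambda>x v. \<Oplus>i. v $ i * conv (pd i k) h x"]) blast
qed

lemma laplacian_sum: "lap f = (\<lambda>x. \<Oplus>i. pd i (pd i f) x)"
 by (simp add: laplacian_def fun_eq_iff)

text \<open>Two integrations by parts turn the square of \<open>pd i (pd j h)\<close> into
  \<open>pd i (pd i h) * pd j (pd j h)\<close>, and the sum of these products is the square of the
  Laplacian. This is the L^2 estimate behind the pressure bound.\<close>

lemma hessian_L2:
 fixes h :: "real^'n::finite \<Rightarrow> real"
 assumes h: "Ck 3 h" and b: "bsupp h"
 shows "(\<Oplus>i. \<Oplus>j. LBINT x. (pd i (pd j h) x)^2) = (LBINT x. (lap h x)^2)"
proof -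
 have h3: "Ck_on (Suc (Suc 1)) UNIV h" using h by (simp only: numeral_3_eq_3 One_nat_def)
 have h2: "Ck (Suc 1) (pd j h)" for j using Ck_partial[OF h3] .
 have h2': "Ck 2 h" "Ck 2 (pd j h)" for j
  using Ck_on_mono[OF h, of 2] h2[of j] by (simp_all add: numeral_2_eq_2)
 have h1: "Ck 1 (pd i (pd j h))" "Ck 1 (pd j h)" for i j
  using Ck_partial[OF h2[of j]] Ck_on_mono[OF h2[of j], of 1] by simp_all
 have c: "cont (pd i (pd j h))" for i j using Ck_cont[OF h1(1)] .
 have comm: "pd i (pd i (pd j h)) = pd j (pd i (pd i h))" for i j
  using partial_commute[OF h2'(1), of i j] partial_commute[OF h2'(2)[of i], of i j] by simp
 have "(LBINT x. (pd i (pd j h) x)^2) = (LBINT x. pd i (pd i h) x * pd j (pd j h) x)" for i j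
 proof -
  have "(LBINT x. (pd i (pd j h) x)^2) = (LBINT x. pd i (pd j h) x * pd i (pd j h) x)"
   by (simp add: power2_eq_square)
  also have "\<dots> = - (LBINT x. pd i (pd i (pd j h)) x * pd j h x)"
   by (rule integral_by_parts[OF h1]) (use b in auto)
  also have "\<dots> = - (LBINT x. pd j (pd i (pd i h)) x * pd j h x)"
   by (subst comm) (rule refl)
  also have "\<dots> = (LBINT x. pd i (pd i h) x * pd j (pd j h) x)"
   by (subst integral_by_parts[OF h1(1) h1(2)]) (use b in auto)
  finally show ?thesis .
 qed
 moreover have "integ (\<lambda>x. pd i (pd i h) x * pd j (pd j h) x)" for i j
  using c b by (intro integrable_cs continuous_intros) auto
 ultimately show ?thesis
  by (simp add: laplacian_sum power2_eq_square sum_product)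
qed

lemma bsupp_continuous_bounded:
 fixes h :: "'a::euclidean_space \<Rightarrow> real"
 assumes "cont h" "bsupp h"
 obtains C where "0 < C" "\<And>x. \<bar>h x\<bar> \<le> C"
proof -
 obtain R where R: "0 < R" "\<And>x. R < norm x \<Longrightarrow> h x = 0" using bsuppE[OF assms(2)] by blast
 have "bounded (h ` cball 0 R)"
  by (intro compact_imp_bounded compact_continuous_image continuous_on_subset[OF assms(1)]) auto
 then obtain C where C: "0 < C" "\<forall>y\<in>h ` cball 0 R. norm y \<le> C" unfolding bounded_pos by blast
 show ?thesis
 proof (rule that[OF C(1)])
  fix x show "\<bar>h x\<bar> \<le> C" using C R(2)[of x] by (cases "R < norm x") auto
 qed
qed

lemma finite_family_bounded:
 fixes f :: "'i::finite \<Rightarrow> 'a::euclidean_space \<Rightarrow> real"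
 assumes "\<And>i. cont (f i)" "\<And>i. bsupp (f i)"
 obtains C where "0 < C" "\<And>i x. \<bar>f i x\<bar> \<le> C"
proof -
 have "\<exists>C>0. \<forall>x. \<bar>f i x\<bar> \<le> C" for i using bsupp_continuous_bounded[OF assms, of i] by metis
 then obtain C where C: "\<And>i. 0 < C i" "\<And>i x. \<bar>f i x\<bar> \<le> C i" by metis
 have "\<bar>f i x\<bar> \<le> (\<Oplus>i. C i)" for i x
  using member_le_sum[of i UNIV C] C(2)[of i x] C(1) by (auto intro: less_imp_le order_trans)
 moreover have "0 < (\<Oplus>i. C i)" by (rule sum_pos) (auto simp: C)
 ultimately show thesis using that by blast
qed

lemma finite_family_bounded2:
 fixes f :: "'i::finite \<Rightarrow> 'j::finite \<Rightarrow> 'a::euclidean_space \<Rightarrow> real"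
 assumes "\<And>i j. cont (f i j)" "\<And>i j. bsupp (f i j)"
 obtains C where "0 < C" "\<And>i j x. \<bar>f i j x\<bar> \<le> C"
proof -
 obtain C where C: "0 < C" "\<And>z x. \<bar>case_prod f z x\<bar> \<le> C"
  using finite_family_bounded[of "case_prod f"] assms by (auto simp: split_beta)
 show thesis using C(2)[of "(_, _)"] by (intro that[OF C(1)]) simp
qed

lemma bsupp_uniformly_continuous:
 fixes h :: "'a::euclidean_space \<Rightarrow> real"
 assumes "cont h" "bsupp h" "0 < e"
 obtains d where "0 < d" "d \<le> 1" "\<And>x y. norm (x - y) \<le> d \<Longrightarrow> \<bar>h x - h y\<bar> \<le> e"
proof -
 obtain R where R: "0 < R" "\<And>x. R < norm x \<Longrightarrow> h x = 0" using bsuppE[OF assms(2)] by blast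
 have "uniformly_continuous_on (cball 0 (R + 1)) h"
  by (intro compact_uniformly_continuous continuous_on_subset[OF assms(1)]) auto
 then obtain d where d: "0 < d" "\<And>x y. x \<in> cball 0 (R+1) \<Longrightarrow> y \<in> cball 0 (R+1) \<Longrightarrow> dist y x < d \<Longrightarrow> dist (h y) (h x) < e"
  unfolding uniformly_continuous_on_def using assms(3) by metis
 show ?thesis
 proof (rule that[of "min (d/2) 1"])
  fix x y :: 'a assume xy: "norm (x - y) \<le> min (d/2) 1"
  show "\<bar>h x - h y\<bar> \<le> e"
  proof (cases "norm x \<le> R + 1 \<and> norm y \<le> R + 1")
   case True
   then have "dist (h x) (h y) < e"
    by (intro d(2)) (use xy d(1) in \<open>auto simp: dist_norm\<close>)
   then show ?thesis by (simp add: dist_norm)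
  next
   case False
   moreover have "\<bar>norm x - norm y\<bar> \<le> 1" using norm_triangle_ineq3[of x y] xy by linarith
   ultimately have "R < norm x" "R < norm y" by linarith+
   then show ?thesis using R(2) assms(3) by simp
  qed
 qed (use d in auto)
qed

text \<open>Cauchy-Schwarz with \<open>\<eta>\<close> split into two square roots gives the
  pointwise bound \<open>p\<close>; integrating it and exchanging the order of integration produces
  the second factor of the mass.\<close>

lemma conv_Young:
 fixes \<eta> h :: "'a::euclidean_space \<Rightarrow> real"
 assumes e: "cont \<eta>" "bsupp \<eta>" "\<And>x. 0 \<le> \<eta> x" and t: "cont h" "bsupp h"
 shows "(LBINT x. (conv \<eta> h x)^2) \<le> (LBINT x. \<eta> x)^2 * (LBINT x. (h x)^2)"
proof -
 let ?m = "LBINT x. \<eta> x"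
 have ec: "cont (\<lambda>y. \<eta> (x - y))" for x
  by (intro continuous_on_compose2[OF e(1)] continuous_intros) auto
 have eb: "bsupp (\<lambda>y. \<eta> (x - y))" for x
  using bsupp_scale[OF e(2), of "-1" x] by simp
 have m: "(LBINT y. \<eta> (x - y)) = ?m" for x
  using integral_scale_reflect[of \<eta> "-1" x] cont_borel[OF e(1)] by simp
 have m0: "0 \<le> ?m" using e(3) by simp
 have p: "(conv \<eta> h x)^2 \<le> ?m * (LBINT y. \<eta> (x - y) * (h y)^2)" for x
 proof -
  have bm: "(\<lambda>y. sqrt (\<eta> (x - y))) \<in> borel_measurable lborel" "(\<lambda>y. sqrt (\<eta> (x - y)) * h y) \<in> borel_measurable lborel"
   using ec t(1) by (auto intro!: cont_borel continuous_intros)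
  have sq: "(sqrt (\<eta> (x - y)))^2 = \<eta> (x - y)" "(sqrt (\<eta> (x - y)) * h y)^2 = \<eta> (x - y) * (h y)^2"
   "sqrt (\<eta> (x - y)) * (sqrt (\<eta> (x - y)) * h y) = \<eta> (x - y) * h y" for y
   using e(3)[of "x - y"] by (simp_all add: power_mult_distrib)
  have "\<bar>LBINT y. sqrt (\<eta> (x - y)) * (sqrt (\<eta> (x - y)) * h y)\<bar>
   \<le> sqrt (LBINT y. (sqrt (\<eta> (x - y)))^2) * sqrt (LBINT y. (sqrt (\<eta> (x - y)) * h y)^2)"
   by (rule integral_Cauchy_Schwarz[OF bm])
    (unfold sq, auto intro!: integrable_cs ec eb continuous_intros t bsupp_mult1)
  then have "\<bar>conv \<eta> h x\<bar> \<le> sqrt (?m * (LBINT y. \<eta> (x - y) * (h y)^2))"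
   unfolding sq m conv_def by (simp add: real_sqrt_mult)
  then have "\<bar>conv \<eta> h x\<bar>\<^sup>2 \<le> (sqrt (?m * (LBINT y. \<eta> (x - y) * (h y)^2)))^2"
   by (intro power_mono) auto
  then show ?thesis using m0 e(3) by simp
 qed
 have t2: "cont (\<lambda>x. (h x)^2)" "bsupp (\<lambda>x. (h x)^2)"
  using t by (auto intro!: continuous_intros)
 have cc: "cont (conv \<eta> (\<lambda>y. (h y)^2))" "bsupp (conv \<eta> (\<lambda>y. (h y)^2))"
  by (rule conv_continuous[OF e(1) t2], rule bsupp_conv[OF e(2) t2(2)])
 obtain R where R: "0 < R" "\<And>x. R < norm x \<Longrightarrow> \<eta> x = 0" using bsuppE[OF e(2)] by blast
 obtain R' where R': "0 < R'" "\<And>x. R' < norm x \<Longrightarrow> h x = 0" using bsuppE[OF t(2)] by blast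
 have "(LBINT x. (conv \<eta> h x)^2) \<le> (LBINT x. ?m * conv \<eta> (\<lambda>y. (h y)^2) x)"
 proof (rule integral_mono)
  show "integ (\<lambda>x. (conv \<eta> h x)^2)"
   by (intro integrable_cs continuous_intros conv_continuous[OF e(1) t] bsupp_power bsupp_conv[OF e(2) t(2)]) auto
  show "integ (\<lambda>x. ?m * conv \<eta> (\<lambda>y. (h y)^2) x)"
   by (intro integrable_cs continuous_intros cc bsupp_mult2)
  show "(conv \<eta> h x)^2 \<le> ?m * conv \<eta> (\<lambda>y. (h y)^2) x" for x
   using p by (simp only: conv_def)
 qed
 also have "\<dots> = ?m * (LBINT x. (LBINT y. \<eta> (x - y) * (h y)^2))" by (simp add: conv_def)
 also have "(LBINT x. (LBINT y. \<eta> (x - y) * (h y)^2)) = (LBINT y. (LBINT x. \<eta> (x - y) * (h y)^2))"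
 proof (rule fubini_cs[symmetric, where R = "R + R'"])
  show "cont (\<lambda>(x, y). \<eta> (x - y) * (h y)^2)"
   unfolding split_beta
   by (intro continuous_intros continuous_on_compose2[OF e(1)] continuous_on_compose2[OF t(1)]) auto
  fix x y :: 'a assume nz: "\<eta> (x - y) * (h y)^2 \<noteq> 0"
  then have "norm (x - y) \<le> R" "norm y \<le> R'" using R(2)[of "x - y"] R'(2)[of y] by (auto simp: not_less[symmetric])
  then show "norm x \<le> R + R' \<and> norm y \<le> R + R'" using norm_triangle_ineq[of "x - y" y] R(1) by simp
 qed
 also have "(LBINT y. (LBINT x. \<eta> (x - y) * (h y)^2)) = (LBINT y. ?m * (h y)^2)"
 proof -
  have "(LBINT x. \<eta> (x - y)) = ?m" for y
   using integral_translate[of \<eta> "-y"] cont_borel[OF e(1)] by simp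
  then show ?thesis by simp
 qed
 finally show ?thesis by (simp add: power2_eq_square)
qed

text \<open>After the substitution \<open>y = x - r z\<close> the kernel no longer depends on
  \<open>r\<close>, and the uniform continuity of \<open>h\<close> gives the limit. The mass of
  \<open>\<eta>\<close> is not normalised and appears as a factor.\<close>

lemma conv_approx_identity:
 fixes \<eta> h q :: "real^3 \<Rightarrow> real"
 assumes e: "cont \<eta>" "bsupp \<eta>" "\<And>x. 0 \<le> \<eta> x" and t: "cont h" "bsupp h"
  and q: "cont q"
 shows "((\<lambda>r. LBINT x. q x * conv (\<lambda>z. (1/r)^3 * \<eta> ((1/r) *\<^sub>R z)) h x) \<longlongrightarrow>
  (LBINT x. \<eta> x) * (LBINT x. q x * h x)) (at_right 0)"
proof -
 let ?m = "LBINT x. \<eta> x"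
 let ?e = "\<lambda>r z. (1/r)^3 * \<eta> ((1/r) *\<^sub>R z)"
 obtain R where R: "0 < R" "\<And>x. R < norm x \<Longrightarrow> \<eta> x = 0" using bsuppE[OF e(2)] by blast
 obtain R' where R': "0 < R'" "\<And>x. R' < norm x \<Longrightarrow> h x = 0" using bsuppE[OF t(2)] by blast
 have cv: "conv (?e r) h x = (LBINT z. \<eta> z * h (x - r *\<^sub>R z))" if "0 < r" for r x
 proof -
  have "(LBINT y. ?e r (x - y) * h y)
   = \<bar>-r\<bar> ^ DIM(real^3) * (LBINT z. ?e r (x - (x + (-r) *\<^sub>R z)) * h (x + (-r) *\<^sub>R z))"
   using that
   by (intro integral_scale_reflect cont_borel)
    (auto intro!: continuous_intros continuous_on_compose2[OF e(1)] t)
  also have "\<dots> = (LBINT z. r^3 * (?e r (x - (x + (-r) *\<^sub>R z)) * h (x + (-r) *\<^sub>R z)))"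
   using that by simp
  also have "\<dots> = (LBINT z. \<eta> z * h (x - r *\<^sub>R z))"
   using that by (intro Bochner_Integration.integral_cong refl) (simp add: field_simps)
  finally show ?thesis by (simp add: conv_def)
 qed
 define S where "S = cball (0::real^3) (R + R')"
 have qi: "integ (\<lambda>x. indicator S x *\<^sub>R \<bar>q x\<bar>)"
  unfolding S_def
  by (intro borel_integrable_compact continuous_intros continuous_on_subset[OF q]) auto
 define Q where "Q = (LBINT x. indicator S x *\<^sub>R \<bar>q x\<bar>)"
 have Q0: "0 \<le> Q" unfolding Q_def by simp
 have m0: "0 \<le> ?m" using e(3) by simp
 show ?thesis
 proof (rule tendstoI)
  fix \<epsilon> :: real assume "0 < \<epsilon>"
  \<comment> \<open>Chosen so that \<open>Q * (?m * \<epsilon>')\<close> is at most half of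
    \<open>\<epsilon>\<close>; the summands 1 keep the denominator positive.\<close>
  define \<epsilon>' where "\<epsilon>' = \<epsilon> / (2 * (?m + 1) * (Q + 1))"
  have e': "0 < \<epsilon>'" using \<open>0 < \<epsilon>\<close> m0 Q0 by (simp add: \<epsilon>'_def)
  obtain d where d: "0 < d" "d \<le> 1" "\<And>x y. norm (x - y) \<le> d \<Longrightarrow> \<bar>h x - h y\<bar> \<le> \<epsilon>'"
   using bsupp_uniformly_continuous[OF t e'] by blast
  have close: "dist (LBINT x. q x * conv (?e r) h x) (?m * (LBINT x. q x * h x)) < \<epsilon>"
   if r: "0 < r" "r < min 1 (d / R)" for r
  proof -
   have rR: "r * R \<le> d" using r R(1) by (simp add: field_simps)
   have ct: "cont (\<lambda>z. h (x - r *\<^sub>R z))" for x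
    by (intro continuous_on_compose2[OF t(1)] continuous_intros) auto
   have i1: "integ (\<lambda>z. \<eta> z * h (x - r *\<^sub>R z))" "integ (\<lambda>z. \<eta> z * h x)" for x
    using e ct by (auto intro!: integrable_cs continuous_intros)
   have i2: "integ \<eta>" using e by auto
   have pt: "\<bar>conv (?e r) h x - ?m * h x\<bar> \<le> ?m * \<epsilon>'" for x
   proof -
    have "conv (?e r) h x - ?m * h x = (LBINT z. \<eta> z * h (x - r *\<^sub>R z) - \<eta> z * h x)"
     unfolding cv[OF r(1)] by (subst Bochner_Integration.integral_diff[OF i1]) simp
    also have "\<bar>\<dots>\<bar> \<le> (LBINT z. \<bar>\<eta> z * h (x - r *\<^sub>R z) - \<eta> z * h x\<bar>)"
     by (rule integral_abs_bound)
    also have "\<dots> \<le> (LBINT z. \<eta> z * \<epsilon>')"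
    proof (rule integral_mono)
     fix z
     show "\<bar>\<eta> z * h (x - r *\<^sub>R z) - \<eta> z * h x\<bar> \<le> \<eta> z * \<epsilon>'"
     proof (cases "R < norm z")
      case False
      then have "r * norm z \<le> r * R" using r(1) by (intro mult_left_mono) auto
      moreover have "norm ((x - r *\<^sub>R z) - x) = r * norm z" using r(1) by simp
      ultimately have "norm ((x - r *\<^sub>R z) - x) \<le> d" using rR by linarith
      then have "\<bar>h (x - r *\<^sub>R z) - h x\<bar> \<le> \<epsilon>'" by (rule d(3))
      then show ?thesis using e(3)[of z]
       by (simp add: abs_mult mult_left_mono flip: right_diff_distrib)
     qed (simp add: R)
    qed (use i1 i2 in auto)
    finally show ?thesis by simp
   qed
   have sup: "conv (?e r) h x - ?m * h x = 0" if "x \<notin> S" for x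
   proof -
    have x: "R + R' < norm x" using that by (simp add: S_def)
    have "\<eta> z * h (x - r *\<^sub>R z) = 0" for z
    proof (cases "R < norm z")
     case False
     then have "norm (r *\<^sub>R z) \<le> 1 * R" using r unfolding norm_scaleR by (intro mult_mono) auto
     then have "R' < norm (x - r *\<^sub>R z)" using x norm_triangle_ineq2[of x "r *\<^sub>R z"] by linarith
     then show ?thesis by (simp add: R')
    qed (simp add: R)
    then have "(\<lambda>z. \<eta> z * h (x - r *\<^sub>R z)) = (\<lambda>z. 0)" by (rule ext)
    then have "conv (?e r) h x = 0" unfolding cv[OF r(1)] by simp
    moreover have "h x = 0" using R'(2)[of x] x R(1) by simp
    ultimately show ?thesis by simp
   qed
   have ec: "cont (?e r)" "bsupp (?e r)"
    using bsupp_scale[OF e(2), of "1/r" 0] r(1)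
    by (auto intro!: continuous_intros continuous_on_compose2[OF e(1)])
   have cc: "cont (conv (?e r) h)" "bsupp (conv (?e r) h)"
    by (rule conv_continuous[OF ec(1) t], rule bsupp_conv[OF ec(2) t(2)])
   have j: "integ (\<lambda>x. q x * conv (?e r) h x)" "integ (\<lambda>x. q x * h x)"
    using q cc t by (auto intro!: integrable_cs continuous_intros)
   have eq: "(LBINT x. q x * conv (?e r) h x) - ?m * (LBINT x. q x * h x)
    = (LBINT x. q x * conv (?e r) h x - ?m * (q x * h x))"
    using j by simp
   have "\<bar>LBINT x. q x * conv (?e r) h x - ?m * (q x * h x)\<bar> \<le> (LBINT x. \<bar>q x * conv (?e r) h x - ?m * (q x * h x)\<bar>)"
    by (rule integral_abs_bound)
   also have "\<dots> \<le> (LBINT x. indicator S x *\<^sub>R \<bar>q x\<bar> * (?m * \<epsilon>'))"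
   proof (rule integral_mono)
    fix x
    have "\<bar>q x * conv (?e r) h x - ?m * (q x * h x)\<bar> = \<bar>q x\<bar> * \<bar>conv (?e r) h x - ?m * h x\<bar>"
     unfolding abs_mult[symmetric] right_diff_distrib by (simp only: mult.left_commute)
    also have "\<dots> \<le> indicator S x *\<^sub>R \<bar>q x\<bar> * (?m * \<epsilon>')"
     using pt[of x] sup[of x] by (cases "x \<in> S") (auto intro!: mult_left_mono)
    finally show "\<bar>q x * conv (?e r) h x - ?m * (q x * h x)\<bar> \<le> indicator S x *\<^sub>R \<bar>q x\<bar> * (?m * \<epsilon>')" .
   qed (use j qi in auto)
   also have "\<dots> = Q * (?m * \<epsilon>')" by (simp add: Q_def)
   also have "\<dots> \<le> (Q + 1) * ((?m + 1) * \<epsilon>')"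
    using Q0 m0 e' by (intro mult_mono) auto
   also have "\<dots> = \<epsilon> / 2"
   proof -
    have "Q + 1 \<noteq> 0" "?m + 1 \<noteq> 0" using Q0 m0 by linarith+
    moreover have "a * (b * (\<epsilon> / (2 * b * a))) = \<epsilon> / 2" if "a \<noteq> 0" "b \<noteq> 0" for a b :: real
     using that by simp
    ultimately show ?thesis unfolding \<epsilon>'_def by blast
   qed
   also have "\<dots> < \<epsilon>" using \<open>0 < \<epsilon>\<close> by simp
   finally show ?thesis unfolding dist_real_def eq .
  qed
  show "\<forall>\<^sub>F r in at_right 0. dist (LBINT x. q x * conv (?e r) h x) (?m * (LBINT x. q x * h x)) < \<epsilon>"
   unfolding eventually_at_right_field
   using close d(1) R(1) by (intro exI[of _ "min 1 (d / R)"]) auto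
 qed
qed

section \<open>Smooth finite energy solutions in coordinates\<close>

definition smooth_slab :: "real \<Rightarrow> (real \<Rightarrow> 'a::euclidean_space \<Rightarrow> 'b::real_normed_vector) \<Rightarrow> bool" where
 "smooth_slab T f \<longleftrightarrow> smooth_on ({0..T} \<times> UNIV) (\<lambda>(t, x). f t x)"

abbreviation slab_derivative ::
 "real \<Rightarrow> (real \<Rightarrow> 'a::euclidean_space \<Rightarrow> 'b::real_normed_vector) \<Rightarrow> real \<times> 'a \<Rightarrow> real \<times> 'a \<Rightarrow> 'b" where
 "slab_derivative T f z \<equiv> frechet_derivative (\<lambda>(t, x). f t x) (at z within {0..T} \<times> UNIV)"

lemma slab_has_derivative:
 assumes "smooth_slab T f" "z \<in> {0..T} \<times> UNIV"
 shows "((\<lambda>(t, x). f t x) has_derivative slab_derivative T f z) (at z within {0..T} \<times> UNIV)"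
proof -
 have "Ck_on (Suc 0) ({0..T} \<times> UNIV) (\<lambda>(t, x). f t x)"
  using assms(1) unfolding smooth_slab_def smooth_on_def by blast
 then show ?thesis
  using assms(2) unfolding Ck_on.simps(2) differentiable_on_def frechet_derivative_works by blast
qed

text \<open>At the faces \<open>t = 0\<close> and \<open>t = T\<close> the time direction can still
  be probed inwards, and displacements of one sign in each basis direction already determine the
  derivative.\<close>

lemma slab_derivative_unique:
 fixes F :: "real \<times> 'a::euclidean_space \<Rightarrow> 'b::real_normed_vector"
 assumes "0 < T" "z \<in> {0..T} \<times> UNIV"
  and "(F has_derivative D) (at z within {0..T} \<times> UNIV)" "(F has_derivative D') (at z within {0..T} \<times> UNIV)"
 shows "D = D'"
proof (rule frechet_derivative_unique_within[OF assms(3,4)])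
 fix i :: "real \<times> 'a" and e :: real
 assume i: "i \<in> Basis" and e: "0 < e"
 obtain t x where z: "z = (t, x)" "0 \<le> t" "t \<le> T" using assms(2) by auto
 show "\<exists>d. 0 < \<bar>d\<bar> \<and> \<bar>d\<bar> < e \<and> z + d *\<^sub>R i \<in> {0..T} \<times> UNIV"
 proof (cases "fst i = 0")
  case True
  then show ?thesis using z e by (intro exI[of _ "e/2"]) (auto simp: mem_Times_iff)
 next
  case False
  then have i1: "i = (1, 0)" using i by (auto simp: Basis_prod_def)
  show ?thesis
  proof (cases "t = T")
   case True
   then show ?thesis using z e i1 assms(1)
    by (intro exI[of _ "- (min (e/2) T)"]) (auto simp: mem_Times_iff min_def)
  next
   case False
   then show ?thesis using z e i1 assms(1)
    by (intro exI[of _ "min (e/2) (T - t)"]) (auto simp: mem_Times_iff min_def)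
  qed
 qed
qed

lemma smooth_slab_direction:
 assumes "smooth_slab T f"
 shows "smooth_slab T (\<lambda>t x. slab_derivative T f (t, x) v)"
 unfolding smooth_slab_def smooth_on_def
proof
 fix k
 have "Ck_on (Suc k) ({0..T} \<times> UNIV) (\<lambda>(t, x). f t x)"
  using assms unfolding smooth_slab_def smooth_on_def by blast
 then have "Ck_on k ({0..T} \<times> UNIV) (\<lambda>z. slab_derivative T f z v)"
  unfolding Ck_on.simps(2) by blast
 then show "Ck_on k ({0..T} \<times> UNIV) (\<lambda>(t, x). slab_derivative T f (t, x) v)"
  by (rule Ck_on_cong[THEN iffD1, rotated]) auto
qed

lemma smooth_slab_cong:
 assumes "smooth_slab T f" "\<And>t x. t \<in> {0..T} \<Longrightarrow> f t x = g t x"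
 shows "smooth_slab T g"
 unfolding smooth_slab_def smooth_on_def
proof
 fix k
 have "Ck_on k ({0..T} \<times> UNIV) (\<lambda>(t, x). f t x)"
  using assms(1) unfolding smooth_slab_def smooth_on_def by blast
 then show "Ck_on k ({0..T} \<times> UNIV) (\<lambda>(t, x). g t x)"
  by (rule Ck_on_cong[THEN iffD1, rotated]) (use assms(2) in auto)
qed

lemma slab_space_derivative:
 assumes "smooth_slab T f" "t \<in> {0..T}"
 shows "(f t has_derivative (\<lambda>v. slab_derivative T f (t, x) (0, v))) (at x)"
proof -
 have e: "((\<lambda>x. (t, x)) has_derivative (\<lambda>v. (0, v))) (at x)"
  by (auto intro!: derivative_eq_intros)
 have "((\<lambda>(t, x). f t x) has_derivative slab_derivative T f (t, x)) (at (t, x) within range (\<lambda>x. (t, x)))"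
  by (rule has_derivative_subset[OF slab_has_derivative[OF assms(1)]]) (use assms(2) in auto)
 from has_derivative_in_compose[OF e this] show ?thesis by simp
qed

lemma slab_time_derivative:
 assumes "smooth_slab T f" "t \<in> {0..T}"
 shows "((\<lambda>s. f s x) has_vector_derivative slab_derivative T f (t, x) (1, 0)) (at t within {0..T})"
proof -
 have e: "((\<lambda>s. (s, x)) has_derivative (\<lambda>h. (h, 0))) (at t within {0..T})"
  by (auto intro!: derivative_eq_intros)
 have D: "((\<lambda>(t, x). f t x) has_derivative slab_derivative T f (t, x)) (at (t, x) within (\<lambda>s. (s, x)) ` {0..T})"
  by (rule has_derivative_subset[OF slab_has_derivative[OF assms(1)]]) (use assms(2) in auto)
 from has_derivative_in_compose[OF e D]
 have "((\<lambda>s. f s x) has_derivative (\<lambda>h. slab_derivative T f (t, x) (h, 0))) (at t within {0..T})" by simp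
 moreover have lin: "slab_derivative T f (t, x) (h, 0) = h *\<^sub>R slab_derivative T f (t, x) (1, 0)" for h
  using linear_cmul[OF has_derivative_linear[OF D], of h "(1, 0)"] by simp
 have "(\<lambda>h. slab_derivative T f (t, x) (h, 0)) = (\<lambda>h. h *\<^sub>R slab_derivative T f (t, x) (1, 0))"
  by (rule ext) (rule lin)
 with calculation(1) show ?thesis unfolding has_vector_derivative_def by (rule has_derivative_eq_rhs)
qed

lemma slab_partial:
 fixes f :: "real \<Rightarrow> real^'n::finite \<Rightarrow> 'b::real_normed_vector"
 assumes "smooth_slab T f" "t \<in> {0..T}"
 shows "pd i (f t) x = slab_derivative T f (t, x) (0, axis i 1)"
 by (rule partial_eq[OF slab_space_derivative[OF assms]])

lemma smooth_slab_partial: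
 fixes f :: "real \<Rightarrow> real^'n::finite \<Rightarrow> 'b::real_normed_vector"
 assumes "smooth_slab T f"
 shows "smooth_slab T (\<lambda>t. pd i (f t))"
 by (rule smooth_slab_cong[OF smooth_slab_direction[OF assms]])
  (rule slab_partial[OF assms, symmetric])

lemma smooth_slab_Ck:
 assumes "smooth_slab T f" "t \<in> {0..T}"
 shows "Ck k (f t)"
 using assms(1)
proof (induction k arbitrary: f)
 case 0
 have "isCont (f t) x" for x
  by (rule has_derivative_continuous[OF slab_space_derivative[OF 0 assms(2)]])
 then show ?case by (simp add: continuous_on_eq_continuous_at)
next
 case (Suc k)
 have "Ck k (\<lambda>x. slab_derivative T f (t, x) (0, v))" for v
  using Suc.IH[OF smooth_slab_direction[OF Suc.prems]] .
 with slab_space_derivative[OF Suc.prems assms(2)] show ?case unfolding Ck_Suc_iff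
  by (intro exI[of _ "\<lambda>x v. slab_derivative T f (t, x) (0, v)"]) blast
qed

lemma smooth_slab_continuous:
 assumes "smooth_slab T f"
 shows "continuous_on ({0..T} \<times> UNIV) (\<lambda>(t, x). f t x)"
proof -
 have "Ck_on 0 ({0..T} \<times> UNIV) (\<lambda>(t, x). f t x)"
  using assms unfolding smooth_slab_def smooth_on_def by blast
 then show ?thesis by simp
qed

text \<open>Used to pass from the velocity vector to its components. The relative derivative of the
  composite is identified by uniqueness on the slab, which is where \<open>0 < T\<close>
  enters.\<close>

lemma smooth_slab_linear_comp:
 fixes f :: "real \<Rightarrow> 'a::euclidean_space \<Rightarrow> 'b::real_normed_vector"
 assumes T: "0 < T" and L: "bounded_linear L" and f: "smooth_slab T f"
 shows "smooth_slab T (\<lambda>t x. L (f t x))"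
 unfolding smooth_slab_def smooth_on_def
proof
 fix k
 show "Ck_on k ({0..T} \<times> UNIV) (\<lambda>(t, x). L (f t x))"
  using f
 proof (induction k arbitrary: f)
  case 0
  have "continuous_on ({0..T} \<times> UNIV) (\<lambda>z. L (case z of (t, x) \<Rightarrow> f t x))"
   using bounded_linear.continuous_on[OF L smooth_slab_continuous[OF 0]] .
  then show ?case by (simp add: split_beta)
 next
  case (Suc k)
  let ?S = "{0..T} \<times> (UNIV :: 'a set)"
  have D: "((\<lambda>(t, x). L (f t x)) has_derivative (\<lambda>v. L (slab_derivative T f z v))) (at z within ?S)"
   if "z \<in> ?S" for z
   using bounded_linear.has_derivative[OF L slab_has_derivative[OF Suc.prems that]]
   by (simp only: case_prod_beta')
  have eq: "slab_derivative T (\<lambda>t x. L (f t x)) z v = L (slab_derivative T f z v)" if "z \<in> ?S" for z v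
  proof -
   have "((\<lambda>(t, x). L (f t x)) has_derivative slab_derivative T (\<lambda>t x. L (f t x)) z) (at z within ?S)"
    using D[OF that] frechet_derivative_works differentiable_def by blast
   from slab_derivative_unique[OF T that this D[OF that]] show ?thesis by simp
  qed
  have "Ck_on k ?S (\<lambda>z. slab_derivative T (\<lambda>t x. L (f t x)) z v)" for v
  proof (rule Ck_on_cong[THEN iffD1])
   show "Ck_on k ?S (\<lambda>(t, x). L (slab_derivative T f (t, x) v))"
    by (rule Suc.IH[OF smooth_slab_direction[OF Suc.prems]])
   show "(case z of (t, x) \<Rightarrow> L (slab_derivative T f (t, x) v)) = slab_derivative T (\<lambda>t x. L (f t x)) z v"
    if "z \<in> ?S" for z
    using eq[OF that] by (simp add: split_beta)
  qed
  moreover have "(\<lambda>(t, x). L (f t x)) differentiable_on ?S"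
   unfolding differentiable_on_def differentiable_def using D by blast
  ultimately show ?case unfolding Ck_on.simps(2) by blast
 qed
qed

lemma fatou_L2:
 fixes f :: "nat \<Rightarrow> 'a::euclidean_space \<Rightarrow> real"
 assumes [measurable]: "\<And>n. f n \<in> borel_measurable lborel" "g \<in> borel_measurable lborel"
  and i: "\<And>n. integ (f n)" "\<And>n x. 0 \<le> f n x" and le: "\<And>n. (LBINT x. f n x) \<le> C"
  and lim: "\<And>x. (\<lambda>n. f n x) \<longlonglongrightarrow> g x"
 shows "integ g" "(LBINT x. g x) \<le> C"
proof -
 have g0: "0 \<le> g x" for x
  using lim[of x] i(2) by (intro LIMSEQ_le_const[of "\<lambda>n. f n x"]) auto
 have "(\<integral>\<^sup>+x. ennreal (g x) \<partial>lborel) = (\<integral>\<^sup>+x. liminf (\<lambda>n. ennreal (f n x)) \<partial>lborel)"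
  using lim by (intro nn_integral_cong lim_imp_Liminf[symmetric]) (auto intro!: tendsto_ennrealI)
 also have "\<dots> \<le> liminf (\<lambda>n. \<integral>\<^sup>+x. ennreal (f n x) \<partial>lborel)"
  by (rule nn_integral_liminf) measurable
 also have "\<dots> \<le> ennreal C"
 proof (rule order_trans[OF Liminf_le_Limsup])
  show "limsup (\<lambda>n. \<integral>\<^sup>+x. ennreal (f n x) \<partial>lborel) \<le> ennreal C"
   by (intro Limsup_bounded always_eventually allI)
    (simp add: nn_integral_eq_integral[OF i(1)] i(2) le ennreal_leI)
 qed simp
 finally have *: "(\<integral>\<^sup>+x. ennreal (g x) \<partial>lborel) \<le> ennreal C" .
 then show "integ g"
  using g0 by (intro integrableI_nonneg) (auto simp: top_unique less_top[symmetric])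
 then have "(\<integral>\<^sup>+x. ennreal (g x) \<partial>lborel) = ennreal (LBINT x. g x)"
  by (rule nn_integral_eq_integral) (simp add: g0)
 with * have "ennreal (LBINT x. g x) \<le> ennreal C" by (simp only:)
 moreover have "0 \<le> (LBINT x. f 0 x)" by (rule Bochner_Integration.integral_nonneg) (rule i(2))
 then have "0 \<le> C" using le[of 0] by linarith
 ultimately show "(LBINT x. g x) \<le> C" by (simp only: ennreal_le_iff)
qed

text \<open>Solutions in components, with the time derivative as a field of its own. The energy
  bound holds at every time, and \<open>E\<close> is a parameter so that later estimates can be
  uniform over all solutions with a given bound.\<close>

locale nse_solution =
 fixes U :: "3 \<Rightarrow> real \<Rightarrow> real^3 \<Rightarrow> real" and Ut :: "3 \<Rightarrow> real \<Rightarrow> real^3 \<Rightarrow> real"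
  and p :: "real \<Rightarrow> real^3 \<Rightarrow> real" and T E :: real
 assumes T: "0 < T" and E: "0 < E"
  and U: "\<And>i. smooth_slab T (U i)" and Ut: "\<And>i. smooth_slab T (Ut i)" and p: "smooth_slab T p"
  and Ut_deriv: "\<And>i t x. t \<in> {0..T} \<Longrightarrow> ((\<lambda>s. U i s x) has_real_derivative Ut i t x) (at t within {0..T})"
  and momentum: "\<And>i t x. t \<in> {0..T} \<Longrightarrow>
   Ut i t x = lap (U i t) x - (\<Oplus>j. U j t x * pd j (U i t) x) - pd i (p t) x"
  and divfree: "\<And>t x. t \<in> {0..T} \<Longrightarrow> (\<Oplus>i. pd i (U i t) x) = 0"
  and energy: "\<And>t. t \<in> {0..T} \<Longrightarrow> integ (\<lambda>x. \<Oplus>i. (U i t x)^2)"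
   "\<And>t. t \<in> {0..T} \<Longrightarrow> (LBINT x. (\<Oplus>i. (U i t x)^2)) \<le> E^2"

lemma norm_vec_sq: "(norm (x :: real^'n))^2 = (\<Oplus>i. (x $ i)^2)"
 by (simp add: norm_vec_def L2_set_def sum_nonneg)

lemma in_L2_continuous:
 fixes f :: "real^'n \<Rightarrow> real^'m"
 assumes "cont f"
 shows "in_L2 f \<longleftrightarrow> integ (\<lambda>x. (norm (f x))^2)"
  "(L2_norm f)^2 = (LBINT x. (norm (f x))^2)"
proof -
 have m: "f \<in> borel_measurable borel" "(\<lambda>x. (norm (f x))^2) \<in> borel_measurable lborel"
  using assms by (auto intro!: cont_borel continuous_intros)
 then have "f \<in> borel_measurable lebesgue" by (simp add: measurable_completion)
 with m show "in_L2 f \<longleftrightarrow> integ (\<lambda>x. (norm (f x))^2)"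
  by (simp add: in_L2_def integrable_completion)
 show "(L2_norm f)^2 = (LBINT x. (norm (f x))^2)"
  using m by (simp add: L2_norm_def integral_completion)
qed

text \<open>The finite energy condition holds only for almost every time. Good times accumulate at
  every \<open>t\<close>, the velocity is continuous in time at each point, and Fatou's lemma
  carries the bound over to \<open>t\<close>.\<close>

lemma nse_solution_of_smooth:
 assumes s: "smooth_finite_energy_solution u p u0 T"
 obtains E Ut where "nse_solution (\<lambda>i t x. u t x $ i) Ut p T E"
proof -
 note d = s[unfolded smooth_finite_energy_solution_def]
 have T: "0 < T" using d by blast
 have u: "smooth_slab T u" and p: "smooth_slab T p" using d by (auto simp: smooth_slab_def)
 have U: "smooth_slab T (\<lambda>t x. u t x $ i)" for i
  by (rule smooth_slab_linear_comp[OF T bounded_linear_vec_nth u])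
 define Ut where "Ut i t x = slab_derivative T (\<lambda>t x. u t x $ i) (t, x) (1, 0)" for i t x
 have Uts: "smooth_slab T (Ut i)" for i
  unfolding Ut_def by (rule smooth_slab_direction[OF U])
 have Utd: "((\<lambda>s. u s x $ i) has_real_derivative Ut i t x) (at t within {0..T})" if "t \<in> {0..T}" for i t x
  unfolding Ut_def has_real_derivative_iff_has_vector_derivative by (rule slab_time_derivative[OF U that])
 have pn: "pd j (\<lambda>x. u t x $ i) = (\<lambda>x. pd j (u t) x $ i)" if "t \<in> {0..T}" for i j t
  by (rule partial_nth[OF smooth_slab_Ck[OF u that]])
 have pn2: "pd k (\<lambda>x. pd j (u t) x $ i) = (\<lambda>x. pd k (pd j (u t)) x $ i)" if "t \<in> {0..T}" for i j k t
  by (rule partial_nth[OF smooth_slab_Ck[OF smooth_slab_partial[OF u] that]])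
 have mom: "Ut i t x = lap (\<lambda>x. u t x $ i) x - (\<Oplus>j. u t x $ j * pd j (\<lambda>x. u t x $ i) x) - pd i (p t) x"
  if t: "t \<in> {0..T}" for i t x
 proof -
  have vd: "((\<lambda>s. u s x) has_vector_derivative slab_derivative T u (t, x) (1, 0)) (at t within {0..T})"
   by (rule slab_time_derivative[OF u t])
  have tc: "t \<in> cbox 0 T" using t by simp
  have "vector_derivative (\<lambda>s. u s x) (at t within {0..T}) = slab_derivative T u (t, x) (1, 0)"
   using vector_derivative_within_cbox[OF T tc] vd unfolding cbox_interval by blast
  moreover have "((\<lambda>s. u s x $ i) has_vector_derivative slab_derivative T u (t, x) (1, 0) $ i) (at t within {0..T})"
   by (rule bounded_linear.has_vector_derivative[OF bounded_linear_vec_nth vd])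
  then have "Ut i t x = slab_derivative T u (t, x) (1, 0) $ i"
   using vector_derivative_within_cbox[OF T tc, of "\<lambda>s. u s x $ i"] Utd[OF t, of x i]
   unfolding cbox_interval has_real_derivative_iff_has_vector_derivative by metis
  moreover have "vector_derivative (\<lambda>s. u s x) (at t within {0..T}) + advection (u t) (u t) x
     = lap (u t) x - gradient (p t) x"
   using d t by blast
  ultimately have "Ut i t x = (lap (u t) x - gradient (p t) x - advection (u t) (u t) x) $ i"
   by (metis add_diff_cancel_right')
  then show ?thesis
   by (simp add: laplacian_def gradient_def advection_def pn[OF t] pn2[OF t])
 qed
 have dv: "(\<Oplus>i. pd i (\<lambda>x. u t x $ i) x) = 0" if "t \<in> {0..T}" for t x
  using d that by (simp add: divergence_free_def divergence_def)
 obtain C where C: "AE t in lebesgue_on {0..T}. in_L2 (u t) \<and> L2_norm (u t) \<le> C"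
  using d unfolding finite_Linf_L2_def by blast
 have cu: "cont (u t)" if "t \<in> {0..T}" for t
  using Ck_cont[OF smooth_slab_Ck[OF u that, of 0]] .
 \<comment> \<open>The summand 1 provides the positivity of \<open>E\<close> demanded by the
   locale.\<close>
 define E where "E = \<bar>C\<bar> + 1"
 have good: "integ (\<lambda>x. (norm (u t x))^2) \<and> (LBINT x. (norm (u t x))^2) \<le> E^2"
  if "in_L2 (u t) \<and> L2_norm (u t) \<le> C" "t \<in> {0..T}" for t
 proof -
  have "0 \<le> L2_norm (u t)" by (simp add: L2_norm_def)
  then have "(L2_norm (u t))^2 \<le> E^2" using that(1) by (intro power_mono) (auto simp: E_def)
  then show ?thesis using in_L2_continuous[OF cu[OF that(2)]] that(1) by simp
 qed
 have en: "integ (\<lambda>x. (norm (u t x))^2) \<and> (LBINT x. (norm (u t x))^2) \<le> E^2"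
  if t: "t \<in> {0..T}" for t
 proof -
  \<comment> \<open>Otherwise a nondegenerate interval around \<open>t\<close>, cut off at 0 and
    \<open>T\<close>, would consist of bad times and be a null set.\<close>
  have ex: "\<exists>s\<in>{0..T}. \<bar>s - t\<bar> < e \<and> in_L2 (u s) \<and> L2_norm (u s) \<le> C" if e: "0 < e" for e
  proof (rule ccontr)
   assume n: "\<not> ?thesis"
   define a where "a = max 0 (t - e/2)"
   define b where "b = min T (t + e/2)"
   have ab: "a < b" "{a..b} \<subseteq> {0..T}" using t e T by (auto simp: a_def b_def)
   have near: "\<bar>s - t\<bar> < e" if "s \<in> {a..b}" for s using that e by (auto simp: a_def b_def abs_less_iff)
   obtain N where N: "N \<in> null_sets (lebesgue_on {0..T})"
    "{s \<in> space (lebesgue_on {0..T}). \<not> (in_L2 (u s) \<and> L2_norm (u s) \<le> C)} \<subseteq> N"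
    using C unfolding eventually_ae_filter by blast
   have "{a..b} \<subseteq> N" using N(2) n near ab(2) by (auto simp: space_restrict_space)
   then have "{a..b} \<in> null_sets (lebesgue_on {0..T})"
    by (intro null_sets_subset[OF N(1)]) (use ab(2) in \<open>auto simp: sets_restrict_space_iff\<close>)
   then have "emeasure lebesgue {a..b} = 0"
    using ab(2) by (simp add: null_sets_restrict_space null_setsD1)
   then show False using ab(1) by simp
  qed
  have "\<exists>s. s \<in> {0..T} \<and> \<bar>s - t\<bar> < inverse (real (Suc n)) \<and> in_L2 (u s) \<and> L2_norm (u s) \<le> C" for n
   using ex[of "inverse (real (Suc n))"] by auto
  then have "\<exists>s. \<forall>n. s n \<in> {0..T} \<and> \<bar>s n - t\<bar> < inverse (real (Suc n)) \<and> in_L2 (u (s n)) \<and> L2_norm (u (s n)) \<le> C"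
   by (intro choice) blast
  then obtain s where s: "\<forall>n. s n \<in> {0..T} \<and> \<bar>s n - t\<bar> < inverse (real (Suc n)) \<and> in_L2 (u (s n)) \<and> L2_norm (u (s n)) \<le> C"
   by blast
  then have sn: "\<And>n. s n \<in> {0..T}" "\<And>n. \<bar>s n - t\<bar> < inverse (real (Suc n))"
   "\<And>n. in_L2 (u (s n)) \<and> L2_norm (u (s n)) \<le> C" by blast+
  have "(\<lambda>n. s n - t) \<longlonglongrightarrow> 0"
   by (rule Lim_null_comparison[OF always_eventually LIMSEQ_inverse_real_of_nat])
    (use sn(2) in \<open>auto intro: less_imp_le\<close>)
  then have st: "s \<longlonglongrightarrow> t" by (rule LIM_zero_cancel)
  have ut: "(\<lambda>n. (norm (u (s n) x))^2) \<longlonglongrightarrow> (norm (u t x))^2" for x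
  proof -
   have "continuous (at t within {0..T}) (\<lambda>s. u s x)"
    by (rule has_vector_derivative_continuous[OF slab_time_derivative[OF u t]])
   then have "(\<lambda>n. u (s n) x) \<longlonglongrightarrow> u t x"
    using st sn(1) t by (simp add: continuous_within_sequentially o_def)
   then show ?thesis by (intro tendsto_intros)
  qed
  have m: "(\<lambda>x. (norm (u s x))^2) \<in> borel_measurable lborel" if "s \<in> {0..T}" for s
   using cu[OF that] by (auto intro!: cont_borel continuous_intros)
  have g: "integ (\<lambda>x. (norm (u (s n) x))^2)" "(LBINT x. (norm (u (s n) x))^2) \<le> E^2" for n
   using good[OF sn(3) sn(1)] by blast+
  show ?thesis
   using fatou_L2[OF m[OF sn(1)] m[OF t] g(1) _ g(2) ut] by simp
 qed
 have "nse_solution (\<lambda>i t x. u t x $ i) Ut p T E"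
  by unfold_locales (use T U Uts p Utd mom dv en in \<open>auto simp: E_def norm_vec_sq\<close>)
 then show thesis by (rule that)
qed

section \<open>The regularised Newton potential\<close>

text \<open>
 Inside the unit ball \<open>s powr (-1/2)\<close> is replaced by its Taylor polynomial of degree 6 at \<open>s = 1\<close>, which
 makes \<open>newt\<close> of class \<open>C\<^sup>6\<close> and, conveniently, superharmonic; \<open>gam j\<close> is the \<open>j\<close>-th derivative of the profile.
\<close>

definition gam_inner :: "nat \<Rightarrow> real \<Rightarrow> real" where
 "gam_inner j s = (\<Sum>i\<le>6 - j. (pochhammer (1/2) (i + j) / fact i) * (1 - s) ^ i)"

text \<open>The \<open>j\<close>-th derivative of \<open>s powr (-1/2)\<close> without its sign
  \<open>(-1) ^ j\<close>, which \<open>gam\<close> restores for both pieces.\<close>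

definition gam_outer :: "nat \<Rightarrow> real \<Rightarrow> real" where
 "gam_outer j s = pochhammer (1/2) j * s powr (- (1/2) - real j)"

definition gam :: "nat \<Rightarrow> real \<Rightarrow> real" where
 "gam j s = (-1) ^ j * (if s \<in> {..1} then gam_inner j s else gam_outer j s)"

lemma pochhammer_half:
 "pochhammer (1/2::real) 0 = 1" "pochhammer (1/2::real) 1 = 1/2" "pochhammer (1/2::real) 2 = 3/4"
 "pochhammer (1/2::real) 3 = 15/8" "pochhammer (1/2::real) 4 = 105/16" "pochhammer (1/2::real) 5 = 945/32"
 "pochhammer (1/2::real) 6 = 10395/64"
proof -
 have s: "pochhammer (1/2::real) (Suc n) = pochhammer (1/2) n * (1/2 + real n)" for n
  by (rule pochhammer_Suc)
 show 0: "pochhammer (1/2::real) 0 = 1" by simp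
 show 1: "pochhammer (1/2::real) 1 = 1/2" using s[of 0] by simp
 show 2: "pochhammer (1/2::real) 2 = 3/4" using s[of 1] 1 by (simp add: numeral_2_eq_2)
 show 3: "pochhammer (1/2::real) 3 = 15/8" using s[of 2] 2 by (simp add: numeral_3_eq_3 numeral_2_eq_2)
 show 4: "pochhammer (1/2::real) 4 = 105/16" using s[of 3] 3 by simp
 show 5: "pochhammer (1/2::real) 5 = 945/32" using s[of 4] 4 by simp
 show "pochhammer (1/2::real) 6 = 10395/64" using s[of 5] 5 by simp
qed

lemma gam_inner_deriv:
 assumes "j < 6"
 shows "(gam_inner j has_real_derivative - gam_inner (Suc j) s) (at s within S)"
proof -
 obtain m where m: "6 - j = Suc m" "6 - Suc j = m" using assms by (metis Suc_diff_Suc)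
 have "((\<lambda>s. \<Sum>i\<le>Suc m. (pochhammer (1/2) (i + j) / fact i) * (1 - s) ^ i) has_real_derivative
   (\<Sum>i\<le>Suc m. (pochhammer (1/2) (i + j) / fact i) * (real i * (1 - s) ^ (i - 1) * (0 - 1)))) (at s within S)"
  by (intro DERIV_sum DERIV_cmult) (auto intro!: derivative_eq_intros)
 also have "(\<Sum>i\<le>Suc m. (pochhammer (1/2) (i + j) / fact i) * (real i * (1 - s) ^ (i - 1) * (0 - 1)))
   = - (\<Sum>i\<le>m. (pochhammer (1/2) (i + Suc j) / fact i) * (1 - s) ^ i)"
  unfolding sum.atMost_Suc_shift sum_negf[symmetric]
  by (simp add: divide_simps del: of_nat_Suc)
 finally show ?thesis unfolding gam_inner_def m .
qed

lemma gam_outer_deriv: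
 assumes "0 < s"
 shows "(gam_outer j has_real_derivative - gam_outer (Suc j) s) (at s within S)"
proof -
 have "((\<lambda>s. pochhammer (1/2) j * s powr (- (1/2) - real j)) has_real_derivative
   pochhammer (1/2) j * ((- (1/2) - real j) * s powr (- (1/2) - real j - 1))) (at s within S)"
  using assms by (intro DERIV_cmult has_real_derivative_powr has_field_derivative_at_within)
 also have "pochhammer (1/2) j * ((- (1/2) - real j) * s powr (- (1/2) - real j - 1))
   = - (pochhammer (1/2) (Suc j) * s powr (- (1/2) - real (Suc j)))"
  by (simp add: pochhammer_Suc algebra_simps)
 finally show ?thesis unfolding gam_outer_def .
qed

lemma gam_inner_outer: "gam_inner j 1 = gam_outer j 1"
proof -
 have "gam_inner j 1 = (\<Sum>i\<le>6 - j. if i = 0 then pochhammer (1/2) j else 0)"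
  unfolding gam_inner_def by (intro sum.cong) auto
 then show ?thesis by (simp add: gam_outer_def)
qed

text \<open>Both pieces take the value \<open>pochhammer (1/2) j\<close> at \<open>s = 1\<close>,
  for every order that occurs, so they glue to a function that is differentiable across 1.\<close>

lemma gam_deriv:
 assumes "j < 6"
 shows "(gam j has_real_derivative gam (Suc j) s) (at s)"
proof -
 have cl: "closure {..1::real} = {..1}" "closure {1::real<..} = {1..}" by simp_all
 have "((\<lambda>s. if s \<in> {..1} then gam_inner j s else gam_outer j s) has_vector_derivative
   (if s \<in> {..1} then - gam_inner (Suc j) s else - gam_outer (Suc j) s)) (at s within {..1} \<union> {1<..})"
 proof (rule has_vector_derivative_If_within_closures)
  assume "s \<in> {..1} \<union> (closure {..1} \<inter> closure {1<..})"
  show "(gam_inner j has_vector_derivative - gam_inner (Suc j) s) (at s within {..1} \<union> (closure {..1} \<inter> closure {1<..}))"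
   using gam_inner_deriv[OF assms] unfolding has_real_derivative_iff_has_vector_derivative .
 next
  assume "s \<in> {1<..} \<union> (closure {..1} \<inter> closure {1<..})"
  then have "0 < s" unfolding cl by auto
  then show "(gam_outer j has_vector_derivative - gam_outer (Suc j) s) (at s within {1<..} \<union> (closure {..1} \<inter> closure {1<..}))"
   using gam_outer_deriv[of s j] unfolding has_real_derivative_iff_has_vector_derivative by blast
 next
  assume "s \<in> closure {..1}" "s \<in> closure {1<..}"
  then have "s = 1" unfolding cl by auto
  then show "gam_inner j s = gam_outer j s" "- gam_inner (Suc j) s = - gam_outer (Suc j) s"
   by (simp_all add: gam_inner_outer)
 qed auto
 moreover have "{..1} \<union> {1<..} = (UNIV :: real set)" by auto
 ultimately have "((\<lambda>s. if s \<in> {..1} then gam_inner j s else gam_outer j s) has_real_derivative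
   (if s \<in> {..1} then - gam_inner (Suc j) s else - gam_outer (Suc j) s)) (at s)"
  unfolding has_real_derivative_iff_has_vector_derivative by simp
 from DERIV_cmult[OF this, of "(-1)^j"] show ?thesis
  unfolding gam_def[abs_def] by (rule DERIV_cong) simp
qed

lemma gam_continuous: "cont (gam 6)"
proof -
 have "continuous_on ({..1} \<union> {1..}) (\<lambda>s::real. if s \<in> {..1} then gam_inner 6 s else gam_outer 6 s)"
 proof (rule continuous_on_If)
  show "continuous_on {..1} (gam_inner 6)" unfolding gam_inner_def by (intro continuous_intros)
  show "continuous_on {1..} (gam_outer 6)" unfolding gam_outer_def by (intro continuous_intros) auto
 qed (auto simp: gam_inner_outer order_antisym[of _ "1::real"])
 moreover have "{..1} \<union> {1..} = (UNIV :: real set)" by auto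
 ultimately show ?thesis unfolding gam_def[abs_def] by (auto intro!: continuous_intros)
qed

lemma Ck_gam: "Ck 6 (gam 0)"
 by (rule Ck_real_derivI[of 6 gam]) (use gam_deriv gam_continuous in auto)

lemma Ck_gam': "j \<le> 6 \<Longrightarrow> Ck (6 - j) (gam j)"
 by (rule Ck_real_derivI[of "6 - j" "\<lambda>i. gam (i + j)", simplified]) (use gam_deriv gam_continuous in auto)

lemma gam_outside:
 assumes "1 \<le> s"
 shows "gam j s = (-1) ^ j * pochhammer (1/2) j * s powr (- (1/2) - real j)"
 using assms gam_inner_outer[of j] by (cases "s = 1") (auto simp: gam_def gam_outer_def)

text \<open>For a radial function \<open>g (x \<bullet> x)\<close> with
  \<open>s = x \<bullet> x\<close> the Laplacian in dimension three is
  \<open>6 g' + 4 s g''\<close>, and \<open>g + 2 s g'\<close> governs its behaviour under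
  rescaling. Both expressions vanish for \<open>s powr (-1/2)\<close>; for its Taylor polynomial
  only one top-order remainder survives, and it has a definite sign for
  \<open>s \<le> 1\<close>.\<close>

lemma gam_identities:
 assumes "s \<le> 1"
 shows "6 * gam 1 s + 4 * s * gam 2 s = - (9009 / 256) * (1 - s) ^ 5"
  "gam 0 s + 2 * s * gam 1 s = 3003 / 1024 * (1 - s) ^ 6"
proof -
 define y where "y = 1 - s"
 have s: "s = 1 - y" by (simp add: y_def)
 have sums: "{..6::nat} = {0,1,2,3,4,5,6}" "{..5::nat} = {0,1,2,3,4,5}" "{..4::nat} = {0,1,2,3,4}" by auto
 have f: "fact 2 = (2::real)" "fact 3 = (6::real)" "fact 4 = (24::real)" "fact 5 = (120::real)" "fact 6 = (720::real)"
  by (simp_all add: eval_nat_numeral)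
 have g: "gam 0 s = 1 + 1/2*y + 3/8*y^2 + 5/16*y^3 + 35/128*y^4 + 63/256*y^5 + 231/1024*y^6"
  "gam 1 s = - (1/2 + 3/4*y + 15/16*y^2 + 35/32*y^3 + 315/256*y^4 + 693/512*y^5)"
  "gam 2 s = 3/4 + 15/8*y + 105/32*y^2 + 315/64*y^3 + 3465/512*y^4"
  using assms unfolding gam_def gam_inner_def y_def[symmetric]
  by (simp_all add: sums pochhammer_half f del: One_nat_def add_2_eq_Suc add_2_eq_Suc')
 have "6 * gam 1 s + 4 * (1 - y) * gam 2 s = - (9009 / 256) * y ^ 5"
  "gam 0 s + 2 * (1 - y) * gam 1 s = 3003 / 1024 * y ^ 6"
  unfolding g by (simp_all add: field_simps eval_nat_numeral)
 then show "6 * gam 1 s + 4 * s * gam 2 s = - (9009 / 256) * (1 - s) ^ 5"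
  "gam 0 s + 2 * s * gam 1 s = 3003 / 1024 * (1 - s) ^ 6"
  by (simp_all add: y_def)
qed

definition newt :: "real^3 \<Rightarrow> real" where
 "newt x = gam 0 (x \<bullet> x)"

definition bump_density :: "real^3 \<Rightarrow> real" where
 "bump_density x = - lap newt x"

lemma Ck_inner_self: "Ck k (\<lambda>x::real^3. x \<bullet> x)"
 by (rule Ck_bilinear[OF bounded_bilinear_inner]) auto

lemma partial_inner_self: "pd i (\<lambda>x::real^3. x \<bullet> x) = (\<lambda>x. 2 * x $ i)"
proof
 fix x :: "real^3"
 have "((\<lambda>x::real^3. x \<bullet> x) has_derivative (\<lambda>v. x \<bullet> v + v \<bullet> x)) (at x)"
  by (auto intro!: derivative_eq_intros)
 from partial_eq[OF this] show "pd i (\<lambda>x::real^3. x \<bullet> x) x = 2 * x $ i"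
  by (simp add: inner_axis inner_axis')
qed

lemma Ck_newt: "Ck 6 newt"
 unfolding newt_def[abs_def] by (rule Ck_comp_real[OF Ck_gam Ck_inner_self])

lemma partial_gam:
 "j < 6 \<Longrightarrow> pd i (\<lambda>x::real^3. gam j (x \<bullet> x)) = (\<lambda>x. gam (Suc j) (x \<bullet> x) * (2 * x $ i))"
 using partial_comp_real[OF gam_deriv Ck_inner_self, of j i] by (simp add: partial_inner_self)

lemma Ck_gam_self: "j < 6 \<Longrightarrow> Ck 1 (\<lambda>x::real^3. gam j (x \<bullet> x))"
 by (rule Ck_comp_real[OF _ Ck_inner_self]) (rule Ck_on_mono[OF Ck_gam'], auto)

lemma Ck_coord: "Ck k (\<lambda>x::real^'n. x $ i)"
 by auto

lemma partial1_newt: "pd i newt = (\<lambda>x. gam 1 (x \<bullet> x) * (2 * x $ i))"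
 unfolding newt_def[abs_def] by (simp add: partial_gam)

lemma partial2_newt:
 "pd j (pd i newt) = (\<lambda>x. gam 1 (x \<bullet> x) * (2 * (if j = i then 1 else 0)) +
  gam 2 (x \<bullet> x) * (2 * x $ j) * (2 * x $ i))"
proof -
 have p: "pd j (\<lambda>x::real^3. 2 * x $ i) = (\<lambda>x. 2 * (if j = i then 1 else 0))"
  by (subst partial_cmult) (auto simp: partial_coord)
 have c: "Ck 1 (\<lambda>x::real^3. 2 * x $ i)" by (intro Ck_mult Ck_const Ck_coord)
 show ?thesis
  unfolding partial1_newt
  by (subst partial_mult[OF Ck_gam_self c]) (simp_all add: p partial_gam numeral_2_eq_2)
qed

lemma partial3_newt:
 "pd k (pd j (pd i newt)) = (\<lambda>x. gam 2 (x \<bullet> x) * (2 * x $ k) * (2 * (if j = i then 1 else 0)) +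
  (gam 2 (x \<bullet> x) * (2 * x $ j) * (2 * (if k = i then 1 else 0)) +
   (gam 2 (x \<bullet> x) * (2 * (if k = j then 1 else 0)) + gam 3 (x \<bullet> x) * (2 * x $ k) * (2 * x $ j)) * (2 * x $ i)))"
proof -
 have p: "pd k (\<lambda>x::real^3. 2 * x $ i) = (\<lambda>x. 2 * (if k = i then 1 else 0))" for i
  by (subst partial_cmult) (auto simp: partial_coord)
 have c: "Ck 1 (\<lambda>x::real^3. 2 * x $ i)" "Ck 1 (\<lambda>x::real^3. 2 * (if j = i then 1 else 0 :: real))" for i
  by (auto intro!: Ck_mult Ck_coord)
 have g: "Ck 1 (\<lambda>x::real^3. gam 1 (x \<bullet> x))" "Ck 1 (\<lambda>x::real^3. gam 2 (x \<bullet> x))"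
  by (rule Ck_gam_self, simp)+
 have g2: "Ck 1 (\<lambda>x::real^3. gam 2 (x \<bullet> x) * (2 * x $ j))" by (rule Ck_mult[OF g(2) c(1)])
 show ?thesis
  unfolding partial2_newt
  by (simp only: partial_add[OF Ck_mult[OF g(1) c(2)] Ck_mult[OF g2 c(1)]] partial_mult[OF g(1) c(2)]
    partial_mult[OF g2 c(1)] partial_mult[OF g(2) c(1)] p partial_const partial_gam)
   (simp add: partial_gam numeral_2_eq_2 numeral_3_eq_3)
qed

text \<open>Outside the unit ball \<open>newt\<close> is \<open>1 / \<bar>x\<bar>\<close>, which is
  harmonic; inside, the first identity of \<open>gam_identities\<close> applies.\<close>

lemma bump_density_eq:
 "bump_density x = (if x \<bullet> x \<le> 1 then 9009 / 256 * (1 - x \<bullet> x) ^ 5 else 0)"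
proof -
 have s: "(\<Oplus>i. gam 2 (x \<bullet> x) * (2 * x $ i) * (2 * x $ i)) = 4 * (x \<bullet> x) * gam 2 (x \<bullet> x)"
 proof -
  have "(\<Oplus>i. gam 2 (x \<bullet> x) * (2 * x $ i) * (2 * x $ i)) = (\<Oplus>i. 4 * gam 2 (x \<bullet> x) * (x $ i * x $ i))"
   by (intro sum.cong refl) simp
  also have "\<dots> = 4 * gam 2 (x \<bullet> x) * (\<Oplus>i. x $ i * x $ i)"
   by (rule sum_distrib_left[symmetric])
  also have "(\<Oplus>i. x $ i * x $ i) = x \<bullet> x" by (simp add: inner_vec_def)
  also have "4 * gam 2 (x \<bullet> x) * (x \<bullet> x) = 4 * (x \<bullet> x) * gam 2 (x \<bullet> x)" by simp
  finally show ?thesis .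
 qed
 have "bump_density x = - (6 * gam 1 (x \<bullet> x) + 4 * (x \<bullet> x) * gam 2 (x \<bullet> x))"
  unfolding bump_density_def laplacian_sum partial2_newt sum.distrib s by simp
 also have "\<dots> = (if x \<bullet> x \<le> 1 then 9009 / 256 * (1 - x \<bullet> x) ^ 5 else 0)"
 proof (cases "x \<bullet> x \<le> 1")
  case True
  then show ?thesis using gam_identities(1)[of "x \<bullet> x"] by simp
 next
  case False
  define s where "s = x \<bullet> x"
  have s: "1 < s" using False by (simp add: s_def)
  have e: "s * s powr (- (1/2) - 2) = s powr (- (1/2) - 1)"
   using powr_add[of s 1 "- (1/2) - 2"] s by simp
  have G: "gam 1 s = - (1/2 * s powr (- (1/2) - 1))" "gam 2 s = 3/4 * s powr (- (1/2) - 2)"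
   using s gam_outside[of s 1] gam_outside[of s 2] by (simp_all add: pochhammer_half del: One_nat_def)
  have "4 * s * gam 2 s = 3 * (s * s powr (- (1/2) - 2))" unfolding G by simp
  moreover have "6 * gam 1 s = - 3 * s powr (- (1/2) - 1)" unfolding G by simp
  ultimately have "6 * gam 1 s + 4 * s * gam 2 s = 0" unfolding e by simp
  then show ?thesis unfolding s_def[symmetric] using s by simp
 qed
 finally show ?thesis .
qed

lemma bump_density_nonneg: "0 \<le> bump_density x"
 by (simp add: bump_density_eq)

lemma bump_density_bsupp: "bsupp bump_density"
proof (rule bsuppI[of 1])
 fix x :: "real^3" assume "1 < norm x"
 then have "1 < x \<bullet> x" using power2_norm_eq_inner[of x] one_less_power[of "norm x" 2] by simp
 then show "bump_density x = 0" by (simp add: bump_density_eq)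
qed

lemma Ck_bump_density: "Ck 4 bump_density"
proof -
 have "Ck_on (Suc (Suc 4)) UNIV newt" using Ck_newt by simp
 then show ?thesis unfolding bump_density_def[abs_def] laplacian_def
  by (intro Ck_minus Ck_sum Ck_partial)
qed

text \<open>The total charge of the Newton potential \<open>1 / \<bar>x\<bar>\<close>, that is 4
  pi.\<close>

definition mass :: real where "mass = (LBINT x. bump_density x)"

lemma integral_pos:
 fixes f :: "real^3 \<Rightarrow> real"
 assumes c: "cont f" and b: "bsupp f" and n: "\<And>x. 0 \<le> f x" and y: "f y \<noteq> 0"
 shows "0 < (LBINT x. f x)"
proof -
 have i: "integ f" by (rule integrable_cs[OF c b])
 have "0 \<noteq> (LBINT x. f x)"
 proof
  assume "0 = (LBINT x. f x)"
  then have ae: "AE x in lborel. f x = 0" using integral_nonneg_eq_0_iff_AE[OF i] n by simp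
  have o: "open {x. f x \<noteq> 0}" by (intro open_Collect_neq c continuous_intros)
  then have "{x. f x \<noteq> 0} \<in> sets lborel" by simp
  then have "{x. f x \<noteq> 0} \<in> null_sets lborel" using ae by (subst AE_iff_null_sets) auto
  then have "negligible {x. f x \<noteq> 0}" unfolding negligible_iff_null_sets by (rule null_sets_completionI)
  then show False using open_not_negligible[OF o] y by blast
 qed
 moreover have "0 \<le> (LBINT x. f x)" using n by simp
 ultimately show ?thesis by simp
qed

lemma mass_pos: "0 < mass"
 unfolding mass_def
 by (rule integral_pos[where y = 0, OF Ck_cont[OF Ck_bump_density] bump_density_bsupp bump_density_nonneg])
  (simp add: bump_density_eq)

lemma newt_outside: "1 \<le> norm x \<Longrightarrow> newt x = 1 / norm x"
proof -
 assume x: "1 \<le> norm x"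
 then have "1 \<le> x \<bullet> x" using power2_norm_eq_inner[of x] one_le_power[of "norm x" 2] by simp
 then have "newt x = (x \<bullet> x) powr (-(1/2))" by (simp add: newt_def gam_outside)
 also have "\<dots> = 1 / sqrt (x \<bullet> x)"
  unfolding powr_minus powr_half_sqrt[OF inner_ge_zero] by (rule inverse_eq_divide)
 finally show "newt x = 1 / norm x" by (simp add: norm_eq_sqrt_inner)
qed

text \<open>Compactness handles the unit ball. Outside, the explicit derivatives of
  \<open>1 / \<bar>x\<bar>\<close> decay like the fourth power of the inverse distance.\<close>

lemma third_newt_bounded:
 obtains C where "0 < C" "\<And>i j k x. \<bar>pd k (pd j (pd i newt)) x\<bar> \<le> C"
proof -
 have c: "cont (pd k (pd j (pd i newt)))" for i j k
 proof -
  have "Ck_on (Suc (Suc (Suc 3))) UNIV newt" using Ck_newt by simp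
  then show ?thesis by (intro Ck_cont[of 3] Ck_partial)
 qed
 have "bounded (\<Union>z. (case z of (i, j, k) \<Rightarrow> pd k (pd j (pd i newt))) ` cball 0 1)"
  by (rule bounded_UN) (auto intro!: compact_imp_bounded compact_continuous_image continuous_on_subset[OF c])
 then obtain C where C: "\<And>y. y \<in> (\<Union>z. (case z of (i, j, k) \<Rightarrow> pd k (pd j (pd i newt))) ` cball 0 1) \<Longrightarrow> norm y \<le> C"
  unfolding bounded_iff by blast
 have inside: "\<bar>pd k (pd j (pd i newt)) x\<bar> \<le> C" if "norm x \<le> 1" for i j k x
  using that C[of "pd k (pd j (pd i newt)) x"] by force
 \<comment> \<open>24 collects three terms with \<open>gam 2\<close>, each at most 3, and one term
   with \<open>gam 3\<close>, at most 15.\<close>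
 have out: "\<bar>pd k (pd j (pd i newt)) x\<bar> \<le> 24" if x: "1 < norm x" for i j k x
 proof -
  define s where "s = x \<bullet> x"
  define \<rho> where "\<rho> = norm x"
  have \<rho>: "1 < \<rho>" and s: "s = \<rho>\<^sup>2" using x by (simp_all add: \<rho>_def s_def power2_norm_eq_inner)
  have s1: "1 \<le> s" using \<rho> unfolding s by (intro one_le_power) simp
  have pw: "s powr a = \<rho> powr (2 * a)" for a
   unfolding s using \<rho> by (simp add: powr_powr flip: powr_numeral)
  have g: "\<bar>gam 2 s\<bar> * \<rho> \<le> 3/4" "\<bar>gam 3 s\<bar> * \<rho> * \<rho> * \<rho> \<le> 15/8"
  proof -
   have le1: "\<rho> powr a \<le> 1" if "a \<le> 0" for a
    using powr_mono[OF that, of \<rho>] \<rho> by simp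
   have G: "gam 2 s = 3/4 * \<rho> powr (-5)" "gam 3 s = - (15/8 * \<rho> powr (-7))"
    using gam_outside[OF s1, of 2] gam_outside[OF s1, of 3] by (simp_all add: pw pochhammer_half)
   have P: "\<rho> powr (-5) * \<rho> = \<rho> powr (-4)" "\<rho> powr (-7) * \<rho> = \<rho> powr (-6)" "\<rho> powr (-6) * \<rho> = \<rho> powr (-5)"
    using powr_add[of \<rho> "-5" 1] powr_add[of \<rho> "-7" 1] powr_add[of \<rho> "-6" 1] \<rho> by simp_all
   have "\<bar>gam 2 s\<bar> = 3/4 * \<rho> powr (-5)" "\<bar>gam 3 s\<bar> = 15/8 * \<rho> powr (-7)"
    unfolding G by (simp_all add: abs_mult)
   then have "\<bar>gam 2 s\<bar> * \<rho> = 3/4 * \<rho> powr (-4)" "\<bar>gam 3 s\<bar> * \<rho> * \<rho> * \<rho> = 15/8 * \<rho> powr (-4)"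
    by (simp_all only: mult.assoc[of "3/4"] mult.assoc[of "15/8"] P)
   then show "\<bar>gam 2 s\<bar> * \<rho> \<le> 3/4" "\<bar>gam 3 s\<bar> * \<rho> * \<rho> * \<rho> \<le> 15/8"
    using le1[of "-4"] by simp_all
  qed
  have xi: "\<bar>x $ i\<bar> \<le> \<rho>" for i unfolding \<rho>_def by (rule component_le_norm_cart)
  have b2: "\<bar>gam 2 s * (2 * x $ a) * (2 * (if P then 1 else 0))\<bar> \<le> 3" for a P
  proof -
   have "\<bar>gam 2 s\<bar> * \<bar>x $ a\<bar> \<le> \<bar>gam 2 s\<bar> * \<rho>" by (intro mult_left_mono xi) simp
   then show ?thesis using g(1) by (auto simp: abs_mult)
  qed
  have b3: "\<bar>gam 3 s * (2 * x $ k) * (2 * x $ j) * (2 * x $ i)\<bar> \<le> 15"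
  proof -
   have "\<bar>gam 3 s\<bar> * \<bar>x $ k\<bar> * \<bar>x $ j\<bar> * \<bar>x $ i\<bar> \<le> \<bar>gam 3 s\<bar> * \<rho> * \<rho> * \<rho>"
    by (intro mult_mono xi) (use \<rho> in auto)
   then show ?thesis using g(2) by (simp add: abs_mult mult.assoc)
  qed
  have "pd k (pd j (pd i newt)) x =
   gam 2 s * (2 * x $ k) * (2 * (if j = i then 1 else 0)) + gam 2 s * (2 * x $ j) * (2 * (if k = i then 1 else 0))
   + gam 2 s * (2 * x $ i) * (2 * (if k = j then 1 else 0)) + gam 3 s * (2 * x $ k) * (2 * x $ j) * (2 * x $ i)"
   unfolding partial3_newt s_def by (simp add: algebra_simps)
  then show ?thesis using b2[of k "j = i"] b2[of j "k = i"] b2[of i "k = j"] b3 by linarith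
 qed
 show thesis
 proof (rule that)
  show "\<bar>pd k (pd j (pd i newt)) x\<bar> \<le> max C 24" for i j k x
   using inside[of x k j i] out[of x k j i] by (cases "norm x \<le> 1") auto
 qed simp
qed

text \<open>The potential regularised at scale \<open>R\<close> around \<open>y\<close>. Since the
  tail \<open>1 / \<bar>x - y\<bar>\<close> is the same for every \<open>R\<close>, potentials at
  two scales differ by a function of bounded support.\<close>

definition newt_at :: "real \<Rightarrow> real^3 \<Rightarrow> real^3 \<Rightarrow> real" where
 "newt_at R y x = (1/R) * newt ((1/R) *\<^sub>R (x - y))"

definition density_at :: "real \<Rightarrow> real^3 \<Rightarrow> real^3 \<Rightarrow> real" where
 "density_at R y x = (1/R)^3 * bump_density ((1/R) *\<^sub>R (x - y))"

lemma partial_cmult_scale: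
 fixes f :: "real^'n::finite \<Rightarrow> real"
 assumes "Ck 1 f"
 shows "pd i (\<lambda>x. c * f (r *\<^sub>R (x - y))) = (\<lambda>x. (c * r) * pd i f (r *\<^sub>R (x - y)))"
 using partial_cmult[OF Ck_comp_scale[OF assms], of i c r y] by (simp add: partial_scale[OF assms] mult.assoc)

lemma Ck_newt_at: "Ck 6 (newt_at R y)"
 unfolding newt_at_def[abs_def] by (intro Ck_mult Ck_const Ck_comp_scale Ck_newt)

lemma Ck_density_at: "Ck 4 (density_at R y)"
 unfolding density_at_def[abs_def] by (intro Ck_mult Ck_const Ck_comp_scale Ck_bump_density)

lemma Ck_newt_partial:
 "Ck 5 (pd i newt)" "Ck 4 (pd j (pd i newt))"
 "Ck 3 (pd k (pd j (pd i newt)))"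
proof -
 have "Ck (Suc 5) newt" using Ck_newt by simp
 from Ck_partial[OF this] show a: "Ck 5 (pd i newt)" for i .
 then have "Ck (Suc 4) (pd i newt)" for i by simp
 from Ck_partial[OF this] show b: "Ck 4 (pd j (pd i newt))" for i j .
 then have "Ck (Suc 3) (pd j (pd i newt))" for i j by simp
 from Ck_partial[OF this] show "Ck 3 (pd k (pd j (pd i newt)))" .
qed

lemma partial1_newt_at: "pd i (newt_at R y) = (\<lambda>x. (1/R)^2 * pd i newt ((1/R) *\<^sub>R (x - y)))"
 unfolding newt_at_def[abs_def]
 by (subst partial_cmult_scale[OF Ck_on_mono[OF Ck_newt]]) (simp_all add: power2_eq_square)

lemma partial2_newt_at:
 "pd j (pd i (newt_at R y)) = (\<lambda>x. (1/R)^3 * pd j (pd i newt) ((1/R) *\<^sub>R (x - y)))"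
 unfolding partial1_newt_at
 by (subst partial_cmult_scale[OF Ck_on_mono[OF Ck_newt_partial(1)]]) (simp_all add: power2_eq_square power3_eq_cube)

lemma partial3_newt_at:
 "pd k (pd j (pd i (newt_at R y))) =
  (\<lambda>x. (1/R)^4 * pd k (pd j (pd i newt)) ((1/R) *\<^sub>R (x - y)))"
 unfolding partial2_newt_at
 by (subst partial_cmult_scale[OF Ck_on_mono[OF Ck_newt_partial(2)]])
  (simp_all add: power3_eq_cube eval_nat_numeral mult.assoc)

lemma laplacian_newt_at: "lap (newt_at R y) = (\<lambda>x. - density_at R y x)"
 unfolding laplacian_sum partial2_newt_at density_at_def bump_density_def
 by (simp add: sum_distrib_left)

lemma partial_density_at: "pd i (density_at R y) = (\<lambda>x. (1/R)^4 * pd i bump_density ((1/R) *\<^sub>R (x - y)))"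
 unfolding density_at_def[abs_def]
 by (subst partial_cmult_scale[OF Ck_on_mono[OF Ck_bump_density]]) (simp_all add: power3_eq_cube eval_nat_numeral mult.assoc)

lemma laplacian_density_at:
 "lap (density_at R y) = (\<lambda>x. (1/R)^5 * lap bump_density ((1/R) *\<^sub>R (x - y)))"
proof -
 have "Ck (Suc 3) bump_density" using Ck_bump_density by simp
 from Ck_partial[OF this] have "Ck 1 (pd i bump_density)" for i
  by (rule Ck_on_mono) simp
 note * = partial_cmult_scale[OF this]
 show ?thesis unfolding laplacian_sum partial_density_at *
  by (simp add: sum_distrib_left eval_nat_numeral mult.assoc)
qed

lemma density_at_bsupp: "0 < R \<Longrightarrow> bsupp (density_at R y)"
 unfolding density_at_def[abs_def] by (intro bsupp_mult2 bsupp_scale bump_density_bsupp) simp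

lemma density_at_nonneg: "0 \<le> R \<Longrightarrow> 0 \<le> density_at R y x"
 unfolding density_at_def by (intro mult_nonneg_nonneg bump_density_nonneg zero_le_power) simp

lemma newt_at_outside:
 assumes "0 < R" "R \<le> norm (x - y)"
 shows "newt_at R y x = 1 / norm (x - y)"
proof -
 have "1 \<le> norm ((1/R) *\<^sub>R (x - y))" using assms by (simp add: divide_simps)
 from newt_outside[OF this] show ?thesis using assms by (simp add: newt_at_def)
qed

lemma newt_diff_bsupp:
 assumes "0 < r" "0 < R"
 shows "bsupp (\<lambda>x. newt_at r y x - newt_at R y x)"
proof (rule bsuppI[of "r + R + norm y"])
 fix x :: "real^3" assume "r + R + norm y < norm x"
 then have "r \<le> norm (x - y)" "R \<le> norm (x - y)" using norm_triangle_ineq2[of x y] assms by linarith+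
 then show "newt_at r y x - newt_at R y x = 0" using newt_at_outside assms by simp
qed

lemma newt_diff_zero:
 assumes "0 < r" "r \<le> R" "R \<le> norm (x - y)"
 shows "newt_at r y x - newt_at R y x = 0"
 using newt_at_outside[of r x y] newt_at_outside[of R x y] assms by simp

text \<open>In the variable \<open>1/R\<close> the value is \<open>f\<close>, whose derivative has
  the form \<open>gam 0 \<sigma> + 2 * \<sigma> * gam 1 \<sigma>\<close> and is nonnegative. The
  differences of potentials used as convolution kernels are therefore nonnegative, and their
  integrals control them.\<close>

lemma newt_at_antimono:
 assumes "0 < r" "r \<le> R"
 shows "newt_at R y x \<le> newt_at r y x"
proof -
 define s where "s = (x - y) \<bullet> (x - y)"
 have s0: "0 \<le> s" by (simp add: s_def)
 define f where "f \<rho> = \<rho> * gam 0 (\<rho>\<^sup>2 * s)" for \<rho> :: real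
 have f: "newt_at R y x = f (1/R)" for R
  by (simp add: newt_at_def newt_def f_def s_def power2_eq_square)
 have "f (1/R) \<le> f (1/r)"
 proof (rule DERIV_nonneg_imp_nondecreasing[of "1/R" "1/r" f])
  show "1/R \<le> 1/r" using assms by (simp add: frac_le)
  fix \<rho> assume "1/R \<le> \<rho>" "\<rho> \<le> 1/r"
  moreover have "0 < 1/R" using assms by simp
  ultimately have \<rho>: "0 < \<rho>" by linarith
  have "((\<lambda>\<rho>. \<rho>\<^sup>2 * s) has_real_derivative 2 * \<rho> * s) (at \<rho>)"
   by (auto intro!: derivative_eq_intros)
  from DERIV_chain2[OF gam_deriv[of 0] this]
  have g: "((\<lambda>\<rho>. gam 0 (\<rho>\<^sup>2 * s)) has_real_derivative gam 1 (\<rho>\<^sup>2 * s) * (2 * \<rho> * s)) (at \<rho>)" by simp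
  have "(f has_real_derivative 1 * gam 0 (\<rho>\<^sup>2 * s) + gam 1 (\<rho>\<^sup>2 * s) * (2 * \<rho> * s) * \<rho>) (at \<rho>)"
   unfolding f_def by (rule DERIV_mult[OF DERIV_ident g])
  moreover have "0 \<le> gam 0 \<sigma> + 2 * \<sigma> * gam 1 \<sigma>" for \<sigma>
  proof (cases "\<sigma> \<le> 1")
   case True
   then show ?thesis unfolding gam_identities(2)[OF True] by simp
  next
   case False
   then have "\<sigma> * \<sigma> powr (- (1/2) - 1) = \<sigma> powr (- (1/2))"
    using powr_add[of \<sigma> 1 "- (1/2) - 1"] by simp
   then show ?thesis using False gam_outside[of \<sigma> 0] gam_outside[of \<sigma> 1]
    by (simp add: mult.assoc)
  qed
  from this[of "\<rho>\<^sup>2 * s"] have "0 \<le> 1 * gam 0 (\<rho>\<^sup>2 * s) + gam 1 (\<rho>\<^sup>2 * s) * (2 * \<rho> * s) * \<rho>"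
   by (simp add: power2_eq_square mult_ac)
  ultimately show "\<exists>y. (f has_real_derivative y) (at \<rho>) \<and> 0 \<le> y" by blast
 qed
 then show ?thesis by (simp add: f)
qed

lemma integral_scale3:
 fixes f :: "real^3 \<Rightarrow> real"
 assumes "f \<in> borel_measurable borel" "0 < R"
 shows "(LBINT x. f ((1/R) *\<^sub>R (x - y))) = R^3 * (LBINT x. f x)"
proof -
 have m: "(\<lambda>x. f ((1/R) *\<^sub>R (x - y))) \<in> borel_measurable borel"
  by (rule measurable_compose[OF _ assms(1)]) measurable
 show ?thesis
  by (subst integral_scale_reflect[OF m, of R y]) (use assms(2) in simp_all)
qed

lemma mass_density_at: "0 < R \<Longrightarrow> (LBINT x. density_at R y x) = mass"
 unfolding density_at_def mass_def
 using integral_scale3[OF cont_borel[OF Ck_cont[OF Ck_bump_density]], of R y]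
 by (simp add: power_one_over)

section \<open>Testing the equation\<close>

lemma deriv_zero_within:
 assumes "0 < T" "t \<in> {0..T}" "(f has_real_derivative D) (at t within {0..T})" "\<And>s. s \<in> {0..T} \<Longrightarrow> f s = c"
 shows "D = 0"
proof -
 have "((\<lambda>s. c) has_real_derivative D) (at t within {0..T})"
  by (rule has_field_derivative_transform_within[OF assms(3) zero_less_one assms(2)]) (rule assms(4))
 moreover have "((\<lambda>s. c) has_real_derivative 0) (at t within {0..T})" by simp
 moreover have "t \<in> cbox 0 T" using assms(2) by simp
 ultimately show ?thesis
  using vector_derivative_unique_within_closed_interval[OF assms(1), of t "\<lambda>s. c" D 0]
  unfolding has_real_derivative_iff_has_vector_derivative cbox_interval by blast
qed

lemma laplacian_by_parts:
 fixes f g :: "real^'n::finite \<Rightarrow> real"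
 assumes f: "Ck 2 f" and g: "Ck 2 g" and b: "bsupp g"
 shows "(LBINT x. lap f x * g x) = (LBINT x. f x * lap g x)"
proof -
 have f2: "Ck (Suc 1) f" and g2: "Ck (Suc 1) g" using f g by (simp_all add: numeral_2_eq_2)
 have f1: "Ck 1 f" "Ck 1 (pd i f)" and g1: "Ck 1 g" "Ck 1 (pd i g)" for i
  using Ck_on_mono[OF f2, of 1] Ck_on_mono[OF g2, of 1] Ck_partial[OF f2] Ck_partial[OF g2] by simp_all
 have c: "cont (pd i (pd i f))" "cont (pd i (pd i g))" for i
  using Ck_partial[of 0] f1(2)[of i] g1(2)[of i] by simp_all
 have "(LBINT x. pd i (pd i f) x * g x) = (LBINT x. f x * pd i (pd i g) x)" for i
  using integral_by_parts[OF f1(2)[of i] g1(1), of i] integral_by_parts[OF f1(1) g1(2)[of i], of i] b bsupp_partial[OF b, of i] by simp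
 moreover have "integ (\<lambda>x. pd i (pd i f) x * g x)" "integ (\<lambda>x. f x * pd i (pd i g) x)" for i
  using b by (auto intro!: integrable_cs continuous_intros c Ck_cont[OF f1(1)] Ck_cont[OF g1(1)])
 ultimately show ?thesis unfolding laplacian_sum sum_distrib_left sum_distrib_right by simp
qed

context nse_solution
begin

lemma CkU: "t \<in> {0..T} \<Longrightarrow> Ck k (U i t)"
 using smooth_slab_Ck[OF U] .

lemma Ckp: "t \<in> {0..T} \<Longrightarrow> Ck k (p t)"
 using smooth_slab_Ck[OF p] .

lemma Ckdp: "t \<in> {0..T} \<Longrightarrow> Ck k (pd j (p t))"
 using smooth_slab_Ck[OF smooth_slab_partial[OF p]] .

lemma CkddU: "t \<in> {0..T} \<Longrightarrow> Ck k (pd l (pd j (U i t)))"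
 using smooth_slab_Ck[OF smooth_slab_partial[OF smooth_slab_partial[OF U]]] .

lemma CkdU: "t \<in> {0..T} \<Longrightarrow> Ck k (pd j (U i t))"
 using smooth_slab_Ck[OF smooth_slab_partial[OF U]] .

lemmas contU = Ck_cont[OF CkU[where k=0]]
lemmas contp = Ck_cont[OF Ckp[where k=0]]
lemmas contdU = Ck_cont[OF CkdU[where k=0]]
lemmas contdp = Ck_cont[OF Ckdp[where k=0]]
lemmas contddU = Ck_cont[OF CkddU[where k=0]]

lemma contlU: "t \<in> {0..T} \<Longrightarrow> cont (lap (U i t))"
 unfolding laplacian_sum by (intro continuous_on_sum contddU)

lemma gradient_test:
 assumes t: "t \<in> {0..T}" and f: "Ck 1 \<phi>" "bsupp \<phi>"
 shows "(\<Oplus>i. LBINT x. U i t x * pd i \<phi> x) = 0"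
proof -
 have c: "cont \<phi>" using Ck_cont[OF f(1)] .
 have i: "integ (\<lambda>x. pd i (U i t) x * \<phi> x)" for i
  using f(2) by (intro integrable_cs continuous_intros contdU[OF t] c) auto
 have "(\<Oplus>i. LBINT x. U i t x * pd i \<phi> x) = - (\<Oplus>i. LBINT x. pd i (U i t) x * \<phi> x)"
  using integral_by_parts[OF CkU[OF t] f(1)] f(2) by (simp add: sum_negf)
 also have "(\<Oplus>i. LBINT x. pd i (U i t) x * \<phi> x) = (LBINT x. (\<Oplus>i. pd i (U i t) x) * \<phi> x)"
  unfolding sum_distrib_right by (rule Bochner_Integration.integral_sum[symmetric]) (rule i)
 also have "\<dots> = 0" by (simp add: divfree[OF t])
 finally show ?thesis by simp
qed

lemma time_derivative_test:
 assumes t: "t \<in> {0..T}" and g: "cont g" "bsupp g"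
 shows "((\<lambda>s. LBINT x. U i s x * g x) has_real_derivative (LBINT x. Ut i t x * g x)) (at t within {0..T})"
proof -
 obtain R where R: "\<And>x. R < norm x \<Longrightarrow> g x = 0" using bsuppE[OF g(2)] by blast
 show ?thesis
 proof (rule leibniz_lborel[where R = R])
  show "((\<lambda>s. U i s x * g x) has_real_derivative Ut i s x * g x) (at s within {0..T})" if "s \<in> {0..T}" for s x
   by (rule DERIV_cmult_right[OF Ut_deriv[OF that]])
  show "cont (\<lambda>x. U i s x * g x)" if "s \<in> {0..T}" for s
   by (intro continuous_intros contU[OF that] g)
  have "continuous_on ({0..T} \<times> UNIV) (\<lambda>z. (case z of (s, x) \<Rightarrow> Ut i s x) * g (snd z))"
   by (intro continuous_intros smooth_slab_continuous[OF Ut] continuous_on_compose2[OF g(1)]) auto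
  then show "continuous_on ({0..T} \<times> UNIV) (\<lambda>(s, x). Ut i s x * g x)" by (simp add: case_prod_beta')
 qed (use R t in auto)
qed

text \<open>By incompressibility the advection term is the divergence of \<open>U j * U i\<close>,
  so its derivative can be moved onto the test function.\<close>

lemma advection_test:
 assumes t: "t \<in> {0..T}" and g: "Ck 1 g" "bsupp g"
 shows "(LBINT x. (\<Oplus>j. U j t x * pd j (U i t) x) * g x)
  = - (\<Oplus>j. LBINT x. U j t x * U i t x * pd j g x)"
proof -
 have c: "cont g" using Ck_cont[OF g(1)] .
 have UU: "Ck 1 (\<lambda>x. U j t x * U i t x)" for j by (intro Ck_mult CkU[OF t])
 have eq: "(\<Oplus>j. U j t x * pd j (U i t) x) = (\<Oplus>j. pd j (\<lambda>x. U j t x * U i t x) x)" for x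
  by (simp add: partial_mult[OF CkU[OF t] CkU[OF t]] sum.distrib divfree[OF t] flip: sum_distrib_right)
 have i: "integ (\<lambda>x. pd j (\<lambda>x. U j t x * U i t x) x * g x)" for j
 proof -
  from cont_partial[OF UU] show ?thesis
   using g(2) by (intro integrable_cs continuous_intros c) auto
 qed
 have "(LBINT x. (\<Oplus>j. U j t x * pd j (U i t) x) * g x)
  = (\<Oplus>j. LBINT x. pd j (\<lambda>x. U j t x * U i t x) x * g x)"
  unfolding eq sum_distrib_right by (rule Bochner_Integration.integral_sum) (rule i)
 also have "\<dots> = (\<Oplus>j. - (LBINT x. U j t x * U i t x * pd j g x))"
  using integral_by_parts[OF UU g(1)] g(2) by (intro sum.cong refl) simp
 finally show ?thesis by (simp add: sum_negf)
qed

lemma momentum_split: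
 assumes t: "t \<in> {0..T}" and g: "cont g" "bsupp g"
 shows "(LBINT x. Ut i t x * g x) = (LBINT x. lap (U i t) x * g x)
  - (LBINT x. (\<Oplus>j. U j t x * pd j (U i t) x) * g x) - (LBINT x. pd i (p t) x * g x)"
proof -
 have "integ (\<lambda>x. lap (U i t) x * g x)"
  "integ (\<lambda>x. (\<Oplus>j. U j t x * pd j (U i t) x) * g x)"
  "integ (\<lambda>x. pd i (p t) x * g x)"
  using g by (auto intro!: integrable_cs continuous_intros contU[OF t] contlU[OF t] contdU[OF t] contdp[OF t])
 then show ?thesis by (simp add: momentum[OF t] left_diff_distrib)
qed

lemma momentum_test:
 assumes t: "t \<in> {0..T}" and g: "Ck 2 g" "bsupp g"
 shows "(LBINT x. Ut i t x * g x) = (LBINT x. U i t x * lap g x)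
  + (\<Oplus>j. LBINT x. U j t x * U i t x * pd j g x) - (LBINT x. pd i (p t) x * g x)"
 using momentum_split[OF t Ck_cont[OF g(1)] g(2)] advection_test[OF t Ck_on_mono[OF g(1)] g(2)]
  laplacian_by_parts[OF CkU[OF t] g] by simp

text \<open>The Poisson equation for the pressure in weak form, obtained by testing the momentum
  equation with a gradient. The acceleration drops out because \<open>gradient_test\<close> holds at
  all times, the viscous term because the derivatives of the divergence vanish.\<close>

lemma pressure_test:
 assumes t: "t \<in> {0..T}" and f: "Ck 2 \<phi>" "bsupp \<phi>"
 shows "(LBINT x. p t x * lap \<phi> x)
  = - (\<Oplus>i. \<Oplus>j. LBINT x. U j t x * U i t x * pd j (pd i \<phi>) x)"
proof -
 have f2: "Ck (Suc 1) \<phi>" using f(1) by (simp add: numeral_2_eq_2)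
 have f1: "Ck 1 \<phi>" "Ck 1 (pd i \<phi>)" for i
  using Ck_on_mono[OF f2, of 1] Ck_partial[OF f2] by simp_all
 have c: "cont (pd i \<phi>)" "cont (pd j (pd i \<phi>))" for i j
  using Ck_cont[OF f1(2)] Ck_partial[of 0] f1(2)[of i] by simp_all
 have b: "bsupp (pd i \<phi>)" for i using f(2) by auto
 let ?a = "\<lambda>i. LBINT x. lap (U i t) x * pd i \<phi> x"
 let ?b = "\<lambda>i. LBINT x. (\<Oplus>j. U j t x * pd j (U i t) x) * pd i \<phi> x"
 let ?c = "\<lambda>i. LBINT x. pd i (p t) x * pd i \<phi> x"
 have "((\<lambda>s. \<Oplus>i. LBINT x. U i s x * pd i \<phi> x) has_real_derivative
   (\<Oplus>i. LBINT x. Ut i t x * pd i \<phi> x)) (at t within {0..T})"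
  by (intro DERIV_sum time_derivative_test[OF t c(1) b])
 then have "(\<Oplus>i. LBINT x. Ut i t x * pd i \<phi> x) = 0"
  by (rule deriv_zero_within[OF T t]) (rule gradient_test[OF _ f1(1) f(2)])
 then have sum0: "(\<Oplus>i. ?a i) - (\<Oplus>i. ?b i) - (\<Oplus>i. ?c i) = 0"
  unfolding momentum_split[OF t c(1) b] sum_subtractf .
 have a: "(\<Oplus>i. ?a i) = 0"
 proof -
  have ij: "(LBINT x. pd j (pd j (U i t)) x * pd i \<phi> x)
   = (LBINT x. pd j (pd i (U i t)) x * pd j \<phi> x)" for i j
  proof -
   have "(LBINT x. pd j (pd j (U i t)) x * pd i \<phi> x)
     = - (LBINT x. pd j (U i t) x * pd j (pd i \<phi>) x)"
    using integral_by_parts[OF CkdU[OF t] f1(2)] b by simp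
   also have "\<dots> = - (LBINT x. pd j (U i t) x * pd i (pd j \<phi>) x)"
    by (subst partial_commute[OF f(1)]) (rule refl)
   also have "\<dots> = (LBINT x. pd i (pd j (U i t)) x * pd j \<phi> x)"
    using integral_by_parts[OF CkdU[OF t] f1(2)] b by simp
   finally show ?thesis by (subst (asm) partial_commute[OF CkU[OF t]])
  qed
  have int: "integ (\<lambda>x. pd k (pd j (U i t)) x * pd l \<phi> x)" for i j k l
   by (intro integrable_cs continuous_intros contddU[OF t] c bsupp_mult2 b)
  have z: "(\<Oplus>i. pd j (pd i (U i t)) x) = 0" for j x
  proof -
   have "(\<lambda>x. \<Oplus>i. pd i (U i t) x) = (\<lambda>x. 0)" using divfree[OF t] by auto
   then have "pd j (\<lambda>x. \<Oplus>i. pd i (U i t) x) x = 0" by simp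
   then show ?thesis by (subst (asm) partial_sum) (auto intro: CkdU[OF t])
  qed
  have "(\<Oplus>i. ?a i) = (\<Oplus>i. \<Oplus>j. LBINT x. pd j (pd j (U i t)) x * pd i \<phi> x)"
   unfolding laplacian_sum sum_distrib_right by (intro sum.cong refl Bochner_Integration.integral_sum int)
  also have "\<dots> = (\<Oplus>j. \<Oplus>i. LBINT x. pd j (pd i (U i t)) x * pd j \<phi> x)"
   unfolding ij by (rule sum.swap)
  also have "\<dots> = (\<Oplus>j. LBINT x. (\<Oplus>i. pd j (pd i (U i t)) x) * pd j \<phi> x)"
   unfolding sum_distrib_right by (intro sum.cong refl Bochner_Integration.integral_sum[symmetric] int)
  finally show ?thesis by (simp add: z)
 qed
 have b': "?b i = - (\<Oplus>j. LBINT x. U j t x * U i t x * pd j (pd i \<phi>) x)" for i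
  by (rule advection_test[OF t f1(2) b])
 have c': "(\<Oplus>i. ?c i) = - (LBINT x. p t x * lap \<phi> x)"
 proof -
  have "?c i = - (LBINT x. p t x * pd i (pd i \<phi>) x)" for i
   using integral_by_parts[OF Ckp[OF t] f1(2)] b by simp
  moreover have "integ (\<lambda>x. p t x * pd i (pd i \<phi>) x)" for i
   using b by (intro integrable_cs continuous_intros contp[OF t] c) auto
  ultimately show ?thesis unfolding laplacian_sum sum_distrib_left by (simp add: sum_negf)
 qed
 show ?thesis using sum0 unfolding a b' c' sum_negf by linarith
qed

lemma stress_bound:
 assumes t: "t \<in> {0..T}" and H: "H \<in> borel_measurable lborel" "\<And>x. \<bar>H x\<bar> \<le> C"
 shows "integ (\<lambda>x. U j t x * U k t x * H x)" "\<bar>LBINT x. U j t x * U k t x * H x\<bar> \<le> C * E^2"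
proof -
 have C: "0 \<le> C" using H(2)[of 0] by linarith
 have b: "\<bar>U j t x * U k t x * H x\<bar> \<le> (\<Oplus>i. (U i t x)^2) * C" for x
 proof -
  have "2 * (\<bar>U j t x\<bar> * \<bar>U k t x\<bar>) \<le> (U j t x)^2 + (U k t x)^2"
   using zero_le_power2[of "\<bar>U j t x\<bar> - \<bar>U k t x\<bar>"] by (simp add: power2_eq_square algebra_simps)
  moreover have "(U j t x)^2 \<le> (\<Oplus>i. (U i t x)^2)" "(U k t x)^2 \<le> (\<Oplus>i. (U i t x)^2)"
   by (rule member_le_sum; simp)+
  ultimately have "\<bar>U j t x\<bar> * \<bar>U k t x\<bar> \<le> (\<Oplus>i. (U i t x)^2)" by linarith
  then show ?thesis unfolding abs_mult by (intro mult_mono H(2)) (auto intro: sum_nonneg)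
 qed
 have m: "(\<lambda>x. U j t x * U k t x * H x) \<in> borel_measurable lborel"
  using cont_borel[OF contU[OF t]] H(1) by measurable
 show i: "integ (\<lambda>x. U j t x * U k t x * H x)"
  by (rule Bochner_Integration.integrable_bound[OF integrable_mult_left[OF energy(1)[OF t], of C] m])
   (use b C in \<open>auto intro!: AE_I2 simp: abs_mult sum_nonneg\<close>)
 have "\<bar>LBINT x. U j t x * U k t x * H x\<bar> \<le> (LBINT x. \<bar>U j t x * U k t x * H x\<bar>)"
  by (rule integral_abs_bound)
 also have "\<dots> \<le> (LBINT x. (\<Oplus>i. (U i t x)^2) * C)"
  by (rule integral_mono) (use i energy(1)[OF t] b in auto)
 also have "\<dots> \<le> C * E^2" using mult_right_mono[OF energy(2)[OF t] C] by (simp add: mult.commute)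
 finally show "\<bar>LBINT x. U j t x * U k t x * H x\<bar> \<le> C * E^2" .
qed

lemma component_L2:
 assumes t: "t \<in> {0..T}"
 shows "integ (\<lambda>x. (U i t x)^2)" "(LBINT x. (U i t x)^2) \<le> E^2"
proof -
 have le: "(U i t x)^2 \<le> (\<Oplus>i. (U i t x)^2)" for x by (rule member_le_sum) auto
 have m: "(\<lambda>x. (U i t x)^2) \<in> borel_measurable lborel"
  using cont_borel[OF contU[OF t]] by measurable
 show i: "integ (\<lambda>x. (U i t x)^2)"
  by (rule Bochner_Integration.integrable_bound[OF energy(1)[OF t] m]) (use le in \<open>auto intro!: AE_I2 simp: sum_nonneg\<close>)
 have "(LBINT x. (U i t x)^2) \<le> (LBINT x. (\<Oplus>i. (U i t x)^2))"
  by (rule integral_mono[OF i energy(1)[OF t]]) (rule le)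
 then show "(LBINT x. (U i t x)^2) \<le> E^2" using energy(2)[OF t] by linarith
qed

lemma linear_bound:
 assumes t: "t \<in> {0..T}" and g: "cont g" "bsupp g"
 shows "\<bar>LBINT x. U i t x * g x\<bar> \<le> E * sqrt (LBINT x. (g x)^2)"
proof -
 have "\<bar>LBINT x. U i t x * g x\<bar> \<le> sqrt (LBINT x. (U i t x)^2) * sqrt (LBINT x. (g x)^2)"
  using contU[OF t] g component_L2(1)[OF t]
  by (intro integral_Cauchy_Schwarz) (auto intro!: cont_borel integrable_cs continuous_intros)
 also have "\<dots> \<le> E * sqrt (LBINT x. (g x)^2)"
  using component_L2(2)[OF t] E by (intro mult_right_mono real_le_lsqrt) auto
 finally show ?thesis .
qed

end

section \<open>The pressure\<close>

lemma laplacian_partial: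
 fixes k :: "real^'n::finite \<Rightarrow> real"
 assumes "Ck 3 k"
 shows "lap (pd i k) = pd i (lap k)"
proof -
 have k3: "Ck_on (Suc (Suc 1)) UNIV k" using assms by (simp only: numeral_3_eq_3 One_nat_def)
 have k2: "Ck 2 k" "Ck 2 (pd j k)" for j
  using Ck_on_mono[OF assms, of 2] Ck_partial[OF k3] by (simp_all add: numeral_2_eq_2)
 have k1: "Ck 1 (pd j (pd j k))" for j
  using Ck_partial[OF Ck_partial[OF k3]] .
 have "pd j (pd j (pd i k)) = pd i (pd j (pd j k))" for j
  using partial_commute[OF k2(1), of j i] partial_commute[OF k2(2)[of j], of j i] by simp
 then show ?thesis unfolding laplacian_sum by (simp add: partial_sum[OF k1])
qed

lemma laplacian_diff:
 fixes f g :: "real^'n::finite \<Rightarrow> real"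
 assumes "Ck 2 f" "Ck 2 g"
 shows "lap (\<lambda>x. f x - g x) = (\<lambda>x. lap f x - lap g x)"
  and "pd i (pd j (\<lambda>x. f x - g x)) = (\<lambda>x. pd i (pd j f) x - pd i (pd j g) x)"
proof -
 have f2: "Ck (Suc 1) f" and g2: "Ck (Suc 1) g" using assms by (simp_all add: numeral_2_eq_2)
 have f1: "Ck 1 f" "Ck 1 (pd i f)" and g1: "Ck 1 g" "Ck 1 (pd i g)" for i
  using Ck_on_mono[OF f2, of 1] Ck_on_mono[OF g2, of 1] Ck_partial[OF f2] Ck_partial[OF g2] by simp_all
 show *: "pd i (pd j (\<lambda>x. f x - g x)) = (\<lambda>x. pd i (pd j f) x - pd i (pd j g) x)" for i j
  by (simp add: partial_diff[OF f1(1) g1(1)] partial_diff[OF f1(2) g1(2)])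
 show "lap (\<lambda>x. f x - g x) = (\<lambda>x. lap f x - lap g x)"
  unfolding laplacian_sum * by (simp add: sum_subtractf)
qed

lemma Ck_laplacian:
 fixes f :: "real^'n::finite \<Rightarrow> real"
 assumes "Ck (k + 2) f"
 shows "Ck k (lap f)"
proof -
 have "Ck_on (Suc (Suc k)) UNIV f" using assms by simp
 then show ?thesis unfolding laplacian_sum by (intro Ck_sum Ck_partial)
qed

lemma third_newt_at_bounded:
 obtains C where "0 < C"
  "\<And>i j k R y x. 0 < R \<Longrightarrow> \<bar>pd k (pd j (pd i (newt_at R y))) x\<bar> \<le> C * (1/R)^4"
proof -
 obtain C where C: "0 < C" "\<And>i j k x. \<bar>pd k (pd j (pd i newt)) x\<bar> \<le> C"
  using third_newt_bounded by metis
 show thesis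
 proof (rule that[OF C(1)])
  fix i j k y x and R :: real assume "0 < R"
  then show "\<bar>pd k (pd j (pd i (newt_at R y))) x\<bar> \<le> C * (1/R)^4"
   using mult_left_mono[OF C(2)[of k j i "(1/R) *\<^sub>R (x - y)"], of "(1/R)^4"]
   unfolding partial3_newt_at by (simp add: abs_mult mult.commute)
 qed
qed

lemma cont_third_newt_at: "cont (pd k (pd j (pd i (newt_at R y))))"
proof -
 have "Ck_on (Suc (Suc (Suc 3))) UNIV (newt_at R y)" using Ck_newt_at[of R y] by simp
 then show ?thesis by (intro Ck_cont[of 3] Ck_partial)
qed

context nse_solution
begin

definition stress :: "real \<Rightarrow> (3 \<Rightarrow> 3 \<Rightarrow> real^3 \<Rightarrow> real) \<Rightarrow> real" where
 "stress t H = (\<Oplus>a. \<Oplus>b. LBINT x. U b t x * U a t x * H a b x)"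

lemma stress_abs_le:
 assumes "t \<in> {0..T}" "\<And>a b. H a b \<in> borel_measurable lborel" "\<And>a b x. \<bar>H a b x\<bar> \<le> C"
 shows "\<bar>stress t H\<bar> \<le> 9 * C * E^2"
proof -
 have "\<bar>stress t H\<bar> \<le> (\<Oplus>a. \<Oplus>b. \<bar>LBINT x. U b t x * U a t x * H a b x\<bar>)"
  unfolding stress_def by (intro order_trans[OF sum_abs] sum_mono order_refl)
 also have "\<dots> \<le> (\<Sum>a\<in>(UNIV :: 3 set). \<Sum>b\<in>(UNIV :: 3 set). C * E^2)"
  by (intro sum_mono stress_bound(2) assms)
 finally show ?thesis by simp
qed

lemma stress_diff:
 assumes "t \<in> {0..T}" "\<And>a b. H a b \<in> borel_measurable lborel" "\<And>a b x. \<bar>H a b x\<bar> \<le> C"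
  "\<And>a b. H' a b \<in> borel_measurable lborel" "\<And>a b x. \<bar>H' a b x\<bar> \<le> C'"
 shows "stress t (\<lambda>a b x. H a b x - H' a b x) = stress t H - stress t H'"
 unfolding stress_def right_diff_distrib
 using stress_bound(1)[OF assms(1) assms(2) assms(3)] stress_bound(1)[OF assms(1) assms(4) assms(5)]
 by (simp add: sum_subtractf)

lemma pressure_test':
 "t \<in> {0..T} \<Longrightarrow> Ck 2 \<phi> \<Longrightarrow> bsupp \<phi> \<Longrightarrow>
  (LBINT x. p t x * lap \<phi> x) = - stress t (\<lambda>a b. pd b (pd a \<phi>))"
 unfolding stress_def by (rule pressure_test)

text \<open>The difference of the potentials at scales \<open>r\<close> and \<open>R\<close> has
  bounded support, so its \<open>i\<close>-th derivative may be inserted into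
  \<open>pressure_test\<close>. Its Laplacian is the difference of the two densities.\<close>

lemma gauge_difference:
 assumes t: "t \<in> {0..T}" and r: "0 < r" "0 < R"
 shows "(LBINT x. pd i (p t) x * density_at r y x) + stress t (\<lambda>a b. pd b (pd a (pd i (newt_at r y))))
  = (LBINT x. pd i (p t) x * density_at R y x) + stress t (\<lambda>a b. pd b (pd a (pd i (newt_at R y))))"
proof -
 let ?k = "\<lambda>x. newt_at r y x - newt_at R y x"
 have k: "Ck 6 ?k" by (intro Ck_diff Ck_newt_at)
 have kb: "bsupp ?k" by (rule newt_diff_bsupp[OF r])
 have n2: "Ck 2 (newt_at R y)" for R by (rule Ck_on_mono[OF Ck_newt_at]) simp
 have lk: "lap ?k = (\<lambda>x. density_at R y x - density_at r y x)"
  unfolding laplacian_diff(1)[OF n2 n2] laplacian_newt_at by simp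
 have "Ck (Suc 5) ?k" using k by simp
 from Ck_partial[OF this, of i] have dk: "Ck 2 (pd i ?k)" by (rule Ck_on_mono) simp
 have pk: "pd i ?k = (\<lambda>x. pd i (newt_at r y) x - pd i (newt_at R y) x)"
  by (rule partial_diff; rule Ck_on_mono[OF Ck_newt_at]; simp)
 have n2': "Ck 2 (pd i (newt_at R y))" for R
 proof -
  have "Ck (Suc 5) (newt_at R y)" using Ck_newt_at[of R y] by simp
  from Ck_partial[OF this] show ?thesis by (rule Ck_on_mono) simp
 qed
 have d1: "Ck 1 (lap ?k)"
  by (rule Ck_laplacian) (rule Ck_on_mono[OF k], simp)
 have ii: "integ (\<lambda>x. pd i (p t) x * density_at R y x)" if "0 < R" for R
  using density_at_bsupp[OF that] by (intro integrable_cs continuous_intros contdp[OF t] Ck_cont[OF Ck_density_at]) auto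
 obtain C where C: "0 < C"
  "\<And>i j k R y x. 0 < R \<Longrightarrow> \<bar>pd k (pd j (pd i (newt_at R y))) x\<bar> \<le> C * (1/R)^4"
  using third_newt_at_bounded by metis
 have "(LBINT x. p t x * lap (pd i ?k) x) = - stress t (\<lambda>a b. pd b (pd a (pd i ?k)))"
  by (rule pressure_test'[OF t dk]) (use kb in auto)
 also have "(\<lambda>a b. pd b (pd a (pd i ?k))) =
   (\<lambda>a b x. pd b (pd a (pd i (newt_at r y))) x - pd b (pd a (pd i (newt_at R y))) x)"
  unfolding pk laplacian_diff(2)[OF n2' n2'] ..
 also have "stress t \<dots> = stress t (\<lambda>a b. pd b (pd a (pd i (newt_at r y))))
   - stress t (\<lambda>a b. pd b (pd a (pd i (newt_at R y))))"
  using cont_borel[OF cont_third_newt_at] C(2)[OF r(1)] C(2)[OF r(2)]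
  by (intro stress_diff[OF t]) auto
 also have "(LBINT x. p t x * lap (pd i ?k) x) = - (LBINT x. pd i (p t) x * lap ?k x)"
  unfolding laplacian_partial[OF Ck_on_mono[OF k, of 3, simplified]]
  by (rule integral_by_parts[OF Ckp[OF t] d1]) (use density_at_bsupp r in \<open>auto simp: lk\<close>)
 also have "(LBINT x. pd i (p t) x * lap ?k x)
   = (LBINT x. pd i (p t) x * density_at R y x) - (LBINT x. pd i (p t) x * density_at r y x)"
  unfolding lk right_diff_distrib using ii r by simp
 finally show ?thesis by linarith
qed

text \<open>
 By the previous lemma the difference of the two sides is independent of \<open>R\<close>. The momentum equation makes it a
 time derivative of \<open>\<integral> U i t x * density_at R y x\<close> up to an error, and both tend to \<open>0\<close> as \<open>R\<close> grows.
\<close>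

lemma pressure_gauge:
 assumes t: "t \<in> {0..T}" and R: "0 < R"
 shows "(LBINT x. pd i (p t) x * density_at R y x)
  = - stress t (\<lambda>a b. pd b (pd a (pd i (newt_at R y))))"
proof -
 define c where "c t = (LBINT x. pd i (p t) x * density_at 1 y x)
  + stress t (\<lambda>a b. pd b (pd a (pd i (newt_at 1 y))))" for t
 have c: "(LBINT x. pd i (p t) x * density_at R y x)
  = c t - stress t (\<lambda>a b. pd b (pd a (pd i (newt_at R y))))" if "t \<in> {0..T}" "0 < R" for t R
  using gauge_difference[OF that zero_less_one, of i y] unfolding c_def by linarith
 obtain C where C: "0 < C"
  "\<And>i j k R y x. 0 < R \<Longrightarrow> \<bar>pd k (pd j (pd i (newt_at R y))) x\<bar> \<le> C * (1/R)^4"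
  using third_newt_at_bounded by metis
 have "Ck (Suc 3) bump_density" using Ck_bump_density by simp
 from Ck_partial[OF this] have pbc: "cont (pd j bump_density)" for j
  by (rule Ck_cont)
 have lbc: "cont (lap bump_density)"
  by (rule Ck_cont[OF Ck_laplacian[of 2]]) (use Ck_bump_density in simp)
 have bbs: "bsupp (pd j bump_density)" "bsupp (lap bump_density)" for j
  unfolding laplacian_sum by (intro bsupp_sum bsupp_partial bump_density_bsupp)+
 obtain B where B_pos: "0 < B" and B: "\<And>j x. \<bar>pd j bump_density x\<bar> \<le> B"
  using finite_family_bounded[of "\<lambda>j. pd j bump_density", OF pbc bbs(1)] by metis
 have B_nonneg: "0 \<le> B" using B_pos by simp
 define L where "L = sqrt (LBINT x. (lap bump_density x)^2)"
 define D where "D = sqrt (LBINT x. (bump_density x)^2)"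
 have LD: "0 \<le> L" "0 \<le> D" by (simp_all add: L_def D_def)
 let ?m = "\<lambda>R t. LBINT x. U i t x * density_at R y x"
 define err where "err R t = (LBINT x. U i t x * lap (density_at R y) x)
  + (\<Oplus>j. LBINT x. U j t x * U i t x * pd j (density_at R y) x)
  + stress t (\<lambda>a b. pd b (pd a (pd i (newt_at R y))))" for R t
 have dm: "(?m R has_real_derivative err R t - c t) (at t within {0..T})" if "t \<in> {0..T}" "0 < R" for R t
 proof -
  have "(?m R has_real_derivative (LBINT x. Ut i t x * density_at R y x)) (at t within {0..T})"
   by (rule time_derivative_test[OF that(1) Ck_cont[OF Ck_density_at] density_at_bsupp[OF that(2)]])
  also have "(LBINT x. Ut i t x * density_at R y x) = err R t - c t"
   using momentum_test[OF that(1) Ck_on_mono[OF Ck_density_at[of R y], of 2] density_at_bsupp[OF that(2), of y], of i]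
    c[OF that] unfolding err_def by simp
  finally show ?thesis .
 qed
 \<comment> \<open>The change of variables costs \<open>R ^ 3\<close>. It is applied with
   \<open>n = 10\<close> to the Laplacian of the density and with \<open>n = 6\<close> to the
   density itself.\<close>
 have scale_le: "sqrt ((1/R)^n * R^3 * a) \<le> (1/R) * sqrt a" if "1 \<le> R" "0 \<le> a" "5 \<le> n" for R a :: real and n
 proof -
  obtain m where m: "n = 5 + m" using \<open>5 \<le> n\<close> le_Suc_ex by blast
  have "(1/R)^n * R^3 = (1/R)^2 * (1/R)^m"
   using that(1) unfolding m by (simp add: power_add eval_nat_numeral)
  also have "\<dots> \<le> (1/R)^2 * 1" using that(1) by (intro mult_left_mono power_le_one) auto
  finally have "(1/R)^n * R^3 * a \<le> (1/R)^2 * 1 * a"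
   using that(2) by (rule mult_right_mono)
  also have "\<dots> = ((1/R) * sqrt a)^2" using that(2) by (simp add: power_mult_distrib power_divide)
  finally have "(1/R)^n * R^3 * a \<le> ((1/R) * sqrt a)^2" .
  then show ?thesis using that by (intro real_le_lsqrt) auto
 qed
 define K where "K = E * L + 3 * B * E^2 + 9 * C * E^2 + E * D"
 have err_le: "\<bar>err R t\<bar> \<le> K / R" and m_le: "\<bar>?m R t\<bar> \<le> K / R" if t: "t \<in> {0..T}" and R: "1 \<le> R" for R t
 proof -
  have R0: "0 < R" using R by simp
  have R4: "(1/R)^4 \<le> 1/R"
   using power_decreasing[of 1 4 "1/R"] R by simp
  have "(LBINT x. (lap (density_at R y) x)^2) = (1/R)^10 * R^3 * (LBINT x. (lap bump_density x)^2)"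
   unfolding laplacian_density_at power_mult_distrib
   using integral_scale3[of "\<lambda>x. (lap bump_density x)^2", OF _ R0, of y] lbc
   by (simp add: cont_borel continuous_intros power_divide flip: power_mult)
  then have "sqrt (LBINT x. (lap (density_at R y) x)^2) \<le> (1/R) * L"
   using scale_le[OF R, of _ 10] by (simp add: L_def)
  moreover have lb: "\<bar>LBINT x. U i t x * lap (density_at R y) x\<bar> \<le> E * sqrt (LBINT x. (lap (density_at R y) x)^2)"
  proof (rule linear_bound[OF t])
   show "cont (lap (density_at R y))"
    by (rule Ck_cont[OF Ck_laplacian[of 2]]) (use Ck_density_at in simp)
   show "bsupp (lap (density_at R y))"
    unfolding laplacian_sum by (intro bsupp_sum bsupp_partial density_at_bsupp[OF R0])
  qed
  ultimately have 1: "\<bar>LBINT x. U i t x * lap (density_at R y) x\<bar> \<le> E * ((1/R) * L)"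
   using E by (meson less_imp_le mult_left_mono order_trans)
  have pd: "\<bar>pd j (density_at R y) x\<bar> \<le> (1/R) * B" for j x
   unfolding partial_density_at abs_mult using R R4 B by (intro mult_mono) auto
  have pdm: "pd j (density_at R y) \<in> borel_measurable lborel" for j
  proof -
   have "Ck (Suc 3) (density_at R y)" using Ck_density_at by simp
   from Ck_cont[OF Ck_partial[OF this]] show ?thesis by (simp add: cont_borel)
  qed
  have "\<bar>\<Oplus>j. LBINT x. U j t x * U i t x * pd j (density_at R y) x\<bar> \<le> (\<Sum>j\<in>(UNIV::3 set). (1/R) * B * E^2)"
   by (intro order_trans[OF sum_abs] sum_mono stress_bound(2)[OF t pdm pd])
  then have 2: "\<bar>\<Oplus>j. LBINT x. U j t x * U i t x * pd j (density_at R y) x\<bar> \<le> 3 * ((1/R) * B * E^2)"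
   by simp
  have "\<bar>stress t (\<lambda>a b. pd b (pd a (pd i (newt_at R y))))\<bar> \<le> 9 * (C * (1/R)^4) * E^2"
   by (rule stress_abs_le[OF t _ C(2)[OF R0]]) (simp add: cont_borel cont_third_newt_at)
  also have "\<dots> \<le> 9 * (C * (1/R)) * E^2" using R4 C(1) by (intro mult_right_mono mult_left_mono) auto
  finally have 3: "\<bar>stress t (\<lambda>a b. pd b (pd a (pd i (newt_at R y))))\<bar> \<le> 9 * (C * (1/R)) * E^2" .
  have "0 \<le> E * D / R" using E LD R0 by simp
  then show "\<bar>err R t\<bar> \<le> K / R" using 1 2 3 unfolding err_def K_def by (simp add: add_divide_distrib algebra_simps)
  have "(LBINT x. (density_at R y x)^2) = (1/R)^6 * R^3 * (LBINT x. (bump_density x)^2)"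
   unfolding density_at_def power_mult_distrib
   using integral_scale3[of "\<lambda>x. (bump_density x)^2", OF _ R0, of y] Ck_cont[OF Ck_bump_density]
   by (simp add: cont_borel continuous_intros power_divide flip: power_mult)
  then have "sqrt (LBINT x. (density_at R y x)^2) \<le> (1/R) * D"
   using scale_le[OF R, of _ 6] by (simp add: D_def)
  moreover have "\<bar>?m R t\<bar> \<le> E * sqrt (LBINT x. (density_at R y x)^2)"
   by (rule linear_bound[OF t Ck_cont[OF Ck_density_at] density_at_bsupp[OF R0]])
  ultimately have "\<bar>?m R t\<bar> \<le> E * ((1/R) * D)"
   using E by (meson less_imp_le mult_left_mono order_trans)
  also have "\<dots> \<le> K / R"
   using E LD B_nonneg C R0 unfolding K_def by (simp add: divide_simps)
  finally show "\<bar>?m R t\<bar> \<le> K / R" .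
 qed
 have Klim: "(\<lambda>n. K / real (Suc n)) \<longlonglongrightarrow> 0"
  using LIMSEQ_Suc[OF tendsto_divide_0[OF tendsto_const filterlim_real_at_infinity_sequentially]] by simp
 have mlim: "(\<lambda>n. ?m (real (Suc n)) t) \<longlonglongrightarrow> 0" if "t \<in> {0..T}" for t
  by (rule Lim_null_comparison[OF _ Klim]) (use m_le[OF that] in auto)
 \<comment> \<open>The averages tend to 0 and their derivatives \<open>err - c\<close> converge
   uniformly to \<open>- c\<close>. Hence the limit function 0 has derivative \<open>- c\<close>,
   and \<open>c\<close> vanishes.\<close>
 have "\<exists>g. \<forall>x\<in>{0..T}. (\<lambda>n. ?m (real (Suc n)) x) \<longlonglongrightarrow> g x \<and> (g has_derivative (\<lambda>h. h * (- c x))) (at x within {0..T})"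
 proof (rule has_derivative_sequence[where f' = "\<lambda>n x h. h * (err (real (Suc n)) x - c x)"])
  show "(?m (real (Suc n)) has_derivative (\<lambda>h. h * (err (real (Suc n)) x - c x))) (at x within {0..T})"
   if "x \<in> {0..T}" for n x
   using dm[OF that, of "real (Suc n)"] by (simp add: has_field_derivative_def mult_commute_abs)
  show "\<forall>\<^sub>F n in sequentially. \<forall>x\<in>{0..T}. \<forall>h. norm (h * (err (real (Suc n)) x - c x) - h * (- c x)) \<le> e * norm h"
   if "0 < e" for e
  proof -
   have "\<forall>\<^sub>F n in sequentially. dist (K / real (Suc n)) 0 < e" using Klim that by (rule tendstoD)
   then show ?thesis
   proof (rule eventually_mono, intro ballI allI)
    fix n x and h :: real assume n: "dist (K / real (Suc n)) 0 < e" and x: "x \<in> {0..T}"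
    have "\<bar>K / real (Suc n)\<bar> < e" using n unfolding dist_real_def diff_zero .
    moreover have "1 \<le> real (Suc n)" by simp
    ultimately have "\<bar>err (real (Suc n)) x\<bar> \<le> e"
     using err_le[OF x, of "real (Suc n)"] abs_ge_self[of "K / real (Suc n)"] by linarith
    then show "norm (h * (err (real (Suc n)) x - c x) - h * (- c x)) \<le> e * norm h"
     using mult_left_mono[of "\<bar>err (real (Suc n)) x\<bar>" e "\<bar>h\<bar>"]
     by (simp add: algebra_simps abs_mult)
   qed
  qed
  show "0 \<in> {0..T}" using T by simp
  show "(\<lambda>n. ?m (real (Suc n)) 0) \<longlonglongrightarrow> 0" by (rule mlim) (use T in simp)
 qed simp
 then obtain g where g: "\<And>x. x \<in> {0..T} \<Longrightarrow> (\<lambda>n. ?m (real (Suc n)) x) \<longlonglongrightarrow> g x"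
  "\<And>x. x \<in> {0..T} \<Longrightarrow> (g has_derivative (\<lambda>h. h * (- c x))) (at x within {0..T})" by blast
 have "g s = 0" if "s \<in> {0..T}" for s
  using LIMSEQ_unique[OF g(1)[OF that] mlim[OF that]] .
 moreover have "(g has_real_derivative - c t) (at t within {0..T})"
  using g(2)[OF t] unfolding has_field_derivative_def mult_commute_abs[of "- c t"] .
 ultimately have "- c t = 0" using deriv_zero_within[OF T t] by blast
 then show ?thesis using c[OF t R] by simp
qed

end

section \<open>Near and far part of the pressure\<close>

lemma conv_integrable:
 assumes "cont k" "cont h" "bsupp h"
 shows "integ (\<lambda>y. k (x - y) * h y :: real)"
proof (rule integrable_cs)
 show "cont (\<lambda>y. k (x - y) * h y)"
  by (intro continuous_on_mult continuous_on_compose2[OF assms(1)] assms(2) continuous_intros) auto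
 show "bsupp (\<lambda>y. k (x - y) * h y)" using assms(3) by auto
qed

lemma conv_diff:
 assumes "cont k" "cont k'" "cont h" "bsupp h"
 shows "conv (\<lambda>z. k z - k' z) h = (\<lambda>x. conv k h x - conv k' h x)"
 unfolding conv_def left_diff_distrib
 using conv_integrable[OF assms(1,3,4)] conv_integrable[OF assms(2,3,4)] by simp

lemma conv_sum_right:
 assumes "cont k" "\<And>i. i \<in> I \<Longrightarrow> cont (f i)" "\<And>i. i \<in> I \<Longrightarrow> bsupp (f i)"
 shows "conv k (\<lambda>x. \<Sum>i\<in>I. f i x) = (\<lambda>x. \<Sum>i\<in>I. conv k (f i) x)"
 unfolding conv_def sum_distrib_left
 by (intro ext Bochner_Integration.integral_sum conv_integrable assms)

lemma partial2_conv:
 fixes k h :: "real^'n::finite \<Rightarrow> real"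
 assumes "Ck 2 k" "cont h" "bsupp h"
 shows "pd b (pd a (conv k h)) = conv (pd b (pd a k)) h"
  and "lap (conv k h) = conv (lap k) h"
proof -
 have k2: "Ck (Suc 1) k" using assms(1) by (simp add: numeral_2_eq_2)
 have k1: "Ck 1 k" "Ck 1 (pd a k)" for a
  using Ck_on_mono[OF k2, of 1] Ck_partial[OF k2] by simp_all
 have c: "cont (pd b (pd a k))" for a b
  using Ck_partial[of 0 "pd a k"] k1(2)[of a] by simp
 show *: "pd b (pd a (conv k h)) = conv (pd b (pd a k)) h" for a b
  by (simp add: partial_conv[OF k1(1) assms(2,3)] partial_conv[OF k1(2) assms(2,3)])
 have "(\<lambda>x. \<Oplus>i. conv (pd i (pd i k)) h x) = conv (\<lambda>x. \<Oplus>i. pd i (pd i k) x) h"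
  unfolding conv_def sum_distrib_right
  by (intro ext Bochner_Integration.integral_sum[symmetric] conv_integrable c assms)
 then show "lap (conv k h) = conv (lap k) h"
  unfolding laplacian_sum * .
qed

abbreviation newt_diff :: "real \<Rightarrow> real \<Rightarrow> real^3 \<Rightarrow> real" where
 "newt_diff r R \<equiv> (\<lambda>z. newt_at r 0 z - newt_at R 0 z)"

lemma Ck_newt_diff: "Ck 6 (newt_diff r R)"
 by (intro Ck_diff Ck_newt_at)

lemma laplacian_newt_diff: "lap (newt_diff r R) = (\<lambda>z. density_at R 0 z - density_at r 0 z)"
proof -
 have n2: "Ck 2 (newt_at R 0)" for R by (rule Ck_on_mono[OF Ck_newt_at]) simp
 show ?thesis unfolding laplacian_diff(1)[OF n2 n2] laplacian_newt_at by simp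
qed

lemma density_at_shift: "density_at R 0 (x - y) = density_at R y x"
 by (simp add: density_at_def)

lemma cont_density_at: "cont (density_at R y)"
 by (rule Ck_cont[OF Ck_density_at])

lemma laplacian_conv_newt_diff:
 assumes "cont h" "bsupp h"
 shows "lap (conv (newt_diff r R) h) = (\<lambda>x. conv (density_at R 0) h x - conv (density_at r 0) h x)"
 unfolding partial2_conv(2)[OF Ck_on_mono[OF Ck_newt_diff, of 2, simplified] assms] laplacian_newt_diff
 by (rule conv_diff[OF cont_density_at cont_density_at assms])

text \<open>
 The kernels converge to \<open>1 / \<bar>z\<bar>\<close> minus a smooth function as \<open>r\<close> tends to \<open>0\<close>, so their mass stays
 bounded. As they are nonnegative, integrating \<open>\<bar>z\<bar>\<^sup>2\<close> against their Laplacian shows this without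
 any estimate of the singularity.
\<close>

lemma integral_newt_diff_le:
 obtains M where "\<And>r. 0 < r \<Longrightarrow> r \<le> 1 \<Longrightarrow> (LBINT z. newt_diff r 1 z) \<le> M"
proof
 fix r :: real assume r: "0 < r" "r \<le> 1"
 have b: "bsupp (newt_diff r 1)" by (rule newt_diff_bsupp) (use r in auto)
 have lq: "lap (\<lambda>z::real^3. z \<bullet> z) = (\<lambda>z. 6)"
 proof -
  have "pd i (pd i (\<lambda>z::real^3. z \<bullet> z)) = (\<lambda>z. 2)" for i
   unfolding partial_inner_self by (subst partial_cmult) (auto simp: partial_coord)
  then show ?thesis by (simp add: laplacian_sum)
 qed
 have cq: "cont (\<lambda>z::real^3. z \<bullet> z)" by (intro continuous_intros)
 have i: "integ (\<lambda>z. z \<bullet> z * density_at R 0 z)" if "0 < R" for R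
  using density_at_bsupp[OF that] by (intro integrable_cs continuous_intros cont_density_at) auto
 have "6 * (LBINT z. newt_diff r 1 z) = (LBINT z. lap (\<lambda>z. z \<bullet> z) z * newt_diff r 1 z)"
  unfolding lq by (rule integral_mult_right_zero[symmetric])
 also have "\<dots> = (LBINT z. z \<bullet> z * lap (newt_diff r 1) z)"
  by (rule laplacian_by_parts[OF Ck_inner_self Ck_on_mono[OF Ck_newt_diff] b]) simp
 also have "\<dots> = (LBINT z. z \<bullet> z * density_at 1 0 z) - (LBINT z. z \<bullet> z * density_at r 0 z)"
  unfolding laplacian_newt_diff right_diff_distrib using i[of 1] i[OF r(1)] by simp
 also have "\<dots> \<le> (LBINT z. z \<bullet> z * density_at 1 0 z)"
  using density_at_nonneg[of r 0] r by simp
 finally show "(LBINT z. newt_diff r 1 z) \<le> (LBINT z. z \<bullet> z * density_at 1 0 z) / 6" by simp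
qed

text \<open>Both derivatives are moved onto \<open>h\<close>. What remains is convolution with a
  nonnegative kernel whose mass is bounded uniformly in \<open>r\<close>, so the bound survives the
  limit \<open>r \<rightarrow> 0\<close>.\<close>

lemma hessian_conv_newt_diff_bounded:
 fixes h :: "real^3 \<Rightarrow> real"
 assumes t: "Ck 2 h" "bsupp h"
 obtains K where "\<And>r a b x. 0 < r \<Longrightarrow> r \<le> 1 \<Longrightarrow> \<bar>pd b (pd a (conv (newt_diff r 1) h)) x\<bar> \<le> K"
proof -
 have t2: "Ck (Suc 1) h" using t(1) by (simp add: numeral_2_eq_2)
 have "Ck (Suc 0) (pd a h)" for a using Ck_partial[OF t2] by simp
 from Ck_cont[OF Ck_partial[OF this]]
 have c: "cont (pd b (pd a h))" for a b .
 have bs: "bsupp (pd b (pd a h))" for a b using t(2) by auto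
 obtain S where S: "0 < S" "\<And>a b x. \<bar>pd b (pd a h) x\<bar> \<le> S"
  using finite_family_bounded2[of "\<lambda>a b. pd b (pd a h)", OF c bs] by metis
 obtain M where M: "\<And>r. 0 < r \<Longrightarrow> r \<le> 1 \<Longrightarrow> (LBINT z. newt_diff r 1 z) \<le> M"
  using integral_newt_diff_le by metis
 show thesis
 proof (rule that[of "S * M"])
  fix r :: real and a b x assume r: "0 < r" "r \<le> 1"
  have k: "cont (newt_diff r 1)" "bsupp (newt_diff r 1)"
   by (rule Ck_cont[OF Ck_newt_diff], rule newt_diff_bsupp) (use r in auto)
  have "conv (newt_diff r 1) h = conv h (newt_diff r 1)"
   by (rule conv_commute) (use k Ck_cont[OF t(1)] in \<open>auto intro: cont_borel\<close>)
  then have eq: "pd b (pd a (conv (newt_diff r 1) h)) x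
   = (LBINT y. pd b (pd a h) (x - y) * newt_diff r 1 y)"
   using partial2_conv(1)[OF t(1) k] by (simp add: conv_def)
  have pos: "0 \<le> newt_diff r 1 y" for y using newt_at_antimono[OF r] by simp
  have "\<bar>pd b (pd a (conv (newt_diff r 1) h)) x\<bar> \<le> (LBINT y. \<bar>pd b (pd a h) (x - y) * newt_diff r 1 y\<bar>)"
   unfolding eq by (rule integral_abs_bound)
  also have "\<dots> \<le> (LBINT y. S * newt_diff r 1 y)"
  proof (rule integral_mono)
   show "integ (\<lambda>y. \<bar>pd b (pd a h) (x - y) * newt_diff r 1 y\<bar>)"
    by (rule integrable_abs[OF conv_integrable[OF c k]])
   show "integ (\<lambda>y. S * newt_diff r 1 y)" using integrable_cs[OF k] by simp
   show "\<bar>pd b (pd a h) (x - y) * newt_diff r 1 y\<bar> \<le> S * newt_diff r 1 y" for y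
    unfolding abs_mult using pos[of y] S(2)[of b a "x - y"]
    by (simp add: mult_right_mono)
  qed
  also have "\<dots> \<le> S * M" using M[OF r] S(1) by (simp add: mult_left_mono)
  finally show "\<bar>pd b (pd a (conv (newt_diff r 1) h)) x\<bar> \<le> S * M" .
 qed
qed

context nse_solution
begin

text \<open>The part of the pressure that the stress generates through the potential smoothed at
  scale \<open>R\<close>. The complementary near part is carried by \<open>newt_diff r R\<close>
  with \<open>r\<close> tending to 0.\<close>

definition far_pressure :: "real \<Rightarrow> (3 \<Rightarrow> real^3 \<Rightarrow> real) \<Rightarrow> real \<Rightarrow> real" where
 "far_pressure R g t = (\<Oplus>i. LBINT y. g i y * stress t (\<lambda>a b. pd b (pd a (pd i (newt_at R y)))))"

text \<open>Integrates \<open>pressure_gauge\<close> over the centre \<open>y\<close> against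
  \<open>g i y\<close>, after one derivative has been moved from \<open>g\<close> to the pressure.
  Testing with a divergence is essential: the equations determine the pressure only up to a function
  of time, which such test functions annihilate.\<close>

lemma pressure_far:
 assumes t: "t \<in> {0..T}" and R: "0 < R"
  and g: "\<And>i. Ck 1 (g i)" "\<And>i. bsupp (g i)"
 shows "(LBINT x. p t x * conv (density_at R 0) (\<lambda>x. \<Oplus>i. pd i (g i) x) x) = far_pressure R g t"
  and "\<And>i. integ (\<lambda>y. g i y * stress t (\<lambda>a b. pd b (pd a (pd i (newt_at R y)))))"
proof -
 let ?W = "\<lambda>i y a b. pd b (pd a (pd i (newt_at R y)))"
 let ?d = "density_at R 0"
 have db: "bsupp ?d" by (rule density_at_bsupp[OF R])
 have gc: "cont (g i)" for i by (rule Ck_cont[OF g(1)])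
 have pgc: "cont (pd i (g i))" for i
  using Ck_partial[of 0 "g i" i] g(1)[of i] by simp
 have m: "?d \<in> borel_measurable borel" "g i \<in> borel_measurable borel" "pd i (g i) \<in> borel_measurable borel" for i
  by (rule cont_borel, rule cont_density_at gc pgc)+
 have cd: "conv ?d (pd i (g i)) = pd i (conv ?d (g i))" for i
 proof -
  have "conv ?d (pd i (g i)) = conv (pd i (g i)) ?d" by (rule conv_commute[OF m(1,3)])
  also have "\<dots> = pd i (conv (g i) ?d)" by (rule partial_conv[OF g(1) cont_density_at db, symmetric])
  also have "conv (g i) ?d = conv ?d (g i)" by (rule conv_commute[OF m(2,1)])
  finally show ?thesis .
 qed
 have cC: "Ck 1 (conv ?d (g i))" for i
  by (rule Ck_conv[OF Ck_on_mono[OF Ck_density_at] gc g(2)]) simp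
 have cb: "bsupp (conv ?d (g i))" for i by (rule bsupp_conv[OF db g(2)])
 have int: "integ (\<lambda>x. p t x * pd i (conv ?d (g i)) x)" for i
  by (intro integrable_cs continuous_intros contp[OF t] cont_partial[OF cC] bsupp_mult2 bsupp_partial cb)
 have gauge: "(LBINT x. pd i (p t) x * (density_at R y x * g i y))
   = - (g i y * stress t (?W i y))" for i y
  using pressure_gauge[OF t R, of i y]
  by (simp add: mult.assoc[symmetric])
 have fub: "(LBINT x. pd i (p t) x * conv ?d (g i) x)
   = - (LBINT y. g i y * stress t (?W i y))"
  and fi: "integ (\<lambda>y. g i y * stress t (?W i y))" for i
 proof -
  obtain \<rho> where \<rho>: "0 < \<rho>" "\<And>x. \<rho> < norm x \<Longrightarrow> g i x = 0" using bsuppE[OF g(2)] by blast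
  obtain \<rho>' where \<rho>': "0 < \<rho>'" "\<And>x. \<rho>' < norm x \<Longrightarrow> ?d x = 0" using bsuppE[OF db] by blast
  have K0: "cont (\<lambda>z. pd i (p t) (fst z) * (?d (fst z - snd z) * g i (snd z)))"
   by (intro continuous_intros continuous_on_compose2[OF cont_density_at] continuous_on_compose2[OF gc]
     continuous_on_compose2[OF contdp[OF t]]) auto
  have K: "cont (\<lambda>(x, y). pd i (p t) x * (density_at R y x * g i y))"
   using K0 by (simp add: case_prod_beta' density_at_shift)
  have supp: "norm x \<le> \<rho> + \<rho>' \<and> norm y \<le> \<rho> + \<rho>'" if "pd i (p t) x * (density_at R y x * g i y) \<noteq> 0" for x y
  proof -
   have "norm (x - y) \<le> \<rho>'" "norm y \<le> \<rho>"
    using that \<rho>(2)[of y] \<rho>'(2)[of "x - y"] by (auto simp: density_at_shift not_less[symmetric])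
   then show ?thesis using norm_triangle_ineq[of "x - y" y] \<rho>'(1) by simp
  qed
  have "(LBINT x. pd i (p t) x * conv ?d (g i) x) = (LBINT x. (LBINT y. pd i (p t) x * (density_at R y x * g i y)))"
   unfolding conv_def density_at_shift by simp
  also have "\<dots> = (LBINT y. (LBINT x. pd i (p t) x * (density_at R y x * g i y)))"
   by (rule fubini_cs[OF K supp, symmetric])
  finally show "(LBINT x. pd i (p t) x * conv ?d (g i) x)
   = - (LBINT y. g i y * stress t (?W i y))"
   unfolding gauge by simp
  have "bsupp (\<lambda>(x, y). pd i (p t) x * (density_at R y x * g i y))"
   unfolding bsupp_def
   by (rule bounded_subset[of "cball 0 (\<rho> + \<rho>') \<times> cball 0 (\<rho> + \<rho>')"]) (use supp in \<open>auto intro: bounded_Times\<close>)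
  with K have "integrable (lborel \<Otimes>\<^sub>M lborel) (\<lambda>(x, y). pd i (p t) x * (density_at R y x * g i y))"
   unfolding lborel_prod by (rule integrable_cs)
  from lborel_pair.integrable_snd[OF this]
  show "integ (\<lambda>y. g i y * stress t (?W i y))"
   unfolding gauge by simp
 qed
 have "conv ?d (\<lambda>x. \<Oplus>i. pd i (g i) x) = (\<lambda>x. \<Oplus>i. conv ?d (pd i (g i)) x)"
  by (rule conv_sum_right[OF cont_density_at pgc bsupp_partial[OF g(2)]])
 then have "conv ?d (\<lambda>x. \<Oplus>i. pd i (g i) x) = (\<lambda>x. \<Oplus>i. pd i (conv ?d (g i)) x)"
  by (simp only: cd)
 then have "(LBINT x. p t x * conv ?d (\<lambda>x. \<Oplus>i. pd i (g i) x) x)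
   = (\<Oplus>i. LBINT x. p t x * pd i (conv ?d (g i)) x)"
  using int by (simp add: sum_distrib_left)
 also have "\<dots> = (\<Oplus>i. - (LBINT x. pd i (p t) x * conv ?d (g i) x))"
  by (intro sum.cong refl integral_by_parts[OF Ckp[OF t] cC] disjI2 cb)
 finally show "(LBINT x. p t x * conv (density_at R 0) (\<lambda>x. \<Oplus>i. pd i (g i) x) x) = far_pressure R g t"
  unfolding fub far_pressure_def by simp
 show "\<And>i. integ (\<lambda>y. g i y * stress t (?W i y))"
  by (rule fi)
qed

text \<open>\<open>pressure_test\<close> with the test function
  \<open>conv (newt_diff r R) k\<close> expresses the pressure averaged at scale \<open>r\<close> by
  the near stress plus the average at scale \<open>R\<close>, which is \<open>far_pressure\<close>.
  As \<open>r\<close> tends to 0 the averages converge to \<open>mass\<close> times the pressure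
  integral.\<close>

lemma pressure_limit:
 assumes t: "t \<in> {0..T}" and R: "0 < R"
  and g: "\<And>i. Ck 1 (g i)" "\<And>i. bsupp (g i)"
 defines "k \<equiv> \<lambda>x. \<Oplus>i. pd i (g i) x"
 shows "((\<lambda>r. stress t (\<lambda>a b. pd b (pd a (conv (newt_diff r R) k))) + far_pressure R g t)
  \<longlongrightarrow> mass * (LBINT x. p t x * k x)) (at_right 0)"
proof -
 have th: "cont k" "bsupp k"
 proof -
  from cont_partial[OF g(1)] show "cont k"
   unfolding k_def by (intro continuous_intros)
  show "bsupp k" unfolding k_def by (intro bsupp_sum bsupp_partial g(2))
 qed
 have eq: "stress t (\<lambda>a b. pd b (pd a (conv (newt_diff r R) k))) + far_pressure R g t
   = (LBINT x. p t x * conv (density_at r 0) k x)" if r: "0 < r" for r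
 proof -
  let ?h = "conv (newt_diff r R) k"
  have h: "Ck 2 ?h" by (rule Ck_conv[OF Ck_on_mono[OF Ck_newt_diff] th]) simp
  have hb: "bsupp ?h" by (rule bsupp_conv[OF newt_diff_bsupp[OF r R] th(2)])
  have i: "integ (\<lambda>x. p t x * conv (density_at s 0) k x)" if "0 < s" for s
   by (intro integrable_cs continuous_intros contp[OF t] conv_continuous[OF cont_density_at th]
     bsupp_mult2 bsupp_conv[OF density_at_bsupp[OF that] th(2)])
  have "(LBINT x. p t x * lap ?h x) = - stress t (\<lambda>a b. pd b (pd a ?h))"
   by (rule pressure_test'[OF t h hb])
  then show ?thesis
   using i[OF R] i[OF r] pressure_far(1)[OF t R g] unfolding laplacian_conv_newt_diff[OF th]
   by (simp add: right_diff_distrib k_def)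
 qed
 have "((\<lambda>r. LBINT x. p t x * conv (\<lambda>z. (1/r)^3 * bump_density ((1/r) *\<^sub>R z)) k x) \<longlongrightarrow>
   mass * (LBINT x. p t x * k x)) (at_right 0)"
  unfolding mass_def
  by (rule conv_approx_identity[OF Ck_cont[OF Ck_bump_density] bump_density_bsupp bump_density_nonneg th contp[OF t]])
 then have "((\<lambda>r. LBINT x. p t x * conv (density_at r 0) k x) \<longlongrightarrow>
   mass * (LBINT x. p t x * k x)) (at_right 0)"
  by (simp add: density_at_def[abs_def])
 then show ?thesis
  by (rule Lim_transform_eventually) (auto simp: eventually_at_right_field eq intro!: exI[of _ 1])
qed

lemma far_pressure_le:
 assumes C: "\<And>i j k R y x. 0 < R \<Longrightarrow> \<bar>pd k (pd j (pd i (newt_at R y))) x\<bar> \<le> C * (1/R)^4"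
  and t: "t \<in> {0..T}" and R: "0 < R"
  and g: "\<And>i. Ck 1 (g i)" "\<And>i. bsupp (g i)"
 shows "\<bar>far_pressure R g t\<bar> \<le> 9 * (C * (1/R)^4) * E^2 * (\<Oplus>i. LBINT y. \<bar>g i y\<bar>)"
proof -
 let ?W = "\<lambda>i y a b. pd b (pd a (pd i (newt_at R y)))"
 have s: "\<bar>stress t (?W i y)\<bar> \<le> 9 * (C * (1/R)^4) * E^2" for i y
  by (rule stress_abs_le[OF t _ C[OF R]]) (simp add: cont_borel cont_third_newt_at)
 have gi: "integ (\<lambda>y. \<bar>g i y\<bar>)" for i
  by (intro integrable_abs integrable_cs Ck_cont[OF g(1)] g(2))
 have "\<bar>LBINT y. g i y * stress t (?W i y)\<bar>
   \<le> 9 * (C * (1/R)^4) * E^2 * (LBINT y. \<bar>g i y\<bar>)" for i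
 proof -
  have "\<bar>LBINT y. g i y * stress t (?W i y)\<bar>
   \<le> (LBINT y. \<bar>g i y * stress t (?W i y)\<bar>)"
   by (rule integral_abs_bound)
  also have "\<dots> \<le> (LBINT y. \<bar>g i y\<bar> * (9 * (C * (1/R)^4) * E^2))"
  proof (rule integral_mono)
   show "integ (\<lambda>y. \<bar>g i y * stress t (?W i y)\<bar>)"
    by (rule integrable_abs[OF pressure_far(2)[OF t R g]])
   show "integ (\<lambda>y. \<bar>g i y\<bar> * (9 * (C * (1/R)^4) * E^2))"
    by (rule integrable_mult_left) (rule gi)
   show "\<bar>g i y * stress t (?W i y)\<bar> \<le> \<bar>g i y\<bar> * (9 * (C * (1/R)^4) * E^2)" for y
    unfolding abs_mult by (intro mult_left_mono s) simp
  qed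
  finally show ?thesis by (simp add: mult.commute)
 qed
 then show ?thesis
  unfolding far_pressure_def sum_distrib_left by (intro order_trans[OF sum_abs] sum_mono)
qed

text \<open>The near kernel vanishes beyond distance \<open>R\<close>, so the near part sees the
  velocity only on the ball of radius \<open>\<rho> + R\<close>, where \<open>\<psi>\<close> equals
  1. There Cauchy-Schwarz pairs the stress with the Hessian of the convolution, which
  \<open>hessian_L2\<close> and \<open>conv_Young\<close> bound uniformly in \<open>r\<close>; the
  far part is small by the decay of the third derivatives.\<close>

lemma pressure_bound:
 assumes C: "\<And>i j k R y x. 0 < R \<Longrightarrow> \<bar>pd k (pd j (pd i (newt_at R y))) x\<bar> \<le> C * (1/R)^4"
  and t: "t \<in> {0..T}" and R: "0 < R"
  and g: "\<And>i. Ck 1 (g i)" and \<rho>: "0 \<le> \<rho>" "\<And>i x. \<rho> < norm x \<Longrightarrow> g i x = 0"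
  and \<psi>: "cont \<psi>" "bsupp \<psi>" "\<And>x. norm x \<le> \<rho> + R \<Longrightarrow> \<psi> x = 1"
 defines "\<theta> \<equiv> \<lambda>x. \<Oplus>i. pd i (g i) x"
 shows "mass * \<bar>LBINT x. p t x * \<theta> x\<bar>
  \<le> 18 * mass * sqrt (LBINT x. (\<psi> x * (\<Oplus>i. (U i t x)^2))^2) * sqrt (LBINT x. (\<theta> x)^2)
   + 9 * (C * (1/R)^4) * E^2 * (\<Oplus>i. LBINT y. \<bar>g i y\<bar>)"
proof -
 let ?S = "\<lambda>x. \<Oplus>i. (U i t x)^2"
 have gb: "bsupp (g i)" for i by (rule bsuppI[OF \<rho>(2)])
 have th: "cont \<theta>" "bsupp \<theta>"
 proof -
  from cont_partial[OF g(1)] show "cont \<theta>"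
   unfolding \<theta>_def by (intro continuous_intros)
  show "bsupp \<theta>" unfolding \<theta>_def by (intro bsupp_sum bsupp_partial gb)
 qed
 have th0: "\<theta> x = 0" if "\<rho> < norm x" for x
 proof -
  have "pd i (g i) x = pd i (\<lambda>x. 0) x" for i
   by (rule partial_cong_open[of "- cball 0 \<rho>"]) (use that \<rho>(2) in auto)
  then show ?thesis by (simp add: \<theta>_def)
 qed
 let ?A = "sqrt (LBINT x. (\<psi> x * ?S x)^2)"
 let ?N = "sqrt (LBINT x. (\<theta> x)^2)"
 have m0: "0 < mass" by (rule mass_pos)
 \<comment> \<open>18 is 9 pairs of components times the factor 2 from the Laplacian, which is a
   difference of two mollifications of \<open>\<theta>\<close>.\<close>
 have near: "\<bar>stress t (\<lambda>a b. pd b (pd a (conv (newt_diff r R) \<theta>)))\<bar> \<le> 18 * mass * ?A * ?N"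
  if r: "0 < r" "r \<le> R" for r
 proof -
  let ?h = "conv (newt_diff r R) \<theta>"
  have h6: "Ck 6 ?h" by (rule Ck_conv[OF Ck_newt_diff th])
  have hb: "bsupp ?h" by (rule bsupp_conv[OF newt_diff_bsupp[OF r(1) R] th(2)])
  have h5: "Ck_on (Suc (Suc 4)) UNIV ?h" using h6 by simp
  have hc: "cont (pd b (pd a ?h))" for a b
   by (rule Ck_cont[OF Ck_partial[OF Ck_partial[OF h5]]])
  have hbb: "bsupp (pd b (pd a ?h))" for a b using hb by auto
  have h0: "?h x = 0" if "\<rho> + R < norm x" for x
  proof -
   have "newt_diff r R (x - y) * \<theta> y = 0" for y
   proof (cases "\<rho> < norm y")
    case False
    then have "R \<le> norm (x - y)" using that norm_triangle_ineq2[of x y] by linarith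
    then show ?thesis using newt_diff_zero[of r R "x - y" 0] r by simp
   qed (simp add: th0)
   then have "(\<lambda>y. newt_diff r R (x - y) * \<theta> y) = (\<lambda>y. 0)" by (rule ext)
   then show ?thesis unfolding conv_def by simp
  qed
  have hp0: "pd b (pd a ?h) x = 0" if "\<rho> + R < norm x" for a b x
  proof -
   have p1: "pd a ?h x = 0" if "\<rho> + R < norm x" for x
   proof -
    have "pd a ?h x = pd a (\<lambda>x. 0) x"
     by (rule partial_cong_open[of "- cball 0 (\<rho> + R)"]) (use that h0 in auto)
    then show ?thesis by simp
   qed
   have "pd b (pd a ?h) x = pd b (\<lambda>x. 0) x"
    by (rule partial_cong_open[of "- cball 0 (\<rho> + R)"]) (use that p1 in auto)
   then show ?thesis by simp
  qed
  have cv: "cont (conv (density_at s 0) \<theta>)" "bsupp (conv (density_at s 0) \<theta>)" if "0 < s" for s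
   by (rule conv_continuous[OF cont_density_at th], rule bsupp_conv[OF density_at_bsupp[OF that] th(2)])
  have Y: "(LBINT x. (conv (density_at s 0) \<theta> x)^2) \<le> mass^2 * (LBINT x. (\<theta> x)^2)" if "0 < s" for s
   using conv_Young[OF cont_density_at density_at_bsupp[OF that] density_at_nonneg th] that
   by (simp add: mass_density_at)
  have iY: "integ (\<lambda>x. (conv (density_at s 0) \<theta> x)^2)" if "0 < s" for s
   using cv[OF that] by (intro integrable_cs continuous_intros bsupp_power) auto
  have "(LBINT x. (lap ?h x)^2) \<le> (LBINT x. 2 * (conv (density_at R 0) \<theta> x)^2 + 2 * (conv (density_at r 0) \<theta> x)^2)"
   unfolding laplacian_conv_newt_diff[OF th]
  proof (rule integral_mono)
   show "integ (\<lambda>x. (conv (density_at R 0) \<theta> x - conv (density_at r 0) \<theta> x)^2)"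
    using cv[OF R] cv[OF r(1)] by (intro integrable_cs continuous_intros bsupp_power bsupp_diff) auto
   show "integ (\<lambda>x. 2 * (conv (density_at R 0) \<theta> x)^2 + 2 * (conv (density_at r 0) \<theta> x)^2)"
    using iY[OF R] iY[OF r(1)] by simp
   show "(conv (density_at R 0) \<theta> x - conv (density_at r 0) \<theta> x)^2
     \<le> 2 * (conv (density_at R 0) \<theta> x)^2 + 2 * (conv (density_at r 0) \<theta> x)^2" for x
    using zero_le_power2[of "conv (density_at R 0) \<theta> x + conv (density_at r 0) \<theta> x"]
    by (simp add: power2_eq_square algebra_simps)
  qed
  also have "\<dots> \<le> 4 * (mass^2 * (LBINT x. (\<theta> x)^2))"
   using iY[OF R] iY[OF r(1)] Y[OF R] Y[OF r(1)] by simp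
  finally have "sqrt (LBINT x. (lap ?h x)^2) \<le> sqrt (4 * (mass^2 * (LBINT x. (\<theta> x)^2)))"
   by (rule real_sqrt_le_mono)
  also have "\<dots> = 2 * mass * ?N" using m0 by (simp add: real_sqrt_mult)
  finally have lap: "sqrt (LBINT x. (lap ?h x)^2) \<le> 2 * mass * ?N" .
  have hess: "sqrt (LBINT x. (pd b (pd a ?h) x)^2) \<le> 2 * mass * ?N" for a b
  proof -
   have "(LBINT x. (pd b (pd a ?h) x)^2) \<le> (\<Oplus>a. LBINT x. (pd b (pd a ?h) x)^2)"
    by (rule member_le_sum) auto
   also have "\<dots> \<le> (\<Oplus>b. \<Oplus>a. LBINT x. (pd b (pd a ?h) x)^2)"
    by (rule member_le_sum) (auto intro: sum_nonneg)
   also have "\<dots> = (LBINT x. (lap ?h x)^2)"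
    by (rule hessian_L2[OF Ck_on_mono[OF h6] hb]) simp
   finally show ?thesis using lap real_sqrt_le_mono order_trans by blast
  qed
  have pc: "cont (\<lambda>x. \<psi> x * ?S x)" "bsupp (\<lambda>x. \<psi> x * ?S x)"
   using \<psi> by (auto intro!: continuous_intros contU[OF t])
  have ab: "\<bar>LBINT x. U b t x * U a t x * pd b (pd a ?h) x\<bar> \<le> ?A * (2 * mass * ?N)" for a b
  proof -
   have wc: "cont (\<lambda>x. \<psi> x * (U b t x * U a t x))" "bsupp (\<lambda>x. \<psi> x * (U b t x * U a t x))"
    using \<psi> by (auto intro!: continuous_intros contU[OF t])
   have "(\<lambda>x. U b t x * U a t x * pd b (pd a ?h) x) = (\<lambda>x. \<psi> x * (U b t x * U a t x) * pd b (pd a ?h) x)"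
   proof
    fix x show "U b t x * U a t x * pd b (pd a ?h) x = \<psi> x * (U b t x * U a t x) * pd b (pd a ?h) x"
     using \<psi>(3)[of x] hp0[of x b a] by (cases "\<rho> + R < norm x") auto
   qed
   then have "\<bar>LBINT x. U b t x * U a t x * pd b (pd a ?h) x\<bar>
     = \<bar>LBINT x. \<psi> x * (U b t x * U a t x) * pd b (pd a ?h) x\<bar>" by simp
   also have "\<dots> \<le> sqrt (LBINT x. (\<psi> x * (U b t x * U a t x))^2) * sqrt (LBINT x. (pd b (pd a ?h) x)^2)"
    using cont_borel[OF wc(1)] cont_borel[OF hc]
    by (intro integral_Cauchy_Schwarz(2) integrable_cs continuous_on_power wc hc bsupp_power hbb) auto
   also have "\<dots> \<le> ?A * (2 * mass * ?N)"
   proof (intro mult_mono hess real_sqrt_le_mono integral_mono)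
    show "integ (\<lambda>x. (\<psi> x * (U b t x * U a t x))^2)"
     using wc by (intro integrable_cs continuous_on_power bsupp_power) auto
    show "integ (\<lambda>x. (\<psi> x * ?S x)^2)"
     using pc by (intro integrable_cs continuous_on_power bsupp_power) auto
    show "(\<psi> x * (U b t x * U a t x))^2 \<le> (\<psi> x * ?S x)^2" for x
    proof -
     have "(U b t x)^2 \<le> ?S x" "(U a t x)^2 \<le> ?S x"
      by (rule member_le_sum; simp)+
     then have "(U b t x)^2 * (U a t x)^2 \<le> ?S x * ?S x"
      by (intro mult_mono) (auto intro: sum_nonneg)
     then have "(\<psi> x)^2 * ((U b t x)^2 * (U a t x)^2) \<le> (\<psi> x)^2 * (?S x * ?S x)"
      by (intro mult_left_mono) auto
     then show ?thesis by (simp only: power_mult_distrib power2_eq_square[of "\<Oplus>i. (U i t x)^2"])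
    qed
   qed auto
   finally show ?thesis .
  qed
  have "\<bar>stress t (\<lambda>a b. pd b (pd a ?h))\<bar> \<le> (\<Sum>a\<in>(UNIV::3 set). \<Sum>b\<in>(UNIV::3 set). ?A * (2 * mass * ?N))"
   unfolding stress_def by (intro order_trans[OF sum_abs] sum_mono ab)
  also have "\<dots> = 18 * mass * ?A * ?N" by simp
  finally show ?thesis .
 qed
 have lim: "((\<lambda>r. stress t (\<lambda>a b. pd b (pd a (conv (newt_diff r R) \<theta>))) + far_pressure R g t)
  \<longlongrightarrow> mass * (LBINT x. p t x * \<theta> x)) (at_right 0)"
  unfolding \<theta>_def by (rule pressure_limit[OF t R g gb])
 let ?F = "9 * (C * (1/R)^4) * E^2 * (\<Oplus>i. LBINT y. \<bar>g i y\<bar>)"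
 have far: "\<bar>far_pressure R g t\<bar> \<le> ?F"
  by (rule far_pressure_le[OF _ t R g gb]) (rule C)
 have "\<bar>mass * (LBINT x. p t x * \<theta> x)\<bar> \<le> 18 * mass * ?A * ?N + ?F"
 proof (rule tendsto_upperbound[OF tendsto_rabs[OF lim]])
  show "\<forall>\<^sub>F r in at_right 0. \<bar>stress t (\<lambda>a b. pd b (pd a (conv (newt_diff r R) \<theta>))) + far_pressure R g t\<bar>
    \<le> 18 * mass * ?A * ?N + ?F"
   unfolding eventually_at_right_field
  proof (intro exI[of _ R] conjI allI impI R)
   fix r assume "0 < r" "r < R"
   then show "\<bar>stress t (\<lambda>a b. pd b (pd a (conv (newt_diff r R) \<theta>))) + far_pressure R g t\<bar>
    \<le> 18 * mass * ?A * ?N + ?F"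
    using near[of r] far by linarith
  qed
 qed simp
 then show ?thesis using m0 by (simp add: abs_mult)
qed

end

section \<open>Local bounds for the fourth power\<close>

text \<open>The third coordinate comes first, so that the outer integral runs over slices
  \<open>x $ 3 = c\<close>.\<close>

definition vec3 :: "real \<times> real \<times> real \<Rightarrow> real^3" where
 "vec3 z = (\<chi> i. if i = 1 then fst (snd z) else if i = 2 then snd (snd z) else fst z)"

lemma vec3_continuous: "cont vec3"
proof -
 have "vec3 = (\<lambda>z. fst (snd z) *\<^sub>R axis 1 1 + snd (snd z) *\<^sub>R axis 2 1 + fst z *\<^sub>R axis 3 1)"
  by (auto simp: vec3_def fun_eq_iff vec_eq_iff axis_def forall_3)
 then show ?thesis by (rule ssubst) (intro continuous_intros)
qed

lemma prod_Basis_vec3: "(\<Prod>b\<in>Basis. (u :: real^3) \<bullet> b) = u $ 1 * u $ 2 * u $ 3"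
proof -
 have B: "(Basis :: (real^3) set) = range (\<lambda>i. axis i 1)" by (auto simp: Basis_vec_def)
 have "inj (\<lambda>i. axis i (1::real) :: real^3)" by (auto simp: inj_on_def axis_eq_axis)
 from prod.reindex[OF this, of "\<lambda>b. u \<bullet> b"]
 have "(\<Prod>b\<in>Basis. u \<bullet> b) = (\<Prod>i\<in>UNIV. u $ i)" unfolding B by (simp add: inner_axis)
 also have "\<dots> = (\<Prod>i\<in>{1, 2, 3 :: 3}. u $ i)" by (simp only: UNIV_3)
 finally show ?thesis by simp
qed

lemma lborel_vec3: "distr lborel borel vec3 = (lborel :: (real^3) measure)"
proof (rule lborel_eqI[symmetric])
 fix l u :: "real^3" assume le: "\<And>b. b \<in> Basis \<Longrightarrow> l \<bullet> b \<le> u \<bullet> b"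
 have lu: "l $ i \<le> u $ i" for i
  using le[of "axis i 1"] by (auto simp: Basis_vec_def inner_axis)
 have pre: "vec3 -` box l u = box (l $ 3) (u $ 3) \<times> box (l $ 1) (u $ 1) \<times> box (l $ 2) (u $ 2)"
  by (auto simp: vec3_def mem_box_cart forall_3)
 have "emeasure (distr lborel borel vec3) (box l u) = emeasure lborel (vec3 -` box l u)"
  using cont_borel[OF vec3_continuous] by (subst emeasure_distr) auto
 also have "\<dots> = emeasure (lborel \<Otimes>\<^sub>M (lborel \<Otimes>\<^sub>M lborel)) (box (l $ 3) (u $ 3) \<times> box (l $ 1) (u $ 1) \<times> box (l $ 2) (u $ 2))"
  unfolding pre lborel_prod ..
 also have "\<dots> = emeasure lborel (box (l $ 3) (u $ 3)) * (emeasure lborel (box (l $ 1) (u $ 1)) * emeasure lborel (box (l $ 2) (u $ 2)))"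
 proof -
  have m: "box (l $ 1) (u $ 1) \<times> box (l $ 2) (u $ 2) \<in> sets (lborel :: (real \<times> real) measure)"
   by (simp add: borel_open open_Times open_box)
  have "emeasure ((lborel :: real measure) \<Otimes>\<^sub>M (lborel :: real measure)) (box (l $ 1) (u $ 1) \<times> box (l $ 2) (u $ 2))
    = emeasure lborel (box (l $ 1) (u $ 1)) * emeasure lborel (box (l $ 2) (u $ 2))"
   by (rule lborel.emeasure_pair_measure_Times) auto
  then show ?thesis
   unfolding lborel_prod using m by (subst lborel_prod[symmetric], subst lborel.emeasure_pair_measure_Times) auto
 qed
 also have "\<dots> = ennreal ((u $ 3 - l $ 3) * ((u $ 1 - l $ 1) * (u $ 2 - l $ 2)))"
  using lu by (simp add: ennreal_mult'' ennreal_mult)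
 also have "\<dots> = (\<Prod>b\<in>Basis. (u - l) \<bullet> b)"
  by (simp add: prod_Basis_vec3 mult_ac)
 finally show "emeasure (distr lborel borel vec3) (box l u) = (\<Prod>b\<in>Basis. (u - l) \<bullet> b)" .
qed simp

lemma nn_integral_vec3:
 assumes [measurable]: "H \<in> borel_measurable borel"
 shows "(\<integral>\<^sup>+x. H x \<partial>lborel) = (\<integral>\<^sup>+c. \<integral>\<^sup>+w. H (vec3 (c, w)) \<partial>lborel \<partial>lborel)"
proof -
 have [measurable]: "vec3 \<in> borel_measurable borel"
  by (rule cont_borel[OF vec3_continuous])
 have "(\<integral>\<^sup>+x. H x \<partial>lborel) = (\<integral>\<^sup>+z. H (vec3 z) \<partial>lborel)"
  by (subst lborel_vec3[symmetric], subst nn_integral_distr) auto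
 also have "\<dots> = (\<integral>\<^sup>+z. H (vec3 z) \<partial>(lborel \<Otimes>\<^sub>M lborel))" by (simp only: lborel_prod)
 also have "\<dots> = (\<integral>\<^sup>+c. \<integral>\<^sup>+w. H (vec3 (c, w)) \<partial>lborel \<partial>lborel)"
  by (rule lborel.nn_integral_fst[symmetric]) (simp add: lborel_prod)
 finally show ?thesis .
qed

text \<open>The square is the integral of its derivative from a point \<open>a\<close> to the left
  of the support.\<close>

lemma square_le_line_integral:
 fixes h :: "real \<Rightarrow> real"
 assumes d: "\<And>s. (h has_real_derivative h' s) (at s)" and c: "cont h'" and b: "bsupp h"
 shows "ennreal ((h s)^2) \<le> (\<integral>\<^sup>+r. ennreal (2 * \<bar>h r\<bar> * \<bar>h' r\<bar>) \<partial>lborel)"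
proof -
 obtain R where R: "0 < R" "\<And>x. R < norm x \<Longrightarrow> h x = 0" using bsuppE[OF b] by blast
 define a where "a = - (R + \<bar>s\<bar> + 1)"
 have a: "a \<le> s" "h a = 0" using R by (auto simp: a_def)
 have hc: "cont h"
  by (intro continuous_at_imp_continuous_on ballI DERIV_isCont[OF d])
 have i: "integ (\<lambda>r. 2 * \<bar>h r\<bar> * \<bar>h' r\<bar>)"
  by (intro integrable_cs continuous_intros hc c) (rule bsupp_subset[OF b], simp)
 have D: "((\<lambda>s. (h s)^2) has_real_derivative 2 * h r * h' r) (at r)" for r
  using DERIV_power[OF d, of 2 r] by (simp add: mult_ac)
 have "(h s)^2 = (LBINT r. 2 * h r * h' r * indicator {a..s} r)"
  using integral_FTC_Icc_real[OF a(1) D] hc c a(2)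
  by (simp add: continuous_on_eq_continuous_at)
 also have "\<dots> \<le> (LBINT r. 2 * \<bar>h r\<bar> * \<bar>h' r\<bar>)"
 proof (rule integral_mono[OF _ i])
  have "has_bochner_integral lborel (\<lambda>r. 2 * h r * h' r * indicator {a..s} r) ((h s)^2 - (h a)^2)"
   using hc c by (intro has_bochner_integral_FTC_Icc_real[OF a(1) D]) (simp add: continuous_on_eq_continuous_at)
  then show "integ (\<lambda>r. 2 * h r * h' r * indicator {a..s} r)"
   by (simp add: has_bochner_integral_iff)
  show "2 * h r * h' r * indicator {a..s} r \<le> 2 * \<bar>h r\<bar> * \<bar>h' r\<bar>" for r
   using abs_ge_self[of "h r * h' r"] by (auto simp: indicator_def abs_mult)
 qed
 finally have "ennreal ((h s)^2) \<le> ennreal (LBINT r. 2 * \<bar>h r\<bar> * \<bar>h' r\<bar>)" by (rule ennreal_leI)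
 also have "\<dots> = (\<integral>\<^sup>+r. ennreal (2 * \<bar>h r\<bar> * \<bar>h' r\<bar>) \<partial>lborel)"
  by (rule nn_integral_eq_integral[OF i, symmetric]) simp
 finally show ?thesis .
qed

lemma vec3_line:
 "vec3 (s, w) = vec3 (0, w) + s *\<^sub>R axis 3 1"
 "vec3 (c, (s, b)) = vec3 (c, (0, b)) + s *\<^sub>R axis 1 1"
 "vec3 (c, (a, s)) = vec3 (c, (a, 0)) + s *\<^sub>R axis 2 1"
 by (auto simp: vec3_def vec_eq_iff axis_def forall_3)

lemma square_le_axis_integral:
 fixes f :: "real^3 \<Rightarrow> real"
 assumes f: "Ck 1 f" "bsupp f"
 shows "ennreal ((f (x + s *\<^sub>R axis i 1))^2)
  \<le> (\<integral>\<^sup>+r. ennreal (2 * \<bar>f (x + r *\<^sub>R axis i 1)\<bar> * \<bar>pd i f (x + r *\<^sub>R axis i 1)\<bar>) \<partial>lborel)"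
proof (rule square_le_line_integral)
 show "((\<lambda>s. f (x + s *\<^sub>R axis i 1)) has_real_derivative pd i f (x + s *\<^sub>R axis i 1)) (at s)" for s
  using partial_line[OF f(1)] .
 from cont_partial[OF f(1)]
 show "cont (\<lambda>s. pd i f (x + s *\<^sub>R axis i 1))"
  by (rule continuous_on_compose2) (auto intro!: continuous_intros)
 obtain R where R: "0 < R" "\<And>x. R < norm x \<Longrightarrow> f x = 0" using bsuppE[OF f(2)] by blast
 show "bsupp (\<lambda>s. f (x + s *\<^sub>R axis i 1))"
 proof (rule bsuppI[of "R + norm x"])
  fix s :: real assume s: "R + norm x < norm s"
  have "norm (s *\<^sub>R axis i 1 :: real^3) \<le> norm (x + s *\<^sub>R axis i 1) + norm x"
   using norm_triangle_ineq4[of "x + s *\<^sub>R axis i 1" x] by simp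
  then show "f (x + s *\<^sub>R axis i 1) = 0" using s by (intro R(2)) simp
 qed
qed

text \<open>
 An inequality of Ladyzhenskaya type: two of the three factors of \<open>f\<^sup>4 = f\<^sup>2 f\<^sup>2\<close> are bounded by
 line integrals in different directions, which decouples the integral over each slice.
\<close>

lemma L4_nn_integral:
 fixes f :: "real^3 \<Rightarrow> real"
 assumes f: "Ck 1 f" "bsupp f"
 shows "(\<integral>\<^sup>+x. ennreal ((f x) ^ 4) \<partial>lborel)
  \<le> 4 * (\<integral>\<^sup>+x. ennreal (2 * \<bar>f x\<bar> * \<bar>pd 3 f x\<bar>) \<partial>lborel)
   * ((\<integral>\<^sup>+x. ennreal ((pd 1 f x)^2) \<partial>lborel) + (\<integral>\<^sup>+x. ennreal ((pd 2 f x)^2) \<partial>lborel))"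
proof -
 have [measurable]: "vec3 \<in> borel_measurable borel"
  by (rule cont_borel[OF vec3_continuous])
 have [measurable]: "f \<in> borel_measurable borel"
  by (rule cont_borel[OF Ck_cont[OF f(1)]])
 from cont_partial[OF f(1)] have [measurable]: "pd i f \<in> borel_measurable borel" for i
  by (rule cont_borel)
 have [measurable]: "vec3 \<in> borel_measurable (borel \<Otimes>\<^sub>M borel \<Otimes>\<^sub>M borel)"
  "vec3 \<in> borel_measurable (borel \<Otimes>\<^sub>M borel)"
  by (simp_all add: borel_prod)
 let ?G = "\<lambda>i z. ennreal (2 * \<bar>f (vec3 z)\<bar> * \<bar>pd i f (vec3 z)\<bar>)"
 let ?D = "\<lambda>i c. \<integral>\<^sup>+w. ennreal ((pd i f (vec3 (c, w)))^2) \<partial>lborel"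
 define \<kappa> where "\<kappa> = (\<integral>\<^sup>+x. ennreal (2 * \<bar>f x\<bar> * \<bar>pd 3 f x\<bar>) \<partial>lborel)"
 have g3: "ennreal ((f (vec3 (c, w)))^2) \<le> (\<integral>\<^sup>+r. ?G 3 (r, w) \<partial>lborel)" for c w
  using square_le_axis_integral[OF f, of "vec3 (0, w)" c 3] by (simp only: vec3_line(1)[symmetric])
 have g1: "ennreal ((f (vec3 (c, (a, b))))^2) \<le> (\<integral>\<^sup>+r. ?G 1 (c, (r, b)) \<partial>lborel)" for a b c
  using square_le_axis_integral[OF f, of "vec3 (c, (0, b))" a 1] by (simp only: vec3_line(2)[symmetric])
 have g2: "ennreal ((f (vec3 (c, (a, b))))^2) \<le> (\<integral>\<^sup>+r. ?G 2 (c, (a, r)) \<partial>lborel)" for a b c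
  using square_le_axis_integral[OF f, of "vec3 (c, (a, 0))" b 2] by (simp only: vec3_line(3)[symmetric])
 \<comment> \<open>Line integrals in the third direction bound the energy of every slice by the same
   number \<open>\<kappa>\<close>.\<close>
 have S: "(\<integral>\<^sup>+w. ennreal ((f (vec3 (c, w)))^2) \<partial>lborel) \<le> \<kappa>" for c
 proof -
  have "(\<integral>\<^sup>+w. ennreal ((f (vec3 (c, w)))^2) \<partial>lborel) \<le> (\<integral>\<^sup>+w. \<integral>\<^sup>+r. ?G 3 (r, w) \<partial>lborel \<partial>lborel)"
   by (intro nn_integral_mono g3)
  also have "\<dots> = (\<integral>\<^sup>+r. \<integral>\<^sup>+w. ?G 3 (r, w) \<partial>lborel \<partial>lborel)"
   by (rule lborel_pair.Fubini') (simp add: lborel_prod split_beta')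
  also have "\<dots> = \<kappa>" unfolding \<kappa>_def by (subst nn_integral_vec3) auto
  finally show ?thesis .
 qed
 have \<alpha>: "(\<integral>\<^sup>+w. ?G i (c, w) \<partial>lborel)^2 \<le> 4 * \<kappa> * ?D i c" for i c
 proof -
  have "(\<integral>\<^sup>+w. ?G i (c, w) \<partial>lborel) = (\<integral>\<^sup>+w. ennreal (2 * \<bar>f (vec3 (c, w))\<bar>) * ennreal \<bar>pd i f (vec3 (c, w))\<bar> \<partial>lborel)"
   by (simp add: ennreal_mult)
  also have "\<dots>\<^sup>2 \<le> (\<integral>\<^sup>+w. (ennreal (2 * \<bar>f (vec3 (c, w))\<bar>))^2 \<partial>lborel) * (\<integral>\<^sup>+w. (ennreal \<bar>pd i f (vec3 (c, w))\<bar>)^2 \<partial>lborel)"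
   by (rule Cauchy_Schwarz_nn_integral) measurable
  also have "(\<integral>\<^sup>+w. (ennreal (2 * \<bar>f (vec3 (c, w))\<bar>))^2 \<partial>lborel) = 4 * (\<integral>\<^sup>+w. ennreal ((f (vec3 (c, w)))^2) \<partial>lborel)"
   by (subst nn_integral_cmult[symmetric]) (auto simp: ennreal_power power_mult_distrib ennreal_mult)
  also have "(\<integral>\<^sup>+w. (ennreal \<bar>pd i f (vec3 (c, w))\<bar>)^2 \<partial>lborel) = ?D i c"
   by (simp add: ennreal_power)
  also have "4 * (\<integral>\<^sup>+w. ennreal ((f (vec3 (c, w)))^2) \<partial>lborel) * ?D i c \<le> 4 * \<kappa> * ?D i c"
   by (intro mult_right_mono mult_left_mono S) auto
  finally show ?thesis .
 qed
 have slice: "(\<integral>\<^sup>+w. ennreal ((f (vec3 (c, w))) ^ 4) \<partial>lborel) \<le> 4 * \<kappa> * ?D 1 c + 4 * \<kappa> * ?D 2 c" for c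
 proof -
  let ?A = "\<lambda>b. \<integral>\<^sup>+r. ?G 1 (c, (r, b)) \<partial>lborel" and ?B = "\<lambda>a. \<integral>\<^sup>+r. ?G 2 (c, (a, r)) \<partial>lborel"
  have "(\<integral>\<^sup>+w. ennreal ((f (vec3 (c, w))) ^ 4) \<partial>lborel) = (\<integral>\<^sup>+w. ennreal ((f (vec3 (c, w))) ^ 4) \<partial>(lborel \<Otimes>\<^sub>M lborel))"
   by (simp only: lborel_prod)
  also have "\<dots> = (\<integral>\<^sup>+a. \<integral>\<^sup>+b. ennreal ((f (vec3 (c, (a, b)))) ^ 4) \<partial>lborel \<partial>lborel)"
   by (rule lborel.nn_integral_fst[symmetric]) (simp add: lborel_prod)
  also have "\<dots> \<le> (\<integral>\<^sup>+a. \<integral>\<^sup>+b. ?A b * ?B a \<partial>lborel \<partial>lborel)"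
  proof (intro nn_integral_mono)
   fix a b
   have "ennreal ((f (vec3 (c, (a, b)))) ^ 4) = ennreal ((f (vec3 (c, (a, b))))^2) * ennreal ((f (vec3 (c, (a, b))))^2)"
    by (simp add: ennreal_mult[symmetric] flip: power_add)
   also have "\<dots> \<le> ?A b * ?B a" by (intro mult_mono g1 g2) auto
   finally show "ennreal ((f (vec3 (c, (a, b)))) ^ 4) \<le> ?A b * ?B a" .
  qed
  also have "\<dots> = (\<integral>\<^sup>+b. ?A b \<partial>lborel) * (\<integral>\<^sup>+a. ?B a \<partial>lborel)"
   by (simp add: nn_integral_multc nn_integral_cmult)
  also have "(\<integral>\<^sup>+b. ?A b \<partial>lborel) = (\<integral>\<^sup>+w. ?G 1 (c, w) \<partial>lborel)"
   by (subst lborel_prod[symmetric], subst lborel_pair.nn_integral_snd[symmetric]) (simp_all add: lborel_prod)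
  also have "(\<integral>\<^sup>+a. ?B a \<partial>lborel) = (\<integral>\<^sup>+w. ?G 2 (c, w) \<partial>lborel)"
   by (subst lborel_prod[symmetric], subst lborel.nn_integral_fst[symmetric]) (simp_all add: lborel_prod)
  also have "(\<integral>\<^sup>+w. ?G 1 (c, w) \<partial>lborel) * (\<integral>\<^sup>+w. ?G 2 (c, w) \<partial>lborel)
    \<le> (\<integral>\<^sup>+w. ?G 1 (c, w) \<partial>lborel)^2 + (\<integral>\<^sup>+w. ?G 2 (c, w) \<partial>lborel)^2"
  proof -
   have "x * y \<le> x^2 + y^2" for x y :: ennreal
   proof (cases "x \<le> y")
    case True
    then have "x * y \<le> y * y" by (intro mult_right_mono) auto
    then show ?thesis by (simp add: power2_eq_square add_increasing)
   next
    case False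
    then have "x * y \<le> x * x" by (intro mult_left_mono) auto
    then show ?thesis by (simp add: power2_eq_square add_increasing2)
   qed
   then show ?thesis .
  qed
  also have "\<dots> \<le> 4 * \<kappa> * ?D 1 c + 4 * \<kappa> * ?D 2 c" by (intro add_mono \<alpha>)
  finally show ?thesis .
 qed
 have "(\<integral>\<^sup>+x. ennreal ((f x) ^ 4) \<partial>lborel) = (\<integral>\<^sup>+c. \<integral>\<^sup>+w. ennreal ((f (vec3 (c, w))) ^ 4) \<partial>lborel \<partial>lborel)"
  by (subst nn_integral_vec3) auto
 also have "\<dots> \<le> (\<integral>\<^sup>+c. 4 * \<kappa> * ?D 1 c + 4 * \<kappa> * ?D 2 c \<partial>lborel)"
  by (intro nn_integral_mono slice)
 also have "\<dots> = 4 * \<kappa> * (\<integral>\<^sup>+c. ?D 1 c \<partial>lborel) + 4 * \<kappa> * (\<integral>\<^sup>+c. ?D 2 c \<partial>lborel)"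
  by (subst nn_integral_add) (auto simp: nn_integral_cmult)
 also have "\<dots> = 4 * \<kappa> * ((\<integral>\<^sup>+x. ennreal ((pd 1 f x)^2) \<partial>lborel) + (\<integral>\<^sup>+x. ennreal ((pd 2 f x)^2) \<partial>lborel))"
 proof -
  have "(\<integral>\<^sup>+x. ennreal ((pd i f x)^2) \<partial>lborel) = (\<integral>\<^sup>+c. ?D i c \<partial>lborel)" for i
   by (rule nn_integral_vec3) measurable
  then show ?thesis by (simp only: distrib_left)
 qed
 finally show ?thesis unfolding \<kappa>_def .
qed

text \<open>In terms of norms this is one power of the function and three powers of its gradient. In
  the energy estimate the square root of the left side is thus a 3/4 power of the dissipation, which
  Young's inequality can absorb.\<close>

lemma L4_bound:
 fixes f :: "real^3 \<Rightarrow> real"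
 assumes f: "Ck 1 f" "bsupp f"
 defines "G \<equiv> \<Oplus>i. LBINT x. (pd i f x)^2"
 shows "(LBINT x. (f x) ^ 4) \<le> 8 * sqrt (LBINT x. (f x)^2) * sqrt G * G"
proof -
 have fc: "cont f" by (rule Ck_cont[OF f(1)])
 have pc: "cont (pd i f)" for i by (rule cont_partial[OF f(1)])
 have pb: "bsupp (pd i f)" for i using f(2) by auto
 have i4: "integ (\<lambda>x. (f x) ^ 4)" and i2: "integ (\<lambda>x. (f x)^2)"
  and ip: "integ (\<lambda>x. (pd i f x)^2)" for i
  by (intro integrable_cs continuous_on_power fc pc bsupp_power f(2) pb; simp)+
 have ifp: "integ (\<lambda>x. 2 * \<bar>f x\<bar> * \<bar>pd 3 f x\<bar>)"
  using f(2) by (intro integrable_cs continuous_intros fc pc) (rule bsupp_subset, auto)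
 have G: "(LBINT x. (pd i f x)^2) \<le> G" for i
  unfolding G_def by (rule member_le_sum) auto
 have G12: "(LBINT x. (pd 1 f x)^2) + (LBINT x. (pd 2 f x)^2) \<le> G"
  unfolding G_def by (simp add: sum_3)
 have G0: "0 \<le> G" unfolding G_def by (intro sum_nonneg) simp
 let ?k = "LBINT x. 2 * \<bar>f x\<bar> * \<bar>pd 3 f x\<bar>"
 have "?k = 2 * (LBINT x. \<bar>f x\<bar> * \<bar>pd 3 f x\<bar>)"
  by (simp add: mult.assoc)
 also have "(LBINT x. \<bar>f x\<bar> * \<bar>pd 3 f x\<bar>) \<le> sqrt (LBINT x. \<bar>f x\<bar>\<^sup>2) * sqrt (LBINT x. \<bar>pd 3 f x\<bar>\<^sup>2)"
  using cont_borel[OF fc] cont_borel[OF pc] i2 ip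
  by (intro order_trans[OF abs_ge_self integral_Cauchy_Schwarz(2)]) auto
 also have "\<dots> \<le> sqrt (LBINT x. (f x)^2) * sqrt G"
  using G by (simp add: mult_left_mono)
 finally have k: "?k \<le> 2 * (sqrt (LBINT x. (f x)^2) * sqrt G)" by simp
 have k0: "0 \<le> ?k" by simp
 have "ennreal (LBINT x. (f x) ^ 4) = (\<integral>\<^sup>+x. ennreal ((f x) ^ 4) \<partial>lborel)"
  by (rule nn_integral_eq_integral[OF i4, symmetric]) simp
 also have "\<dots> \<le> 4 * (\<integral>\<^sup>+x. ennreal (2 * \<bar>f x\<bar> * \<bar>pd 3 f x\<bar>) \<partial>lborel)
   * ((\<integral>\<^sup>+x. ennreal ((pd 1 f x)^2) \<partial>lborel) + (\<integral>\<^sup>+x. ennreal ((pd 2 f x)^2) \<partial>lborel))"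
  by (rule L4_nn_integral[OF f])
 also have "\<dots> = 4 * ennreal ?k * (ennreal (LBINT x. (pd 1 f x)^2) + ennreal (LBINT x. (pd 2 f x)^2))"
  using nn_integral_eq_integral[OF ifp] nn_integral_eq_integral[OF ip] by simp
 also have "\<dots> = ennreal (4 * ?k * ((LBINT x. (pd 1 f x)^2) + (LBINT x. (pd 2 f x)^2)))"
  using k0 by (simp add: ennreal_mult'' ennreal_mult' ennreal_plus[symmetric] del: ennreal_plus)
 finally have "(LBINT x. (f x) ^ 4) \<le> 4 * ?k * ((LBINT x. (pd 1 f x)^2) + (LBINT x. (pd 2 f x)^2))"
  using k0 by (subst (asm) ennreal_le_iff) auto
 also have "\<dots> \<le> 4 * (2 * (sqrt (LBINT x. (f x)^2) * sqrt G)) * G"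
  using k G12 k0 G0 by (intro mult_mono) auto
 finally show ?thesis by simp
qed

section \<open>The energy inequality\<close>

text \<open>A cubic step is of class C^1, the regularity that the local energy identity asks of a
  cutoff.\<close>

definition smoothstep :: "real \<Rightarrow> real" where
 "smoothstep s = (if s \<in> {..0} then 0 else if s \<in> {..1} then 3 * s^2 - 2 * s ^ 3 else 1)"

definition smoothstep' :: "real \<Rightarrow> real" where
 "smoothstep' s = 6 * max 0 (min 1 s) * (1 - max 0 (min 1 s))"

lemma smoothstep_deriv: "(smoothstep has_real_derivative smoothstep' s) (at s)"
proof -
 have cl: "closure {..a::real} = {..a}" "closure {a<..} = {a..}" for a by simp_all
 have U: "{..a} \<union> {a<..} = (UNIV :: real set)" for a by auto
 let ?f = "\<lambda>s::real. 3 * s^2 - 2 * s ^ 3"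
 have f: "(?f has_vector_derivative 6 * s * (1 - s)) (at s within S)" for s S
  unfolding has_real_derivative_iff_has_vector_derivative[symmetric]
  by (rule has_field_derivative_at_within)
   (auto intro!: derivative_eq_intros simp: algebra_simps power2_eq_square)
 have g: "((\<lambda>s. if s \<in> {..1} then ?f s else 1) has_vector_derivative
   (if s \<in> {..1} then 6 * s * (1 - s) else 0)) (at s within {..1} \<union> {1<..})" for s
  by (rule has_vector_derivative_If_within_closures[where g="\<lambda>_. 1" and g'="\<lambda>_. 0"])
   (use f in \<open>auto simp: cl\<close>)
 have "((\<lambda>s. if s \<in> {..0} then 0 else if s \<in> {..1} then ?f s else 1) has_vector_derivative
   (if s \<in> {..0} then 0 else if s \<in> {..1} then 6 * s * (1 - s) else 0)) (at s within {..0} \<union> {0<..})"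
 proof (rule has_vector_derivative_If_within_closures[where f="\<lambda>_. 0" and f'="\<lambda>_. 0"
    and g="\<lambda>s. if s \<in> {..1} then ?f s else 1" and g'="\<lambda>s. if s \<in> {..1} then 6 * s * (1 - s) else 0"])
  show "((\<lambda>s. if s \<in> {..1} then ?f s else 1) has_vector_derivative
   (if s \<in> {..1} then 6 * s * (1 - s) else 0)) (at s within {0<..} \<union> (closure {..0} \<inter> closure {0<..}))"
   using g[of s] unfolding U by (rule has_vector_derivative_at_within)
  show "(\<lambda>_. 0) s = (if s \<in> {..1} then ?f s else 1)" "(\<lambda>_. 0) s = (if s \<in> {..1} then 6 * s * (1 - s) else 0)"
   if "s \<in> closure {..0}" "s \<in> closure {0<..}"
  proof -
   have "s = 0" using that unfolding cl by simp
   then show "(\<lambda>_. 0) s = (if s \<in> {..1} then ?f s else 1)" "(\<lambda>_. 0) s = (if s \<in> {..1} then 6 * s * (1 - s) else 0)"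
    by simp_all
  qed
 qed auto
 moreover have "(if s \<in> {..0} then 0 else if s \<in> {..1} then 6 * s * (1 - s) else 0) = smoothstep' s"
  by (auto simp: smoothstep'_def max_def min_def)
 ultimately show ?thesis
  unfolding has_real_derivative_iff_has_vector_derivative smoothstep_def[abs_def] U by simp
qed

lemma smoothstep'_bounds: "0 \<le> smoothstep' s" "smoothstep' s \<le> 3/2"
proof -
 define m where "m = max 0 (min 1 s)"
 have "0 \<le> m" "m \<le> 1" by (auto simp: m_def)
 moreover have "6 * m * (1 - m) \<le> 3/2"
  using zero_le_power2[of "m - 1/2"] by (simp add: power2_eq_square algebra_simps)
 ultimately show "0 \<le> smoothstep' s" "smoothstep' s \<le> 3/2"
  unfolding smoothstep'_def m_def[symmetric] by auto
qed

lemma smoothstep_bounds: "0 \<le> smoothstep s" "smoothstep s \<le> 1"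
proof -
 have mono: "smoothstep a \<le> smoothstep b" if "a \<le> b" for a b
  by (rule DERIV_nonneg_imp_nondecreasing[OF that]) (use smoothstep_deriv smoothstep'_bounds in blast)
 show "0 \<le> smoothstep s" "smoothstep s \<le> 1"
  using mono[of "min s 0" s] mono[of s "max s 2"] by (auto simp: smoothstep_def min_def max_def split: if_splits)
qed

lemma Ck_smoothstep: "Ck 1 smoothstep"
proof -
 define D where "D j = (if j = 0 then smoothstep else smoothstep')" for j :: nat
 have "Ck 1 (D 0)"
 proof (rule Ck_real_derivI)
  show "(D j has_real_derivative D (Suc j) x) (at x)" if "j < 1" for j x
   using that smoothstep_deriv by (simp add: D_def)
  show "cont (D 1)"
   unfolding D_def smoothstep'_def by (auto intro!: continuous_intros)
 qed
 then show ?thesis by (simp add: D_def)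
qed

text \<open>Equal to 1 up to radius \<open>\<rho>\<close> and to 0 from radius
  \<open>\<rho> + r\<close> on. It is a function of \<open>x \<bullet> x\<close> instead of the
  norm, so that the origin needs no special treatment.\<close>

definition cutoff :: "real \<Rightarrow> real \<Rightarrow> real^3 \<Rightarrow> real" where
 "cutoff \<rho> r x = smoothstep (((\<rho> + r)^2 - x \<bullet> x) / ((\<rho> + r)^2 - \<rho>\<^sup>2))"

lemma Ck_cutoff: "Ck 1 (cutoff \<rho> r)"
 unfolding cutoff_def[abs_def] divide_inverse
 by (intro Ck_comp_real[OF Ck_smoothstep] Ck_mult Ck_diff Ck_const Ck_inner_self)

lemma cutoff_bounds: "0 \<le> cutoff \<rho> r x" "cutoff \<rho> r x \<le> 1"
 unfolding cutoff_def by (rule smoothstep_bounds)+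

lemma cutoff_inside:
 assumes "0 \<le> \<rho>" "0 < r" "norm x \<le> \<rho>" shows "cutoff \<rho> r x = 1"
proof -
 have "x \<bullet> x \<le> \<rho>\<^sup>2" using power_mono[OF assms(3), of 2] by (simp add: power2_norm_eq_inner)
 moreover have "\<rho>\<^sup>2 < (\<rho> + r)^2" using assms by (intro power_strict_mono) auto
 ultimately have "1 \<le> ((\<rho> + r)^2 - x \<bullet> x) / ((\<rho> + r)^2 - \<rho>\<^sup>2)" by (simp add: le_divide_eq)
 then show ?thesis unfolding cutoff_def smoothstep_def by (cases "((\<rho> + r)^2 - x \<bullet> x) / ((\<rho> + r)^2 - \<rho>\<^sup>2) = 1") auto
qed

lemma cutoff_outside:
 assumes "0 \<le> \<rho>" "0 < r" "\<rho> + r \<le> norm x" shows "cutoff \<rho> r x = 0"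
proof -
 have "(\<rho> + r)^2 \<le> x \<bullet> x" using power_mono[OF assms(3), of 2] assms by (simp add: power2_norm_eq_inner)
 moreover have "\<rho>\<^sup>2 < (\<rho> + r)^2" using assms by (intro power_strict_mono) auto
 ultimately have "((\<rho> + r)^2 - x \<bullet> x) / ((\<rho> + r)^2 - \<rho>\<^sup>2) \<le> 0" by (simp add: divide_le_0_iff)
 then show ?thesis unfolding cutoff_def smoothstep_def by simp
qed

lemma cutoff_bsupp: "0 \<le> \<rho> \<Longrightarrow> 0 < r \<Longrightarrow> bsupp (cutoff \<rho> r)"
 by (rule bsuppI[of "\<rho> + r"]) (simp add: cutoff_outside)

lemma cutoff_partial:
 assumes "0 \<le> \<rho>" "0 < r"
 shows "\<bar>pd i (cutoff \<rho> r) x\<bar> \<le> 3 / r"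
proof (cases "\<rho> + r < norm x")
 case True
 have "pd i (cutoff \<rho> r) x = pd i (\<lambda>x. 0) x"
  by (rule partial_cong_open[of "- cball 0 (\<rho> + r)"]) (use True assms in \<open>auto simp: cutoff_outside\<close>)
 then show ?thesis using assms by simp
next
 case False
 let ?w = "(\<rho> + r)^2 - \<rho>\<^sup>2"
 have w: "?w = r * (2 * \<rho> + r)" by (simp add: power2_eq_square algebra_simps)
 have w0: "0 < ?w" unfolding w using assms by simp
 have C: "Ck 1 (\<lambda>x::real^3. inverse ?w * ((\<rho> + r)^2 - x \<bullet> x))"
  by (intro Ck_mult Ck_diff Ck_const Ck_inner_self)
 have "pd i (\<lambda>x::real^3. inverse ?w * ((\<rho> + r)^2 - x \<bullet> x)) = (\<lambda>x. inverse ?w * (0 - 2 * x $ i))"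
  using partial_diff[OF Ck_const Ck_inner_self, of i "(\<rho> + r)^2"]
  by (subst partial_cmult) (auto simp: partial_inner_self intro!: Ck_inner_self)
 then have "pd i (cutoff \<rho> r) x
   = smoothstep' (inverse ?w * ((\<rho> + r)^2 - x \<bullet> x)) * (inverse ?w * (0 - 2 * x $ i))"
  unfolding cutoff_def[abs_def] divide_inverse mult.commute[of _ "inverse ?w"]
  by (simp add: partial_comp_real[OF smoothstep_deriv C])
 then have "\<bar>pd i (cutoff \<rho> r) x\<bar> = smoothstep' (inverse ?w * ((\<rho> + r)^2 - x \<bullet> x)) * (2 * \<bar>x $ i\<bar> / ?w)"
  using w0 smoothstep'_bounds(1) by (simp add: abs_mult divide_inverse)
 also have "\<dots> \<le> 3/2 * (2 * (\<rho> + r) / ?w)"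
  using False component_le_norm_cart[of x i] w0 assms
  by (intro mult_mono smoothstep'_bounds divide_right_mono mult_left_mono) auto
 also have "\<dots> = 3 / r * ((\<rho> + r) / (2 * \<rho> + r))" unfolding w using assms by (simp add: divide_simps)
 also have "\<dots> \<le> 3 / r * 1" using assms by (intro mult_left_mono) auto
 finally show ?thesis by simp
qed

text \<open>Young's inequality with exponents 4/3 and 4, stated without fractional powers. If
  \<open>\<delta> * Z\<close> does not dominate \<open>a * Q\<close>, then \<open>Z\<close> can be
  eliminated from the hypothesis and a bound for \<open>Q\<close> remains.\<close>

lemma young_quarter:
 fixes Q Z a B \<delta> :: real
 assumes "0 \<le> Q" "0 \<le> Z" "0 \<le> a" "0 \<le> B" "0 < \<delta>" "Q ^ 4 \<le> B * Z ^ 3"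
 shows "a * Q \<le> \<delta> * Z + B * a ^ 4 / \<delta> ^ 3"
proof (cases "a * Q \<le> \<delta> * Z")
 case True
 moreover have "0 \<le> B * a ^ 4 / \<delta> ^ 3" using assms by simp
 ultimately show ?thesis by linarith
next
 case False
 have aQ: "0 < a * Q" using False assms by (meson le_less_trans mult_nonneg_nonneg not_le less_imp_le)
 then have Q: "0 < Q" using assms by (metis less_eq_real_def mult_zero_right order_less_irrefl)
 have "\<delta> ^ 3 * Z ^ 3 \<le> (a * Q) ^ 3"
  using False assms power_mono[of "\<delta> * Z" "a * Q" 3] by (simp add: power_mult_distrib)
 then have "\<delta> ^ 3 * (B * Z ^ 3) \<le> B * (a * Q) ^ 3"
  using mult_left_mono[of "\<delta> ^ 3 * Z ^ 3" "(a * Q) ^ 3" B] assms by (simp add: mult_ac)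
 moreover have "\<delta> ^ 3 * Q ^ 4 \<le> \<delta> ^ 3 * (B * Z ^ 3)" using assms by (intro mult_left_mono) auto
 ultimately have "Q ^ 3 * (\<delta> ^ 3 * Q) \<le> Q ^ 3 * (B * a ^ 3)"
  by (simp add: power_mult_distrib eval_nat_numeral mult_ac)
 then have "\<delta> ^ 3 * Q \<le> B * a ^ 3" using Q by (simp add: mult_le_cancel_left_pos)
 then have "Q \<le> B * a ^ 3 / \<delta> ^ 3" using assms(5) by (simp add: pos_le_divide_eq mult.commute)
 then have "a * Q \<le> a * (B * a ^ 3 / \<delta> ^ 3)" using assms by (intro mult_left_mono) auto
 also have "\<dots> = B * a ^ 4 / \<delta> ^ 3" by (simp add: eval_nat_numeral)
 also have "\<dots> \<le> \<delta> * Z + B * a ^ 4 / \<delta> ^ 3" using assms by simp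
 finally show ?thesis .
qed

lemma integral_param_continuous:
 fixes F :: "real \<Rightarrow> 'a::euclidean_space \<Rightarrow> real"
 assumes c: "continuous_on (S \<times> UNIV) (\<lambda>(s, x). F s x)" and R: "\<And>s x. s \<in> S \<Longrightarrow> R < norm x \<Longrightarrow> F s x = 0"
 shows "continuous_on S (\<lambda>s. LBINT x. F s x)"
proof -
 obtain a b :: 'a where ab: "cball 0 R \<subseteq> cbox a b" by (rule cbox_cover)
 have eq: "(LBINT x. F s x) = integral (cbox a b) (F s)" if "s \<in> S" for s
 proof (rule integral_cs_cbox)
  have "cont (\<lambda>x::'a. (s, x))" by (intro continuous_intros)
  from continuous_on_compose2[OF c this] that show "cont (F s)" by auto
  show "F s x = 0" if "x \<notin> cbox a b" for x
   using that ab R[OF \<open>s \<in> S\<close>, of x] by (cases "R < norm x") (auto simp: subset_iff)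
 qed
 have "continuous_on S (\<lambda>s. integral (cbox a b) (F s))"
  by (rule integral_continuous_on_param) (rule continuous_on_subset[OF c], auto)
 then show ?thesis by (rule continuous_on_cong[THEN iffD1, rotated 2]) (auto simp: eq)
qed

context nse_solution
begin

text \<open>The weights of \<open>kin\<close> and \<open>dis\<close> are squared: a cross term
  \<open>z * pd j z\<close> then splits into a share of the weighted dissipation and a term with the
  gradient of \<open>z\<close>.\<close>

definition kin :: "(real^3 \<Rightarrow> real) \<Rightarrow> real \<Rightarrow> real" where
 "kin z t = (LBINT x. (z x)^2 * (\<Oplus>i. (U i t x)^2))"

definition dis :: "(real^3 \<Rightarrow> real) \<Rightarrow> real \<Rightarrow> real" where
 "dis z t = (\<Oplus>i. \<Oplus>j. LBINT x. (z x)^2 * (pd j (U i t) x)^2)"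

text \<open>The momentum equation tested with \<open>z^2 U\<close>. Every term that is not
  dissipation carries a derivative of the cutoff; in the pressure term this becomes visible once
  incompressibility is used.\<close>

lemma energy_derivative:
 assumes t: "t \<in> {0..T}" and z: "Ck 1 z" "bsupp z"
 shows "(kin z has_real_derivative 2 * (- dis z t
   - (\<Oplus>i. \<Oplus>j. LBINT x. 2 * z x * pd j z x * U i t x * pd j (U i t) x)
   + (\<Oplus>i. \<Oplus>j. LBINT x. z x * pd j z x * U j t x * (U i t x)^2)
   + (LBINT x. p t x * (\<Oplus>i. pd i (\<lambda>x. (z x)^2 * U i t x) x)))) (at t within {0..T})"
proof -
 have zc: "cont z" by (rule Ck_cont[OF z(1)])
 have pzc: "cont (pd j z)" for j by (rule cont_partial[OF z(1)])
 have pzb: "bsupp (pd j z)" for j using z(2) by auto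
 let ?g = "\<lambda>i x. (z x)^2 * U i t x"
 have g: "Ck 1 (?g i)" for i by (intro Ck_mult Ck_power z CkU[OF t])
 have gb: "bsupp (?g i)" for i by (rule bsupp_subset[OF z(2)]) simp
 have gc: "cont (?g i)" for i by (rule Ck_cont[OF g])
 have pg: "pd j (?g i) = (\<lambda>x. (z x)^2 * pd j (U i t) x + 2 * z x * pd j z x * U i t x)" for i j
 proof -
  have "pd j (\<lambda>x. (z x)^2) = (\<lambda>x. 2 * z x * pd j z x)"
   unfolding power2_eq_square by (subst partial_mult[OF z(1) z(1)]) (simp add: algebra_simps)
  moreover have "Ck 1 (\<lambda>x. (z x)^2)" by (intro Ck_power z)
  ultimately show ?thesis by (subst partial_mult[OF _ CkU[OF t]]) auto
 qed
 have bz: "bsupp (\<lambda>x. z x * h x)" for h :: "real^3 \<Rightarrow> real" using z(2) by auto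
 have bz2: "bsupp (\<lambda>x. (z x)^2 * h x)" for h :: "real^3 \<Rightarrow> real" by (rule bsupp_subset[OF z(2)]) simp
 obtain R where R: "\<And>x. R < norm x \<Longrightarrow> z x = 0" using bsuppE[OF z(2)] by blast
 have "(kin z has_real_derivative (LBINT x. (z x)^2 * (\<Oplus>i. 2 * U i t x * Ut i t x))) (at t within {0..T})"
  unfolding kin_def
 proof (rule leibniz_lborel[where R = R])
  show "((\<lambda>s. (z x)^2 * (\<Oplus>i. (U i s x)^2)) has_real_derivative (z x)^2 * (\<Oplus>i. 2 * U i s x * Ut i s x)) (at s within {0..T})"
   if "s \<in> {0..T}" for s x
   using DERIV_power[OF Ut_deriv[OF that], of _ x 2]
   by (intro DERIV_cmult DERIV_sum) (simp add: mult_ac)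
  show "cont (\<lambda>x. (z x)^2 * (\<Oplus>i. (U i s x)^2))" if "s \<in> {0..T}" for s
   by (intro continuous_intros zc contU[OF that])
  have "continuous_on ({0..T} \<times> UNIV) (\<lambda>w. (z (snd w))^2 * (\<Oplus>i. 2 * (case w of (s, x) \<Rightarrow> U i s x) * (case w of (s, x) \<Rightarrow> Ut i s x)))"
   by (intro continuous_intros smooth_slab_continuous[OF U] smooth_slab_continuous[OF Ut] continuous_on_compose2[OF zc]) auto
  then show "continuous_on ({0..T} \<times> UNIV) (\<lambda>(s, x). (z x)^2 * (\<Oplus>i. 2 * U i s x * Ut i s x))"
   by (simp add: case_prod_beta')
 qed (use R t in auto)
 also have "(LBINT x. (z x)^2 * (\<Oplus>i. 2 * U i t x * Ut i t x)) = 2 * (\<Oplus>i. LBINT x. Ut i t x * ?g i x)"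
 proof -
  have Utc: "cont (Ut i t)" for i
   by (rule Ck_cont[OF smooth_slab_Ck[OF Ut t, of 0]])
  have "integ (\<lambda>x. Ut i t x * ?g i x)" for i
   by (intro integrable_cs continuous_intros Utc gc bsupp_mult2 gb zc contU[OF t])
  then have "2 * (\<Oplus>i. LBINT x. Ut i t x * ?g i x) = (LBINT x. 2 * (\<Oplus>i. Ut i t x * ?g i x))"
   by simp
  also have "\<dots> = (LBINT x. (z x)^2 * (\<Oplus>i. 2 * U i t x * Ut i t x))"
   by (intro Bochner_Integration.integral_cong refl) (simp add: sum_distrib_left mult_ac)
  finally show ?thesis by simp
 qed
 also have "(\<Oplus>i. LBINT x. Ut i t x * ?g i x) = (\<Oplus>i. LBINT x. lap (U i t) x * ?g i x)
   - (\<Oplus>i. LBINT x. (\<Oplus>j. U j t x * pd j (U i t) x) * ?g i x)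
   - (\<Oplus>i. LBINT x. pd i (p t) x * ?g i x)"
  unfolding momentum_split[OF t gc gb] sum_subtractf ..
 also have "(\<Oplus>i. LBINT x. lap (U i t) x * ?g i x) = - dis z t
   - (\<Oplus>i. \<Oplus>j. LBINT x. 2 * z x * pd j z x * U i t x * pd j (U i t) x)"
 proof -
  have "(LBINT x. lap (U i t) x * ?g i x) = (\<Oplus>j. LBINT x. pd j (pd j (U i t)) x * ?g i x)" for i
   unfolding laplacian_sum sum_distrib_right
   by (intro Bochner_Integration.integral_sum integrable_cs continuous_intros contddU[OF t] gc zc contU[OF t] bsupp_mult2 gb)
  moreover have "(LBINT x. pd j (pd j (U i t)) x * ?g i x)
    = - (LBINT x. (z x)^2 * (pd j (U i t) x)^2) - (LBINT x. 2 * z x * pd j z x * U i t x * pd j (U i t) x)" for i j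
  proof -
   have "(LBINT x. ?g i x * pd j (pd j (U i t)) x) = - (LBINT x. pd j (?g i) x * pd j (U i t) x)"
    by (rule integral_by_parts[OF g CkdU[OF t]]) (simp add: gb)
   also have "(LBINT x. pd j (?g i) x * pd j (U i t) x)
     = (LBINT x. (z x)^2 * (pd j (U i t) x)^2 + 2 * z x * pd j z x * U i t x * pd j (U i t) x)"
    unfolding pg by (intro Bochner_Integration.integral_cong refl) (simp add: algebra_simps power2_eq_square)
   also have "\<dots> = (LBINT x. (z x)^2 * (pd j (U i t) x)^2) + (LBINT x. 2 * z x * pd j z x * U i t x * pd j (U i t) x)"
    by (rule Bochner_Integration.integral_add; intro integrable_cs continuous_intros zc pzc contU[OF t] contdU[OF t] bz2)
     (rule bsupp_subset[OF z(2)], simp)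
   finally show ?thesis by (simp add: mult.commute)
  qed
  ultimately show ?thesis unfolding dis_def by (simp add: sum_negf sum_subtractf)
 qed
 also have "(\<Oplus>i. LBINT x. (\<Oplus>j. U j t x * pd j (U i t) x) * ?g i x)
   = - (\<Oplus>i. \<Oplus>j. LBINT x. z x * pd j z x * U j t x * (U i t x)^2)"
 proof -
  have "(LBINT x. (\<Oplus>j. U j t x * pd j (U i t) x) * ?g i x)
    = - (\<Oplus>j. LBINT x. z x * pd j z x * U j t x * (U i t x)^2)" (is "?L = - ?S") for i
  proof -
   have j: "(LBINT x. U j t x * U i t x * pd j (?g i) x)
     = (LBINT x. (U j t x * pd j (U i t) x) * ?g i x) + 2 * (LBINT x. z x * pd j z x * U j t x * (U i t x)^2)" for j
   proof -
    have "(LBINT x. U j t x * U i t x * pd j (?g i) x)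
      = (LBINT x. (U j t x * pd j (U i t) x) * ?g i x + 2 * (z x * pd j z x * U j t x * (U i t x)^2))"
     unfolding pg by (intro Bochner_Integration.integral_cong refl) (simp add: algebra_simps power2_eq_square)
    also have "\<dots> = (LBINT x. (U j t x * pd j (U i t) x) * ?g i x) + (LBINT x. 2 * (z x * pd j z x * U j t x * (U i t x)^2))"
     by (rule Bochner_Integration.integral_add; intro integrable_cs continuous_intros zc pzc contU[OF t] contdU[OF t])
      (rule bsupp_subset[OF z(2)], simp)+
    finally show ?thesis by simp
   qed
   \<comment> \<open>Integration by parts reproduces \<open>?L\<close> with the opposite sign, so
     the identity can be solved for it: \<open>?L = - (?L + 2 ?S)\<close>.\<close>
   have "?L = - (\<Oplus>j. LBINT x. U j t x * U i t x * pd j (?g i) x)"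
    by (rule advection_test[OF t g gb])
   also have "(\<Oplus>j. LBINT x. U j t x * U i t x * pd j (?g i) x)
     = (\<Oplus>j. LBINT x. (U j t x * pd j (U i t) x) * ?g i x) + 2 * ?S"
    unfolding j sum.distrib sum_distrib_left[symmetric] ..
   also have "(\<Oplus>j. LBINT x. (U j t x * pd j (U i t) x) * ?g i x) = ?L"
    unfolding sum_distrib_right
    by (rule Bochner_Integration.integral_sum[symmetric])
     (intro integrable_cs continuous_intros zc contU[OF t] contdU[OF t] bsupp_mult2 gb)
   finally show ?thesis by linarith
  qed
  then show ?thesis by (simp add: sum_negf)
 qed
 also have "(\<Oplus>i. LBINT x. pd i (p t) x * ?g i x) = - (LBINT x. p t x * (\<Oplus>i. pd i (?g i) x))"
 proof -
  have pgc: "cont (pd i (?g i))" for i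
   unfolding pg by (intro continuous_intros zc pzc contU[OF t] contdU[OF t])
  have "integ (\<lambda>x. p t x * pd i (?g i) x)" for i
   by (intro integrable_cs continuous_intros contp[OF t] pgc bsupp_mult2 bsupp_partial gb)
  then have "(LBINT x. p t x * (\<Oplus>i. pd i (?g i) x)) = (\<Oplus>i. LBINT x. p t x * pd i (?g i) x)"
   unfolding sum_distrib_left by (rule Bochner_Integration.integral_sum)
  then show ?thesis
   using integral_by_parts[OF Ckp[OF t] g] gb by (simp add: sum_negf)
 qed
 finally show ?thesis by (simp add: algebra_simps)
qed

end

text \<open>The mean value theorem applied to \<open>f\<close> minus the integral of
  \<open>F\<close>. The derivative \<open>f'\<close> is supplied separately at each time, while its
  majorant \<open>F\<close> is continuous.\<close>

lemma derivative_le_integral: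
 fixes f :: "real \<Rightarrow> real"
 assumes d: "\<And>s. s \<in> {0..t} \<Longrightarrow> (f has_real_derivative f' s) (at s within {0..t})"
  and le: "\<And>s. s \<in> {0..t} \<Longrightarrow> f' s \<le> F s" and c: "continuous_on {0..t} F" and t: "0 \<le> t"
 shows "f t - f 0 \<le> integral {0..t} F"
proof (cases "t = 0")
 case False
 then have t: "0 < t" using t by simp
 let ?h = "\<lambda>s. f s - integral {0..s} F"
 have "\<exists>x\<in>{0<..<t}. ?h t - ?h 0 = (\<lambda>h. (f' x - F x) * h) (t - 0)"
 proof (rule mvt_simple[OF t])
  fix s assume s: "0 \<le> s" "s \<le> t"
  then have s': "s \<in> {0..t}" by simp
  have "((\<lambda>s. integral {0..s} F) has_real_derivative F s) (at s within {0..t})"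
   by (rule integral_has_real_derivative[OF c s'])
  from DERIV_diff[OF d[OF s'] this]
  show "(?h has_derivative (\<lambda>h. (f' s - F s) * h)) (at s within {0..t})"
   by (simp add: has_field_derivative_def)
 qed
 then obtain x where x: "x \<in> {0<..<t}" "?h t - ?h 0 = (f' x - F x) * t" by auto
 have "(f' x - F x) * t \<le> 0" using le[of x] x(1) t by (intro mult_nonpos_nonneg) auto
 then show ?thesis using x(2) by simp
qed simp

text \<open>Each step multiplies the error by 16 and gains a factor 32, so the errors form a
  geometric series of ratio 1/2. The a priori bound \<open>M\<close> makes the last term disappear
  in the limit.\<close>

lemma absorb_iteration:
 fixes I :: "nat \<Rightarrow> real"
 assumes rec: "\<And>m. I m \<le> A * 16 ^ m + I (Suc m) / 32" and b: "\<And>m. I m \<le> M" and A: "0 \<le> A"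
 shows "I 0 \<le> 2 * A"
proof -
 have *: "I 0 \<le> A * (\<Sum>m<n. (1/2) ^ m) + I n / 32 ^ n" for n
 proof (induction n)
  case (Suc n)
  have "I n / 32 ^ n \<le> (A * 16 ^ n + I (Suc n) / 32) / 32 ^ n"
   by (rule divide_right_mono[OF rec]) simp
  also have "\<dots> = A * (1/2) ^ n + I (Suc n) / 32 ^ Suc n"
  proof -
   have "(32::real) ^ n = 16 ^ n * 2 ^ n" by (simp flip: power_mult_distrib)
   then show ?thesis by (simp add: add_divide_distrib power_one_over)
  qed
  finally show ?case using Suc by (simp add: distrib_left)
 qed simp
 have "I 0 \<le> 2 * A + M / 32 ^ n" for n
 proof -
  have "(\<Sum>m<n. (1/2::real) ^ m) \<le> 2" by (simp add: geometric_sum)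
  then have "A * (\<Sum>m<n. (1/2) ^ m) \<le> A * 2" using A by (rule mult_left_mono)
  moreover have "I n / 32 ^ n \<le> M / 32 ^ n" by (rule divide_right_mono[OF b]) simp
  ultimately show ?thesis using *[of n] by linarith
 qed
 moreover have "(\<lambda>n. 2 * A + M / 32 ^ n) \<longlonglongrightarrow> 2 * A + M * 0"
  unfolding divide_inverse power_inverse[symmetric]
  by (intro tendsto_intros LIMSEQ_power_zero) simp
 ultimately show ?thesis
  by (intro LIMSEQ_le_const[of "\<lambda>n. 2 * A + M / 32 ^ n"]) auto
qed

context nse_solution
begin

lemma dis_mono:
 assumes t: "t \<in> {0..T}" and z: "cont z" "bsupp z" and w: "cont w" "bsupp w"
  and le: "\<And>x. (z x)^2 \<le> (w x)^2"
 shows "dis z t \<le> dis w t"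
proof -
 have i: "integ (\<lambda>x. (z x)^2 * (pd j (U i t) x)^2)" if "cont z" "bsupp z" for z i j
  by (intro integrable_cs continuous_intros that contdU[OF t]) (rule bsupp_subset[OF that(2)], simp)
 show ?thesis unfolding dis_def
  by (intro sum_mono integral_mono i z w mult_right_mono le) simp
qed

lemma dis_nonneg: "0 \<le> dis z t"
 unfolding dis_def by (intro sum_nonneg Bochner_Integration.integral_nonneg) simp

lemma dis_continuous:
 assumes z: "cont z" "bsupp z"
 shows "continuous_on {0..T} (dis z)"
 unfolding dis_def
proof (intro continuous_on_sum)
 fix i j
 obtain R where R: "\<And>x. R < norm x \<Longrightarrow> z x = 0" using bsuppE[OF z(2)] by blast
 show "continuous_on {0..T} (\<lambda>t. LBINT x. (z x)^2 * (pd j (U i t) x)^2)"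
 proof (rule integral_param_continuous[where R=R])
  have "continuous_on ({0..T} \<times> UNIV) (\<lambda>w. (z (snd w))^2 * (case w of (s, x) \<Rightarrow> pd j (U i s) x)^2)"
   by (intro continuous_intros smooth_slab_continuous[OF smooth_slab_partial[OF U]] continuous_on_compose2[OF z(1)]) auto
  then show "continuous_on ({0..T} \<times> UNIV) (\<lambda>(s, x). (z x)^2 * (pd j (U i s) x)^2)"
   by (simp add: case_prod_beta')
 qed (simp add: R)
qed

lemma kin_nonneg: "0 \<le> kin z t"
 unfolding kin_def by (intro Bochner_Integration.integral_nonneg mult_nonneg_nonneg sum_nonneg) auto

lemma kin_le:
 assumes t: "t \<in> {0..T}" and z: "cont z" "bsupp z" "\<And>x. (z x)^2 \<le> 1"
 shows "kin z t \<le> (LBINT x. (\<Oplus>i. (U i t x)^2))"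
 unfolding kin_def
proof (rule integral_mono[OF _ energy(1)[OF t]])
 show "integ (\<lambda>x. (z x)^2 * (\<Oplus>i. (U i t x)^2))"
  by (intro integrable_cs continuous_intros z contU[OF t]) (rule bsupp_subset[OF z(2)], simp)
 show "(z x)^2 * (\<Oplus>i. (U i t x)^2) \<le> (\<Oplus>i. (U i t x)^2)" for x
  using mult_right_mono[OF z(3), of "\<Oplus>i. (U i t x)^2" x] by (simp add: sum_nonneg)
qed

lemma weighted_energy_le:
 assumes t: "t \<in> {0..T}" and w: "cont w" "bsupp w" "\<And>x. \<bar>w x\<bar> \<le> c"
 shows "(\<Oplus>i. LBINT x. (w x)^2 * (U i t x)^2) \<le> c^2 * E^2"
proof -
 have c2: "(w x)^2 \<le> c^2" for x using w(3)[of x] abs_le_square_iff[of "w x" c] by linarith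
 have i: "integ (\<lambda>x. (w x)^2 * (U i t x)^2)" for i
  by (intro integrable_cs continuous_intros w contU[OF t]) (rule bsupp_subset[OF w(2)], simp)
 have "(\<Oplus>i. LBINT x. (w x)^2 * (U i t x)^2) = (LBINT x. (\<Oplus>i. (w x)^2 * (U i t x)^2))"
  by (rule Bochner_Integration.integral_sum[symmetric]) (rule i)
 also have "\<dots> \<le> (LBINT x. c^2 * (\<Oplus>i. (U i t x)^2))"
 proof (rule integral_mono)
  show "integ (\<lambda>x. \<Oplus>i. (w x)^2 * (U i t x)^2)" using i by simp
  show "integ (\<lambda>x. c^2 * (\<Oplus>i. (U i t x)^2))" using energy(1)[OF t] by simp
  show "(\<Oplus>i. (w x)^2 * (U i t x)^2) \<le> c^2 * (\<Oplus>i. (U i t x)^2)" for x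
   unfolding sum_distrib_left[symmetric] by (intro mult_right_mono c2 sum_nonneg) simp
 qed
 also have "\<dots> \<le> c^2 * E^2" using energy(2)[OF t] by (simp add: mult_left_mono)
 finally show ?thesis .
qed

text \<open>\<open>L4_bound\<close> applied to the truncated components \<open>\<phi> * U i\<close>,
  whose gradients are controlled by the dissipation on a slightly larger ball and by the energy in
  the transition layer of the cutoff.\<close>

lemma local_L4:
 assumes t: "t \<in> {0..T}" and \<rho>: "0 \<le> \<rho>" "0 < r" "\<rho> + r \<le> \<rho>'" "0 < r'"
 defines "\<phi> \<equiv> cutoff \<rho> r"
 shows "(sqrt (LBINT x. ((\<phi> x)^2 * (\<Oplus>i. (U i t x)^2))^2)) ^ 4
  \<le> 5184 * E^2 * (2 * dis (cutoff \<rho>' r') t + 54 * E^2 / r^2) ^ 3"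
proof -
 \<comment> \<open>The 2 comes from \<open>(a + b)^2 \<le> 2 a^2 + 2 b^2\<close>; 54 is 2 * 3 * 9,
   from three partial derivatives of the cutoff, each at most \<open>3 / r\<close>.\<close>
 define Z where "Z = 2 * dis (cutoff \<rho>' r') t + 54 * E^2 / r^2"
 have Z0: "0 \<le> Z" unfolding Z_def using dis_nonneg[of "cutoff \<rho>' r'" t] by simp
 have f: "Ck 1 \<phi>" unfolding \<phi>_def by (rule Ck_cutoff)
 have fc: "cont \<phi>" by (rule Ck_cont[OF f])
 have fb: "bsupp \<phi>" unfolding \<phi>_def using \<rho> by (intro cutoff_bsupp) auto
 have pfc: "cont (pd j \<phi>)" for j by (rule cont_partial[OF f])
 have pfb: "bsupp (pd j \<phi>)" for j using fb by auto
 have z': "cont (cutoff \<rho>' r')" "bsupp (cutoff \<rho>' r')"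
  using \<rho> by (auto intro!: Ck_cont[OF Ck_cutoff] cutoff_bsupp)
 have dm: "dis \<phi> t \<le> dis (cutoff \<rho>' r') t"
 proof (rule dis_mono[OF t fc fb z'])
  fix x show "(\<phi> x)^2 \<le> (cutoff \<rho>' r' x)^2"
  proof (cases "norm x \<le> \<rho>'")
   case True
   then have "cutoff \<rho>' r' x = 1" using \<rho> by (intro cutoff_inside) auto
   then show ?thesis unfolding \<phi>_def using cutoff_bounds[of \<rho> r x] by (simp add: power_le_one)
  next
   case False
   then have "\<phi> x = 0" unfolding \<phi>_def using \<rho> by (intro cutoff_outside) auto
   then show ?thesis by simp
  qed
 qed
 let ?f = "\<lambda>i x. \<phi> x * U i t x"
 have fi: "Ck 1 (?f i)" for i by (intro Ck_mult f CkU[OF t])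
 have fib: "bsupp (?f i)" for i using fb by auto
 have fic: "cont (?f i)" for i by (rule Ck_cont[OF fi])
 have I2: "integ (\<lambda>x. (\<phi> x)^2 * (pd j (U i t) x)^2)" "integ (\<lambda>x. (pd j \<phi> x)^2 * (U i t x)^2)" for i j
  by (intro integrable_cs continuous_intros fc pfc contU[OF t] contdU[OF t]; rule bsupp_subset[OF fb] bsupp_subset[OF pfb[of j]]; simp)+
 have G: "(\<Oplus>j. LBINT x. (pd j (?f i) x)^2) \<le> Z" for i
 proof -
  have "(LBINT x. (pd j (?f i) x)^2)
    \<le> 2 * (LBINT x. (\<phi> x)^2 * (pd j (U i t) x)^2) + 2 * (LBINT x. (pd j \<phi> x)^2 * (U i t x)^2)" for j
  proof -
   have "(LBINT x. (pd j (?f i) x)^2)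
     \<le> (LBINT x. 2 * ((\<phi> x)^2 * (pd j (U i t) x)^2) + 2 * ((pd j \<phi> x)^2 * (U i t x)^2))"
   proof (rule integral_mono)
    show "integ (\<lambda>x. (pd j (?f i) x)^2)"
    proof -
     from cont_partial[OF fi] show ?thesis
      by (intro integrable_cs continuous_on_power bsupp_power bsupp_partial fib) auto
    qed
    show "integ (\<lambda>x. 2 * ((\<phi> x)^2 * (pd j (U i t) x)^2) + 2 * ((pd j \<phi> x)^2 * (U i t x)^2))"
     using I2 by simp
    show "(pd j (?f i) x)^2 \<le> 2 * ((\<phi> x)^2 * (pd j (U i t) x)^2) + 2 * ((pd j \<phi> x)^2 * (U i t x)^2)" for x
     unfolding partial_mult[OF f CkU[OF t]]
     using zero_le_power2[of "\<phi> x * pd j (U i t) x - pd j \<phi> x * U i t x"]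
     by (simp add: power2_eq_square algebra_simps)
   qed
   also have "\<dots> = 2 * (LBINT x. (\<phi> x)^2 * (pd j (U i t) x)^2) + 2 * (LBINT x. (pd j \<phi> x)^2 * (U i t x)^2)"
    using I2 by simp
   finally show ?thesis .
  qed
  then have "(\<Oplus>j. LBINT x. (pd j (?f i) x)^2)
    \<le> (\<Oplus>j. 2 * (LBINT x. (\<phi> x)^2 * (pd j (U i t) x)^2) + 2 * (LBINT x. (pd j \<phi> x)^2 * (U i t x)^2))"
   by (intro sum_mono)
  also have "\<dots> = 2 * (\<Oplus>j. LBINT x. (\<phi> x)^2 * (pd j (U i t) x)^2) + 2 * (\<Oplus>j. LBINT x. (pd j \<phi> x)^2 * (U i t x)^2)"
   by (simp only: sum.distrib sum_distrib_left)
  also have "\<dots> \<le> 2 * dis \<phi> t + 2 * (\<Sum>j\<in>(UNIV::3 set). (3 / r)^2 * E^2)"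
  proof (intro add_mono mult_left_mono sum_mono)
   show "(\<Oplus>j. LBINT x. (\<phi> x)^2 * (pd j (U i t) x)^2) \<le> dis \<phi> t"
    unfolding dis_def
    by (rule member_le_sum[of i UNIV "\<lambda>i. \<Oplus>j. LBINT x. (\<phi> x)^2 * (pd j (U i t) x)^2"]) (auto intro!: sum_nonneg)
   show "(LBINT x. (pd j \<phi> x)^2 * (U i t x)^2) \<le> (3 / r)^2 * E^2" for j
   proof -
    have "(LBINT x. (pd j \<phi> x)^2 * (U i t x)^2) \<le> (\<Oplus>i. LBINT x. (pd j \<phi> x)^2 * (U i t x)^2)"
     by (rule member_le_sum[of i UNIV "\<lambda>i. LBINT x. (pd j \<phi> x)^2 * (U i t x)^2"]) auto
    also have "\<dots> \<le> (3 / r)^2 * E^2"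
     by (rule weighted_energy_le[OF t pfc pfb]) (use cutoff_partial \<rho> in \<open>auto simp: \<phi>_def\<close>)
    finally show ?thesis .
   qed
  qed auto
  also have "\<dots> \<le> Z" unfolding Z_def using dm by (simp add: power_divide)
  finally show ?thesis .
 qed
 have L2: "(LBINT x. (?f i x)^2) \<le> E^2" for i
 proof -
  have "(LBINT x. (?f i x)^2) \<le> (\<Oplus>i. LBINT x. (\<phi> x)^2 * (U i t x)^2)"
   unfolding power_mult_distrib by (rule member_le_sum[of i UNIV "\<lambda>i. LBINT x. (\<phi> x)^2 * (U i t x)^2"]) auto
  also have "\<dots> \<le> 1^2 * E^2"
   by (rule weighted_energy_le[OF t fc fb]) (use cutoff_bounds in \<open>auto simp: \<phi>_def abs_le_iff intro: order_trans[of _ 0]\<close>)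
  finally show ?thesis by simp
 qed
 have f4: "(LBINT x. (?f i x) ^ 4) \<le> 8 * E * sqrt Z * Z" for i
 proof -
  let ?G = "\<Oplus>j. LBINT x. (pd j (?f i) x)^2"
  have "(LBINT x. (?f i x) ^ 4) \<le> 8 * sqrt (LBINT x. (?f i x)^2) * sqrt ?G * ?G"
   by (rule L4_bound[OF fi fib])
  also have "\<dots> \<le> 8 * E * sqrt Z * Z"
  proof (intro mult_mono real_sqrt_le_mono G)
   show "sqrt (LBINT x. (?f i x)^2) \<le> E" using L2 E by (intro real_le_lsqrt) auto
  qed (use E Z0 in \<open>auto intro!: sum_nonneg\<close>)
  finally show ?thesis .
 qed
 have i4: "integ (\<lambda>x. (?f i x) ^ 4)" for i
  by (intro integrable_cs continuous_on_power fic bsupp_power fib) simp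
 have "(LBINT x. ((\<phi> x)^2 * (\<Oplus>i. (U i t x)^2))^2) \<le> (LBINT x. 3 * (\<Oplus>i. (?f i x) ^ 4))"
 proof (rule integral_mono)
  show "integ (\<lambda>x. ((\<phi> x)^2 * (\<Oplus>i. (U i t x)^2))^2)"
   by (intro integrable_cs continuous_intros fc contU[OF t]) (rule bsupp_subset[OF fb], simp)
  show "integ (\<lambda>x. 3 * (\<Oplus>i. (?f i x) ^ 4))" using i4 by simp
  fix x
  have "(a + b + c)^2 \<le> 3 * (a^2 + b^2 + c^2)" for a b c :: real
   using zero_le_power2[of "a - b"] zero_le_power2[of "a - c"] zero_le_power2[of "b - c"]
   by (simp add: power2_eq_square algebra_simps)
  from this[of "(?f 1 x)^2" "(?f 2 x)^2" "(?f 3 x)^2"]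
  show "((\<phi> x)^2 * (\<Oplus>i. (U i t x)^2))^2 \<le> 3 * (\<Oplus>i. (?f i x) ^ 4)"
   by (simp add: sum_3 power_mult_distrib distrib_left flip: power_mult)
 qed
 also have "\<dots> = 3 * (\<Oplus>i. LBINT x. (?f i x) ^ 4)" using i4 by simp
 also have "\<dots> \<le> 3 * (\<Sum>i\<in>(UNIV::3 set). 8 * E * sqrt Z * Z)" by (intro mult_left_mono sum_mono f4) simp
 \<comment> \<open>72 is 3 * 3 * 8: the square of a sum of three terms, three components, and the
   constant of \<open>L4_bound\<close>. Its square is 5184.\<close>
 finally have Q2: "(LBINT x. ((\<phi> x)^2 * (\<Oplus>i. (U i t x)^2))^2) \<le> 72 * E * sqrt Z * Z" (is "?I \<le> _") by simp
 have I0: "0 \<le> ?I" by simp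
 have "(sqrt ?I) ^ 4 = ?I^2"
  using I0 power_mult[of "sqrt ?I" 2 2] by simp
 also have "\<dots> \<le> (72 * E * sqrt Z * Z)^2" by (rule power_mono[OF Q2 I0])
 also have "\<dots> = 5184 * E^2 * Z ^ 3" using Z0 by (simp add: power_mult_distrib eval_nat_numeral)
 finally show ?thesis unfolding Z_def .
qed

end

lemma integral_cball_indicator:
 fixes f :: "real^3 \<Rightarrow> real"
 assumes "cont f" "\<And>x. 0 \<le> f x" "\<And>x. f x \<le> 1" "\<And>x. R < norm x \<Longrightarrow> f x = 0" "0 \<le> R"
 shows "(LBINT x. f x) \<le> unit_ball_vol 3 * R ^ 3"
proof -
 have b: "bsupp f" by (rule bsuppI[OF assms(4)])
 have "(LBINT x. f x) \<le> (LBINT x. indicator (cball (0::real^3) R) x)"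
 proof (rule integral_mono[of lborel f "indicator (cball 0 R)"])
  show "integ f" by (rule integrable_cs[OF assms(1) b])
  show "integ (indicat_real (cball (0::real^3) R))"
   using emeasure_bounded_finite[OF bounded_cball[of "0::real^3" R]] by (intro integrable_real_indicator) auto
  show "f x \<le> indicator (cball 0 R) x" for x
   using assms(3)[of x] assms(4)[of x] by (cases "R < norm x") (auto simp: indicator_def)
 qed
 also have "\<dots> = measure lborel (cball (0::real^3) R)" by simp
 also have "\<dots> = unit_ball_vol 3 * R ^ 3" using content_cball[OF assms(5), of "0 :: real^3"] by simp
 finally show ?thesis .
qed

context nse_solution
begin

text \<open>Geometry: \<open>z\<close> ends at radius \<open>\<rho> + r\<close>, the near pressure
  reaches a distance \<open>r\<close> further, and \<open>\<phi>\<close> is 1 there and ends at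
  \<open>\<rho> + 3 * r\<close>, inside the ball of radius \<open>\<rho>'\<close>. The parameter
  \<open>e\<close> is the share of the dissipation given up to the viscous cross term;
  \<open>\<delta>\<close> is the share of the dissipation on the larger ball that pays for the cubic
  and the pressure term.\<close>

lemma local_energy:
 assumes C: "\<And>i j k R y x. 0 < R \<Longrightarrow> \<bar>pd k (pd j (pd i (newt_at R y))) x\<bar> \<le> C * (1/R)^4"
  and t: "t \<in> {0..T}" and \<rho>: "0 \<le> \<rho>" "0 < r" "\<rho> + 3 * r \<le> \<rho>'" "0 < r'" and e: "0 < e" and \<delta>: "0 < \<delta>"
 defines "z \<equiv> cutoff \<rho> r"
 obtains D where "(kin z has_real_derivative D) (at t within {0..T})"
  "D \<le> 2 * (- (1 - e) * dis z t + 2 * \<delta> * dis (cutoff \<rho>' r') t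
   + (27 * E^2 / (e * r^2) + 54 * \<delta> * E^2 / r^2 + 5184 * E^2 * (207 * E) ^ 4 / (\<delta> ^ 3 * r ^ 4)
    + 27 * C * E ^ 3 / mass * sqrt (unit_ball_vol 3 * (\<rho> + r) ^ 3) / r ^ 4))"
proof -
 let ?S = "\<lambda>x. \<Oplus>i. (U i t x)^2"
 have z: "Ck 1 z" unfolding z_def by (rule Ck_cutoff)
 have zc: "cont z" by (rule Ck_cont[OF z])
 have zb: "bsupp z" unfolding z_def using \<rho> by (intro cutoff_bsupp) auto
 have z01: "0 \<le> z x" "z x \<le> 1" for x unfolding z_def by (rule cutoff_bounds)+
 have z0: "z x = 0" if "\<rho> + r < norm x" for x unfolding z_def using that \<rho> by (intro cutoff_outside) auto
 have pzc: "cont (pd j z)" for j by (rule cont_partial[OF z])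
 have pzb: "bsupp (pd j z)" for j using zb by auto
 have pz: "\<bar>pd j z x\<bar> \<le> 3 / r" for j x unfolding z_def by (rule cutoff_partial[OF \<rho>(1,2)])
 define \<phi> where "\<phi> = cutoff (\<rho> + 2 * r) r"
 define \<psi> where "\<psi> x = (\<phi> x)^2" for x
 have \<phi>c: "cont \<phi>" unfolding \<phi>_def by (rule Ck_cont[OF Ck_cutoff])
 have \<phi>b: "bsupp \<phi>" unfolding \<phi>_def using \<rho> by (intro cutoff_bsupp) auto
 have \<psi>c: "cont \<psi>" unfolding \<psi>_def by (intro continuous_intros \<phi>c)
 have \<psi>b: "bsupp \<psi>" unfolding \<psi>_def using \<phi>b by auto
 have \<psi>1: "\<psi> x = 1" if "norm x \<le> (\<rho> + r) + r" for x
  unfolding \<psi>_def \<phi>_def using that \<rho> by (subst cutoff_inside) auto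
 define Q where "Q = sqrt (LBINT x. (\<psi> x * ?S x)^2)"
 define Z where "Z = 2 * dis (cutoff \<rho>' r') t + 54 * E^2 / r^2"
 have Q0: "0 \<le> Q" unfolding Q_def by simp
 have Z0: "0 \<le> Z" unfolding Z_def using dis_nonneg[of "cutoff \<rho>' r'" t] by simp
 have Q4: "Q ^ 4 \<le> 5184 * E^2 * Z ^ 3"
  unfolding Q_def Z_def \<psi>_def \<phi>_def by (rule local_L4[OF t]) (use \<rho> in auto)
 let ?A1 = "\<Oplus>i. \<Oplus>j. LBINT x. 2 * z x * pd j z x * U i t x * pd j (U i t) x"
 let ?A2 = "\<Oplus>i. \<Oplus>j. LBINT x. z x * pd j z x * U j t x * (U i t x)^2"
 let ?h = "\<lambda>x. \<Oplus>i. pd i (\<lambda>x. (z x)^2 * U i t x) x"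
 let ?A3 = "LBINT x. p t x * ?h x"
 have A1: "- ?A1 \<le> e * dis z t + 27 * E^2 / (e * r^2)"
 proof -
  have I2: "integ (\<lambda>x. (z x)^2 * (pd j (U i t) x)^2)" "integ (\<lambda>x. (pd j z x)^2 * (U i t x)^2)"
   "integ (\<lambda>x. 2 * z x * pd j z x * U i t x * pd j (U i t) x)" for i j
   by (intro integrable_cs continuous_intros zc pzc contU[OF t] contdU[OF t]; rule bsupp_subset[OF zb] bsupp_subset[OF pzb[of j]]; simp)+
  have ij: "- (LBINT x. 2 * z x * pd j z x * U i t x * pd j (U i t) x)
    \<le> e * (LBINT x. (z x)^2 * (pd j (U i t) x)^2) + 1/e * (LBINT x. (pd j z x)^2 * (U i t x)^2)" for i j
  proof -
   have "(LBINT x. - (2 * z x * pd j z x * U i t x * pd j (U i t) x))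
     \<le> (LBINT x. e * ((z x)^2 * (pd j (U i t) x)^2) + 1/e * ((pd j z x)^2 * (U i t x)^2))"
   proof (rule integral_mono)
    show "integ (\<lambda>x. e * ((z x)^2 * (pd j (U i t) x)^2) + 1/e * ((pd j z x)^2 * (U i t x)^2))"
     using I2(1)[of j i] I2(2)[of j i] by simp
    show "integ (\<lambda>x. - (2 * z x * pd j z x * U i t x * pd j (U i t) x))"
     using I2(3)[of j i] by simp
    fix x
    define a where "a = z x * pd j (U i t) x"
    define b where "b = pd j z x * U i t x"
    have "0 \<le> (e * a + b)^2 / e" using e by simp
    also have "\<dots> = e * a^2 + 2 * a * b + 1/e * b^2"
     using e by (simp add: power2_eq_square field_simps)
    finally have "- (2 * a * b) \<le> e * a^2 + 1/e * b^2" by linarith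
    then show "- (2 * z x * pd j z x * U i t x * pd j (U i t) x)
     \<le> e * ((z x)^2 * (pd j (U i t) x)^2) + 1/e * ((pd j z x)^2 * (U i t x)^2)"
     unfolding a_def b_def by (simp add: power_mult_distrib mult_ac)
   qed
   also have "\<dots> = e * (LBINT x. (z x)^2 * (pd j (U i t) x)^2) + 1/e * (LBINT x. (pd j z x)^2 * (U i t x)^2)"
    using I2(1)[of j i] I2(2)[of j i] by simp
   finally show ?thesis by simp
  qed
  have "- ?A1 = (\<Oplus>i. \<Oplus>j. - (LBINT x. 2 * z x * pd j z x * U i t x * pd j (U i t) x))"
   by (simp only: sum_negf)
  also have "\<dots> \<le> (\<Oplus>i. \<Oplus>j. e * (LBINT x. (z x)^2 * (pd j (U i t) x)^2) + 1/e * (LBINT x. (pd j z x)^2 * (U i t x)^2))"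
   by (intro sum_mono ij)
  also have "\<dots> = e * dis z t + 1/e * (\<Oplus>j. \<Oplus>i. LBINT x. (pd j z x)^2 * (U i t x)^2)"
   unfolding dis_def sum.distrib sum_distrib_left[symmetric] by (subst (2) sum.swap) simp
  also have "\<dots> \<le> e * dis z t + 1/e * (\<Sum>j\<in>(UNIV::3 set). (3/r)^2 * E^2)"
   using e by (intro add_left_mono mult_left_mono sum_mono weighted_energy_le[OF t pzc pzb pz]) auto
  finally show ?thesis by (simp add: power_divide)
 qed
 have A2: "?A2 \<le> 9 * E * Q / r"
 proof -
  have pc: "cont (\<lambda>x. \<psi> x * ?S x)" "bsupp (\<lambda>x. \<psi> x * ?S x)"
   using \<psi>b by (auto intro!: continuous_intros contU[OF t] \<psi>c)
  have j: "(LBINT x. z x * pd j z x * U j t x * ?S x) \<le> 3 / r * (E * Q)" for j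
  proof -
   have iA: "integ (\<lambda>x. \<bar>U j t x\<bar> * (\<psi> x * ?S x))"
    by (intro integrable_cs continuous_intros contU[OF t] pc bsupp_mult2)
   have "(LBINT x. z x * pd j z x * U j t x * ?S x)
     \<le> (LBINT x. 3 / r * (\<bar>U j t x\<bar> * (\<psi> x * ?S x)))"
   proof (rule integral_mono)
    show "integ (\<lambda>x. z x * pd j z x * U j t x * ?S x)"
     by (intro integrable_cs continuous_intros zc pzc contU[OF t]) (rule bsupp_subset[OF zb], simp)
    show "integ (\<lambda>x. 3 / r * (\<bar>U j t x\<bar> * (\<psi> x * ?S x)))"
     using iA by simp
    fix x
    let ?S = "\<Oplus>i. (U i t x)^2"
    have S0: "0 \<le> ?S" by (intro sum_nonneg) simp
    show "z x * pd j z x * U j t x * ?S \<le> 3 / r * (\<bar>U j t x\<bar> * (\<psi> x * ?S))"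
    proof (cases "\<rho> + r < norm x")
     case True
     then show ?thesis using z0 \<rho> S0 by (simp add: \<psi>_def)
    next
     case False
     then have "\<psi> x = 1" using \<rho> by (intro \<psi>1) auto
     moreover have "\<bar>z x * pd j z x\<bar> \<le> 1 * (3 / r)"
      unfolding abs_mult using z01[of x] by (intro mult_mono pz) auto
     then have "\<bar>z x * pd j z x\<bar> * (\<bar>U j t x\<bar> * ?S) \<le> 3 / r * (\<bar>U j t x\<bar> * ?S)"
      using S0 by (intro mult_right_mono) auto
     then have "\<bar>z x * pd j z x * U j t x * ?S\<bar> \<le> 3 / r * (\<bar>U j t x\<bar> * ?S)"
      using S0 by (simp add: abs_mult mult.assoc)
     ultimately show ?thesis by simp
    qed
   qed
   also have "\<dots> = 3 / r * (LBINT x. \<bar>U j t x\<bar> * (\<psi> x * ?S x))" by simp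
   also have "\<dots> \<le> 3 / r * (E * Q)"
   proof (intro mult_left_mono)
    have "(LBINT x. \<bar>U j t x\<bar> * (\<psi> x * ?S x)) \<le> sqrt (LBINT x. \<bar>U j t x\<bar>\<^sup>2) * Q"
     unfolding Q_def
    proof (rule order_trans[OF abs_ge_self integral_Cauchy_Schwarz(2)])
     show "(\<lambda>x. \<bar>U j t x\<bar>) \<in> borel_measurable lborel"
      "(\<lambda>x. \<psi> x * ?S x) \<in> borel_measurable lborel"
      using cont_borel[OF contU[OF t]] cont_borel[OF pc(1)] by auto
     show "integ (\<lambda>x. \<bar>U j t x\<bar>\<^sup>2)" using component_L2(1)[OF t] by simp
     show "integ (\<lambda>x. (\<psi> x * ?S x)^2)"
      by (intro integrable_cs continuous_on_power bsupp_power pc) simp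
    qed
    also have "\<dots> \<le> E * Q"
     using component_L2(2)[OF t] E by (intro mult_right_mono Q0 real_le_lsqrt) auto
    finally show "(LBINT x. \<bar>U j t x\<bar> * (\<psi> x * ?S x)) \<le> E * Q" .
   qed (use \<rho> in simp)
   finally show ?thesis .
  qed
  have "?A2 = (\<Oplus>j. \<Oplus>i. LBINT x. z x * pd j z x * U j t x * (U i t x)^2)"
   by (rule sum.swap)
  also have "\<dots> = (\<Oplus>j. LBINT x. z x * pd j z x * U j t x * ?S x)"
   unfolding sum_distrib_left
   by (intro sum.cong refl Bochner_Integration.integral_sum[symmetric] integrable_cs continuous_intros zc pzc contU[OF t])
    (rule bsupp_subset[OF zb], simp)
  also have "\<dots> \<le> (\<Sum>j\<in>(UNIV::3 set). 3 / r * (E * Q))" by (intro sum_mono j)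
  finally show ?thesis by (simp add: mult.assoc)
 qed
 \<comment> \<open>198 is 18 * 11, where 18 comes from \<open>pressure_bound\<close> and 11 exceeds
   the square root of 12 * 9; 27 is 9 * 3, for three components.\<close>
 have A3: "?A3 \<le> 198 * E * Q / r + 27 * C * E ^ 3 / mass * sqrt (unit_ball_vol 3 * (\<rho> + r) ^ 3) / r ^ 4"
 proof -
  have g: "Ck 1 (\<lambda>x. (z x)^2 * U i t x)" for i by (intro Ck_mult Ck_power z CkU[OF t])
  have g0: "(z x)^2 * U i t x = 0" if "\<rho> + r < norm x" for i x using z0[OF that] by simp
  have m0: "0 < mass" by (rule mass_pos)
  have C0: "0 \<le> C" using C[of 1 1 1 1 0 0] by simp
  \<comment> \<open>By incompressibility the divergence of \<open>z^2 U\<close> contains no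
    derivative of the velocity, so its L^2 norm is of order \<open>E / r\<close>.\<close>
  have th: "?h x = (\<Oplus>i. 2 * z x * pd i z x * U i t x)" for x
  proof -
   have "pd i (\<lambda>x. (z x)^2) = (\<lambda>x. 2 * z x * pd i z x)" for i
    unfolding power2_eq_square by (subst partial_mult[OF z z]) (simp add: algebra_simps)
   moreover have "Ck 1 (\<lambda>x. (z x)^2)" by (intro Ck_power z)
   ultimately have "pd i (\<lambda>x. (z x)^2 * U i t x) x = (z x)^2 * pd i (U i t) x + 2 * z x * pd i z x * U i t x" for i
    by (subst partial_mult[OF _ CkU[OF t]]) auto
   then show ?thesis
    using divfree[OF t, of x] by (simp add: sum.distrib flip: sum_distrib_left)
  qed
  have thN: "sqrt (LBINT x. (?h x)^2) \<le> 11 * E / r"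
  proof -
   have Ii: "integ (\<lambda>x. (pd i z x)^2 * (U i t x)^2)" for i
    by (intro integrable_cs continuous_intros pzc contU[OF t]) (rule bsupp_subset[OF pzb[of i]], simp)
   have "(LBINT x. (?h x)^2) \<le> (LBINT x. 12 * (\<Oplus>i. (pd i z x)^2 * (U i t x)^2))"
    unfolding th
   proof (rule integral_mono)
    show "integ (\<lambda>x. (\<Oplus>i. 2 * z x * pd i z x * U i t x)^2)"
     by (intro integrable_cs continuous_intros zc pzc contU[OF t]) (rule bsupp_subset[OF zb], simp)
    show "integ (\<lambda>x. 12 * (\<Oplus>i. (pd i z x)^2 * (U i t x)^2))" using Ii by simp
    fix x
    have 3: "(a + b + c)^2 \<le> 3 * (a^2 + b^2 + c^2)" for a b c :: real
     using zero_le_power2[of "a - b"] zero_le_power2[of "a - c"] zero_le_power2[of "b - c"]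
     by (simp add: power2_eq_square algebra_simps)
    have le: "(2 * z x * pd i z x * U i t x)^2 \<le> 4 * ((pd i z x)^2 * (U i t x)^2)" for i
    proof -
     have "(z x)^2 \<le> 1" using z01[of x] by (simp add: power_le_one)
     then have "(z x)^2 * ((pd i z x)^2 * (U i t x)^2) \<le> 1 * ((pd i z x)^2 * (U i t x)^2)"
      by (intro mult_right_mono) auto
     then show ?thesis by (simp add: power_mult_distrib mult.assoc)
    qed
    show "(\<Oplus>i. 2 * z x * pd i z x * U i t x)^2 \<le> 12 * (\<Oplus>i. (pd i z x)^2 * (U i t x)^2)"
    proof -
     have gen: "(s::real) \<le> 12 * (a + b + c)" if "s \<le> 3 * (a' + b' + c')" "a' \<le> 4 * a" "b' \<le> 4 * b" "c' \<le> 4 * c"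
      for s a b c a' b' c'
     proof -
      have "3 * (a' + b' + c') \<le> 3 * (4 * a + 4 * b + 4 * c)" by (intro mult_left_mono add_mono that) simp
      then show ?thesis using that(1) by simp
     qed
     show ?thesis unfolding sum_3 by (rule gen[OF 3 le le le])
    qed
   qed
   also have "\<dots> = 12 * (\<Oplus>i. LBINT x. (pd i z x)^2 * (U i t x)^2)" using Ii by simp
   also have "\<dots> \<le> 12 * (9 * E^2 / r^2)"
   proof (intro mult_left_mono)
    have "(\<Oplus>i. LBINT x. (pd i z x)^2 * (U i t x)^2) \<le> (\<Oplus>i. LBINT x. (3 / r)^2 * (U i t x)^2)"
    proof (intro sum_mono integral_mono Ii)
     show "integ (\<lambda>x. (3 / r)^2 * (U i t x)^2)" for i using component_L2(1)[OF t] by simp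
     show "(pd i z x)^2 * (U i t x)^2 \<le> (3 / r)^2 * (U i t x)^2" for i x
      using pz[of i x] abs_le_square_iff[of "pd i z x" "3 / r"] \<rho> by (intro mult_right_mono) auto
    qed
    also have "\<dots> = (3 / r)^2 * (LBINT x. ?S x)"
     using component_L2(1)[OF t] by (simp add: sum_distrib_left)
    also have "\<dots> \<le> (3 / r)^2 * E^2" by (intro mult_left_mono energy(2)[OF t]) simp
    finally show "(\<Oplus>i. LBINT x. (pd i z x)^2 * (U i t x)^2) \<le> 9 * E^2 / r^2"
     by (simp add: power_divide)
   qed simp
   also have "\<dots> \<le> (11 * E / r)^2" by (simp add: power_divide power_mult_distrib divide_right_mono)
   finally show ?thesis using E \<rho> by (intro real_le_lsqrt) auto
  qed
  have gi: "(\<Oplus>i. LBINT y. \<bar>(z y)^2 * U i t y\<bar>) \<le> 3 * (E * sqrt (unit_ball_vol 3 * (\<rho> + r) ^ 3))"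
  proof -
   have "(LBINT y. \<bar>(z y)^2 * U i t y\<bar>) \<le> E * sqrt (unit_ball_vol 3 * (\<rho> + r) ^ 3)" for i
   proof -
    have "(LBINT y. \<bar>(z y)^2 * U i t y\<bar>) = (LBINT y. \<bar>U i t y\<bar> * (z y)^2)"
     by (simp add: abs_mult mult.commute)
    also have "\<dots> \<le> sqrt (LBINT y. \<bar>U i t y\<bar>\<^sup>2) * sqrt (LBINT y. ((z y)^2)^2)"
    proof (rule order_trans[OF abs_ge_self integral_Cauchy_Schwarz(2)])
     show "(\<lambda>y. \<bar>U i t y\<bar>) \<in> borel_measurable lborel" "(\<lambda>y. (z y)^2) \<in> borel_measurable lborel"
      using cont_borel[OF contU[OF t]] cont_borel[OF zc] by auto
     show "integ (\<lambda>y. \<bar>U i t y\<bar>\<^sup>2)" using component_L2(1)[OF t] by simp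
     show "integ (\<lambda>y. ((z y)^2)^2)"
      by (intro integrable_cs continuous_on_power bsupp_power zc zb) simp_all
    qed
    also have "\<dots> \<le> E * sqrt (unit_ball_vol 3 * (\<rho> + r) ^ 3)"
    proof (intro mult_mono real_sqrt_le_mono)
     show "sqrt (LBINT y. \<bar>U i t y\<bar>\<^sup>2) \<le> E" using component_L2(2)[OF t] E by (intro real_le_lsqrt) auto
     show "(LBINT y. ((z y)^2)^2) \<le> unit_ball_vol 3 * (\<rho> + r) ^ 3"
      using z01 z0 \<rho> by (intro integral_cball_indicator continuous_on_power zc) (auto intro!: power_le_one)
    qed (use E in auto)
    finally show ?thesis .
   qed
   then have "(\<Oplus>i. LBINT y. \<bar>(z y)^2 * U i t y\<bar>) \<le> (\<Sum>i\<in>(UNIV::3 set). E * sqrt (unit_ball_vol 3 * (\<rho> + r) ^ 3))"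
    by (intro sum_mono)
   then show ?thesis by simp
  qed
  have "mass * \<bar>?A3\<bar> \<le> 18 * mass * sqrt (LBINT x. (\<psi> x * ?S x)^2) * sqrt (LBINT x. (?h x)^2)
   + 9 * (C * (1/r)^4) * E^2 * (\<Oplus>i. LBINT y. \<bar>(z y)^2 * U i t y\<bar>)"
   by (rule pressure_bound[OF _ t \<rho>(2) g _ g0 \<psi>c \<psi>b \<psi>1]) (use C \<rho> in auto)
  also have "\<dots> \<le> 18 * mass * Q * (11 * E / r) + 9 * (C * (1/r)^4) * E^2 * (3 * (E * sqrt (unit_ball_vol 3 * (\<rho> + r) ^ 3)))"
   unfolding Q_def[symmetric] using m0 Q0 C0 by (intro add_mono mult_left_mono thN gi) auto
  also have "\<dots> = mass * (198 * E * Q / r + 27 * C * E ^ 3 / mass * sqrt (unit_ball_vol 3 * (\<rho> + r) ^ 3) / r ^ 4)"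
   using m0 \<rho> by (simp add: field_simps power_one_over eval_nat_numeral)
  finally have "\<bar>?A3\<bar> \<le> 198 * E * Q / r + 27 * C * E ^ 3 / mass * sqrt (unit_ball_vol 3 * (\<rho> + r) ^ 3) / r ^ 4"
   using m0 by (simp only: mult_le_cancel_left_pos)
  then show ?thesis by linarith
 qed
 \<comment> \<open>207 is 9 + 198, the coefficients of \<open>Q\<close> in \<open>A2\<close> and
   \<open>A3\<close>.\<close>
 have "(207 * E / r) * Q \<le> \<delta> * Z + 5184 * E^2 * (207 * E / r) ^ 4 / \<delta> ^ 3"
  by (rule young_quarter[OF Q0 Z0 _ _ \<delta> Q4]) (use E \<rho> in auto)
 moreover have "9 * E * Q / r + 198 * E * Q / r = (207 * E / r) * Q"
  unfolding add_divide_distrib[symmetric] by simp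
 moreover have "5184 * E^2 * (207 * E / r) ^ 4 / \<delta> ^ 3 = 5184 * E^2 * (207 * E) ^ 4 / (\<delta> ^ 3 * r ^ 4)"
  by (simp add: power_divide mult.commute)
 ultimately have "9 * E * Q / r + 198 * E * Q / r \<le> \<delta> * Z + 5184 * E^2 * (207 * E) ^ 4 / (\<delta> ^ 3 * r ^ 4)"
  by (simp only:)
 moreover have "\<delta> * Z = 2 * \<delta> * dis (cutoff \<rho>' r') t + 54 * \<delta> * E^2 / r^2"
  by (simp add: Z_def distrib_left)
 ultimately have fin: "2 * (- dis z t - ?A1 + ?A2 + ?A3) \<le> 2 * (- (1 - e) * dis z t + 2 * \<delta> * dis (cutoff \<rho>' r') t
   + (27 * E^2 / (e * r^2) + 54 * \<delta> * E^2 / r^2 + 5184 * E^2 * (207 * E) ^ 4 / (\<delta> ^ 3 * r ^ 4)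
    + 27 * C * E ^ 3 / mass * sqrt (unit_ball_vol 3 * (\<rho> + r) ^ 3) / r ^ 4))"
  using A1 A2 A3 by (simp add: left_diff_distrib)
 show thesis by (rule that[OF energy_derivative[OF t z zb] fin])
qed

end

text \<open>The volume factor of the far pressure grows like the power 3/2 of the radius. The cruder
  bound \<open>R ^ 2\<close> keeps the exponents integral and still loses against
  \<open>1 / r ^ 4\<close>.\<close>

lemma sqrt_cube_over_pow4_le:
 fixes R :: real
 assumes "1 \<le> R" "0 \<le> V" "0 \<le> s" "s \<le> c * R" "0 \<le> c"
 shows "sqrt (V * s ^ 3) \<le> sqrt (V * c ^ 3) * R ^ 2"
proof -
 have "s ^ 3 \<le> (c * R) ^ 3" using assms by (intro power_mono) auto
 also have "\<dots> = c ^ 3 * R ^ 3" by (simp add: power_mult_distrib)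
 also have "\<dots> \<le> c ^ 3 * R ^ 4" using assms by (intro mult_left_mono power_increasing) auto
 finally have "V * s ^ 3 \<le> V * (c ^ 3 * R ^ 4)" using assms(2) by (rule mult_left_mono)
 also have "\<dots> = V * c ^ 3 * (R ^ 2) ^ 2" by (simp flip: power_mult)
 finally have "sqrt (V * s ^ 3) \<le> sqrt (V * c ^ 3 * (R ^ 2) ^ 2)" by (rule real_sqrt_le_mono)
 also have "\<dots> = sqrt (V * c ^ 3) * R ^ 2" by (simp only: real_sqrt_mult real_sqrt_abs abs_power2)
 finally show ?thesis .
qed

lemma le_of_le_add_divide:
 fixes a b c R0 :: real
 assumes "\<And>R. R0 \<le> R \<Longrightarrow> 1 \<le> R \<Longrightarrow> a \<le> b + c / R"
 shows "a \<le> b"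
proof (rule field_le_epsilon)
 fix e :: real assume e: "0 < e"
 define R where "R = max (max R0 1) (\<bar>c\<bar> / e)"
 have R: "R0 \<le> R" "1 \<le> R" "\<bar>c\<bar> / e \<le> R" by (auto simp: R_def)
 have "c / R \<le> \<bar>c\<bar> / R" using R by (intro divide_right_mono) auto
 also have "\<dots> \<le> e" using R e by (simp add: field_simps)
 finally show "a \<le> b + e" using assms[OF R(1,2)] by linarith
qed

lemma cutoff_sq_le:
 assumes "0 \<le> \<rho>" "0 < r" "\<rho> + r \<le> \<rho>'" "0 < r'"
 shows "(cutoff \<rho> r x)^2 \<le> (cutoff \<rho>' r' x)^2"
proof (cases "norm x \<le> \<rho>'")
 case True
 then have "cutoff \<rho>' r' x = 1" using assms by (intro cutoff_inside) auto
 then show ?thesis using cutoff_bounds[of \<rho> r x] by (simp add: power_le_one)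
next
 case False
 then have "cutoff \<rho> r x = 0" using assms by (intro cutoff_outside) auto
 then show ?thesis by simp
qed

lemma cont_cutoff: "cont (cutoff \<rho> r)"
 by (rule Ck_cont[OF Ck_cutoff])

lemma cutoff_sq_le_1: "(cutoff \<rho> r x)^2 \<le> 1"
 using cutoff_bounds[of \<rho> r x] by (simp add: power_le_one)

context nse_solution
begin

lemma dis_cutoff_mono:
 assumes "t \<in> {0..T}" "0 \<le> \<rho>" "0 < r" "\<rho> + r \<le> \<rho>'" "0 < r'"
 shows "dis (cutoff \<rho> r) t \<le> dis (cutoff \<rho>' r') t"
 using assms by (intro dis_mono cont_cutoff cutoff_bsupp cutoff_sq_le) auto

lemma dis_cutoff_continuous:
 assumes "0 \<le> \<rho>" "0 < r" "t \<in> {0..T}" shows "continuous_on {0..t} (dis (cutoff \<rho> r))"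
 by (rule continuous_on_subset[OF dis_continuous[OF cont_cutoff cutoff_bsupp[OF assms(1,2)]]]) (use assms in auto)

lemma dis_integrable:
 assumes "0 \<le> \<rho>" "0 < r" "t \<in> {0..T}" shows "(dis (cutoff \<rho> r)) integrable_on {0..t}"
 using dis_cutoff_continuous[OF assms] by (rule integrable_continuous_real)

lemma integrated_local_energy:
 assumes C: "\<And>i j k R y x. 0 < R \<Longrightarrow> \<bar>pd k (pd j (pd i (newt_at R y))) x\<bar> \<le> C * (1/R)^4"
  and t: "t \<in> {0..T}" and \<rho>: "0 \<le> \<rho>" "0 < r" "\<rho> + 3 * r \<le> \<rho>'" "0 < r'" and e: "0 < e" and \<delta>: "0 < \<delta>"
  and K: "27 * E^2 / (e * r^2) + 54 * \<delta> * E^2 / r^2 + 5184 * E^2 * (207 * E) ^ 4 / (\<delta> ^ 3 * r ^ 4)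
    + 27 * C * E ^ 3 / mass * sqrt (unit_ball_vol 3 * (\<rho> + r) ^ 3) / r ^ 4 \<le> K"
 shows "kin (cutoff \<rho> r) t + 2 * (1 - e) * integral {0..t} (dis (cutoff \<rho> r))
  \<le> kin (cutoff \<rho> r) 0 + 4 * \<delta> * integral {0..t} (dis (cutoff \<rho>' r')) + 2 * K * t"
proof -
 have t0: "0 \<le> t" "t \<le> T" using t by auto
 have \<rho>': "0 \<le> \<rho>'" using \<rho> by simp
 let ?z = "cutoff \<rho> r" and ?w = "cutoff \<rho>' r'"
 let ?F = "\<lambda>s. 2 * (- (1 - e) * dis ?z s + 2 * \<delta> * dis ?w s + K)"
 have "\<exists>D. (kin ?z has_real_derivative D) (at s within {0..t}) \<and> D \<le> ?F s" if s: "s \<in> {0..t}" for s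
 proof -
  have s': "s \<in> {0..T}" using s t by auto
  obtain D where D: "(kin ?z has_real_derivative D) (at s within {0..T})"
   "D \<le> 2 * (- (1 - e) * dis ?z s + 2 * \<delta> * dis ?w s
   + (27 * E^2 / (e * r^2) + 54 * \<delta> * E^2 / r^2 + 5184 * E^2 * (207 * E) ^ 4 / (\<delta> ^ 3 * r ^ 4)
    + 27 * C * E ^ 3 / mass * sqrt (unit_ball_vol 3 * (\<rho> + r) ^ 3) / r ^ 4))"
   by (rule local_energy[OF _ s' \<rho> e \<delta>]) (rule C)
  have "(kin ?z has_real_derivative D) (at s within {0..t})"
   by (rule DERIV_subset[OF D(1)]) (use t0 in auto)
  moreover have "D \<le> ?F s"
   by (rule order_trans[OF D(2)], rule mult_left_mono[OF add_left_mono[OF K]]) simp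
  ultimately show ?thesis by blast
 qed
 then obtain f' where f': "\<And>s. s \<in> {0..t} \<Longrightarrow> (kin ?z has_real_derivative f' s) (at s within {0..t})"
  "\<And>s. s \<in> {0..t} \<Longrightarrow> f' s \<le> ?F s" by metis
 have cont: "continuous_on {0..t} ?F"
  by (intro continuous_intros dis_cutoff_continuous \<rho> \<rho>' t)
 have "kin ?z t - kin ?z 0 \<le> integral {0..t} ?F"
  by (rule derivative_le_integral[OF f' cont t0(1)])
 also have "integral {0..t} ?F = 2 * (- (1 - e) * integral {0..t} (dis ?z) + 2 * \<delta> * integral {0..t} (dis ?w) + t * K)"
 proof -
  have "(?F has_integral 2 * (- (1 - e) * integral {0..t} (dis ?z) + 2 * \<delta> * integral {0..t} (dis ?w) + t * K)) {0..t}"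
   using has_integral_const_real[of K 0 t] t0
   by (intro has_integral_mult_right has_integral_add integrable_integral dis_integrable \<rho> \<rho>' t) simp
  then show ?thesis by (rule integral_unique)
 qed
 finally show ?thesis by (simp add: algebra_simps)
qed

text \<open>
 The estimate on the ball of radius \<open>\<rho> m\<close> loses a small multiple of the dissipation on the ball of radius
 \<open>\<rho> (Suc m)\<close>; iterating along radii \<open>R (2 - 2\<^sup>-\<^sup>m)\<close> absorbs it.
\<close>

lemma dissipation_bounded:
 obtains K where "0 \<le> K" "\<And>R. 1 \<le> R \<Longrightarrow> integral {0..T} (dis (cutoff R (R / 6))) \<le> K"
proof -
 obtain C where C: "0 < C"
  "\<And>i j k R y x. 0 < R \<Longrightarrow> \<bar>pd k (pd j (pd i (newt_at R y))) x\<bar> \<le> C * (1/R)^4"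
  using third_newt_at_bounded by metis
 define V where "V = unit_ball_vol 3"
 have V0: "0 \<le> V" unfolding V_def by (simp add: unit_ball_vol_nonneg)
 define F where "F = 27 * C * E ^ 3 / mass"
 have F0: "0 \<le> F" unfolding F_def using C(1) E mass_pos by simp
 define Y where "Y = 5184 * E^2 * (207 * E) ^ 4 * 128 ^ 3"
 have Y0: "0 \<le> Y" unfolding Y_def by simp
 \<comment> \<open>55 exceeds 54 + 54/128, 36 and 1296 are powers of the 6 in \<open>r m\<close>,
   and the 3 under the root comes from \<open>\<rho> m + r m \<le> 3 * R\<close>.\<close>
 define c where "c = 55 * E^2 * 36 + Y * 1296 + F * (sqrt (V * 3 ^ 3) * 1296)"
 have c0: "0 \<le> c" unfolding c_def using Y0 F0 V0 by simp
 have TT: "T \<in> {0..T}" "0 \<in> {0..T}" using T by auto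
 have "integral {0..T} (dis (cutoff R (R / 6))) \<le> 2 * (E^2 + 2 * c * T)" if R: "1 \<le> R" for R
 proof -
  define \<rho> where "\<rho> m = R * (2 - (1/2) ^ m)" for m :: nat
  \<comment> \<open>A third of the gap \<open>\<rho> (Suc m) - \<rho> m\<close>, so that the three
    layers of \<open>local_energy\<close> fit exactly.\<close>
  define r where "r m = R * (1/2) ^ m / 6" for m :: nat
  have r0: "0 < r m" for m unfolding r_def using R by simp
  have half: "(1/2::real) ^ m \<le> 1" for m by (rule power_le_one) auto
  have \<rho>R: "0 \<le> \<rho> m" "\<rho> m \<le> 2 * R" for m unfolding \<rho>_def using R half[of m] by auto
  have step: "\<rho> m + 3 * r m = \<rho> (Suc m)" for m unfolding \<rho>_def r_def by (simp add: algebra_simps)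
  have rR: "r m \<le> R" for m unfolding r_def using R half[of m] mult_left_mono[OF half[of m], of R] by simp
  let ?I = "\<lambda>m. integral {0..T} (dis (cutoff (\<rho> m) (r m)))"
  have "?I 0 \<le> 2 * (E^2 + 2 * c * T)"
  proof (rule absorb_iteration)
   show "0 \<le> E^2 + 2 * c * T" using c0 T by simp
   show "?I m \<le> integral {0..T} (dis (cutoff (3 * R) 1))" for m
    using R \<rho>R[of m] rR[of m] r0[of m]
    by (intro integral_le dis_integrable dis_cutoff_mono TT) auto
   fix m
   have q: "(4::real) ^ m \<le> 16 ^ m" "(1::real) \<le> 16 ^ m" by (auto intro: power_mono)
   have r2: "1 / (r m)^2 \<le> 36 * 16 ^ m"
   proof -
    have "1 / (r m)^2 = 36 * 4 ^ m / R^2"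
     unfolding r_def by (simp add: power_divide power_mult_distrib power2_eq_square flip: power_mult_distrib)
    also have "\<dots> \<le> 36 * 16 ^ m / 1"
     using R q by (intro frac_le) auto
    finally show ?thesis by simp
   qed
   have r4: "1 / (r m) ^ 4 = 1296 * 16 ^ m / R ^ 4"
    unfolding r_def by (simp add: power_divide power_mult_distrib eval_nat_numeral flip: power_mult_distrib)
   have r4': "1 / (r m) ^ 4 \<le> 1296 * 16 ^ m"
    unfolding r4 using R by (simp add: divide_le_eq mult_le_cancel_left1 one_le_power)
   have sq: "sqrt (V * (\<rho> m + r m) ^ 3) / (r m) ^ 4 \<le> sqrt (V * 3 ^ 3) * 1296 * 16 ^ m"
   proof -
    have "sqrt (V * (\<rho> m + r m) ^ 3) \<le> sqrt (V * 3 ^ 3) * R ^ 2"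
     by (rule sqrt_cube_over_pow4_le[OF R V0]) (use \<rho>R[of m] rR[of m] r0[of m] in auto)
    then have "sqrt (V * (\<rho> m + r m) ^ 3) * (1 / (r m) ^ 4) \<le> (sqrt (V * 3 ^ 3) * R ^ 2) * (1 / (r m) ^ 4)"
     by (rule mult_right_mono) simp
    also have "\<dots> = sqrt (V * 3 ^ 3) * 1296 * 16 ^ m * (R ^ 2 / R ^ 4)" unfolding r4 by simp
    also have "\<dots> \<le> sqrt (V * 3 ^ 3) * 1296 * 16 ^ m * 1"
     using R V0 by (intro mult_left_mono) (auto simp: divide_le_eq_1 power_increasing)
    finally show ?thesis by simp
   qed
   have K: "27 * E^2 / (1/2 * (r m)^2) + 54 * (1/128) * E^2 / (r m)^2 + 5184 * E^2 * (207 * E) ^ 4 / ((1/128) ^ 3 * (r m) ^ 4)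
    + 27 * C * E ^ 3 / mass * sqrt (unit_ball_vol 3 * (\<rho> m + r m) ^ 3) / (r m) ^ 4 \<le> c * 16 ^ m"
   proof -
    have 1: "27 * E^2 / (1/2 * (r m)^2) + 54 * (1/128) * E^2 / (r m)^2 \<le> 55 * E^2 * (36 * 16 ^ m)"
    proof -
     have "27 * E^2 / (1/2 * (r m)^2) + 54 * (1/128) * E^2 / (r m)^2 = (54 + 54/128) * E^2 * (1 / (r m)^2)"
      by (simp add: field_simps)
     also have "\<dots> \<le> 55 * E^2 * (36 * 16 ^ m)" using r2 by (intro mult_mono) auto
     finally show ?thesis .
    qed
    have 2: "5184 * E^2 * (207 * E) ^ 4 / ((1/128) ^ 3 * (r m) ^ 4) \<le> Y * (1296 * 16 ^ m)"
    proof -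
     have "5184 * E^2 * (207 * E) ^ 4 / ((1/128) ^ 3 * (r m) ^ 4) = Y * (1 / (r m) ^ 4)"
      unfolding Y_def by (simp add: field_simps)
     also have "\<dots> \<le> Y * (1296 * 16 ^ m)" using r4' Y0 by (rule mult_left_mono)
     finally show ?thesis .
    qed
    have 3: "27 * C * E ^ 3 / mass * sqrt (unit_ball_vol 3 * (\<rho> m + r m) ^ 3) / (r m) ^ 4 \<le> F * (sqrt (V * 3 ^ 3) * 1296 * 16 ^ m)"
     using mult_left_mono[OF sq F0] unfolding F_def V_def by simp
    show ?thesis using 1 2 3 unfolding c_def by (simp add: algebra_simps)
   qed
   \<comment> \<open>With \<open>e = 1/2\<close> and \<open>\<delta> = 1/128\<close> the dissipation
     terms have the coefficients 1 and 1/32, as \<open>absorb_iteration\<close> expects.\<close>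
   have "kin (cutoff (\<rho> m) (r m)) T + 2 * (1 - 1/2) * ?I m
    \<le> kin (cutoff (\<rho> m) (r m)) 0 + 4 * (1/128) * ?I (Suc m) + 2 * (c * 16 ^ m) * T"
    by (rule integrated_local_energy[OF _ TT(1) \<rho>R(1) r0 _ r0 _ _ K]) (use C(2) step[of m] in auto)
   moreover have "0 \<le> kin (cutoff (\<rho> m) (r m)) T" by (rule kin_nonneg)
   moreover have "kin (cutoff (\<rho> m) (r m)) 0 \<le> E^2"
    using kin_le[OF TT(2) cont_cutoff cutoff_bsupp[OF \<rho>R(1) r0] cutoff_sq_le_1] energy(2)[OF TT(2)] by (rule order_trans)
   moreover have "E^2 \<le> E^2 * 16 ^ m" using q by (simp add: mult_le_cancel_left1)
   ultimately show "?I m \<le> (E^2 + 2 * c * T) * 16 ^ m + ?I (Suc m) / 32"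
    by (simp add: algebra_simps)
  qed
  then show ?thesis by (simp add: \<rho>_def r_def)
 qed
 moreover have "0 \<le> 2 * (E^2 + 2 * c * T)" using c0 T by simp
 ultimately show thesis using that by blast
qed

text \<open>On a ball of radius and layer width \<open>R\<close> the error terms are
  \<open>O(1/R)\<close>, and the dissipation lost on the larger ball is \<open>\<epsilon>\<close>
  times a quantity that \<open>dissipation_bounded\<close> controls uniformly in \<open>R\<close>.
  First \<open>R\<close> tends to infinity, then \<open>\<epsilon>\<close> to 0. The radii
  \<open>R0\<close> and \<open>R1\<close> are independent, so that only one truncation need be
  removed later.\<close>

lemma truncated_energy_inequality:
 assumes t: "t \<in> {0..T}" and R0: "0 \<le> R0" "0 \<le> R1"
 shows "kin (cutoff R1 1) t + 2 * integral {0..t} (dis (cutoff R0 1)) \<le> (LBINT x. (\<Oplus>i. (U i 0 x)^2))"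
proof -
 have t0: "0 \<le> t" "t \<le> T" "0 \<in> {0..T}" "T \<in> {0..T}" using t T by auto
 obtain C where C: "0 < C"
  "\<And>i j k R y x. 0 < R \<Longrightarrow> \<bar>pd k (pd j (pd i (newt_at R y))) x\<bar> \<le> C * (1/R)^4"
  using third_newt_at_bounded by metis
 obtain K where K: "0 \<le> K" "\<And>R. 1 \<le> R \<Longrightarrow> integral {0..T} (dis (cutoff R (R / 6))) \<le> K"
  using dissipation_bounded by metis
 define A where "A = (LBINT x. (\<Oplus>i. (U i 0 x)^2))"
 define F where "F = 27 * C * E ^ 3 / mass"
 have F0: "0 \<le> F" unfolding F_def using C(1) E mass_pos by simp
 have V0: "0 \<le> unit_ball_vol 3" by (simp add: unit_ball_vol_nonneg)
 let ?X = "kin (cutoff R1 1) t" and ?Y = "integral {0..t} (dis (cutoff R0 1))"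
 have Y0: "0 \<le> ?Y" by (rule Henstock_Kurzweil_Integration.integral_nonneg[OF dis_integrable[OF R0(1) _ t]]) (auto simp: dis_nonneg)
 have "?X + 2 * ?Y \<le> A"
 proof (rule field_le_epsilon)
  fix e :: real assume e: "0 < e"
  \<comment> \<open>The total loss is \<open>4 * \<epsilon> * K\<close> from the larger ball and
    \<open>2 * \<epsilon> * ?Y\<close> from the coefficient \<open>1 - \<epsilon>\<close>; this
    choice keeps it below \<open>e\<close>.\<close>
  define \<epsilon> where "\<epsilon> = min 1 (e / (4 * K + 2 * ?Y + 1))"
  have \<epsilon>: "0 < \<epsilon>" "\<epsilon> \<le> 1" "\<epsilon> * (4 * K + 2 * ?Y) \<le> e"
  proof -
   have p: "0 < 4 * K + 2 * ?Y + 1" using K(1) Y0 by linarith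
   show "0 < \<epsilon>" "\<epsilon> \<le> 1" using p e by (auto simp: \<epsilon>_def)
   have "\<epsilon> * (4 * K + 2 * ?Y) \<le> (e / (4 * K + 2 * ?Y + 1)) * (4 * K + 2 * ?Y + 1)"
    using p e K(1) Y0 by (intro mult_mono) (auto simp: \<epsilon>_def)
   also have "\<dots> = e" using p by simp
   finally show "\<epsilon> * (4 * K + 2 * ?Y) \<le> e" .
  qed
  define a where "a = 27 * E^2 / \<epsilon> + 54 * \<epsilon> * E^2 + 5184 * E^2 * (207 * E) ^ 4 / \<epsilon> ^ 3 + F * sqrt (unit_ball_vol 3 * 2 ^ 3)"
  have a0: "0 \<le> a" unfolding a_def using \<epsilon> F0 V0 by simp
  have "?X + 2 * (1 - \<epsilon>) * ?Y \<le> A + 4 * \<epsilon> * K"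
  proof (rule le_of_le_add_divide)
   fix R :: real assume R: "max R0 R1 + 1 \<le> R" "1 \<le> R"
   have R': "0 \<le> R" "0 < R" using R by auto
   have pw: "1 / R^2 \<le> 1 / R" "1 / R ^ 4 \<le> 1 / R"
    using R by (auto intro!: divide_left_mono simp: self_le_power)
   have bound: "27 * E^2 / (\<epsilon> * R^2) + 54 * \<epsilon> * E^2 / R^2 + 5184 * E^2 * (207 * E) ^ 4 / (\<epsilon> ^ 3 * R ^ 4)
    + 27 * C * E ^ 3 / mass * sqrt (unit_ball_vol 3 * (R + R) ^ 3) / R ^ 4 \<le> a / R"
   proof -
    have 1: "27 * E^2 / (\<epsilon> * R^2) \<le> 27 * E^2 / \<epsilon> / R"
     using mult_left_mono[OF pw(1), of "27 * E^2 / \<epsilon>"] \<epsilon> by simp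
    have 2: "54 * \<epsilon> * E^2 / R^2 \<le> 54 * \<epsilon> * E^2 / R"
     using mult_left_mono[OF pw(1), of "54 * \<epsilon> * E^2"] \<epsilon> by simp
    have 3: "5184 * E^2 * (207 * E) ^ 4 / (\<epsilon> ^ 3 * R ^ 4) \<le> 5184 * E^2 * (207 * E) ^ 4 / \<epsilon> ^ 3 / R"
     using mult_left_mono[OF pw(2), of "5184 * E^2 * (207 * E) ^ 4 / \<epsilon> ^ 3"] \<epsilon> by simp
    have "sqrt (unit_ball_vol 3 * (R + R) ^ 3) \<le> sqrt (unit_ball_vol 3 * 2 ^ 3) * R ^ 2"
     by (rule sqrt_cube_over_pow4_le[OF R(2) V0]) (use R' in auto)
    then have "sqrt (unit_ball_vol 3 * (R + R) ^ 3) / R ^ 4 \<le> sqrt (unit_ball_vol 3 * 2 ^ 3) * R ^ 2 / R ^ 4"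
     by (rule divide_right_mono) (use R' in simp)
    also have "\<dots> = sqrt (unit_ball_vol 3 * 2 ^ 3) * (1 / R^2)"
     using R' by (simp add: eval_nat_numeral)
    also have "\<dots> \<le> sqrt (unit_ball_vol 3 * 2 ^ 3) * (1 / R)" using pw V0 by (intro mult_left_mono) auto
    finally have "F * (sqrt (unit_ball_vol 3 * (R + R) ^ 3) / R ^ 4) \<le> F * (sqrt (unit_ball_vol 3 * 2 ^ 3) * (1 / R))"
     using F0 by (rule mult_left_mono)
    then have 4: "27 * C * E ^ 3 / mass * sqrt (unit_ball_vol 3 * (R + R) ^ 3) / R ^ 4 \<le> F * sqrt (unit_ball_vol 3 * 2 ^ 3) / R"
     by (simp add: F_def)
    show ?thesis using 1 2 3 4 unfolding a_def add_divide_distrib by linarith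
   qed
   \<comment> \<open>The larger radius is \<open>R + 3 * R\<close>, and its layer width
     \<open>4 * R / 6\<close> is the one for which \<open>dissipation_bounded\<close> gives
     \<open>K\<close>.\<close>
   have "kin (cutoff R R) t + 2 * (1 - \<epsilon>) * integral {0..t} (dis (cutoff R R))
    \<le> kin (cutoff R R) 0 + 4 * \<epsilon> * integral {0..t} (dis (cutoff (4 * R) (4 * R / 6))) + 2 * (a / R) * t"
    by (rule integrated_local_energy[OF _ t R' _ _ \<epsilon>(1) \<epsilon>(1) bound]) (use C(2) R' in auto)
   moreover have "kin (cutoff R R) 0 \<le> A"
    unfolding A_def by (rule kin_le[OF t0(3) cont_cutoff cutoff_bsupp[OF R'] cutoff_sq_le_1])
   moreover have "4 * \<epsilon> * integral {0..t} (dis (cutoff (4 * R) (4 * R / 6))) \<le> 4 * \<epsilon> * K"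
   proof (rule mult_left_mono)
    have "integral {0..t} (dis (cutoff (4 * R) (4 * R / 6))) \<le> integral {0..T} (dis (cutoff (4 * R) (4 * R / 6)))"
     using R' t0 by (intro integral_subset_le dis_integrable t) (auto simp: dis_nonneg)
    also have "\<dots> \<le> K" using R by (intro K(2)) simp
    finally show "integral {0..t} (dis (cutoff (4 * R) (4 * R / 6))) \<le> K" .
   qed (use \<epsilon> in simp)
   moreover have "2 * (a / R) * t \<le> (2 * a * T) / R"
    using a0 t0 R' by (simp add: divide_right_mono mult_left_mono)
   moreover have "?X \<le> kin (cutoff R R) t"
    unfolding kin_def
   proof (rule integral_mono)
    have "integ (\<lambda>x. (cutoff \<rho> r x)^2 * (\<Oplus>i. (U i t x)^2))" if "0 \<le> \<rho>" "0 < r" for \<rho> r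
     by (intro integrable_cs continuous_intros cont_cutoff contU[OF t] bsupp_mult1 bsupp_power cutoff_bsupp that) simp
    then show "integ (\<lambda>x. (cutoff R1 1 x)^2 * (\<Oplus>i. (U i t x)^2))"
     "integ (\<lambda>x. (cutoff R R x)^2 * (\<Oplus>i. (U i t x)^2))" using R0 R' by auto
    show "(cutoff R1 1 x)^2 * (\<Oplus>i. (U i t x)^2) \<le> (cutoff R R x)^2 * (\<Oplus>i. (U i t x)^2)" for x
     using R R0 by (intro mult_right_mono cutoff_sq_le sum_nonneg) auto
   qed
   moreover have "2 * (1 - \<epsilon>) * ?Y \<le> 2 * (1 - \<epsilon>) * integral {0..t} (dis (cutoff R R))"
    using \<epsilon> R R0 R' t t0 by (intro mult_left_mono integral_le dis_integrable dis_cutoff_mono) auto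
   ultimately show "?X + 2 * (1 - \<epsilon>) * ?Y \<le> A + 4 * \<epsilon> * K + (2 * a * T) / R" by linarith
  qed
  then show "?X + 2 * ?Y \<le> A + e" using \<epsilon>(3) by (simp add: algebra_simps)
 qed
 then show ?thesis unfolding A_def .
qed

text \<open>Dominated convergence removes the cutoff from the kinetic term. The dissipation stays
  truncated: the comparison field has bounded support, so its gradient interacts with the solution
  only inside a ball.\<close>

lemma energy_inequality:
 assumes t: "t \<in> {0..T}" and R0: "0 \<le> R0"
 shows "(LBINT x. (\<Oplus>i. (U i t x)^2)) + 2 * integral {0..t} (dis (cutoff R0 1))
  \<le> (LBINT x. (\<Oplus>i. (U i 0 x)^2))"
proof -
 let ?S = "\<lambda>x. \<Oplus>i. (U i t x)^2"
 have "(\<lambda>n. kin (cutoff (real n) 1) t) \<longlonglongrightarrow> (LBINT x. ?S x)"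
  unfolding kin_def
 proof (rule integral_dominated_convergence[OF _ _ energy(1)[OF t]])
  show "(\<lambda>x. \<Oplus>i. (U i t x)^2) \<in> borel_measurable lborel"
   using energy(1)[OF t] by simp
  show "(\<lambda>x. (cutoff (real n) 1 x)^2 * ?S x) \<in> borel_measurable lborel" for n
   by (auto intro!: cont_borel continuous_intros cont_cutoff contU[OF t])
  show "AE x in lborel. norm ((cutoff (real n) 1 x)^2 * ?S x) \<le> ?S x" for n
   using mult_right_mono[OF cutoff_sq_le_1] by (auto simp: abs_mult sum_nonneg intro!: AE_I2)
  show "AE x in lborel. (\<lambda>n. (cutoff (real n) 1 x)^2 * ?S x) \<longlonglongrightarrow> ?S x"
  proof (rule AE_I2)
   fix x :: "real^3"
   obtain N :: nat where N: "norm x \<le> real N" using real_arch_simple by blast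
   have "\<forall>\<^sub>F n in sequentially. ?S x = (cutoff (real n) 1 x)^2 * ?S x"
    unfolding eventually_sequentially
   proof (intro exI[of _ N] allI impI)
    fix n assume "N \<le> n"
    then have "norm x \<le> real n" using N by linarith
    then have "cutoff (real n) 1 x = 1" by (intro cutoff_inside) auto
    then show "?S x = (cutoff (real n) 1 x)^2 * ?S x" by simp
   qed
   from Lim_transform_eventually[OF tendsto_const this]
   show "(\<lambda>n. (cutoff (real n) 1 x)^2 * ?S x) \<longlonglongrightarrow> ?S x" .
  qed
 qed
 then have "(\<lambda>n. kin (cutoff (real n) 1) t + 2 * integral {0..t} (dis (cutoff R0 1)))
   \<longlonglongrightarrow> (LBINT x. ?S x) + 2 * integral {0..t} (dis (cutoff R0 1))"
  by (intro tendsto_intros)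
 then show ?thesis
  by (rule LIMSEQ_le_const2) (use truncated_energy_inequality[OF t R0] in auto)
qed

end

section \<open>Square integrable fields\<close>

definition L2_field :: "('i::finite \<Rightarrow> real^3 \<Rightarrow> real) \<Rightarrow> bool" where
 "L2_field f \<longleftrightarrow> (\<forall>i. cont (f i)) \<and> integ (\<lambda>x. \<Oplus>i. (f i x)^2)"

definition fnorm :: "('i::finite \<Rightarrow> real^3 \<Rightarrow> real) \<Rightarrow> real" where
 "fnorm f = sqrt (LBINT x. (\<Oplus>i. (f i x)^2))"

lemma fnorm_nonneg [simp]: "0 \<le> fnorm f"
 unfolding fnorm_def by (simp add: sum_nonneg)

lemma fnorm_sq: "(fnorm f)^2 = (LBINT x. (\<Oplus>i. (f i x)^2))"
 unfolding fnorm_def by (simp add: sum_nonneg)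

lemma L2_field_cont: "L2_field f \<Longrightarrow> cont (f i)"
 by (simp add: L2_field_def)

lemma L2_field_measurable: "L2_field f \<Longrightarrow> f i \<in> borel_measurable borel"
 by (intro cont_borel L2_field_cont)

lemma L2_field_component:
 assumes "L2_field f"
 shows "integ (\<lambda>x. (f i x)^2)" "(LBINT x. (f i x)^2) \<le> (fnorm f)^2"
proof -
 have le: "(f i x)^2 \<le> (\<Oplus>i. (f i x)^2)" for x by (rule member_le_sum) auto
 have I: "integ (\<lambda>x. \<Oplus>i. (f i x)^2)" using assms by (simp add: L2_field_def)
 show i: "integ (\<lambda>x. (f i x)^2)"
  using L2_field_measurable[OF assms, of i]
  by (intro Bochner_Integration.integrable_bound[OF I]) (use le in \<open>auto intro!: AE_I2 simp: sum_nonneg\<close>)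
 show "(LBINT x. (f i x)^2) \<le> (fnorm f)^2"
  unfolding fnorm_sq by (rule integral_mono[OF i I le])
qed

lemma L2_fieldI:
 "(\<And>i. cont (f i)) \<Longrightarrow> (\<And>i. integ (\<lambda>x. (f i x)^2)) \<Longrightarrow> L2_field f"
 by (simp add: L2_field_def)

lemma L2_field_cs:
 "(\<And>i. cont (f i)) \<Longrightarrow> (\<And>i. bsupp (f i)) \<Longrightarrow> L2_field f"
 by (intro L2_fieldI integrable_cs continuous_on_power bsupp_power) auto

lemma L2_field_cmult:
 assumes "L2_field f" shows "L2_field (\<lambda>i x. c * f i x)"
proof (rule L2_fieldI)
 show "cont (\<lambda>x. c * f i x)" for i
  by (rule continuous_on_mult_left[OF L2_field_cont[OF assms]])
 show "integ (\<lambda>x. (c * f i x)^2)" for i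
  using L2_field_component(1)[OF assms, of i] by (simp add: power_mult_distrib)
qed

lemma L2_field_add:
 assumes "L2_field f" "L2_field g" shows "L2_field (\<lambda>i x. f i x + g i x)"
proof (rule L2_fieldI)
 show "cont (\<lambda>x. f i x + g i x)" for i
  using assms by (intro continuous_intros L2_field_cont)
 show "integ (\<lambda>x. (f i x + g i x)^2)" for i
 proof (rule Bochner_Integration.integrable_bound)
  show "integ (\<lambda>x. 2 * (f i x)^2 + 2 * (g i x)^2)"
   by (intro Bochner_Integration.integrable_add integrable_mult_right L2_field_component(1) assms)
  show "(\<lambda>x. (f i x + g i x)^2) \<in> borel_measurable lborel"
   using assms[THEN L2_field_measurable, of i] by simp
  have "(a + b)^2 \<le> 2 * a^2 + 2 * b^2" for a b :: real
   using sum_squares_bound[of a b] by (simp add: power2_sum)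
  then show "AE x in lborel. norm ((f i x + g i x)^2) \<le> norm (2 * (f i x)^2 + 2 * (g i x)^2)" by simp
 qed
qed

lemma L2_field_diff:
 assumes "L2_field f" "L2_field g" shows "L2_field (\<lambda>i x. f i x - g i x)"
 using L2_field_add[OF assms(1) L2_field_cmult[OF assms(2), of "-1"]] by simp

lemma fnorm_cmult: "fnorm (\<lambda>i x. c * f i x) = \<bar>c\<bar> * fnorm f"
 unfolding fnorm_def by (simp add: power_mult_distrib real_sqrt_mult flip: sum_distrib_left)

lemma field_product:
 assumes "L2_field f" "L2_field g"
 shows "integ (\<lambda>x. f i x * g j x)"
  using assms[THEN L2_field_component(1)] assms[THEN L2_field_measurable]
  by (intro integral_Cauchy_Schwarz(1)) auto

lemma field_Cauchy_Schwarz: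
 assumes f: "L2_field f" and g: "L2_field g"
 shows "\<bar>LBINT x. (\<Oplus>i. f i x * g i x)\<bar> \<le> fnorm f * fnorm g"
proof -
 let ?F = "\<lambda>x. sqrt (\<Oplus>i. (f i x)^2)" and ?G = "\<lambda>x. sqrt (\<Oplus>i. (g i x)^2)"
 note [measurable] = L2_field_measurable[OF f] L2_field_measurable[OF g]
 have I: "integ (\<lambda>x. (?F x)^2)" "integ (\<lambda>x. (?G x)^2)"
  using f g by (simp_all add: L2_field_def sum_nonneg)
 have cs: "integ (\<lambda>x. ?F x * ?G x)" "\<bar>LBINT x. ?F x * ?G x\<bar> \<le> fnorm f * fnorm g"
  using integral_Cauchy_Schwarz[OF _ _ I] by (auto simp: fnorm_def sum_nonneg)
 have pt: "\<bar>\<Oplus>i. f i x * g i x\<bar> \<le> ?F x * ?G x" for x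
  using L2_set_mult_ineq[of "\<lambda>i. f i x" "\<lambda>i. g i x" UNIV] sum_abs[of "\<lambda>i. f i x * g i x" UNIV]
  by (simp add: L2_set_def abs_mult)
 have "\<bar>LBINT x. (\<Oplus>i. f i x * g i x)\<bar> \<le> (LBINT x. \<bar>\<Oplus>i. f i x * g i x\<bar>)"
  by (rule integral_abs_bound)
 also have "\<dots> \<le> (LBINT x. ?F x * ?G x)"
  using field_product[OF f g] by (intro integral_mono cs pt integrable_abs Bochner_Integration.integrable_sum)
 also have "\<dots> \<le> fnorm f * fnorm g" using cs(2) by linarith
 finally show ?thesis .
qed

lemma fnorm_add_sq:
 assumes f: "L2_field f" and g: "L2_field g"
 shows "(fnorm (\<lambda>i x. f i x + g i x))^2 = (fnorm f)^2 + 2 * (LBINT x. (\<Oplus>i. f i x * g i x)) + (fnorm g)^2"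
proof -
 have "(LBINT x. (\<Oplus>i. (f i x + g i x)^2))
   = (LBINT x. (\<Oplus>i. (f i x)^2) + 2 * (\<Oplus>i. f i x * g i x) + (\<Oplus>i. (g i x)^2))"
  by (simp add: power2_sum sum.distrib sum_distrib_left mult.assoc algebra_simps)
 also have "\<dots> = (LBINT x. (\<Oplus>i. (f i x)^2)) + 2 * (LBINT x. (\<Oplus>i. f i x * g i x)) + (LBINT x. (\<Oplus>i. (g i x)^2))"
  using f g field_product[OF f g] by (simp add: L2_field_def)
 finally show ?thesis unfolding fnorm_sq .
qed

lemma fnorm_triangle:
 assumes f: "L2_field f" and g: "L2_field g"
 shows "fnorm (\<lambda>i x. f i x + g i x) \<le> fnorm f + fnorm g"
proof (rule power2_le_imp_le)
 show "(fnorm (\<lambda>i x. f i x + g i x))^2 \<le> (fnorm f + fnorm g)^2"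
  using field_Cauchy_Schwarz[OF f g] unfolding fnorm_add_sq[OF f g] power2_sum by linarith
qed simp

lemma fnorm_triangle_diff:
 assumes f: "L2_field f" and g: "L2_field g"
 shows "fnorm (\<lambda>i x. f i x - g i x) \<le> fnorm f + fnorm g"
 using fnorm_triangle[OF f L2_field_cmult[OF g, of "-1"]] fnorm_cmult[of "-1" g] by simp

lemma fnorm_le:
 assumes f: "L2_field f" and "0 \<le> c" "\<And>i x. \<bar>g i x\<bar> \<le> c * \<bar>f i x\<bar>"
 shows "fnorm g \<le> c * fnorm f"
proof -
 have "(g i x)^2 \<le> (c * f i x)^2" for i x using assms(2,3) by (simp add: abs_le_square_iff[symmetric] abs_mult)
 then have "(LBINT x. (\<Oplus>i. (g i x)^2)) \<le> (LBINT x. (\<Oplus>i. (c * f i x)^2))"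
  using L2_field_cmult[OF f, of c] by (intro integral_mono' sum_mono) (auto simp: L2_field_def sum_nonneg)
 then have "fnorm g \<le> fnorm (\<lambda>i x. c * f i x)" unfolding fnorm_def by (rule real_sqrt_le_mono)
 then show ?thesis using assms(2) by (simp add: fnorm_cmult)
qed

text \<open>The bilinear form behind \<open>stress\<close>, needed to separate the contributions of
  the old datum, the packet and the remainder to the pressure.\<close>

definition bform :: "('i::finite \<Rightarrow> 'i \<Rightarrow> real^3 \<Rightarrow> real) \<Rightarrow> ('i \<Rightarrow> real^3 \<Rightarrow> real) \<Rightarrow> ('i \<Rightarrow> real^3 \<Rightarrow> real) \<Rightarrow> real" where
 "bform H f g = (\<Oplus>a. \<Oplus>b. LBINT x. f a x * g b x * H a b x)"

lemma weighted_product: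
 assumes f: "L2_field f" and g: "L2_field g"
  and [measurable]: "H \<in> borel_measurable borel" and C: "\<And>x. \<bar>H x\<bar> \<le> C"
 shows "integ (\<lambda>x. f a x * g b x * H x)"
  "\<bar>LBINT x. f a x * g b x * H x\<bar> \<le> C * (fnorm f * fnorm g)"
proof -
 note [measurable] = L2_field_measurable[OF f] L2_field_measurable[OF g]
 have C0: "0 \<le> C" using C[of 0] by linarith
 have m: "\<bar>f a x * g b x * H x\<bar> \<le> C * \<bar>f a x * g b x\<bar>" for x
  using mult_left_mono[OF C[of x], of "\<bar>f a x * g b x\<bar>"] by (simp add: abs_mult mult.commute)
 have I: "integ (\<lambda>x. \<bar>f a x * g b x\<bar>)" by (intro integrable_abs field_product f g)
 show i: "integ (\<lambda>x. f a x * g b x * H x)"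
  by (rule Bochner_Integration.integrable_bound[of _ "\<lambda>x. C * \<bar>f a x * g b x\<bar>"])
   (use I m C0 in \<open>auto simp: abs_mult mult.assoc\<close>)
 have "\<bar>LBINT x. \<bar>f a x\<bar> * \<bar>g b x\<bar>\<bar> \<le> sqrt (LBINT x. \<bar>f a x\<bar>\<^sup>2) * sqrt (LBINT x. \<bar>g b x\<bar>\<^sup>2)"
  using L2_field_component(1)[OF f] L2_field_component(1)[OF g] by (intro integral_Cauchy_Schwarz) auto
 also have "\<dots> \<le> fnorm f * fnorm g"
  using L2_field_component(2)[OF f] L2_field_component(2)[OF g] by (intro mult_mono real_le_lsqrt) auto
 finally have fg: "(LBINT x. \<bar>f a x * g b x\<bar>) \<le> fnorm f * fnorm g" by (simp add: abs_mult)
 have "\<bar>LBINT x. f a x * g b x * H x\<bar> \<le> (LBINT x. \<bar>f a x * g b x * H x\<bar>)" by (rule integral_abs_bound)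
 also have "\<dots> \<le> (LBINT x. C * \<bar>f a x * g b x\<bar>)"
  using I by (intro integral_mono integrable_abs i m) auto
 also have "\<dots> \<le> C * (fnorm f * fnorm g)" using mult_left_mono[OF fg C0] by simp
 finally show "\<bar>LBINT x. f a x * g b x * H x\<bar> \<le> C * (fnorm f * fnorm g)" .
qed

locale bounded_matrix =
 fixes H :: "3 \<Rightarrow> 3 \<Rightarrow> real^3 \<Rightarrow> real" and C :: real
 assumes meas: "\<And>a b. H a b \<in> borel_measurable borel" and bound: "\<And>a b x. \<bar>H a b x\<bar> \<le> C"
begin

lemma bform_bound:
 assumes "L2_field f" "L2_field g" shows "\<bar>bform H f g\<bar> \<le> 9 * C * (fnorm f * fnorm g)"
proof -
 have "\<bar>bform H f g\<bar> \<le> (\<Sum>a\<in>(UNIV::3 set). \<Sum>b\<in>(UNIV::3 set). C * (fnorm f * fnorm g))"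
  unfolding bform_def by (intro order_trans[OF sum_abs] sum_mono weighted_product(2) assms meas bound)
 then show ?thesis by simp
qed

lemma bform_add_left:
 assumes "L2_field f" "L2_field f'" "L2_field g"
 shows "bform H (\<lambda>i x. f i x + f' i x) g = bform H f g + bform H f' g"
 unfolding bform_def using weighted_product(1)[OF assms(1,3) meas bound] weighted_product(1)[OF assms(2,3) meas bound]
 by (simp add: distrib_right sum.distrib)

lemma bform_add_right:
 assumes "L2_field f" "L2_field f'" "L2_field g"
 shows "bform H g (\<lambda>i x. f i x + f' i x) = bform H g f + bform H g f'"
 unfolding bform_def using weighted_product(1)[OF assms(3,1) meas bound] weighted_product(1)[OF assms(3,2) meas bound]
 by (simp add: distrib_right distrib_left sum.distrib)

end

lemma bform_cmult:
 "bform H (\<lambda>i x. c * f i x) g = c * bform H f g" "bform H f (\<lambda>i x. c * g i x) = c * bform H f g"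
 unfolding bform_def by (simp_all add: mult.assoc mult.left_commute sum_distrib_left)

lemma bform_sym:
 assumes "\<And>a b. H a b = H b a" shows "bform H f g = bform H g f"
 unfolding bform_def by (subst sum.swap) (simp add: assms[of _ ] mult.commute mult.left_commute)

section \<open>Relative energy with respect to a divergence-free field\<close>

context nse_solution
begin

lemma U_L2:
 assumes t: "t \<in> {0..T}" shows "L2_field (\<lambda>i. U i t)" "fnorm (\<lambda>i. U i t) \<le> E"
 unfolding L2_field_def fnorm_def
 using contU[OF t] energy[OF t] E by (auto intro!: real_le_lsqrt simp: sum_nonneg)

lemma stress_bform: "stress t H = bform H (\<lambda>i. U i t) (\<lambda>i. U i t)"
 unfolding stress_def bform_def by (simp add: mult.commute mult.left_commute)

lemma stress_difference:
 assumes s: "s \<in> {0..T}" "s' \<in> {0..T}" and H: "bounded_matrix H C"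
 shows "\<bar>stress s H - stress s' H\<bar> \<le> 18 * C * E * fnorm (\<lambda>i x. U i s x - U i s' x)"
proof -
 interpret bounded_matrix H C by (rule H)
 have C0: "0 \<le> C" using bound[of 0 0 0] by linarith
 note u = U_L2[OF s(1)] U_L2[OF s(2)]
 let ?u = "\<lambda>i. U i s" and ?u' = "\<lambda>i. U i s'" and ?d = "\<lambda>i x. U i s x - U i s' x"
 have d: "L2_field ?d" by (rule L2_field_diff[OF u(1,3)])
 have "bform H (\<lambda>i x. ?d i x + ?u' i x) ?u = bform H ?d ?u + bform H ?u' ?u"
  by (rule bform_add_left[OF d u(3,1)])
 moreover have "bform H ?u' (\<lambda>i x. ?d i x + ?u' i x) = bform H ?u' ?d + bform H ?u' ?u'"
  by (rule bform_add_right[OF d u(3,3)])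
 ultimately have "bform H ?u ?u - bform H ?u' ?u' = bform H ?d ?u + bform H ?u' ?d" by simp
 then have "\<bar>stress s H - stress s' H\<bar> \<le> \<bar>bform H ?d ?u\<bar> + \<bar>bform H ?u' ?d\<bar>"
  unfolding stress_bform by linarith
 also have "\<dots> \<le> 9 * C * (fnorm ?d * fnorm ?u) + 9 * C * (fnorm ?u' * fnorm ?d)"
  by (intro add_mono bform_bound d u)
 also have "\<dots> \<le> 9 * C * (fnorm ?d * E) + 9 * C * (E * fnorm ?d)"
  by (intro add_mono mult_left_mono mult_right_mono u) (use C0 in auto)
 finally show ?thesis by (simp add: algebra_simps)
qed

lemma momentum_test_divfree:
 assumes t: "t \<in> {0..T}" and v: "\<And>i. Ck 2 (v i)" "\<And>i. bsupp (v i)"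
  and d: "\<And>x. (\<Oplus>i. pd i (v i) x) = 0"
 shows "(\<Oplus>i. LBINT x. Ut i t x * v i x) = (\<Oplus>i. LBINT x. U i t x * lap (v i) x)
  + (\<Oplus>i. \<Oplus>j. LBINT x. U j t x * U i t x * pd j (v i) x)"
proof -
 have v1: "Ck 1 (v i)" for i by (rule Ck_on_mono[OF v(1)]) simp
 have pv: "cont (pd i (v i))" for i
 by (rule cont_partial[OF v1])
 have "(LBINT x. pd i (p t) x * v i x) = - (LBINT x. p t x * pd i (v i) x)" for i
  using integral_by_parts[OF Ckp[OF t] v1, of i i] v(2) by simp
 then have "(\<Oplus>i. LBINT x. pd i (p t) x * v i x) = - (\<Oplus>i. LBINT x. p t x * pd i (v i) x)"
  by (simp add: sum_negf)
 also have "(\<Oplus>i. LBINT x. p t x * pd i (v i) x) = (LBINT x. (\<Oplus>i. p t x * pd i (v i) x))"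
  by (rule Bochner_Integration.integral_sum[symmetric])
   (intro integrable_cs continuous_intros pv contp[OF t] bsupp_mult2 bsupp_partial v)
 also have "\<dots> = 0" by (simp add: d flip: sum_distrib_left)
 finally have 0: "(\<Oplus>i. LBINT x. pd i (p t) x * v i x) = 0" by simp
 show ?thesis
  by (simp only: momentum_test[OF t v(1) v(2)] sum_subtractf sum.distrib 0 diff_0_right)
qed

text \<open>Integrates \<open>2 a b - b^2 \<le> a^2\<close>, where \<open>a\<close> is a derivative
  of the solution and \<open>b\<close> the same derivative of \<open>v\<close>, over the ball where
  the cutoff is 1. After integration by parts the lower bound contains no derivative of the
  solution.\<close>

lemma dissipation_lower:
 assumes t: "t \<in> {0..T}" and v: "\<And>i. Ck 2 (v i)" and R: "0 \<le> R" "\<And>i x. R < norm x \<Longrightarrow> v i x = 0"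
 shows "(\<Oplus>i. - 2 * (LBINT x. U i t x * lap (v i) x) + (LBINT x. v i x * lap (v i) x))
  \<le> dis (cutoff R 1) t"
proof -
 let ?z = "cutoff R 1"
 have vb: "bsupp (v i)" for i by (rule bsuppI) (rule R)
 have v1: "Ck 1 (v i)" for i by (rule Ck_on_mono[OF v]) simp
 have v2: "Ck (Suc 1) (v i)" for i using v[of i] by (simp add: numeral_2_eq_2)
 have dv1: "Ck 1 (pd j (v i))" for i j by (rule Ck_partial[OF v2])
 have dvc: "cont (pd j (v i))" for i j by (rule Ck_cont[OF dv1])
 have ddvc: "cont (pd j (pd j (v i)))" for i j
 by (rule cont_partial[OF dv1])
 have dvb: "bsupp (pd j (v i))" "bsupp (pd j (pd j (v i)))" for i j by (intro bsupp_partial vb)+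
 have out: "pd j (v i) x = 0" if "R < norm x" for i j x
 proof -
  have o: "open {x::real^3. R < norm x}" by (intro open_Collect_less continuous_intros)
  have "pd j (v i) x = pd j (\<lambda>x. 0) x"
   by (rule partial_cong_open[OF o]) (use that R in auto)
  then show ?thesis by simp
 qed
 have pt: "2 * (pd j (U i t) x * pd j (v i) x) - pd j (v i) x * pd j (v i) x \<le> (?z x)^2 * (pd j (U i t) x)^2" for i j x
 proof (cases "norm x \<le> R")
  case True
  then have "?z x = 1" using R by (intro cutoff_inside) auto
  moreover have "2 * (a * b) - b * b \<le> a^2" for a b :: real using sum_squares_bound[of a b] by (simp add: power2_eq_square)
  ultimately show ?thesis by simp
 qed (use out in auto)
 have i1: "integ (\<lambda>x. pd j (U i t) x * pd j (v i) x)" "integ (\<lambda>x. pd j (v i) x * pd j (v i) x)" for i j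
  by (intro integrable_cs continuous_intros dvc contdU[OF t] bsupp_mult2 dvb)+
 have "(\<Oplus>i. \<Oplus>j. 2 * (LBINT x. pd j (U i t) x * pd j (v i) x) - (LBINT x. pd j (v i) x * pd j (v i) x))
  \<le> dis ?z t"
  unfolding dis_def
 proof (intro sum_mono)
  fix i j :: 3
  have "2 * (LBINT x. pd j (U i t) x * pd j (v i) x) - (LBINT x. pd j (v i) x * pd j (v i) x)
   = (LBINT x. 2 * (pd j (U i t) x * pd j (v i) x) - pd j (v i) x * pd j (v i) x)"
   using i1 by simp
  also have "\<dots> \<le> (LBINT x. (?z x)^2 * (pd j (U i t) x)^2)"
   using R by (intro integral_mono pt Bochner_Integration.integrable_diff integrable_mult_right i1 integrable_cs continuous_intros cont_cutoff
     contdU[OF t] bsupp_mult1 bsupp_power cutoff_bsupp) auto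
  finally show "2 * (LBINT x. pd j (U i t) x * pd j (v i) x) - (LBINT x. pd j (v i) x * pd j (v i) x)
   \<le> (LBINT x. (?z x)^2 * (pd j (U i t) x)^2)" .
 qed
 moreover have "(\<Oplus>j. LBINT x. pd j f x * pd j (v i) x) = - (LBINT x. f x * lap (v i) x)"
  if f: "Ck 1 f" for f :: "real^3 \<Rightarrow> real" and i
 proof -
  have fc: "cont f" by (rule Ck_cont[OF f])
  have "(LBINT x. f x * lap (v i) x) = (LBINT x. (\<Oplus>j. f x * pd j (pd j (v i)) x))"
   by (simp add: laplacian_sum sum_distrib_left)
  also have "\<dots> = (\<Oplus>j. LBINT x. f x * pd j (pd j (v i)) x)"
   by (rule Bochner_Integration.integral_sum) (intro integrable_cs continuous_intros fc ddvc bsupp_mult2 dvb)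
  also have "\<dots> = (\<Oplus>j. - (LBINT x. pd j f x * pd j (v i) x))"
   by (intro sum.cong refl integral_by_parts f dv1 disjI2 dvb)
  finally show ?thesis by (simp add: sum_negf)
 qed
 note this[OF CkU[OF t]] this[OF v1]
 ultimately show ?thesis
  by (simp add: sum_subtractf sum.distrib sum_negf flip: sum_distrib_left)
qed

text \<open>If \<open>g\<close> is the time derivative of \<open>v\<close>, the left side is the
  derivative of \<open>- 2 * <u, v> + \<bar>v\<bar>^2\<close>, the part of the relative energy that
  is not the energy of the solution. The field \<open>f\<close> is the defect of \<open>v\<close> in
  the equation, and the last term is the transport of \<open>w\<close> against the gradient of
  \<open>v\<close>. The dissipation on the right will cancel against the energy inequality.\<close>

lemma relative_energy_rate:
 assumes t: "t \<in> {0..T}" and v: "\<And>i. Ck 2 (v i)" and R: "0 \<le> R" "\<And>i x. R < norm x \<Longrightarrow> v i x = 0"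
  and d: "\<And>x. (\<Oplus>i. pd i (v i) x) = 0"
  and g: "\<And>i. cont (g i)" "\<And>i. bsupp (g i)"
 defines "w \<equiv> \<lambda>i x. U i t x - v i x"
  and "f \<equiv> \<lambda>i x. lap (v i) x - (\<Oplus>j. v j x * pd j (v i) x) - g i x"
 shows "- 2 * ((\<Oplus>i. LBINT x. Ut i t x * v i x) + (\<Oplus>i. LBINT x. U i t x * g i x))
   + 2 * (\<Oplus>i. LBINT x. v i x * g i x)
  \<le> 2 * dis (cutoff R 1) t + 2 * (LBINT x. (\<Oplus>i. w i x * f i x)) - 2 * bform (\<lambda>a b. pd a (v b)) w w"
proof -
 have vb: "bsupp (v i)" for i by (rule bsuppI) (rule R)
 have v1: "Ck 1 (v i)" for i by (rule Ck_on_mono[OF v]) simp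
 have v2: "Ck (0 + 2) (v i)" for i unfolding add_0 by (rule v)
 have vc: "cont (v i)" for i by (rule Ck_cont[OF v])
 have dvc: "cont (pd j (v i))" for i j
 by (rule cont_partial[OF v1])
 have lvc: "cont (lap (v i))" for i
  by (rule Ck_cont[OF Ck_laplacian[OF v2]])
 have dvb: "bsupp (pd j (v i))" "bsupp (lap (v i))" for i j
  unfolding laplacian_sum by (intro bsupp_sum bsupp_partial vb)+
 note cont = continuous_intros vc dvc lvc g(1) contU[OF t]
 have iUl: "integ (\<lambda>x. U i t x * lap (v i) x)" "integ (\<lambda>x. v i x * lap (v i) x)"
  "integ (\<lambda>x. U i t x * g i x)" "integ (\<lambda>x. v i x * g i x)" for i
  by (intro integrable_cs cont bsupp_mult2 dvb g)+
 have i3: "integ (\<lambda>x. U j t x * U i t x * pd j (v i) x)" "integ (\<lambda>x. U j t x * (v i x * pd j (v i) x))" for i j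
  by (intro integrable_cs cont bsupp_mult2 dvb)+
 have iw: "integ (\<lambda>x. w i x * f i x)" "integ (\<lambda>x. w j x * w i x * pd j (v i) x)" for i j
  unfolding w_def f_def by (intro integrable_cs cont bsupp_mult2 bsupp_diff bsupp_sum dvb g)+
 \<comment> \<open>The velocity is integrated against the gradient of
   \<open>\<bar>v\<bar>^2 / 2\<close>, so the term vanishes by incompressibility.\<close>
 have grad: "(\<Oplus>i. \<Oplus>j. LBINT x. U j t x * (v i x * pd j (v i) x)) = 0"
 proof -
  define \<phi> where "\<phi> = (\<lambda>x. \<Oplus>i. v i x * v i x)"
  have "pd j \<phi> = (\<lambda>x. \<Oplus>i. 2 * (v i x * pd j (v i) x))" for j
   unfolding \<phi>_def by (subst partial_sum[OF Ck_mult[OF v1 v1]]) (simp add: partial_mult[OF v1 v1] mult.commute)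
  then have z: "(\<Oplus>j. LBINT x. U j t x * (\<Oplus>i. 2 * (v i x * pd j (v i) x))) = 0"
   using gradient_test[OF t, of \<phi>] vb v1 unfolding \<phi>_def by (simp add: Ck_sum Ck_mult bsupp_sum bsupp_mult1)
  have e: "(LBINT x. U j t x * (\<Oplus>i. 2 * (v i x * pd j (v i) x)))
   = (\<Oplus>i. 2 * (LBINT x. U j t x * (v i x * pd j (v i) x)))" for j
   using i3(2) by (simp add: sum_distrib_left mult.left_commute[of _ 2])
  from z show ?thesis unfolding e by (subst sum.swap) (simp flip: sum_distrib_left)
 qed
 have pt: "w i x * f i x - (\<Oplus>j. w j x * w i x * pd j (v i) x)
  = U i t x * lap (v i) x - v i x * lap (v i) x - U i t x * g i x + v i x * g i x
   - (\<Oplus>j. U j t x * U i t x * pd j (v i) x) + (\<Oplus>j. U j t x * (v i x * pd j (v i) x))" for i x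
  unfolding w_def f_def by (simp add: algebra_simps sum.distrib sum_subtractf sum_distrib_left)
 have sw: "bform (\<lambda>a b. pd a (v b)) w w = (\<Oplus>i. \<Oplus>j. LBINT x. w j x * w i x * pd j (v i) x)"
  unfolding bform_def by (rule sum.swap)
 have "(LBINT x. (\<Oplus>i. w i x * f i x)) - bform (\<lambda>a b. pd a (v b)) w w
  = (\<Oplus>i. LBINT x. w i x * f i x - (\<Oplus>j. w j x * w i x * pd j (v i) x))"
  unfolding sw using iw by (simp add: sum_subtractf)
 also have "\<dots> = (\<Oplus>i. (LBINT x. U i t x * lap (v i) x) - (LBINT x. v i x * lap (v i) x)
   - (LBINT x. U i t x * g i x) + (LBINT x. v i x * g i x)
   - (\<Oplus>j. LBINT x. U j t x * U i t x * pd j (v i) x) + (\<Oplus>j. LBINT x. U j t x * (v i x * pd j (v i) x)))"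
  unfolding pt using iUl i3 by simp
 also have "\<dots> = (\<Oplus>i. (LBINT x. U i t x * lap (v i) x)) - (\<Oplus>i. LBINT x. v i x * lap (v i) x)
   - (\<Oplus>i. LBINT x. U i t x * g i x) + (\<Oplus>i. LBINT x. v i x * g i x)
   - (\<Oplus>i. \<Oplus>j. LBINT x. U j t x * U i t x * pd j (v i) x)"
  using grad by (simp add: sum_subtractf sum.distrib)
 finally have eq: "(LBINT x. (\<Oplus>i. w i x * f i x)) - bform (\<lambda>a b. pd a (v b)) w w = \<dots>" .
 have dl: "(\<Oplus>i. LBINT x. v i x * lap (v i) x) - 2 * (\<Oplus>i. LBINT x. U i t x * lap (v i) x) \<le> dis (cutoff R 1) t"
  using dissipation_lower[where v = v, OF t v R] by (simp add: sum.distrib sum_subtractf sum_negf flip: sum_distrib_left)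
 have "- 2 * (m + ug) + 2 * vg \<le> 2 * d + 2 * i - 2 * b"
  if "i - b = a - c - ug + vg - S" "c - 2 * a \<le> d" "m = a + S" for m ug vg d i b a c S :: real
  using that by argo
 from this[OF eq dl momentum_test_divfree[where v = v, OF t v vb d]] show ?thesis .
qed

end

section \<open>Weak-strong comparison\<close>

lemma fnorm_diff_sq:
 assumes f: "L2_field f" and g: "L2_field g"
 shows "(fnorm (\<lambda>i x. f i x - g i x))^2 = (fnorm f)^2 - 2 * (LBINT x. (\<Oplus>i. f i x * g i x)) + (fnorm g)^2"
 using fnorm_add_sq[OF f L2_field_cmult[OF g, of "-1"]] fnorm_cmult[of "-1" g]
 by (simp add: sum_negf)

lemma quadratic_bound:
 fixes M \<delta> a :: real
 assumes "M^2 \<le> 2 * \<delta>\<^sup>2 + a * M" "0 \<le> M" "0 \<le> \<delta>" "0 \<le> a"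
 shows "M \<le> a + 2 * \<delta>"
proof (rule ccontr)
 assume "\<not> M \<le> a + 2 * \<delta>"
 then have M: "a + 2 * \<delta> < M" by simp
 have "M * (2 * \<delta>) \<le> M * (M - a)" using M assms by (intro mult_left_mono) auto
 also have "\<dots> \<le> 2 * \<delta>\<^sup>2" using assms(1) by (simp add: power2_eq_square algebra_simps)
 finally have *: "M * (2 * \<delta>) \<le> 2 * \<delta>\<^sup>2" .
 show False
 proof (cases "\<delta> = 0")
  case True
  then have "M * (M - a) \<le> 0" using assms(1) by (simp add: power2_eq_square algebra_simps)
  moreover have "0 < M * (M - a)" using M assms True by (intro mult_pos_pos) auto
  ultimately show False by simp
 next
  case False
  then have "0 < \<delta>" using assms by simp
  then have "M \<le> \<delta>" using * by (simp add: power2_eq_square)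
  then show False using M \<open>0 < \<delta>\<close> assms by simp
 qed
qed

context nse_solution
begin

text \<open>The squared distance \<open>(m s)^2\<close> is the energy of the solution plus
  \<open>G s\<close>; the first is controlled by the energy inequality, the second by
  \<open>relative_energy_rate\<close>, and the dissipation cancels. Bounding the right side by the
  supremum \<open>M\<close> of the distance plays the role of a Gronwall argument, since the time
  interval is short compared with the gradient bound \<open>C\<close>.\<close>

lemma weak_strong:
 fixes V b :: "3 \<Rightarrow> real^3 \<Rightarrow> real" and \<nu> C \<delta> t :: real
 defines "v \<equiv> \<lambda>s i x. V i x + exp (- \<nu> * s) * b i x"
 assumes t: "t \<in> {0..T}" and V: "\<And>i. Ck 2 (V i)" and b: "\<And>i. Ck 2 (b i)"
  and R: "0 \<le> R" "\<And>i x. R < norm x \<Longrightarrow> V i x = 0 \<and> b i x = 0"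
  and d: "\<And>x. (\<Oplus>i. pd i (V i) x) = 0" "\<And>x. (\<Oplus>i. pd i (b i) x) = 0"
  and C: "0 < C" "36 * C * t \<le> 1"
  and gradv: "\<And>s i j x. s \<in> {0..t} \<Longrightarrow> \<bar>pd j (v s i) x\<bar> \<le> C"
  and force: "\<And>s. s \<in> {0..t} \<Longrightarrow> fnorm (\<lambda>i x. lap (v s i) x - (\<Oplus>j. v s j x * pd j (v s i) x)
    - (- \<nu> * exp (- \<nu> * s)) * b i x) \<le> C"
  and \<delta>: "fnorm (\<lambda>i x. U i 0 x - v 0 i x) \<le> \<delta>"
  and s: "s \<in> {0..t}"
 shows "fnorm (\<lambda>i x. U i s x - v s i x) \<le> 4 * C * t + 2 * \<delta>"
proof -
 have t0: "0 \<le> t" "t \<le> T" using t by auto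
 have sub: "s \<in> {0..T}" if "s \<in> {0..t}" for s using that t by auto
 have \<delta>0: "0 \<le> \<delta>" by (rule order_trans[OF fnorm_nonneg \<delta>])
 define e where "e s = exp (- \<nu> * s)" for s
 have e_deriv: "(e has_real_derivative - \<nu> * e s) (at s within S)" for s S
  unfolding e_def by (auto intro!: derivative_eq_intros)
 have v_eq: "v s i = (\<lambda>x. V i x + e s * b i x)" for s i by (simp add: v_def e_def)
 let ?g = "\<lambda>s i x. (- \<nu> * e s) * b i x"
 have Vb: "bsupp (V i)" "bsupp (b i)" for i by (rule bsuppI[of R], use R in auto)+
 have Vc: "cont (V i)" "cont (b i)" for i by (rule Ck_cont, rule V b)+
 have v2: "Ck 2 (v s i)" for s i unfolding v_eq by (intro Ck_add Ck_mult Ck_const V b)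
 have v1: "Ck (Suc 0) (v s i)" for s i by (rule Ck_on_mono[OF v2]) simp
 have vc: "cont (v s i)" for s i by (rule Ck_cont[OF v2])
 have vb: "bsupp (v s i)" for s i unfolding v_eq by (intro bsupp_add bsupp_mult2 Vb)
 have vR: "v s i x = 0" if "R < norm x" for s i x using R(2)[OF that, of i] by (simp add: v_def)
 have dvc: "cont (pd j (v s i))" for s i j
  by (rule Ck_cont[OF Ck_partial[OF v1]])
 have lvc: "cont (lap (v s i))" for s i
 proof -
  have "Ck (0 + 2) (v s i)" unfolding add_0 by (rule v2)
  from Ck_cont[OF Ck_laplacian[OF this]] show ?thesis .
 qed
 have lvb: "bsupp (lap (v s i))" for s i unfolding laplacian_sum by (intro bsupp_sum bsupp_partial vb)
 have V1: "Ck 1 (V i)" "Ck 1 (b i)" for i by (rule Ck_on_mono, rule V b, simp)+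
 have dv: "(\<Oplus>i. pd i (v s i) x) = 0" for s x
 proof -
  have "pd i (v s i) x = pd i (V i) x + e s * pd i (b i) x" for i
   unfolding v_eq by (simp only: partial_add[OF V1(1) Ck_mult[OF Ck_const V1(2)]] partial_cmult[OF V1(2)])
  then show ?thesis using d by (simp add: sum.distrib flip: sum_distrib_left)
 qed
 have vL: "L2_field (v s)" for s by (rule L2_field_cs) (rule vc vb)+
 have VL: "L2_field V" "L2_field b" by (rule L2_field_cs, (rule Vc Vb)+)+
 have wL: "L2_field (\<lambda>i x. U i s x - v s i x)" if "s \<in> {0..t}" for s
  by (rule L2_field_diff[OF U_L2(1)[OF sub[OF that]] vL])
 define m where "m s = fnorm (\<lambda>i x. U i s x - v s i x)" for s
 have m0: "0 \<le> m s" for s by (simp add: m_def)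
 have e1: "\<bar>e s\<bar> \<le> exp (\<bar>\<nu>\<bar> * t)" if "s \<in> {0..t}" for s
 proof -
  have "- \<nu> * s \<le> \<bar>\<nu>\<bar> * s" using that by (intro mult_right_mono) auto
  also have "\<dots> \<le> \<bar>\<nu>\<bar> * t" using that by (intro mult_left_mono) auto
  finally show ?thesis by (simp add: e_def)
 qed
 have m_bd: "m s \<le> E + (fnorm V + exp (\<bar>\<nu>\<bar> * t) * fnorm b)" if "s \<in> {0..t}" for s
 proof -
  have "fnorm (v s) \<le> fnorm V + fnorm (\<lambda>i x. e s * b i x)"
   unfolding v_eq by (rule fnorm_triangle[OF VL(1) L2_field_cmult[OF VL(2)]])
  also have "\<dots> \<le> fnorm V + exp (\<bar>\<nu>\<bar> * t) * fnorm b"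
   unfolding fnorm_cmult using e1[OF that] by (intro add_left_mono mult_right_mono) auto
  finally show ?thesis
   using fnorm_triangle_diff[OF U_L2(1)[OF sub[OF that]] vL[of s]] U_L2(2)[OF sub[OF that]] unfolding m_def by linarith
 qed
 define M where "M = (SUP s\<in>{0..t}. m s)"
 have bdd: "bdd_above (m ` {0..t})" using m_bd by (rule bdd_aboveI2)
 have mM: "m s \<le> M" if "s \<in> {0..t}" for s unfolding M_def by (rule cSUP_upper[OF that bdd])
 have M0: "0 \<le> M" using mM[of 0] m0[of 0] t0 by auto
 \<comment> \<open>Rate of growth when the distance is at most \<open>M\<close>: twice
   \<open>C * M\<close> from the defect, twice \<open>9 * C * M^2\<close> from the gradient of
   \<open>v\<close>.\<close>
 define K where "K = 2 * C * M + 18 * C * M^2"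
 define \<phi> where "\<phi> s = (\<Oplus>i. LBINT x. U i s x * v s i x)" for s
 define G where "G s = - 2 * \<phi> s + (fnorm (v s))^2" for s
 have iUv: "integ (\<lambda>x. U i s x * v s' i x)" if "s \<in> {0..t}" for i s s'
  by (intro integrable_cs continuous_intros contU[OF sub[OF that]] vc bsupp_mult2 vb)
 have m_sq: "(m s)^2 = (LBINT x. (\<Oplus>i. (U i s x)^2)) + G s" if "s \<in> {0..t}" for s
  unfolding m_def G_def \<phi>_def fnorm_diff_sq[OF U_L2(1)[OF sub[OF that]] vL] fnorm_sq[of "\<lambda>i. U i s"]
  using iUv[OF that] by simp
 have G_deriv: "(G has_real_derivative - 2 * ((\<Oplus>i. LBINT x. Ut i s x * v s i x) + (\<Oplus>i. LBINT x. U i s x * ?g s i x))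
   + 2 * (\<Oplus>i. LBINT x. v s i x * ?g s i x)) (at s within {0..t})" if s: "s \<in> {0..t}" for s
 proof -
  have s': "s \<in> {0..T}" by (rule sub[OF s])
  have td: "((\<lambda>r. \<Oplus>i. LBINT x. U i r x * h i x) has_real_derivative (\<Oplus>i. LBINT x. Ut i s x * h i x)) (at s within {0..t})"
   if "\<And>i. cont (h i)" "\<And>i. bsupp (h i)" for h
   using t0 by (intro DERIV_sum DERIV_subset[OF time_derivative_test[OF s' that]]) auto
  have Utc: "cont (Ut i s)" for i by (rule Ck_cont[OF smooth_slab_Ck[OF Ut s']])
  have iU: "integ (\<lambda>x. U i r x * h x)" "integ (\<lambda>x. Ut i s x * h x)"
   if "cont h" "bsupp h" "r \<in> {0..t}" for h i r
   by (intro integrable_cs continuous_intros contU[OF sub[OF that(3)]] Utc bsupp_mult2 that)+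
  have split: "(\<Oplus>i. LBINT x. U i r x * v r' i x) = (\<Oplus>i. LBINT x. U i r x * V i x) + e r' * (\<Oplus>i. LBINT x. U i r x * b i x)"
   if "r \<in> {0..t}" for r r'
   unfolding v_eq using iU(1)[OF Vc(1) Vb(1) that] iU(1)[OF Vc(2) Vb(2) that]
   by (simp add: distrib_left mult.left_commute sum.distrib sum_distrib_left)
  have split': "(\<Oplus>i. LBINT x. Ut i s x * v s i x) = (\<Oplus>i. LBINT x. Ut i s x * V i x) + e s * (\<Oplus>i. LBINT x. Ut i s x * b i x)"
   unfolding v_eq using iU(2)[OF Vc(1) Vb(1) s] iU(2)[OF Vc(2) Vb(2) s]
   by (simp add: distrib_left mult.left_commute sum.distrib sum_distrib_left)
  have gsplit: "(\<Oplus>i. LBINT x. f i x * ?g s i x) = (- \<nu> * e s) * (\<Oplus>i. LBINT x. f i x * b i x)" for f :: "3 \<Rightarrow> real^3 \<Rightarrow> real"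
   by (simp add: mult.left_commute sum_distrib_left sum_negf mult.assoc)
  have D\<phi>: "(\<phi> has_real_derivative (\<Oplus>i. LBINT x. Ut i s x * v s i x) + (\<Oplus>i. LBINT x. U i s x * ?g s i x)) (at s within {0..t})"
  proof (rule has_field_derivative_transform_within[OF _ zero_less_one s])
   show "((\<lambda>r. (\<Oplus>i. LBINT x. U i r x * V i x) + e r * (\<Oplus>i. LBINT x. U i r x * b i x)) has_real_derivative
     (\<Oplus>i. LBINT x. Ut i s x * v s i x) + (\<Oplus>i. LBINT x. U i s x * ?g s i x)) (at s within {0..t})"
    unfolding split' gsplit add.assoc
    by (intro DERIV_add td Vc Vb DERIV_mult' e_deriv)
  qed (simp add: \<phi>_def split)
  let ?I = "LBINT x. (\<Oplus>i. V i x * b i x)"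
  have Nv: "(fnorm (v r))^2 = (fnorm V)^2 + 2 * (e r * ?I) + (e r)^2 * (fnorm b)^2" for r
   unfolding v_eq fnorm_add_sq[OF VL(1) L2_field_cmult[OF VL(2)]] fnorm_cmult
   by (simp add: power_mult_distrib mult.left_commute flip: sum_distrib_left)
  have "(\<Oplus>i. LBINT x. v s i x * b i x) = ?I + e s * (fnorm b)^2"
  proof -
   have "(\<Oplus>i. LBINT x. v s i x * b i x) = (\<Oplus>i. LBINT x. V i x * b i x + e s * (b i x)^2)"
    by (simp add: v_eq distrib_right power2_eq_square mult.assoc)
   also have "\<dots> = (\<Oplus>i. LBINT x. V i x * b i x) + e s * (\<Oplus>i. LBINT x. (b i x)^2)"
    using field_product[OF VL] L2_field_component(1)[OF VL(2)] by (simp add: sum.distrib sum_distrib_left)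
   also have "\<dots> = ?I + e s * (fnorm b)^2"
    unfolding fnorm_sq using field_product[OF VL] L2_field_component(1)[OF VL(2)] by simp
   finally show ?thesis .
  qed
  then have vg: "2 * (\<Oplus>i. LBINT x. v s i x * ?g s i x) = 2 * (- \<nu> * e s * ?I) + 2 * e s * (- \<nu> * e s) * (fnorm b)^2"
   unfolding gsplit by (simp add: algebra_simps)
  have DN: "((\<lambda>r. (fnorm (v r))^2) has_real_derivative 2 * (\<Oplus>i. LBINT x. v s i x * ?g s i x)) (at s within {0..t})"
   unfolding Nv vg by (rule derivative_eq_intros e_deriv refl | simp)+
  show ?thesis unfolding G_def by (intro DERIV_add DERIV_cmult D\<phi> DN)
 qed
 have step: "(m s)^2 \<le> \<delta>\<^sup>2 + t * K" if s: "s \<in> {0..t}" for s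
 proof -
  have s0: "0 \<le> s" "s \<le> t" using s by auto
  have s': "s \<in> {0..T}" by (rule sub[OF s])
  let ?F = "\<lambda>r. 2 * dis (cutoff R 1) r + K"
  have cont: "continuous_on {0..s} ?F"
   using R by (intro continuous_intros dis_cutoff_continuous s') auto
  have "G s - G 0 \<le> integral {0..s} ?F"
  proof (rule derivative_le_integral[OF _ _ cont s0(1)])
   fix r assume r: "r \<in> {0..s}"
   then have rt: "r \<in> {0..t}" using s0 by auto
   show "(G has_real_derivative - 2 * ((\<Oplus>i. LBINT x. Ut i r x * v r i x) + (\<Oplus>i. LBINT x. U i r x * ?g r i x))
   + 2 * (\<Oplus>i. LBINT x. v r i x * ?g r i x)) (at r within {0..s})"
    by (rule DERIV_subset[OF G_deriv[OF rt]]) (use s0 in auto)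
   let ?w = "\<lambda>i x. U i r x - v r i x"
   let ?f = "\<lambda>i x. lap (v r i) x - (\<Oplus>j. v r j x * pd j (v r i) x) - ?g r i x"
   have gb: "bsupp (?g r i)" "cont (?g r i)" for i
    by (intro bsupp_mult2 Vb continuous_intros Vc)+
   have fL: "L2_field ?f"
    by (intro L2_field_cs continuous_intros lvc vc dvc gb bsupp_diff bsupp_sum bsupp_mult1 lvb vb Vc bsupp_mult2 Vb)
   have fC: "fnorm ?f \<le> C" using force[OF rt] by (simp add: e_def)
   have mr: "fnorm ?w \<le> M" using mM[OF rt] by (simp add: m_def)
   have "\<bar>LBINT x. (\<Oplus>i. ?w i x * ?f i x)\<bar> \<le> fnorm ?w * fnorm ?f"
    by (rule field_Cauchy_Schwarz[OF wL[OF rt] fL])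
   also have "\<dots> \<le> M * C" by (intro mult_mono mr fC M0 fnorm_nonneg)
   finally have A: "\<bar>LBINT x. (\<Oplus>i. ?w i x * ?f i x)\<bar> \<le> M * C" .
   interpret bounded_matrix "\<lambda>a b. pd a (v r b)" C
    by unfold_locales (rule cont_borel[OF dvc], rule gradv[OF rt])
   have "\<bar>bform (\<lambda>a b. pd a (v r b)) ?w ?w\<bar> \<le> 9 * C * (fnorm ?w * fnorm ?w)"
    by (rule bform_bound[OF wL[OF rt] wL[OF rt]])
   also have "\<dots> \<le> 9 * C * (M * M)" by (intro mult_left_mono mult_mono mr M0 fnorm_nonneg) (use C in simp)
   finally have B: "\<bar>bform (\<lambda>a b. pd a (v r b)) ?w ?w\<bar> \<le> 9 * C * (M * M)" .
   have "x \<le> 2 * D + K" if "x \<le> 2 * D + 2 * i - 2 * b" "\<bar>i\<bar> \<le> M * C" "\<bar>b\<bar> \<le> 9 * C * (M * M)" for x D i b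
    using that unfolding K_def power2_eq_square by (simp add: algebra_simps abs_le_iff)
   from this[OF relative_energy_rate[OF sub[OF rt] v2 R(1) vR dv gb(2,1)] A B]
   show "- 2 * ((\<Oplus>i. LBINT x. Ut i r x * v r i x) + (\<Oplus>i. LBINT x. U i r x * ?g r i x))
   + 2 * (\<Oplus>i. LBINT x. v r i x * ?g r i x) \<le> ?F r" .
  qed
  also have "integral {0..s} ?F = 2 * integral {0..s} (dis (cutoff R 1)) + s * K"
  proof -
   have "(?F has_integral 2 * integral {0..s} (dis (cutoff R 1)) + s * K) {0..s}"
    using has_integral_const_real[of K 0 s] s0 R
    by (intro has_integral_mult_right has_integral_add integrable_integral dis_integrable s') auto
   then show ?thesis by (rule integral_unique)
  qed
  finally have "G s - G 0 \<le> 2 * integral {0..s} (dis (cutoff R 1)) + s * K" .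
  then have "(m s)^2 \<le> (m 0)^2 + s * K"
   using m_sq[OF s] m_sq[of 0] energy_inequality[OF s' R(1)] t0 by simp
  also have "(m 0)^2 \<le> \<delta>\<^sup>2" using \<delta> m0[of 0] by (intro power_mono) (auto simp: m_def)
  also have "s * K \<le> t * K" using s0 M0 C by (intro mult_right_mono) (auto simp: K_def)
  finally show ?thesis by simp
 qed
 have "M \<le> sqrt (\<delta>\<^sup>2 + t * K)"
  unfolding M_def by (rule cSUP_least) (use t0 step in \<open>auto intro: real_le_rsqrt\<close>)
 then have "M^2 \<le> (sqrt (\<delta>\<^sup>2 + t * K))^2" using M0 by (rule power_mono)
 also have "\<dots> = \<delta>\<^sup>2 + t * K" using t0 M0 C by (simp add: K_def)
 \<comment> \<open>The restriction \<open>36 * C * t \<le> 1\<close> allows half of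
   \<open>M^2\<close> to be absorbed on the left.\<close>
 also have "\<dots> = \<delta>\<^sup>2 + 2 * C * t * M + (36 * C * t) * (M^2 / 2)" by (simp add: K_def algebra_simps)
 also have "\<dots> \<le> \<delta>\<^sup>2 + 2 * C * t * M + 1 * (M^2 / 2)" by (intro add_left_mono mult_right_mono C) simp
 finally have "M^2 \<le> 2 * \<delta>\<^sup>2 + 4 * C * t * M" by (simp add: algebra_simps)
 then have "M \<le> 4 * C * t + 2 * \<delta>"
  by (rule quadratic_bound) (use M0 \<delta>0 C t0 in auto)
 then show ?thesis using mM[OF s] unfolding m_def by linarith
qed

end

section \<open>Continuity in time of the acceleration\<close>

text \<open>\<open>B\<close> is chosen before the solution and depends on \<open>g\<close> only. As
  \<open>h\<close> is of class C^2, the near part of the pressure has a bounded kernel uniformly in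
  \<open>r\<close>; hence the tested pressure is a bounded quadratic form of the velocity, and it is
  Lipschitz in L^2 on bounded sets.\<close>

lemma pressure_difference:
 fixes g :: "3 \<Rightarrow> real^3 \<Rightarrow> real"
 assumes g: "\<And>i. Ck 3 (g i)" "\<And>i. bsupp (g i)"
 defines "h \<equiv> \<lambda>x. \<Oplus>i. pd i (g i) x"
 shows "\<exists>B\<ge>0. \<forall>U Ut p T E s s'. nse_solution U Ut p T E \<longrightarrow> s \<in> {0..T} \<longrightarrow> s' \<in> {0..T} \<longrightarrow>
  \<bar>(LBINT x. p s x * h x) - (LBINT x. p s' x * h x)\<bar> \<le> B * E * fnorm (\<lambda>i x. U i s x - U i s' x)"
proof -
 have g1: "Ck 1 (g i)" for i by (rule Ck_on_mono[OF g(1)]) simp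
 have gc: "cont (g i)" for i by (rule Ck_cont[OF g(1)])
 have g3: "Ck (Suc 2) (g i)" for i using g(1)[of i] by simp
 have h: "Ck 2 h" "bsupp h"
  unfolding h_def by (intro Ck_sum Ck_partial g3 bsupp_sum bsupp_partial g)+
 have hc: "cont h" by (rule Ck_cont[OF h(1)])
 obtain K where K: "\<And>r a b x. 0 < r \<Longrightarrow> r \<le> 1 \<Longrightarrow> \<bar>pd b (pd a (conv (newt_diff r 1) h)) x\<bar> \<le> K"
  using hessian_conv_newt_diff_bounded[OF h] by blast
 obtain C where C: "0 < C"
  "\<And>i j k R y x. 0 < R \<Longrightarrow> \<bar>pd k (pd j (pd i (newt_at R y))) x\<bar> \<le> C * (1/R)^4"
  using third_newt_at_bounded by metis
 have K0: "0 \<le> K" using K[of 1 0 0 0] by linarith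
 have near: "bounded_matrix (\<lambda>a b. pd b (pd a (conv (newt_diff r 1) h))) K" if "0 < r" "r \<le> 1" for r
 proof
  have "Ck_on (Suc (Suc 4)) UNIV (conv (newt_diff r 1) h)"
   using Ck_conv[OF Ck_newt_diff hc h(2)] by simp
  from Ck_cont[OF Ck_partial[OF Ck_partial[OF this]]]
  show "pd b (pd a (conv (newt_diff r 1) h)) \<in> borel_measurable borel" for a b
   by (rule cont_borel)
  show "\<bar>pd b (pd a (conv (newt_diff r 1) h)) x\<bar> \<le> K" for a b x by (rule K[OF that])
 qed
 have far: "bounded_matrix (\<lambda>a b. pd b (pd a (pd i (newt_at 1 y)))) C" for i y
  using C(2)[of 1] by unfold_locales (auto intro!: cont_borel cont_third_newt_at)
 define S where "S = (\<Oplus>i. LBINT y. \<bar>g i y\<bar>)"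
 have S0: "0 \<le> S" unfolding S_def by (intro sum_nonneg) simp
 define B where "B = (18 * K + 18 * C * S) / mass"
 show ?thesis
 proof (intro exI[of _ B] conjI allI impI)
  show "0 \<le> B" using K0 C S0 mass_pos by (simp add: B_def)
  fix U Ut p T E s s' assume sol: "nse_solution U Ut p T E" and s: "s \<in> {0..T}" "s' \<in> {0..T}"
  interpret nse_solution U Ut p T E by (rule sol)
  let ?D = "fnorm (\<lambda>i x. U i s x - U i s' x)"
  let ?Y = "\<lambda>i t y. stress t (\<lambda>a b. pd b (pd a (pd i (newt_at 1 y))))"
  have fd: "\<bar>far_pressure 1 g s - far_pressure 1 g s'\<bar> \<le> 18 * C * S * E * ?D"
  proof -
   note I = pressure_far(2)[where g = g, OF s(1) zero_less_one g1 g(2)] pressure_far(2)[where g = g, OF s(2) zero_less_one g1 g(2)]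
   have eq: "far_pressure 1 g s - far_pressure 1 g s' = (\<Oplus>i. LBINT y. g i y * ?Y i s y - g i y * ?Y i s' y)"
    unfolding far_pressure_def using I by (simp add: sum_subtractf)
   have "\<bar>far_pressure 1 g s - far_pressure 1 g s'\<bar> \<le> (\<Oplus>i. 18 * C * E * ?D * (LBINT y. \<bar>g i y\<bar>))"
    unfolding eq
   proof (rule order_trans[OF sum_abs], rule sum_mono)
    fix i
    have gi: "integ (\<lambda>y. \<bar>g i y\<bar>)" by (intro integrable_abs integrable_cs gc g)
    have "\<bar>LBINT y. g i y * ?Y i s y - g i y * ?Y i s' y\<bar> \<le> (LBINT y. \<bar>g i y * ?Y i s y - g i y * ?Y i s' y\<bar>)"
     by (rule integral_abs_bound)
    also have "\<dots> \<le> (LBINT y. (18 * C * E * ?D) * \<bar>g i y\<bar>)"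
    proof (rule integral_mono)
     show "\<bar>g i y * ?Y i s y - g i y * ?Y i s' y\<bar> \<le> (18 * C * E * ?D) * \<bar>g i y\<bar>" for y
     proof -
      have "\<bar>g i y * ?Y i s y - g i y * ?Y i s' y\<bar> = \<bar>g i y\<bar> * \<bar>?Y i s y - ?Y i s' y\<bar>"
       by (simp only: right_diff_distrib[symmetric] abs_mult)
      also have "\<dots> \<le> \<bar>g i y\<bar> * (18 * C * E * ?D)"
       by (rule mult_left_mono[OF stress_difference[OF s far]]) simp
      finally show ?thesis by (simp only: mult.commute)
     qed
     show "integ (\<lambda>y. \<bar>g i y * ?Y i s y - g i y * ?Y i s' y\<bar>)"
      by (intro integrable_abs Bochner_Integration.integrable_diff I)
     show "integ (\<lambda>y. (18 * C * E * ?D) * \<bar>g i y\<bar>)" by (intro integrable_mult_right gi)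
    qed
    finally show "\<bar>LBINT y. g i y * ?Y i s y - g i y * ?Y i s' y\<bar> \<le> 18 * C * E * ?D * (LBINT y. \<bar>g i y\<bar>)" by simp
   qed
   also have "\<dots> = 18 * C * S * E * ?D"
    unfolding sum_distrib_left[symmetric] S_def[symmetric] by (simp only: mult_ac)
   finally show ?thesis .
  qed
  let ?N = "\<lambda>t r. stress t (\<lambda>a b. pd b (pd a (conv (newt_diff r 1) h)))"
  have "((\<lambda>r. (?N s r + far_pressure 1 g s) - (?N s' r + far_pressure 1 g s'))
   \<longlongrightarrow> mass * (LBINT x. p s x * h x) - mass * (LBINT x. p s' x * h x)) (at_right 0)"
   unfolding h_def by (intro tendsto_diff pressure_limit s zero_less_one g1 g)
  from tendsto_rabs[OF this]
  have "\<bar>mass * (LBINT x. p s x * h x) - mass * (LBINT x. p s' x * h x)\<bar> \<le> (18 * K + 18 * C * S) * E * ?D"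
  proof (rule tendsto_upperbound)
   show "\<forall>\<^sub>F r in at_right 0. \<bar>(?N s r + far_pressure 1 g s) - (?N s' r + far_pressure 1 g s')\<bar> \<le> (18 * K + 18 * C * S) * E * ?D"
    unfolding eventually_at_right_field
   proof (intro exI[of _ 1] conjI allI impI)
    fix r :: real assume "0 < r" "r < 1"
    then have "\<bar>?N s r - ?N s' r\<bar> \<le> 18 * K * E * ?D" by (intro stress_difference s near) auto
    then show "\<bar>(?N s r + far_pressure 1 g s) - (?N s' r + far_pressure 1 g s')\<bar> \<le> (18 * K + 18 * C * S) * E * ?D"
     using fd unfolding distrib_right by linarith
   qed simp
  qed simp
  then have "mass * \<bar>(LBINT x. p s x * h x) - (LBINT x. p s' x * h x)\<bar> \<le> (18 * K + 18 * C * S) * E * ?D"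
   using mass_pos by (simp add: abs_mult flip: right_diff_distrib)
  then show "\<bar>(LBINT x. p s x * h x) - (LBINT x. p s' x * h x)\<bar> \<le> B * E * ?D"
   using mass_pos by (simp add: B_def field_simps)
 qed
qed

text \<open>The momentum equation expresses the tested acceleration by the velocity alone. The
  factor \<open>1 + E\<close> collects the linear viscous term and the quadratic terms, whose
  Lipschitz constants grow with \<open>E\<close>.\<close>

lemma acceleration_difference:
 fixes g :: "3 \<Rightarrow> real^3 \<Rightarrow> real"
 assumes g: "\<And>i. Ck 3 (g i)" "\<And>i. bsupp (g i)"
 shows "\<exists>B\<ge>0. \<forall>U Ut p T E s s'. nse_solution U Ut p T E \<longrightarrow> s \<in> {0..T} \<longrightarrow> s' \<in> {0..T} \<longrightarrow>
  \<bar>(\<Oplus>i. LBINT x. Ut i s x * g i x) - (\<Oplus>i. LBINT x. Ut i s' x * g i x)\<bar>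
   \<le> B * (1 + E) * fnorm (\<lambda>i x. U i s x - U i s' x)"
proof -
 have g1: "Ck (Suc 0) (g i)" "Ck 2 (g i)" for i by (rule Ck_on_mono[OF g(1)], simp)+
 have gc: "cont (g i)" for i by (rule Ck_cont[OF g(1)])
 have pgc: "cont (pd j (g i))" for i j by (rule Ck_cont[OF Ck_partial[OF g1(1)]])
 have "(1::nat) + 2 = 3" by simp
 then have g3: "Ck (1 + 2) (g i)" for i by (simp only: g(1))
 have lgc: "cont (lap (g i))" for i by (rule Ck_cont[OF Ck_laplacian[OF g3]])
 have lgb: "bsupp (lap (g i))" for i unfolding laplacian_sum by (intro bsupp_sum bsupp_partial g)
 have lL: "L2_field (\<lambda>i. lap (g i))" by (intro L2_field_cs lgc lgb)
 obtain P where P: "0 \<le> P" "\<And>U Ut p T E s s'. nse_solution U Ut p T E \<Longrightarrow> s \<in> {0..T} \<Longrightarrow> s' \<in> {0..T} \<Longrightarrow>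
  \<bar>(LBINT x. p s x * (\<Oplus>i. pd i (g i) x)) - (LBINT x. p s' x * (\<Oplus>i. pd i (g i) x))\<bar>
   \<le> P * E * fnorm (\<lambda>i x. U i s x - U i s' x)"
  using pressure_difference[of g, OF g] by (elim exE conjE) (rule that, assumption, simp)
 obtain C where "0 < C" and C: "\<And>a b x. \<bar>pd a (g b) x\<bar> \<le> C"
  using finite_family_bounded2[of "\<lambda>a b. pd a (g b)", OF pgc bsupp_partial[OF g(2)]] by metis
 have bm: "bounded_matrix (\<lambda>a b. pd a (g b)) C"
  by unfold_locales (rule cont_borel[OF pgc], rule C)
 have C_nonneg: "0 \<le> C" using C[of 0 0 0] by linarith
 define L where "L = fnorm (\<lambda>i. lap (g i))"
 have L0: "0 \<le> L" by (simp add: L_def)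
 define B where "B = L + 18 * C + P"
 show ?thesis
 proof (intro exI[of _ B] conjI allI impI)
  show "0 \<le> B" using L0 C_nonneg P(1) by (simp add: B_def)
  fix U Ut p T E s s' assume sol: "nse_solution U Ut p T E" and s: "s \<in> {0..T}" "s' \<in> {0..T}"
  interpret nse_solution U Ut p T E by (rule sol)
  let ?D = "fnorm (\<lambda>i x. U i s x - U i s' x)"
  let ?q = "\<lambda>t. LBINT x. p t x * (\<Oplus>i. pd i (g i) x)"
  let ?l = "\<lambda>t. \<Oplus>i. LBINT x. U i t x * lap (g i) x"
  let ?a = "\<lambda>t. \<Oplus>i. LBINT x. Ut i t x * g i x"
  have eq: "?a t = ?l t + stress t (\<lambda>a b. pd a (g b)) + ?q t" if t: "t \<in> {0..T}" for t
  proof -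
   have "(LBINT x. pd i (p t) x * g i x) = - (LBINT x. p t x * pd i (g i) x)" for i
    using integral_by_parts[OF Ckp[OF t], of "g i" i] g1 g(2) by simp
   then have "(\<Oplus>i. LBINT x. pd i (p t) x * g i x) = - (\<Oplus>i. LBINT x. p t x * pd i (g i) x)"
    by (simp add: sum_negf)
   also have "(\<Oplus>i. LBINT x. p t x * pd i (g i) x) = ?q t"
    unfolding sum_distrib_left
    by (rule Bochner_Integration.integral_sum[symmetric])
     (intro integrable_cs continuous_intros pgc contp[OF t] bsupp_mult2 bsupp_partial g)
   finally have pr: "(\<Oplus>i. LBINT x. pd i (p t) x * g i x) = - ?q t" .
   have st: "stress t (\<lambda>a b. pd a (g b)) = (\<Oplus>i. \<Oplus>j. LBINT x. U j t x * U i t x * pd j (g i) x)"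
    unfolding stress_bform bform_def by (rule sum.swap)
   show ?thesis unfolding st
    by (simp only: momentum_test[OF t g1(2) g(2)] sum_subtractf sum.distrib pr diff_minus_eq_add)
  qed
  note u = U_L2(1)[OF s(1)] U_L2(1)[OF s(2)]
  have d: "L2_field (\<lambda>i x. U i s x - U i s' x)" by (rule L2_field_diff[OF u])
  have "?l s - ?l s' = (LBINT x. (\<Oplus>i. (U i s x - U i s' x) * lap (g i) x))"
   using field_product[OF u(1) lL] field_product[OF u(2) lL] by (simp add: left_diff_distrib sum_subtractf)
  then have 1: "\<bar>?l s - ?l s'\<bar> \<le> ?D * L" using field_Cauchy_Schwarz[OF d lL] unfolding L_def by simp
  have 2: "\<bar>stress s (\<lambda>a b. pd a (g b)) - stress s' (\<lambda>a b. pd a (g b))\<bar> \<le> 18 * C * E * ?D"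
   by (rule stress_difference[OF s bm])
  have 3: "\<bar>?q s - ?q s'\<bar> \<le> P * E * ?D" by (rule P(2)[OF sol s])
  have "\<bar>?a s - ?a s'\<bar> \<le> ?D * L + 18 * C * E * ?D + P * E * ?D"
   unfolding eq[OF s(1)] eq[OF s(2)] using 1 2 3 by linarith
  also have "\<dots> = (L + 18 * C * E + P * E) * ?D" by (simp add: algebra_simps)
  also have "\<dots> \<le> B * (1 + E) * ?D"
   using L0 C_nonneg P(1) E by (intro mult_right_mono) (auto simp: B_def algebra_simps)
  finally show "\<bar>?a s - ?a s'\<bar> \<le> B * (1 + E) * ?D" .
 qed
qed

section \<open>Second differences in time\<close>

lemma second_difference_le:
 fixes f :: "real \<Rightarrow> real"
 assumes t: "0 \<le> t" "2 * t \<le> T" and f: "\<And>s. s \<in> {0..T} \<Longrightarrow> (f has_real_derivative f' s) (at s within {0..T})"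
  and d: "\<And>s s'. s \<in> {0..2 * t} \<Longrightarrow> s' \<in> {0..2 * t} \<Longrightarrow> \<bar>f' s - f' s'\<bar> \<le> K"
 shows "\<bar>f 0 - 2 * f t + f (2 * t)\<bar> \<le> K * t"
proof -
 have mvt: "\<exists>x\<in>{a..b}. f b - f a = f' x * (b - a)" if ab: "0 \<le> a" "a \<le> b" "b \<le> 2 * t" for a b
 proof (rule mvt_very_simple[OF ab(2), where f' = "\<lambda>x h. f' x * h"])
  fix x assume x: "a \<le> x" "x \<le> b"
  have "(f has_real_derivative f' x) (at x within {a..b})"
   by (rule DERIV_subset[OF f]) (use x ab t in auto)
  then show "(f has_derivative (\<lambda>h. f' x * h)) (at x within {a..b})"
   by (simp add: has_field_derivative_def)
 qed
 obtain x where x: "x \<in> {0..t}" "f t - f 0 = f' x * t" using mvt[of 0 t] t by auto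
 obtain y where y: "y \<in> {t..2 * t}" "f (2 * t) - f t = f' y * t" using mvt[of t "2 * t"] t by auto
 have "\<bar>f' y - f' x\<bar> * t \<le> K * t"
  by (rule mult_right_mono[OF d t(1)]) (use x y t in auto)
 moreover have "f 0 - 2 * f t + f (2 * t) = (f' y - f' x) * t" using x(2) y(2) by (simp add: algebra_simps)
 ultimately show ?thesis using t by (simp add: abs_mult)
qed

text \<open>\<open>D\<close> bounds the variation of the velocity over \<open>{0..2 * t}\<close>.
  For the packets both \<open>D\<close> is \<open>O(1/N)\<close> and \<open>t\<close> is
  \<open>N^-2\<close>, so linear observables contribute \<open>O(N^-3)\<close>, less than the signal
  \<open>N^-2\<close>.\<close>

lemma linear_second_difference:
 fixes g :: "3 \<Rightarrow> real^3 \<Rightarrow> real"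
 assumes g: "\<And>i. Ck 3 (g i)" "\<And>i. bsupp (g i)"
 shows "\<exists>B\<ge>0. \<forall>U Ut p T E t D. nse_solution U Ut p T E \<longrightarrow> 0 \<le> t \<longrightarrow> 2 * t \<le> T \<longrightarrow>
  (\<forall>s s'. s \<in> {0..2 * t} \<longrightarrow> s' \<in> {0..2 * t} \<longrightarrow> fnorm (\<lambda>i x. U i s x - U i s' x) \<le> D) \<longrightarrow>
  \<bar>(\<Oplus>i. LBINT x. U i 0 x * g i x) - 2 * (\<Oplus>i. LBINT x. U i t x * g i x)
   + (\<Oplus>i. LBINT x. U i (2 * t) x * g i x)\<bar> \<le> B * (1 + E) * D * t"
proof -
 obtain B where B: "0 \<le> B" "\<And>U Ut p T E s s'. nse_solution U Ut p T E \<Longrightarrow> s \<in> {0..T} \<Longrightarrow> s' \<in> {0..T} \<Longrightarrow>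
  \<bar>(\<Oplus>i. LBINT x. Ut i s x * g i x) - (\<Oplus>i. LBINT x. Ut i s' x * g i x)\<bar>
   \<le> B * (1 + E) * fnorm (\<lambda>i x. U i s x - U i s' x)"
  using acceleration_difference[of g, OF g] by (elim exE conjE) (rule that, assumption, simp)
 show ?thesis
 proof (intro exI[of _ B] conjI allI impI)
  show "0 \<le> B" by (rule B(1))
  fix U Ut p T E t D assume sol: "nse_solution U Ut p T E" and t: "0 \<le> t" "2 * t \<le> T"
   and D: "\<forall>s s'. s \<in> {0..2 * t} \<longrightarrow> s' \<in> {0..2 * t} \<longrightarrow> fnorm (\<lambda>i x. U i s x - U i s' x) \<le> D"
  interpret nse_solution U Ut p T E by (rule sol)
  show "\<bar>(\<Oplus>i. LBINT x. U i 0 x * g i x) - 2 * (\<Oplus>i. LBINT x. U i t x * g i x)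
   + (\<Oplus>i. LBINT x. U i (2 * t) x * g i x)\<bar> \<le> B * (1 + E) * D * t"
  proof (rule second_difference_le[OF t])
   show "((\<lambda>s. \<Oplus>i. LBINT x. U i s x * g i x) has_real_derivative (\<Oplus>i. LBINT x. Ut i s x * g i x)) (at s within {0..T})"
    if "s \<in> {0..T}" for s
    by (intro DERIV_sum time_derivative_test that Ck_cont[OF g(1)] g(2))
   fix s s' assume s: "s \<in> {0..2 * t}" "s' \<in> {0..2 * t}"
   have "\<bar>(\<Oplus>i. LBINT x. Ut i s x * g i x) - (\<Oplus>i. LBINT x. Ut i s' x * g i x)\<bar>
    \<le> B * (1 + E) * fnorm (\<lambda>i x. U i s x - U i s' x)"
    by (rule B(2)[OF sol]) (use s t in auto)
   also have "\<dots> \<le> B * (1 + E) * D" by (intro mult_left_mono D[rule_format] s) (use B(1) E in auto)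
   finally show "\<bar>(\<Oplus>i. LBINT x. Ut i s x * g i x) - (\<Oplus>i. LBINT x. Ut i s' x * g i x)\<bar> \<le> B * (1 + E) * D" .
  qed
 qed
qed

section \<open>Oscillating fields\<close>

text \<open>The \<open>j\<close>-th derivative of \<open>exp (- (1/x))\<close> for positive
  \<open>x\<close> is \<open>P (1/x) * exp (- (1/x))\<close> for a polynomial \<open>P\<close>; with
  \<open>y = 1/x\<close>, differentiation sends \<open>P\<close> to
  \<open>y^2 (P - P')\<close>.\<close>

fun flat_poly :: "nat \<Rightarrow> real poly" where
 "flat_poly 0 = 1"
| "flat_poly (Suc j) = monom 1 2 * (flat_poly j - pderiv (flat_poly j))"

definition flat :: "nat \<Rightarrow> real \<Rightarrow> real" where
 "flat j x = (if 0 < x then poly (flat_poly j) (1/x) * exp (- (1/x)) else 0)"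

lemma poly_exp_limit: "((\<lambda>y. poly p y / exp y) \<longlongrightarrow> 0) (at_top :: real filter)"
proof -
 have "((\<lambda>y. \<Sum>i\<le>degree p. coeff p i * (y ^ i / exp y)) \<longlongrightarrow> (\<Sum>i\<le>degree p. coeff p i * 0)) (at_top :: real filter)"
  by (intro tendsto_sum tendsto_mult_left tendsto_power_div_exp_0)
 then show ?thesis by (simp add: poly_altdef sum_divide_distrib)
qed

lemma poly_exp_at_0: "((\<lambda>x. poly p (1/x) * exp (- (1/x))) \<longlongrightarrow> 0) (at_right (0::real))"
proof -
 have "filterlim (\<lambda>x::real. 1/x) at_top (at_right 0)"
  using filterlim_inverse_at_top_right by (simp add: inverse_eq_divide)
 from filterlim_compose[OF poly_exp_limit this] show ?thesis
  by (simp add: exp_minus divide_inverse)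
qed

lemma flat_deriv: "(flat j has_real_derivative flat (Suc j) x) (at x)"
proof (cases "x = 0")
 case False
 show ?thesis
 proof (cases "0 < x")
  case True
  have "((\<lambda>x. poly (flat_poly j) (1/x) * exp (- (1/x))) has_real_derivative
   poly (flat_poly j) (1/x) * (exp (- (1/x)) * (1/x^2)) + poly (pderiv (flat_poly j)) (1/x) * (- 1/x^2) * exp (- (1/x))) (at x)"
   using True
   by (auto intro!: derivative_eq_intros DERIV_chain'[OF _ poly_DERIV] simp: power2_eq_square field_simps)
  also have "poly (flat_poly j) (1/x) * (exp (- (1/x)) * (1/x^2)) + poly (pderiv (flat_poly j)) (1/x) * (- 1/x^2) * exp (- (1/x)) = flat (Suc j) x"
   using True by (simp add: flat_def poly_monom power_divide algebra_simps)
  finally show ?thesis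
   by (rule has_field_derivative_transform_within_open[OF _ open_greaterThan[of 0]]) (use True in \<open>auto simp: flat_def\<close>)
 next
  case False
  then have "x < 0" using \<open>x \<noteq> 0\<close> by simp
  then have "(flat j has_real_derivative 0) (at x)"
   by (intro has_field_derivative_transform_within_open[OF DERIV_const open_lessThan[of 0]]) (auto simp: flat_def)
  then show ?thesis using False by (simp add: flat_def)
 qed
next
 case True
 have "((\<lambda>y. (flat j y - flat j 0) / (y - 0)) \<longlongrightarrow> 0) (at 0)"
  unfolding at_eq_sup_left_right
 proof (rule filterlim_sup)
  show "((\<lambda>y. (flat j y - flat j 0) / (y - 0)) \<longlongrightarrow> 0) (at_left 0)"
   by (rule tendsto_eventually) (auto simp: flat_def eventually_at_left_field intro: exI[of _ "-1"])
  have "\<forall>\<^sub>F y in at_right 0. poly (monom 1 1 * flat_poly j) (1/y) * exp (- (1/y)) = (flat j y - flat j 0) / (y - 0)"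
   by (auto simp: flat_def eventually_at_right_field poly_monom intro: exI[of _ "1"])
  from Lim_transform_eventually[OF poly_exp_at_0 this]
  show "((\<lambda>y. (flat j y - flat j 0) / (y - 0)) \<longlongrightarrow> 0) (at_right 0)" .
 qed
 then show ?thesis using True by (simp add: has_field_derivative_iff flat_def)
qed

lemma Ck_flat: "Ck k (flat 0)"
 by (rule Ck_real_derivI[of k flat]) (auto intro!: flat_deriv DERIV_continuous_on[OF DERIV_subset[OF flat_deriv]])

lemma Ck_sin: "Ck k (sin :: real \<Rightarrow> real)" and Ck_cos: "Ck k (cos :: real \<Rightarrow> real)"
proof -
 define D where "D \<omega> j x = sin (x + \<omega> + real j * (pi/2))" for \<omega> x :: real and j
 have "(D \<omega> j has_real_derivative D \<omega> (Suc j) x) (at x)" for \<omega> j x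
 proof -
  have "x + \<omega> + real (Suc j) * (pi/2) = (x + \<omega> + real j * (pi/2)) + pi/2" by (simp add: distrib_right)
  then have "D \<omega> (Suc j) x = sin ((x + \<omega> + real j * (pi/2)) + pi/2)" by (simp only: D_def)
  also have "\<dots> = cos (x + \<omega> + real j * (pi/2))" by (subst sin_add) simp
  finally have "D \<omega> (Suc j) x = cos (x + \<omega> + real j * (pi/2))" .
  then show ?thesis unfolding D_def by (auto intro!: derivative_eq_intros)
 qed
 moreover have "cont (D \<omega> k)" for \<omega> unfolding D_def by (intro continuous_intros)
 ultimately have "Ck k (D \<omega> 0)" for \<omega> by (intro Ck_real_derivI)
 from this[of 0] this[of "pi/2"] show "Ck k (sin :: real \<Rightarrow> real)" "Ck k (cos :: real \<Rightarrow> real)"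
  unfolding D_def by (simp_all add: sin_add)
qed

text \<open>The datum is a sum of packets and must be smooth, so their envelope needs all
  derivatives; the profiles behind \<open>cutoff\<close> and \<open>newt\<close> are established
  only at finite order.\<close>

definition bump :: "real^3 \<Rightarrow> real^3 \<Rightarrow> real" where
 "bump c x = flat 0 (1 - (x - c) \<bullet> (x - c))"

lemma Ck_bump: "Ck k (bump c)"
 unfolding bump_def
 by (intro Ck_comp_real[OF Ck_flat] Ck_diff Ck_const Ck_bilinear[OF bounded_bilinear_inner] Ck_ident)

lemma bump_outside: "1 < norm (x - c) \<Longrightarrow> bump c x = 0"
 using power_strict_mono[of 1 "norm (x - c)" 2] by (simp add: bump_def flat_def power2_norm_eq_inner)

lemma bump_center: "bump c c \<noteq> 0"
 by (simp add: bump_def flat_def)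

lemma supp_partial:
 fixes f :: "real^3 \<Rightarrow> real"
 assumes "\<And>x. 1 < norm (x - c) \<Longrightarrow> f x = 0" "1 < norm (x - c)" shows "pd j f x = 0"
proof -
 have o: "open {x. 1 < norm (x - c)}" by (intro open_Collect_less continuous_intros)
 have "pd j f x = pd j (\<lambda>x. 0) x" by (rule partial_cong_open[OF o]) (use assms in auto)
 then show ?thesis by simp
qed

lemma bsupp_unit:
 fixes f :: "real^3 \<Rightarrow> real"
 assumes "\<And>x. 1 < norm (x - c) \<Longrightarrow> f x = 0" shows "bsupp f"
proof (rule bsuppI)
 fix x :: "real^3" assume "1 + norm c < norm x"
 then have "1 < norm (x - c)" using norm_triangle_ineq2[of x c] by linarith
 then show "f x = 0" by (rule assms)
qed

text \<open>Derivatives of the oscillating stream function stay in this class, at the cost of factors \<open>N\<close>.\<close>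

definition osc :: "real \<Rightarrow> real \<Rightarrow> (real^3 \<Rightarrow> real) \<Rightarrow> (real^3 \<Rightarrow> real) \<Rightarrow> real^3 \<Rightarrow> real" where
 "osc N \<omega> a c x = a x * sin (N * x $ 2 + \<omega>) + c x * cos (N * x $ 2 + \<omega>)"

lemma Ck_osc: "Ck k a \<Longrightarrow> Ck k c \<Longrightarrow> Ck k (osc N \<omega> a c)"
 unfolding osc_def
 by (intro Ck_add Ck_mult Ck_comp_real[OF Ck_sin] Ck_comp_real[OF Ck_cos] Ck_const Ck_coord)

lemma osc_le: "\<bar>osc N \<omega> a c x\<bar> \<le> \<bar>a x\<bar> + \<bar>c x\<bar>"
proof -
 have "\<bar>osc N \<omega> a c x\<bar> \<le> \<bar>a x\<bar> * \<bar>sin (N * x $ 2 + \<omega>)\<bar> + \<bar>c x\<bar> * \<bar>cos (N * x $ 2 + \<omega>)\<bar>"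
  unfolding osc_def abs_mult[symmetric] by (rule abs_triangle_ineq)
 also have "\<dots> \<le> \<bar>a x\<bar> * 1 + \<bar>c x\<bar> * 1" by (intro add_mono mult_left_mono) auto
 finally show ?thesis by simp
qed

lemma partial_osc:
 assumes a: "Ck 1 a" and c: "Ck 1 c"
 shows "pd j (osc N \<omega> a c) = osc N \<omega> (\<lambda>x. pd j a x - (if j = 2 then N * c x else 0)) (\<lambda>x. pd j c x + (if j = 2 then N * a x else 0))"
proof -
 let ?l = "\<lambda>x::real^3. N * x $ 2 + \<omega>"
 have l: "Ck 1 ?l" by (intro Ck_add Ck_mult Ck_const Ck_coord)
 have pl: "pd j ?l = (\<lambda>x. if j = 2 then N else 0)"
  by (subst partial_add[OF Ck_mult[OF Ck_const Ck_coord] Ck_const], subst partial_cmult[OF Ck_coord]) (simp add: partial_coord fun_eq_iff)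
 have ps: "pd j (\<lambda>x. sin (?l x)) = (\<lambda>x. cos (?l x) * (if j = 2 then N else 0))"
  by (subst partial_comp_real[OF DERIV_sin l]) (simp add: pl)
 have pc: "pd j (\<lambda>x. cos (?l x)) = (\<lambda>x. - sin (?l x) * (if j = 2 then N else 0))"
  by (subst partial_comp_real[OF DERIV_cos l]) (simp add: pl)
 have Cs: "Ck 1 (\<lambda>x. sin (?l x))" "Ck 1 (\<lambda>x. cos (?l x))"
  by (rule Ck_comp_real[OF Ck_sin l] Ck_comp_real[OF Ck_cos l])+
 show ?thesis
  unfolding osc_def partial_add[OF Ck_mult[OF a Cs(1)] Ck_mult[OF c Cs(2)]] partial_mult[OF a Cs(1)] partial_mult[OF c Cs(2)] ps pc
  by (simp add: fun_eq_iff algebra_simps)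
qed

section \<open>The kernel of the observed pressure gradient\<close>

definition kernel :: "3 \<Rightarrow> 3 \<Rightarrow> real^3 \<Rightarrow> real" where
 "kernel a b = pd b (pd a (pd 1 newt))"

lemma Ck_kernel: "Ck 3 (kernel a b)"
 unfolding kernel_def by (rule Ck_newt_partial)

lemma kernel_continuous: "cont (kernel a b)"
 by (rule Ck_cont[OF Ck_kernel])

lemma kernel_bounded: obtains C where "0 < C" "bounded_matrix kernel C"
proof -
 obtain C where "0 < C" "\<And>i j k x. \<bar>pd k (pd j (pd i newt)) x\<bar> \<le> C"
  using third_newt_bounded by metis
 then show thesis
  by (intro that[of C]) (auto simp: bounded_matrix_def kernel_def intro!: cont_borel kernel_continuous[unfolded kernel_def])
qed

lemma kernel_sym: "kernel a b = kernel b a"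
 unfolding kernel_def
 by (rule partial_commute) (rule Ck_on_mono[OF Ck_newt_partial(1)], simp)

text \<open>Away from the unit ball the kernel is the third derivative of
  \<open>1 / \<bar>x\<bar>\<close> along the first axis, \<open>(9 s - 15 x1^2) x1 / s^(7/2)\<close>
  with \<open>s = x \<bullet> x\<close>. Near the positive axis, with \<open>x1\<close> at least 2
  and the other coordinates in the unit disc, \<open>9 s \<le> 9 x1^2 + 9\<close> is smaller than
  \<open>15 x1^2\<close>.\<close>

lemma kernel_11_neg:
 assumes a: "3 \<le> a" and x: "norm (x - axis 1 a) \<le> 1"
 shows "kernel 1 1 x < 0"
proof -
 have s: "x \<bullet> x = (x$1)^2 + (x$2)^2 + (x$3)^2" by (simp add: inner_vec_def sum_3 power2_eq_square)
 have "(norm (x - axis 1 a))^2 \<le> 1" using x by (simp add: power_le_one)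
 then have n: "(x$1 - a)^2 + (x$2)^2 + (x$3)^2 \<le> 1" by (simp add: norm_vec_sq sum_3 axis_def)
 have "(x$1 - a)^2 \<le> 1" using n zero_le_power2[of "x$2"] zero_le_power2[of "x$3"] by linarith
 then have "\<bar>x$1 - a\<bar> \<le> 1" by (simp add: abs_square_le_1)
 then have x1: "2 \<le> x$1" using a by linarith
 then have x1sq: "4 \<le> (x$1)^2" using power_mono[of 2 "x$1" 2] by simp
 have x23: "(x$2)^2 + (x$3)^2 \<le> 1" using n zero_le_power2[of "x$1 - a"] by linarith
 let ?s = "x \<bullet> x"
 have s1: "1 \<le> ?s" unfolding s using x1sq zero_le_power2[of "x$2"] zero_le_power2[of "x$3"] by linarith
 then have s0: "0 < ?s" by linarith
 have g: "gam 2 ?s = 3/4 * ?s * ?s powr (- 7/2)" "gam 3 ?s = - 15/8 * ?s powr (- 7/2)"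
 proof -
  have "?s powr (- 5/2) = ?s powr (1 + - 7/2)" by simp
  also have "\<dots> = ?s * ?s powr (- 7/2)" using s0 by (simp only: powr_add powr_one)
  finally show "gam 2 ?s = 3/4 * ?s * ?s powr (- 7/2)"
   using gam_outside[OF s1, of 2] pochhammer_half(3) by simp
  show "gam 3 ?s = - 15/8 * ?s powr (- 7/2)"
   using gam_outside[OF s1, of 3] pochhammer_half(4) by simp
 qed
 have "kernel 1 1 x = (12 * gam 2 ?s + 8 * gam 3 ?s * (x$1)^2) * x$1"
  by (simp add: kernel_def partial3_newt power2_eq_square algebra_simps)
 also have "12 * gam 2 ?s + 8 * gam 3 ?s * (x$1)^2 = (9 * ?s - 15 * (x$1)^2) * ?s powr (- 7/2)"
  unfolding g by (simp add: algebra_simps)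
 finally have "kernel 1 1 x = (9 * ?s - 15 * (x$1)^2) * (?s powr (- 7/2) * x$1)" by (simp add: mult.assoc)
 moreover have "9 * ?s - 15 * (x$1)^2 < 0" unfolding s using x1sq x23 by simp
 moreover have "0 < ?s powr (- 7/2) * x$1" using s0 x1 by simp
 ultimately show ?thesis by (simp add: mult_neg_pos)
qed

text \<open>The terms of order \<open>N^2\<close> cancel and only \<open>N\<close> times a
  derivative of the amplitudes survives. For amplitudes of size \<open>1/N\<close> the defect from
  being an eigenfunction is bounded.\<close>

lemma laplacian_osc:
 assumes a: "Ck 2 a" and c: "Ck 2 c"
 shows "lap (osc N \<omega> a c) x + N^2 * osc N \<omega> a c x
  = osc N \<omega> (\<lambda>x. lap a x - 2 * N * pd 2 c x) (\<lambda>x. lap c x + 2 * N * pd 2 a x) x"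
proof -
 have 1: "Ck 1 a" "Ck 1 c" by (rule Ck_on_mono[OF a] Ck_on_mono[OF c], simp)+
 have 2: "Ck (Suc 1) a" "Ck (Suc 1) c" using a c by (simp_all add: numeral_2_eq_2)
 have p1: "Ck 1 (pd j a)" "Ck 1 (pd j c)" for j
  using Ck_partial[OF 2(1)] Ck_partial[OF 2(2)] by auto
 let ?A = "\<lambda>j x. pd j a x - (if j = 2 then N * c x else 0)"
 let ?C = "\<lambda>j x. pd j c x + (if j = 2 then N * a x else 0)"
 have Nc: "Ck 1 (\<lambda>x. if P then N * f x else 0)"
  "pd j (\<lambda>x. if P then N * f x else 0) = (\<lambda>x. if P then N * pd j f x else 0)" if "Ck 1 f" for P f j
  using Ck_mult[OF Ck_const that, of N] partial_cmult[OF that, of j N] by (cases P; simp)+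
 have A1: "Ck 1 (?A j)" "Ck 1 (?C j)" for j
  by (rule Ck_diff[OF p1(1) Nc(1)[OF 1(2)]] Ck_add[OF p1(2) Nc(1)[OF 1(1)]])+
 have dA: "pd j (?A j) x = pd j (pd j a) x - (if j = 2 then N * pd j c x else 0)" for j x
  by (simp only: partial_diff[OF p1(1) Nc(1)[OF 1(2)]] Nc(2)[OF 1(2)])
 have dC: "pd j (?C j) x = pd j (pd j c) x + (if j = 2 then N * pd j a x else 0)" for j x
  by (simp only: partial_add[OF p1(2) Nc(1)[OF 1(1)]] Nc(2)[OF 1(1)])
 have "pd j (pd j (osc N \<omega> a c)) x = osc N \<omega> (pd j (pd j a)) (pd j (pd j c)) x
  + (if j = 2 then osc N \<omega> (\<lambda>x. - 2 * N * pd 2 c x) (\<lambda>x. 2 * N * pd 2 a x) x - N\<^sup>2 * osc N \<omega> a c x else 0)" for j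
  unfolding partial_osc[OF 1] partial_osc[OF A1]
  by (simp add: osc_def dA dC power2_eq_square algebra_simps)
 then show ?thesis
  by (simp add: laplacian_sum sum.distrib) (simp add: osc_def sum_distrib_right sum.distrib algebra_simps)
qed

text \<open>A continuous majorant of the indicator of a unit ball, used to turn pointwise bounds for
  packets into bounds for \<open>fnorm\<close>.\<close>

definition unit_plateau :: "real^3 \<Rightarrow> real^3 \<Rightarrow> real" where
 "unit_plateau c x = cutoff 1 1 (x - c)"

lemma unit_plateau: "cont (unit_plateau c)" "bsupp (unit_plateau c)"
proof -
 show "cont (unit_plateau c)"
  unfolding unit_plateau_def by (rule continuous_on_compose2[OF cont_cutoff]) (auto intro: continuous_intros)
 show "bsupp (unit_plateau c)"
  using bsupp_scale[OF cutoff_bsupp[of 1 1], of 1 c] by (simp add: unit_plateau_def[abs_def])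
qed

lemma fnorm_unit_le:
 fixes f :: "3 \<Rightarrow> real^3 \<Rightarrow> real"
 assumes "0 \<le> m" "\<And>i x. \<bar>f i x\<bar> \<le> m" "\<And>i x. 1 < norm (x - c) \<Longrightarrow> f i x = 0"
 shows "fnorm f \<le> m * fnorm (\<lambda>i::3. unit_plateau c)"
proof (rule fnorm_le)
 show "L2_field (\<lambda>i::3. unit_plateau c)" by (rule L2_field_cs) (rule unit_plateau)+
 show "\<bar>f i x\<bar> \<le> m * \<bar>unit_plateau c x\<bar>" for i x
 proof (cases "norm (x - c) \<le> 1")
  case True
  then have "unit_plateau c x = 1" unfolding unit_plateau_def by (intro cutoff_inside) auto
  then show ?thesis using assms(2) by simp
 next
  case False
  then show ?thesis using assms by simp
 qed
qed (rule assms)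

text \<open>A packet of frequency \<open>N\<close> whose values are small in L^2 and whose gradient
  is merely bounded. The bound on \<open>lap (b i) + N^2 b i\<close> says that up to a bounded force
  the packet decays like \<open>exp (- N^2 t)\<close> under the heat flow; the last line is the
  signal it leaves in the pressure. \<open>C\<close> and \<open>q\<close> will not depend on
  \<open>N\<close>.\<close>

definition oscillating :: "real^3 \<Rightarrow> real \<Rightarrow> real \<Rightarrow> real \<Rightarrow> (3 \<Rightarrow> real^3 \<Rightarrow> real) \<Rightarrow> bool" where
 "oscillating c C q N b \<longleftrightarrow>
  (\<forall>i k. Ck k (b i)) \<and> (\<forall>i x. 1 < norm (x - c) \<longrightarrow> b i x = 0) \<and>
  (\<forall>x. (\<Oplus>i. pd i (b i) x) = 0) \<and>
  (\<forall>i x. \<bar>b i x\<bar> \<le> C) \<and> (\<forall>i j x. \<bar>pd j (b i) x\<bar> \<le> C) \<and>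
  fnorm b \<le> C / N \<and> (\<forall>j. fnorm (\<lambda>i. pd j (b i)) \<le> C) \<and>
  fnorm (\<lambda>i x. lap (b i) x + N^2 * b i x) \<le> C \<and>
  bform kernel b b \<le> - q / N^2 + C / N ^ 3"

text \<open>The packet is \<open>(pd 2 \<psi>, - pd 1 \<psi>, 0)\<close> for the stream function
  \<open>\<psi> = \<eta> sin (N x2 + \<omega>) / N^2\<close>, hence divergence-free. Its leading
  part \<open>\<eta> cos (N x2 + \<omega>) / N\<close> points along the first axis, so to leading
  order only \<open>kernel 1 1\<close>, which is negative on the support, enters the form.\<close>

lemma oscillating_field:
 assumes a: "3 \<le> a"
 obtains C q where "0 < C" "0 < q" "\<And>N. 1 \<le> N \<Longrightarrow> \<exists>b. oscillating (axis 1 a) C q N b"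
proof -
 define c :: "real^3" where "c = axis 1 a"
 define \<eta> where "\<eta> = bump c"
 define \<alpha> :: "3 \<Rightarrow> real^3 \<Rightarrow> real" where "\<alpha> i = (if i = 1 then pd 2 \<eta> else if i = 2 then (\<lambda>x. - pd 1 \<eta> x) else (\<lambda>x. 0))" for i
 define \<beta> :: "3 \<Rightarrow> real^3 \<Rightarrow> real" where "\<beta> i = (if i = 1 then \<eta> else (\<lambda>x. 0))" for i
 have C\<eta>: "Ck k \<eta>" for k unfolding \<eta>_def by (rule Ck_bump)
 have Cp\<eta>: "Ck k (pd j \<eta>)" for j k by (rule Ck_partial[OF C\<eta>])
 have s\<eta>: "\<eta> x = 0" if "1 < norm (x - c)" for x unfolding \<eta>_def by (rule bump_outside[OF that])
 have sp\<eta>: "pd j \<eta> x = 0" if "1 < norm (x - c)" for x j by (rule supp_partial[OF s\<eta> that])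
 have C\<alpha>: "Ck k (\<alpha> i)" "Ck k (\<beta> i)" for k i
  by (auto simp: \<alpha>_def \<beta>_def intro: C\<eta> Cp\<eta> Ck_minus)
 have s\<alpha>: "\<alpha> i x = 0" "\<beta> i x = 0" if "1 < norm (x - c)" for i x
  using s\<eta>[OF that] sp\<eta>[OF that] by (auto simp: \<alpha>_def \<beta>_def)
 have b\<alpha>: "bsupp (\<alpha> i)" "bsupp (\<beta> i)" for i by (rule bsupp_unit[of c], erule s\<alpha>)+
 have Cp: "Ck k (pd j (\<alpha> i))" "Ck k (pd j (\<beta> i))"
  "Ck k (pd l (pd j (\<alpha> i)))" "Ck k (pd l (pd j (\<beta> i)))" for k i j l
  by (intro Ck_partial C\<alpha>)+
 obtain D0 where D0: "0 < D0" "\<And>i x. \<bar>\<alpha> i x\<bar> \<le> D0"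
  using finite_family_bounded[of \<alpha>, OF Ck_cont[OF C\<alpha>(1)] b\<alpha>(1)] by metis
 obtain D1 where D1: "0 < D1" "\<And>i x. \<bar>\<beta> i x\<bar> \<le> D1"
  using finite_family_bounded[of \<beta>, OF Ck_cont[OF C\<alpha>(2)] b\<alpha>(2)] by metis
 obtain D2 where D2: "0 < D2" "\<And>i j x. \<bar>pd j (\<alpha> i) x\<bar> \<le> D2"
  using finite_family_bounded2[of "\<lambda>i j. pd j (\<alpha> i)", OF Ck_cont[OF Cp(1)] bsupp_partial[OF b\<alpha>(1)]] by metis
 obtain D3 where D3: "0 < D3" "\<And>i j x. \<bar>pd j (\<beta> i) x\<bar> \<le> D3"
  using finite_family_bounded2[of "\<lambda>i j. pd j (\<beta> i)", OF Ck_cont[OF Cp(2)] bsupp_partial[OF b\<alpha>(2)]] by metis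
 obtain D4 where D4: "0 < D4" "\<And>i j x. \<bar>pd j (pd j (\<alpha> i)) x\<bar> \<le> D4"
  using finite_family_bounded2[of "\<lambda>i j. pd j (pd j (\<alpha> i))", OF Ck_cont[OF Cp(3)] bsupp_partial[OF bsupp_partial[OF b\<alpha>(1)]]] by metis
 obtain D5 where D5: "0 < D5" "\<And>i j x. \<bar>pd j (pd j (\<beta> i)) x\<bar> \<le> D5"
  using finite_family_bounded2[of "\<lambda>i j. pd j (pd j (\<beta> i))", OF Ck_cont[OF Cp(4)] bsupp_partial[OF bsupp_partial[OF b\<alpha>(2)]]] by metis
 define D where "D = D0 + D1 + D2 + D3 + D4 + D5"
 have D: "0 < D" "\<bar>\<alpha> i x\<bar> \<le> D" "\<bar>\<beta> i x\<bar> \<le> D" "\<bar>pd j (\<alpha> i) x\<bar> \<le> D" "\<bar>pd j (\<beta> i) x\<bar> \<le> D"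
  "\<bar>pd j (pd j (\<alpha> i)) x\<bar> \<le> D" "\<bar>pd j (pd j (\<beta> i)) x\<bar> \<le> D" for i j x
  using D0(1) D1(1) D2(1) D3(1) D4(1) D5(1) D0(2)[of i x] D1(2)[of i x] D2(2)[of j i x] D3(2)[of j i x]
   D4(2)[of j i x] D5(2)[of j i x] unfolding D_def by linarith+
 define Z where "Z = fnorm (\<lambda>i::3. unit_plateau c)"
 have Z0: "0 \<le> Z" by (simp add: Z_def)
 obtain K where K: "0 < K" "bounded_matrix kernel K" using kernel_bounded by metis
 interpret bounded_matrix kernel K by (rule K)
 \<comment> \<open>The factor 1/2 anticipates the mean value of the squared cosine.\<close>
 define q where "q = (LBINT x. - kernel 1 1 x * (\<eta> x)^2) / 2"
 have \<eta>c: "cont \<eta>" "bsupp \<eta>" using Ck_cont[OF C\<eta>] bsupp_unit[of c \<eta>] s\<eta> by auto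
 have q: "0 < q"
  unfolding q_def
 proof (rule divide_pos_pos[OF integral_pos])
  show "cont (\<lambda>x. - kernel 1 1 x * (\<eta> x)^2)" by (intro continuous_intros kernel_continuous \<eta>c)
  show "bsupp (\<lambda>x. - kernel 1 1 x * (\<eta> x)^2)" by (intro bsupp_mult2 bsupp_power \<eta>c) simp
  show "0 \<le> - kernel 1 1 x * (\<eta> x)^2" for x
   using kernel_11_neg[OF a, of x] s\<eta>[of x] by (cases "norm (x - c) \<le> 1") (auto simp: c_def mult_nonpos_nonneg)
  show "- kernel 1 1 c * (\<eta> c)^2 \<noteq> 0"
   using kernel_11_neg[OF a, of c] bump_center[of c] by (simp add: c_def \<eta>_def)
 qed simp
 \<comment> \<open>\<open>10 * D\<close> bounds the eigenfunction defect, two amplitudes of size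
   \<open>3 D + 2 D\<close>; 27 is 3 * 9, for the three forms that contain the lower order part
   \<open>r\<close>.\<close>
 define C where "C = 10 * D * (1 + Z) + 27 * K * D^2 * Z^2"
 have C: "0 < C" "10 * D \<le> C" "10 * D * Z \<le> C" "27 * K * D^2 * Z^2 \<le> C"
  unfolding C_def using D(1) Z0 K(1) by (auto simp: algebra_simps add_pos_nonneg)
 have main: "\<exists>b. oscillating c C q N b" if N: "1 \<le> N" for N
 proof -
  define J where "J \<omega> = (LBINT x. kernel 1 1 x * (\<eta> x * cos (N * x $ 2 + \<omega>))^2)" for \<omega>
  \<comment> \<open>Squared sine and cosine add up to 1, so the phases 0 and \<open>pi/2\<close>
    together give the full integral \<open>- 2 * q\<close>; one of them therefore gives at most
    \<open>- q\<close>, for every \<open>N\<close>.\<close>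
  have "J 0 + J (pi/2) = (LBINT x. kernel 1 1 x * (\<eta> x * cos (N * x $ 2 + 0))^2 + kernel 1 1 x * (\<eta> x * cos (N * x $ 2 + pi/2))^2)"
   unfolding J_def
   by (rule Bochner_Integration.integral_add[symmetric])
    (intro integrable_cs continuous_intros kernel_continuous \<eta>c bsupp_mult2[OF bsupp_power] bsupp_mult1, simp)+
  also have "(\<lambda>x. kernel 1 1 x * (\<eta> x * cos (N * x $ 2 + 0))^2 + kernel 1 1 x * (\<eta> x * cos (N * x $ 2 + pi/2))^2) = (\<lambda>x. - (- kernel 1 1 x * (\<eta> x)^2))"
  proof
   fix x :: "real^3"
   have "cos (y + pi/2) = - sin y" for y :: real by (simp add: cos_add)
   then have "(cos (y + 0))^2 + (cos (y + pi/2))^2 = 1" for y :: real by simp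
   from arg_cong[OF this[of "N * x $ 2"], of "\<lambda>z. kernel 1 1 x * (\<eta> x)^2 * z"]
   show "kernel 1 1 x * (\<eta> x * cos (N * x $ 2 + 0))^2 + kernel 1 1 x * (\<eta> x * cos (N * x $ 2 + pi/2))^2 = - (- kernel 1 1 x * (\<eta> x)^2)"
    by (simp add: power_mult_distrib algebra_simps)
  qed
  also have "(LBINT x. - (- kernel 1 1 x * (\<eta> x)^2)) = - 2 * q" unfolding q_def by simp
  finally obtain \<omega> where \<omega>: "J \<omega> \<le> - q" by (metis add_mono_thms_linordered_field(5) linorder_not_le mult_2 mult_minus_left minus_add_distrib less_irrefl)
  define A where "A i x = (1/N^2) * \<alpha> i x" for i x
  define B where "B i x = (1/N) * \<beta> i x" for i x
  define b where "b i = osc N \<omega> (A i) (B i)" for i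
  have CA: "Ck k (A i)" "Ck k (B i)" for i k
   unfolding A_def B_def by (intro Ck_mult Ck_const C\<alpha>)+
  have pA: "pd j (A i) = (\<lambda>x. (1/N^2) * pd j (\<alpha> i) x)" "pd j (B i) = (\<lambda>x. (1/N) * pd j (\<beta> i) x)" for i j
   unfolding A_def B_def by (rule partial_cmult, rule C\<alpha>)+
  have ppA: "pd k (pd j (A i)) = (\<lambda>x. (1/N^2) * pd k (pd j (\<alpha> i)) x)"
   "pd k (pd j (B i)) = (\<lambda>x. (1/N) * pd k (pd j (\<beta> i)) x)" for i j k
   unfolding pA by (rule partial_cmult, rule Cp)+
  have N2: "1 \<le> N^2" using N by simp
  have le: "\<bar>(1/N^2) * y\<bar> \<le> D" "\<bar>(1/N) * y\<bar> \<le> D" "\<bar>N * ((1/N^2) * y)\<bar> \<le> D" "\<bar>N * ((1/N) * y)\<bar> \<le> D"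
   "\<bar>(1/N^2) * y\<bar> \<le> D / N^2" "\<bar>(1/N) * y\<bar> \<le> D / N" if "\<bar>y\<bar> \<le> D" for y
  proof -
   have "1/N * \<bar>y\<bar> \<le> 1 * D" "1/N^2 * \<bar>y\<bar> \<le> 1 * D" using that N N2 D(1) by (intro mult_mono; simp)+
   then show "\<bar>(1/N^2) * y\<bar> \<le> D" "\<bar>(1/N) * y\<bar> \<le> D" "\<bar>N * ((1/N^2) * y)\<bar> \<le> D" using N by (simp_all add: abs_mult power2_eq_square)
   show "\<bar>N * ((1/N) * y)\<bar> \<le> D" "\<bar>(1/N^2) * y\<bar> \<le> D / N^2" "\<bar>(1/N) * y\<bar> \<le> D / N"
    using that N by (auto simp: abs_mult divide_right_mono)
  qed
  have Cb: "Ck k (b i)" for i k unfolding b_def by (intro Ck_osc CA)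
  have sb: "b i x = 0" if "1 < norm (x - c)" for i x using s\<alpha>[OF that] by (simp add: b_def osc_def A_def B_def)
  have sA: "A i x = 0" "B i x = 0" "pd j (A i) x = 0" "pd j (B i) x = 0" "lap (A i) x = 0" "lap (B i) x = 0"
   if "1 < norm (x - c)" for i j x
  proof -
   have 1: "A i x = 0" "B i x = 0" if "1 < norm (x - c)" for x using s\<alpha>[OF that] by (simp_all add: A_def B_def)
   have 2: "pd j (A i) x = 0" "pd j (B i) x = 0" if "1 < norm (x - c)" for x j by (rule supp_partial[OF 1(1) that] supp_partial[OF 1(2) that], assumption)+
   have 3: "pd j (pd j (A i)) x = 0" "pd j (pd j (B i)) x = 0" for j by (rule supp_partial[OF 2(1) that] supp_partial[OF 2(2) that], assumption)+
   show "A i x = 0" "B i x = 0" "pd j (A i) x = 0" "pd j (B i) x = 0" using 1[OF that] 2[OF that] by auto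
   show "lap (A i) x = 0" "lap (B i) x = 0" using 3 by (simp_all add: laplacian_sum)
  qed
  have pb: "pd j (b i) = osc N \<omega> (\<lambda>x. pd j (A i) x - (if j = 2 then N * B i x else 0)) (\<lambda>x. pd j (B i) x + (if j = 2 then N * A i x else 0))" for i j
   unfolding b_def by (rule partial_osc[OF CA])
  have pb_le: "\<bar>pd j (b i) x\<bar> \<le> 4 * D" for i j x
  proof -
   have "\<bar>pd j (A i) x\<bar> \<le> D" "\<bar>pd j (B i) x\<bar> \<le> D" "\<bar>N * A i x\<bar> \<le> D" "\<bar>N * B i x\<bar> \<le> D"
    unfolding pA A_def B_def by (rule le, rule D)+
   then have "\<bar>pd j (A i) x - (if j = 2 then N * B i x else 0)\<bar> \<le> 2 * D" "\<bar>pd j (B i) x + (if j = 2 then N * A i x else 0)\<bar> \<le> 2 * D"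
    using D(1) by (auto split: if_splits)
   then show ?thesis unfolding pb using osc_le[of N \<omega> "\<lambda>x. pd j (A i) x - (if j = 2 then N * B i x else 0)" "\<lambda>x. pd j (B i) x + (if j = 2 then N * A i x else 0)" x]
    by linarith
  qed
  have spb: "pd j (b i) x = 0" if "1 < norm (x - c)" for i j x by (rule supp_partial[OF sb that])
  have b_le: "\<bar>b i x\<bar> \<le> 2 * D / N" for i x
  proof -
   have "\<bar>A i x\<bar> \<le> D / N^2" "\<bar>B i x\<bar> \<le> D / N" unfolding A_def B_def by (rule le, rule D)+
   moreover have "D / N^2 \<le> D / N" using N D(1) by (intro divide_left_mono) (auto simp: power2_eq_square)
   ultimately show ?thesis unfolding b_def using osc_le[of N \<omega> "A i" "B i" x] by simp
  qed
  have lb: "lap (b i) x + N^2 * b i x = osc N \<omega> (\<lambda>x. lap (A i) x - 2 * N * pd 2 (B i) x) (\<lambda>x. lap (B i) x + 2 * N * pd 2 (A i) x) x" for i x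
   unfolding b_def by (rule laplacian_osc[OF CA])
  have lb_le: "\<bar>lap (b i) x + N^2 * b i x\<bar> \<le> 10 * D" for i x
  proof -
   have "\<bar>pd j (pd j (A i)) x\<bar> \<le> D" "\<bar>pd j (pd j (B i)) x\<bar> \<le> D" for j
    unfolding ppA by (rule le, rule D)+
   then have "\<bar>lap (A i) x\<bar> \<le> (\<Sum>j\<in>(UNIV::3 set). D)" "\<bar>lap (B i) x\<bar> \<le> (\<Sum>j\<in>(UNIV::3 set). D)"
    unfolding laplacian_sum by (intro order_trans[OF sum_abs] sum_mono; simp)+
   moreover have "\<bar>N * pd 2 (A i) x\<bar> \<le> D" "\<bar>N * pd 2 (B i) x\<bar> \<le> D"
    unfolding pA by (rule le, rule D)+
   ultimately have "\<bar>lap (A i) x - 2 * N * pd 2 (B i) x\<bar> \<le> 5 * D" "\<bar>lap (B i) x + 2 * N * pd 2 (A i) x\<bar> \<le> 5 * D"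
    by auto
   then show ?thesis unfolding lb using osc_le[of N \<omega> "\<lambda>x. lap (A i) x - 2 * N * pd 2 (B i) x" "\<lambda>x. lap (B i) x + 2 * N * pd 2 (A i) x" x]
    by linarith
  qed
  have slb: "lap (b i) x + N^2 * b i x = 0" if "1 < norm (x - c)" for i x
   unfolding lb osc_def using sA[OF that] by simp
  \<comment> \<open>\<open>b'\<close> is the leading part of order \<open>1/N\<close>;
    \<open>r\<close> is of order \<open>1/N^2\<close> and makes the field divergence-free.\<close>
  define b' where "b' i = osc N \<omega> (\<lambda>x. 0) (B i)" for i
  define r where "r i = osc N \<omega> (A i) (\<lambda>x. 0)" for i
  have b_split: "b i = (\<lambda>x. b' i x + r i x)" for i by (simp add: b_def b'_def r_def osc_def fun_eq_iff)
  have Cb': "Ck k (b' i)" "Ck k (r i)" for i k unfolding b'_def r_def by (intro Ck_osc CA Ck_const)+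
  have sb': "b' i x = 0" "r i x = 0" if "1 < norm (x - c)" for i x using sA[OF that] by (simp_all add: b'_def r_def osc_def)
  have bL: "L2_field b'" "L2_field r"
   by (intro L2_field_cs Ck_cont[OF Cb'(1)] Ck_cont[OF Cb'(2)] bsupp_unit[of c]; erule sb')+
  have nb': "fnorm b' \<le> (D / N) * Z" and nr: "fnorm r \<le> (D / N^2) * Z"
  proof -
   have "\<bar>A i x\<bar> \<le> D / N^2" "\<bar>B i x\<bar> \<le> D / N" for i x unfolding A_def B_def by (rule le, rule D)+
   then have "\<bar>b' i x\<bar> \<le> D / N" "\<bar>r i x\<bar> \<le> D / N^2" for i x
    unfolding b'_def r_def using osc_le[of N \<omega> "\<lambda>x. 0" "B i" x] osc_le[of N \<omega> "A i" "\<lambda>x. 0" x] by (auto intro: order_trans)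
   then show "fnorm b' \<le> (D / N) * Z" "fnorm r \<le> (D / N^2) * Z"
    unfolding Z_def using sb' D(1) N by (intro fnorm_unit_le; simp)+
  qed
  have split: "bform kernel b b = bform kernel b' b' + bform kernel b' r + (bform kernel r b' + bform kernel r r)"
   unfolding b_split using bform_add_left[OF bL L2_field_add[OF bL]] bform_add_right[OF bL bL(1)] bform_add_right[OF bL bL(2)] by simp
  have "bform kernel b' b' = (1/N^2) * J \<omega>"
  proof -
   have "b' i x = (if i = 1 then (1/N) * (\<eta> x * cos (N * x $ 2 + \<omega>)) else 0)" for i x
    by (simp add: b'_def osc_def B_def \<beta>_def)
   then have "bform kernel b' b' = (LBINT x. (1/N^2) * (kernel 1 1 x * (\<eta> x * cos (N * x $ 2 + \<omega>))^2))"
    by (simp add: bform_def sum_3 power2_eq_square mult_ac)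
   then show ?thesis by (simp add: J_def)
  qed
  also have "\<dots> \<le> (1/N^2) * (- q)" using \<omega> by (intro mult_left_mono) auto
  finally have main: "bform kernel b' b' \<le> - q / N^2" by simp
  have bb: "\<bar>bform kernel f g\<bar> \<le> 9 * K * (m * n)" if "L2_field f" "L2_field g" "fnorm f \<le> m" "fnorm g \<le> n" for f g m n
  proof -
   have "9 * K * (fnorm f * fnorm g) \<le> 9 * K * (m * n)"
    using that(3,4) order_trans[OF fnorm_nonneg that(3)] K(1) by (intro mult_left_mono mult_mono) auto
   then show ?thesis using bform_bound[OF that(1,2)] by linarith
  qed
  have e1: "(D / N * Z) * (D / N^2 * Z) = D^2 * Z^2 / N ^ 3"
   by (simp add: power2_eq_square eval_nat_numeral mult_ac)
  have e2: "(D / N^2 * Z) * (D / N * Z) = D^2 * Z^2 / N ^ 3"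
   by (simp add: power2_eq_square eval_nat_numeral mult_ac)
  have e3: "(D / N^2 * Z) * (D / N^2 * Z) \<le> D^2 * Z^2 / N ^ 3"
  proof -
   have "D / N^2 \<le> D / N" using N D(1) by (intro divide_left_mono) (auto simp: power2_eq_square)
   then have "(D / N^2 * Z) * (D / N^2 * Z) \<le> (D / N^2 * Z) * (D / N * Z)"
    using D(1) N Z0 by (intro mult_left_mono mult_right_mono) auto
   then show ?thesis unfolding e2 .
  qed
  have "bform kernel b b \<le> - q / N^2 + 3 * (9 * K * (D^2 * Z^2 / N ^ 3))"
   unfolding split
   using main bb[OF bL nb' nr] bb[OF bL(2,1) nr nb'] order_trans[OF bb[OF bL(2,2) nr nr] mult_left_mono[OF e3, of "9 * K"]] K(1)
   unfolding e1 e2 by linarith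
  also have "3 * (9 * K * (D^2 * Z^2 / N ^ 3)) = 27 * K * D^2 * Z^2 / N ^ 3" by simp
  also have "\<dots> \<le> C / N ^ 3" using C(4) N by (intro divide_right_mono) auto
  finally have Q: "bform kernel b b \<le> - q / N^2 + C / N ^ 3" by simp
  have "oscillating c C q N b"
   unfolding oscillating_def
  proof (intro conjI allI impI Cb Q)
   show "b i x = 0" if "1 < norm (x - c)" for i x by (rule sb[OF that])
   show "\<bar>pd j (b i) x\<bar> \<le> C" for i j x using pb_le[of j i x] C(2) D(1) by linarith
   show "\<bar>b i x\<bar> \<le> C" for i x
   proof -
    have "2 * D / N \<le> 2 * D / 1" using N D(1) by (intro divide_left_mono) auto
    then show ?thesis using b_le[of i x] C(2) D(1) by linarith
   qed
   show "(\<Oplus>i. pd i (b i) x) = 0" for x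
   proof -
    have "pd 1 (pd 2 \<eta>) = pd 2 (pd 1 \<eta>)" by (rule partial_commute[OF C\<eta>])
    then have "pd 2 (\<alpha> 2) x = - pd 1 (\<alpha> 1) x"
     by (simp add: \<alpha>_def partial_minus[OF Cp\<eta>])
    moreover have "\<alpha> 2 x = - pd 1 (\<beta> 1) x" by (simp add: \<alpha>_def \<beta>_def)
    moreover have "\<alpha> 3 = (\<lambda>x. 0)" "\<beta> 3 = (\<lambda>x. 0)" "\<beta> 2 = (\<lambda>x. 0)" by (simp_all add: \<alpha>_def \<beta>_def)
    ultimately show ?thesis
     using N by (simp add: sum_3 pb osc_def pA) (simp add: A_def B_def power2_eq_square)
   qed
   have "fnorm b \<le> (2 * D / N) * Z" unfolding Z_def
    using D(1) N by (intro fnorm_unit_le b_le sb) auto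
   also have "\<dots> = (2 * D * Z) / N" by simp
   also have "\<dots> \<le> C / N" using C(3) Z0 D(1) N by (intro divide_right_mono) (auto intro: order_trans[OF _ C(3)] mult_right_mono)
   finally show "fnorm b \<le> C / N" .
   show "fnorm (\<lambda>i. pd j (b i)) \<le> C" for j
   proof -
    have "fnorm (\<lambda>i. pd j (b i)) \<le> (4 * D) * Z" unfolding Z_def
     using D(1) by (intro fnorm_unit_le pb_le spb) auto
    also have "\<dots> \<le> 10 * D * Z" using D(1) Z0 by (intro mult_right_mono) auto
    finally show ?thesis using C(3) by linarith
   qed
   have "fnorm (\<lambda>i x. lap (b i) x + N^2 * b i x) \<le> (10 * D) * Z" unfolding Z_def
    using D(1) by (intro fnorm_unit_le lb_le slb) auto
   then show "fnorm (\<lambda>i x. lap (b i) x + N^2 * b i x) \<le> C" using C(3) by linarith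
  qed
  then show ?thesis by blast
 qed
 show thesis by (rule that[OF C(1) q main[unfolded c_def]])
qed

section \<open>Refuting a pressure bound by a perturbation\<close>

text \<open>With \<open>y = e b + w\<close> one has exactly
  \<open>form(u, u) = 2 form(V, u) - form(V, V) + form(y, y)\<close>. Keeping the interaction with
  \<open>V\<close> inside the functional \<open>form(V, u)\<close> of the actual solution matters:
  its second difference is small by \<open>linear_second_difference\<close>, whereas the separate
  interaction of \<open>V\<close> with \<open>b\<close> would be only \<open>O(1/N)\<close>.\<close>

lemma bform_expansion:
 assumes K: "bounded_matrix kernel K" and V: "L2_field V" and b: "L2_field b" and w: "L2_field w"
  and u: "\<And>i x. u i x = V i x + (e * b i x + w i x)"
  and m: "fnorm b \<le> m" "fnorm w \<le> n" and e: "\<bar>e\<bar> \<le> 1"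
 shows "\<bar>bform kernel u u - (2 * bform kernel V u - bform kernel V V + e^2 * bform kernel b b)\<bar> \<le> 9 * K * (2 * m * n + n^2)"
proof -
 interpret bounded_matrix kernel K by (rule K)
 have K0: "0 \<le> K" using bound[of 0 0 0] by linarith
 have m0: "0 \<le> m" "0 \<le> n" using m fnorm_nonneg order_trans by blast+
 let ?y = "\<lambda>i x. e * b i x + w i x"
 have eb: "L2_field (\<lambda>i x. e * b i x)" by (rule L2_field_cmult[OF b])
 have y: "L2_field ?y" by (rule L2_field_add[OF eb w])
 have u_eq: "u = (\<lambda>i x. V i x + ?y i x)" using u by (intro ext)
 have uL: "L2_field u" unfolding u_eq by (rule L2_field_add[OF V y])
 have sym: "bform kernel f g = bform kernel g f" for f g by (rule bform_sym[OF kernel_sym])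
 have 1: "bform kernel V u = bform kernel V V + bform kernel V ?y"
  unfolding u_eq by (rule bform_add_right[OF V y V])
 have 2: "bform kernel u u = bform kernel V u + bform kernel ?y u"
  using bform_add_left[OF V y uL] unfolding u_eq[symmetric] .
 have 3: "bform kernel ?y u = bform kernel ?y V + bform kernel ?y ?y"
  unfolding u_eq by (rule bform_add_right[OF V y y])
 have 4: "bform kernel ?y ?y = (bform kernel (\<lambda>i x. e * b i x) (\<lambda>i x. e * b i x) + bform kernel (\<lambda>i x. e * b i x) w) + (bform kernel w (\<lambda>i x. e * b i x) + bform kernel w w)"
  by (simp only: bform_add_left[OF eb w y] bform_add_right[OF eb w eb] bform_add_right[OF eb w w])
 have 5: "bform kernel ?y ?y = e^2 * bform kernel b b + 2 * (e * bform kernel b w) + bform kernel w w"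
  unfolding 4 bform_cmult sym[of w b] by (simp add: power2_eq_square)
 have "bform kernel u u - (2 * bform kernel V u - bform kernel V V + e^2 * bform kernel b b) = 2 * (e * bform kernel b w) + bform kernel w w"
  using 1 2 3 5 sym[of ?y V] by linarith
 moreover have "\<bar>e * bform kernel b w\<bar> \<le> 9 * K * (m * n)"
 proof -
  have "\<bar>e * bform kernel b w\<bar> \<le> 1 * \<bar>bform kernel b w\<bar>" unfolding abs_mult using e by (intro mult_right_mono) auto
  also have "\<dots> \<le> 9 * K * (fnorm b * fnorm w)" using bform_bound[OF b w] by simp
  also have "\<dots> \<le> 9 * K * (m * n)" using K0 m m0 by (intro mult_left_mono mult_mono) auto
  finally show ?thesis .
 qed
 moreover have "\<bar>bform kernel w w\<bar> \<le> 9 * K * (n * n)"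
  using order_trans[OF bform_bound[OF w w] mult_left_mono[OF mult_mono[OF m(2) m(2)], of "9 * K"]] K0 m0 by simp
 ultimately show ?thesis by (simp add: power2_eq_square algebra_simps abs_le_iff)
qed

text \<open>Freezing the old field \<open>V\<close> turns the form into a linear observable with
  test field \<open>g\<close> of bounded support, the situation of
  \<open>linear_second_difference\<close>.\<close>

lemma bform_test:
 fixes V :: "3 \<Rightarrow> real^3 \<Rightarrow> real"
 assumes V: "\<And>i. Ck 3 (V i)" "\<And>i. bsupp (V i)"
 defines "g \<equiv> \<lambda>b x. \<Oplus>a. V a x * kernel a b x"
 shows "Ck 3 (g b)" "bsupp (g b)"
  and "(\<And>i. cont (u i)) \<Longrightarrow> bform kernel V u = (\<Oplus>b. LBINT x. u b x * g b x)"
proof -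
 show "Ck 3 (g b)" "bsupp (g b)" unfolding g_def by (intro Ck_sum Ck_mult Ck_kernel V bsupp_sum bsupp_mult1)+
 assume u: "\<And>i. cont (u i)"
 have I: "integ (\<lambda>x. V a x * u b x * kernel a b x)" for a b
  by (intro integrable_cs continuous_intros Ck_cont[OF V(1)] u kernel_continuous bsupp_mult1 V)
 have "(LBINT x. u b x * g b x) = (\<Oplus>a. LBINT x. V a x * u b x * kernel a b x)" for b
 proof -
  have "(LBINT x. u b x * g b x) = (LBINT x. (\<Oplus>a. V a x * u b x * kernel a b x))"
   unfolding g_def by (simp add: sum_distrib_left mult_ac)
  also have "\<dots> = (\<Oplus>a. LBINT x. V a x * u b x * kernel a b x)"
   by (rule Bochner_Integration.integral_sum[OF I])
  finally show ?thesis .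
 qed
 then show "bform kernel V u = (\<Oplus>b. LBINT x. u b x * g b x)"
  unfolding bform_def by (simp only:) (rule sum.swap)
qed

lemma (in nse_solution) pressure_probe:
 assumes t: "t \<in> {0..T}"
 shows "(LBINT x. pd 1 (p t) x * bump_density x) = - bform kernel (\<lambda>i. U i t) (\<lambda>i. U i t)"
proof -
 have "density_at 1 0 = bump_density" "newt_at 1 0 = newt" by (auto simp: density_at_def newt_at_def)
 then show ?thesis
  using pressure_gauge[OF t zero_less_one, of 1 0] unfolding stress_bform kernel_def by simp
qed

text \<open>The force and the velocity gradient of the heat-damped approximation \<open>V + exp(-N\<^sup>2 s) b\<close> stay
 bounded as \<open>N\<close> grows, because \<open>b\<close> oscillates at frequency \<open>N\<close>.\<close>

lemma approximation_bounds:
 fixes V :: "3 \<Rightarrow> real^3 \<Rightarrow> real"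
 assumes V: "\<And>i. Ck 3 (V i)" "\<And>i. bsupp (V i)"
 obtains M where "0 < M" "\<And>N b e \<epsilon> i j x. oscillating c C q N b \<Longrightarrow> 1 \<le> N \<Longrightarrow> 0 \<le> e \<Longrightarrow> e \<le> 1 \<Longrightarrow> 0 \<le> \<epsilon> \<Longrightarrow> \<epsilon> \<le> 1 \<Longrightarrow>
  \<bar>pd j (\<lambda>x. V i x + e * (\<epsilon> * b i x)) x\<bar> \<le> M \<and>
  fnorm (\<lambda>i x. lap (\<lambda>x. V i x + e * (\<epsilon> * b i x)) x - (\<Oplus>j. (V j x + e * (\<epsilon> * b j x)) * pd j (\<lambda>x. V i x + e * (\<epsilon> * b i x)) x)
    - (- (N^2) * e) * (\<epsilon> * b i x)) \<le> M"
proof -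
 have V1: "Ck 1 (V i)" "Ck (Suc 0) (V i)" "Ck 2 (V i)" for i by (rule Ck_on_mono[OF V(1)], simp)+
 have Vc: "cont (V i)" for i by (rule Ck_cont[OF V(1)])
 have dVc: "cont (pd j (V i))" for i j by (rule Ck_cont[OF Ck_partial[OF V1(2)]])
 have "(1::nat) + 2 = 3" by simp
 then have V3: "Ck (1 + 2) (V i)" for i by (simp only: V(1))
 have lVc: "cont (lap (V i))" for i by (rule Ck_cont[OF Ck_laplacian[OF V3]])
 have lVb: "bsupp (lap (V i))" for i unfolding laplacian_sum by (intro bsupp_sum bsupp_partial V)
 have lVL: "L2_field (\<lambda>i. lap (V i))" by (intro L2_field_cs lVc lVb)
 obtain C0 where C0: "0 < C0" "\<And>i x. \<bar>V i x\<bar> \<le> C0" using finite_family_bounded[of V, OF Vc V(2)] by metis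
 obtain C1 where C1: "0 < C1" and C1': "\<And>i j x. \<bar>pd j (V i) x\<bar> \<le> C1"
  using finite_family_bounded2[of "\<lambda>i j. pd j (V i)", OF dVc bsupp_partial[OF V(2)]] by metis
 obtain R where R: "0 < R" "\<And>i x. R < norm x \<Longrightarrow> V i x = 0"
 proof -
  have "\<exists>R>0. \<forall>x. R < norm x \<longrightarrow> V i x = 0" for i using bsuppE[OF V(2)] by metis
  then obtain R where R: "\<And>i. 0 < R i" "\<And>i x. R i < norm x \<Longrightarrow> V i x = 0" by metis
  show thesis
  proof (rule that)
   show "0 < (\<Oplus>i. R i)" by (rule sum_pos) (auto simp: R)
   show "V i x = 0" if "(\<Oplus>i. R i) < norm x" for i x
    using member_le_sum[of i UNIV R] R(1) that by (intro R(2)) (auto intro: less_imp_le le_less_trans)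
  qed
 qed
 define P where "P = fnorm (\<lambda>i::3. \<lambda>x. C0 * cutoff R 1 x + \<bar>C\<bar> * unit_plateau c x)"
 have PL: "L2_field (\<lambda>i::3. \<lambda>x. C0 * cutoff R 1 x + \<bar>C\<bar> * unit_plateau c x)"
  using R by (intro L2_field_cs continuous_intros cont_cutoff unit_plateau bsupp_add bsupp_mult2 cutoff_bsupp) auto
 define G where "G = C1 + \<bar>C\<bar>"
 have G0: "0 < G" using C1 by (simp add: G_def)
 have P0: "0 \<le> P" by (simp add: P_def)
 define M where "M = G + fnorm (\<lambda>i. lap (V i)) + \<bar>C\<bar> + 3 * G * P"
 have M: "0 < M" "G \<le> M" "fnorm (\<lambda>i. lap (V i)) + \<bar>C\<bar> + 3 * G * P \<le> M"
  unfolding M_def using G0 P0 by (auto intro!: add_pos_nonneg mult_nonneg_nonneg)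
 show thesis
 proof (rule that[OF M(1)])
  fix N b e \<epsilon> i j x
  assume osc: "oscillating c C q N b" and N: "1 \<le> (N::real)" and e: "0 \<le> (e::real)" "e \<le> 1" and \<epsilon>: "0 \<le> (\<epsilon>::real)" "\<epsilon> \<le> 1"
  note o = osc[unfolded oscillating_def]
  have b: "Ck k (b i)" for i k using o by blast
  have bs: "1 < norm (x - c) \<Longrightarrow> b i x = 0" for i x using o by blast
  have b_le: "\<bar>b i x\<bar> \<le> C" "\<bar>pd j (b i) x\<bar> \<le> C" for i j x using o by blast+
  have lb: "fnorm (\<lambda>i x. lap (b i) x + N^2 * b i x) \<le> C" using o by blast
  define d where "d = e * \<epsilon>"
  have d: "0 \<le> d" "d \<le> 1" using e \<epsilon> by (simp_all add: d_def mult_le_one)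
  let ?v = "\<lambda>i x. V i x + d * b i x"
  have v_eq: "V i x + e * (\<epsilon> * b i x) = ?v i x" for i x by (simp add: d_def)
  have pv: "pd j (?v i) = (\<lambda>x. pd j (V i) x + d * pd j (b i) x)" for i j
   by (simp only: partial_add[OF V1(1) Ck_mult[OF Ck_const b]] partial_cmult[OF b])
  have db_le: "\<bar>d * y\<bar> \<le> C" if "\<bar>y\<bar> \<le> C" for y
   using mult_mono[OF d(2) that] by (simp add: abs_mult d)
  have pv_le: "\<bar>pd j (?v i) x\<bar> \<le> G" for i j x
   unfolding pv G_def using C1'[of j i x] db_le[OF b_le(2), of j i x] by linarith
  have C00: "0 \<le> C" using b_le(1)[of 0 0] by linarith
  have v_le: "\<bar>?v i x\<bar> \<le> C0 * cutoff R 1 x + \<bar>C\<bar> * unit_plateau c x" for i x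
  proof -
   have "\<bar>V i x\<bar> \<le> C0 * cutoff R 1 x"
   proof (cases "norm x \<le> R")
    case True
    then have "cutoff R 1 x = 1" using R by (intro cutoff_inside) auto
    then show ?thesis using C0(2)[of i x] by simp
   next
    case False
    then show ?thesis using R(2)[of x i] C0(1) cutoff_bounds(1)[of R 1 x] by simp
   qed
   moreover have "\<bar>d * b i x\<bar> \<le> \<bar>C\<bar> * unit_plateau c x"
   proof (cases "norm (x - c) \<le> 1")
    case True
    then have "unit_plateau c x = 1" unfolding unit_plateau_def by (intro cutoff_inside) auto
    then show ?thesis using db_le[OF b_le(1), of i x] by simp
   next
    case False
    then show ?thesis using bs[of x i] cutoff_bounds(1)[of 1 1 "x - c"] by (simp add: unit_plateau_def)
   qed
   ultimately show ?thesis by linarith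
  qed
  have v1: "Ck (Suc 0) (?v i)" for i by (intro Ck_add Ck_mult Ck_const V1 b)
  have pvc: "cont (pd j (?v i))" for i j by (rule Ck_cont[OF Ck_partial[OF v1]])
  let ?a = "\<lambda>i x. \<Oplus>j. ?v j x * pd j (?v i) x"
  have bb: "bsupp (b i)" for i by (rule bsupp_unit[of c]) (rule bs)
  have vb: "bsupp (?v i)" for i by (intro bsupp_add bsupp_mult2 bb V)
  have vc: "cont (?v i)" for i by (rule Ck_cont[OF v1])
  have aL: "L2_field ?a" by (intro L2_field_cs continuous_intros vc pvc bsupp_sum bsupp_mult1 vb)
  have a_le: "fnorm ?a \<le> (3 * G) * P"
   unfolding P_def
  proof (rule fnorm_le[OF PL])
   show "\<bar>?a i x\<bar> \<le> 3 * G * \<bar>C0 * cutoff R 1 x + \<bar>C\<bar> * unit_plateau c x\<bar>" for i x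
   proof -
    have "\<bar>?a i x\<bar> \<le> (\<Sum>j\<in>(UNIV::3 set). \<bar>C0 * cutoff R 1 x + \<bar>C\<bar> * unit_plateau c x\<bar> * G)"
     by (rule order_trans[OF sum_abs], rule sum_mono, unfold abs_mult[of "?v _ x"], rule mult_mono[OF _ pv_le])
      (use v_le order_trans[OF v_le abs_ge_self] in auto)
    then show ?thesis by (simp add: mult_ac)
   qed
  qed (use G0 in simp)
  have lbc: "cont (lap (b i))" for i by (rule Ck_cont[OF Ck_laplacian[OF b]])
  let ?h = "\<lambda>i x. lap (b i) x + N^2 * b i x"
  have lbb: "bsupp (lap (b i))" for i unfolding laplacian_sum by (intro bsupp_sum bsupp_partial bb)
  have hL: "L2_field ?h" by (intro L2_field_cs continuous_intros lbc Ck_cont[OF b] bsupp_add bsupp_mult2 lbb bb)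
  have lv: "lap (?v i) x = lap (V i) x + d * lap (b i) x" for i x
  proof -
   have p1: "Ck 1 (pd j (V i))" for j
    using Ck_partial[of 1 "V i" j] V1(3)[of i] by (simp add: numeral_2_eq_2)
   have p2: "Ck 1 (pd j (b i))" for j by (rule Ck_partial[OF b])
   have "pd j (pd j (?v i)) x = pd j (pd j (V i)) x + d * pd j (pd j (b i)) x" for j
    by (simp only: pv partial_add[OF p1 Ck_mult[OF Ck_const p2]] partial_cmult[OF p2])
   then show ?thesis by (simp add: laplacian_sum sum.distrib sum_distrib_left)
  qed
  have "fnorm (\<lambda>i x. (lap (V i) x + d * ?h i x) - ?a i x) \<le> fnorm (\<lambda>i x. lap (V i) x + d * ?h i x) + fnorm ?a"
   by (rule fnorm_triangle_diff[OF L2_field_add[OF lVL L2_field_cmult[OF hL]] aL])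
  also have "\<dots> \<le> (fnorm (\<lambda>i. lap (V i)) + fnorm (\<lambda>i x. d * ?h i x)) + fnorm ?a"
   by (intro add_right_mono fnorm_triangle lVL L2_field_cmult hL)
  also have "\<dots> \<le> (fnorm (\<lambda>i. lap (V i)) + \<bar>C\<bar>) + 3 * G * P"
  proof -
   have "fnorm (\<lambda>i x. d * ?h i x) \<le> 1 * C" unfolding fnorm_cmult using d lb by (intro mult_mono) auto
   then show ?thesis using a_le by linarith
  qed
  also have "\<dots> \<le> M" by (rule M(3))
  finally have F: "fnorm (\<lambda>i x. (lap (V i) x + d * ?h i x) - ?a i x) \<le> M" .
  \<comment> \<open>The time derivative of the damping factor supplies the \<open>N^2 b\<close> that
    completes \<open>lap b\<close> to the bounded combination \<open>?h\<close>.\<close>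
  have eq: "(lap (V i) x + d * ?h i x) - ?a i x = lap (?v i) x - ?a i x - (- (N^2) * e) * (\<epsilon> * b i x)" for i x
   unfolding lv by (simp add: d_def algebra_simps)
  show "\<bar>pd j (\<lambda>x. V i x + e * (\<epsilon> * b i x)) x\<bar> \<le> M \<and>
   fnorm (\<lambda>i x. lap (\<lambda>x. V i x + e * (\<epsilon> * b i x)) x - (\<Oplus>j. (V j x + e * (\<epsilon> * b j x)) * pd j (\<lambda>x. V i x + e * (\<epsilon> * b i x)) x)
    - (- (N^2) * e) * (\<epsilon> * b i x)) \<le> M"
   unfolding v_eq by (rule conjI[OF order_trans[OF pv_le M(2)] F[unfolded eq]])
 qed
qed

lemma perturbation:
 fixes V :: "3 \<Rightarrow> real^3 \<Rightarrow> real"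
 assumes V: "\<And>i k. Ck k (V i)" and R: "0 \<le> R" "\<And>i x. R < norm x \<Longrightarrow> V i x = 0"
  and divV: "\<And>x. (\<Oplus>i. pd i (V i) x) = 0" and n: "0 < n" and \<kappa>: "0 < \<kappa>"
 shows "\<exists>b \<delta> R'. 0 < \<delta> \<and> (\<forall>i k. Ck k (b i)) \<and> (\<forall>i x. norm x \<le> R \<longrightarrow> b i x = 0) \<and>
  (\<forall>i x. R' < norm x \<longrightarrow> b i x = 0) \<and> (\<forall>x. (\<Oplus>i. pd i (b i) x) = 0) \<and>
  fnorm b \<le> \<kappa> \<and> (\<forall>j. fnorm (\<lambda>i. pd j (b i)) \<le> \<kappa>) \<and>
  (\<forall>U Ut p T E. nse_solution U Ut p T E \<longrightarrow> 1 \<le> n * T \<longrightarrow> E \<le> n \<longrightarrow>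
   (\<forall>t\<ge>0. 2 * t \<le> T \<longrightarrow> \<bar>bform kernel (\<lambda>i. U i 0) (\<lambda>i. U i 0) - 2 * bform kernel (\<lambda>i. U i t) (\<lambda>i. U i t)
    + bform kernel (\<lambda>i. U i (2 * t)) (\<lambda>i. U i (2 * t))\<bar> \<le> n * t^2) \<longrightarrow>
   \<delta> < fnorm (\<lambda>i x. U i 0 x - (V i x + b i x)))"
proof -
 \<comment> \<open>The unit ball around \<open>axis 1 a\<close> avoids the ball of radius
   \<open>R\<close> and, because \<open>3 \<le> a\<close>, lies where \<open>kernel 1 1\<close> is
   negative.\<close>
 define a where "a = R + 3"
 define c :: "real^3" where "c = axis 1 a"
 have a3: "3 \<le> a" using R by (simp add: a_def)
 have c_norm: "norm c = a" using a3 by (simp add: c_def norm_eq_sqrt_inner inner_axis_axis)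
 obtain C q where C: "0 < C" "0 < q" and osc: "\<And>N. 1 \<le> N \<Longrightarrow> \<exists>b. oscillating c C q N b"
  using oscillating_field[OF a3] unfolding c_def by metis
 define \<epsilon> where "\<epsilon> = min 1 (\<kappa> / C)"
 have \<epsilon>: "0 < \<epsilon>" "\<epsilon> \<le> 1" "\<epsilon> * C \<le> \<kappa>"
 proof -
  show "0 < \<epsilon>" "\<epsilon> \<le> 1" using \<kappa> C by (simp_all add: \<epsilon>_def)
  have "\<epsilon> * C \<le> \<kappa> / C * C" using C by (intro mult_right_mono) (auto simp: \<epsilon>_def)
  then show "\<epsilon> * C \<le> \<kappa>" using C by simp
 qed
 have Vb: "bsupp (V i)" for i by (rule bsuppI) (rule R)
 have Vc: "cont (V i)" for i by (rule Ck_cont[OF V])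
 have VL: "L2_field V" by (rule L2_field_cs) (rule Vc Vb)+
 obtain K where K: "0 < K" "bounded_matrix kernel K" using kernel_bounded by metis
 let ?g = "\<lambda>b x. \<Oplus>a. V a x * kernel a b x"
 note g = bform_test(1,2)[of V, OF V Vb]
 have test: "bform kernel V u = (\<Oplus>b. LBINT x. u b x * ?g b x)" if "\<And>i. cont (u i)" for u
  by (rule bform_test(3)[of V, OF V Vb that])
 obtain B where B: "0 \<le> B" and lin: "\<forall>U Ut p T E t D. nse_solution U Ut p T E \<longrightarrow> 0 \<le> t \<longrightarrow> 2 * t \<le> T \<longrightarrow>
  (\<forall>s s'. s \<in> {0..2 * t} \<longrightarrow> s' \<in> {0..2 * t} \<longrightarrow> fnorm (\<lambda>i x. U i s x - U i s' x) \<le> D) \<longrightarrow>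
  \<bar>(\<Oplus>i. LBINT x. U i 0 x * ?g i x) - 2 * (\<Oplus>i. LBINT x. U i t x * ?g i x)
   + (\<Oplus>i. LBINT x. U i (2 * t) x * ?g i x)\<bar> \<le> B * (1 + E) * D * t"
  using linear_second_difference[of ?g, OF g] by (elim exE conjE) (rule that)
 show ?thesis
 proof (rule approximation_bounds[of V c C q, OF V Vb])
  fix M :: real assume M: "0 < M" and bounds: "\<And>N b e \<epsilon> i j x. oscillating c C q N b \<Longrightarrow> 1 \<le> N \<Longrightarrow> 0 \<le> e \<Longrightarrow> e \<le> 1 \<Longrightarrow> 0 \<le> \<epsilon> \<Longrightarrow> \<epsilon> \<le> 1 \<Longrightarrow>
  \<bar>pd j (\<lambda>x. V i x + e * (\<epsilon> * b i x)) x\<bar> \<le> M \<and>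
  fnorm (\<lambda>i x. lap (\<lambda>x. V i x + e * (\<epsilon> * b i x)) x - (\<Oplus>j. (V j x + e * (\<epsilon> * b j x)) * pd j (\<lambda>x. V i x + e * (\<epsilon> * b i x)) x)
    - (- (N^2) * e) * (\<epsilon> * b i x)) \<le> M"
  \<comment> \<open>The second difference of \<open>exp (- 2 N^2 s)\<close> at \<open>0\<close>,
    \<open>t\<close>, \<open>2 t\<close> when \<open>N^2 t = 1\<close>.\<close>
  define \<gamma> where "\<gamma> = (1 - exp (- 2 :: real))^2"
  have \<gamma>: "0 < \<gamma>" by (simp add: \<gamma>_def)
  \<comment> \<open>The bound of \<open>weak_strong\<close> over \<open>{0..2 * t}\<close> with
    \<open>\<delta> = t\<close> is \<open>4 M (2 t) + 2 t = Y t\<close>.\<close>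
  define Y where "Y = 8 * M + 2"
  have Y: "0 < Y" using M by (simp add: Y_def)
  \<comment> \<open>Collects the coefficients of all contributions of order \<open>N^-3\<close>;
    \<open>L\<close> below is the coefficient of the signal of order \<open>N^-2\<close>.\<close>
  define X where "X = \<epsilon>\<^sup>2 * \<gamma> * C + n + 2 * (B * (1 + n) * (C + 2 * Y)) + 36 * K * (2 * C * Y + Y^2)"
  have X: "0 < X" unfolding X_def using n C Y K B \<gamma> by (intro add_pos_nonneg add_nonneg_pos) auto
  define L where "L = \<gamma> * \<epsilon>\<^sup>2 * q"
  have L: "0 < L" using \<gamma> \<epsilon> C by (simp add: L_def)
  \<comment> \<open>\<open>72 * M\<close> makes the time span \<open>2 t\<close> admissible for
    \<open>weak_strong\<close>, \<open>2 * n\<close> makes it fit into the lifespan, and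
    \<open>X / L\<close> lets the signal win.\<close>
  define N where "N = 1 + 72 * M + 2 * n + X / L"
  have XL: "0 < X / L" using X L by simp
  have N: "1 \<le> N" "72 * M \<le> N" "2 * n \<le> N" "X / L < N" using M n XL unfolding N_def by linarith+
  have N0: "0 < N" using N by linarith
  have NN: "N \<le> N^2" using N by (simp add: self_le_power)
  obtain b0 where b0: "oscillating c C q N b0" using osc[OF N(1)] by blast
  note o = b0[unfolded oscillating_def]
  have Cb0: "Ck k (b0 i)" for i k using o by blast
  have s0: "b0 i x = 0" if "1 < norm (x - c)" for i x using o that by blast
  have div0: "(\<Oplus>i. pd i (b0 i) x) = 0" for x using o by blast
  have n0: "fnorm b0 \<le> C / N" using o by blast
  have nd0: "fnorm (\<lambda>i. pd j (b0 i)) \<le> C" for j using o by blast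
  have Q0: "bform kernel b0 b0 \<le> - q / N^2 + C / N ^ 3" using o by blast
  define b where "b i x = \<epsilon> * b0 i x" for i x
  have b_eq: "b = (\<lambda>i x. \<epsilon> * b0 i x)" by (simp add: b_def fun_eq_iff)
  have Cb: "Ck k (b i)" for i k unfolding b_eq by (intro Ck_mult Ck_const Cb0)
  have pb: "pd j (b i) = (\<lambda>x. \<epsilon> * pd j (b0 i) x)" for i j unfolding b_eq by (rule partial_cmult[OF Cb0])
  have bin: "b i x = 0" if "norm x \<le> R" for i x
  proof -
   have "norm c - norm x \<le> norm (x - c)" using norm_triangle_ineq2[of c x] by (simp add: norm_minus_commute)
   then show ?thesis using that s0[of x i] by (simp add: b_def c_norm a_def)
  qed
  have bout: "b i x = 0" if "a + 1 < norm x" for i x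
  proof -
   have "norm x - norm c \<le> norm (x - c)" by (rule norm_triangle_ineq2)
   then show ?thesis using that s0[of x i] by (simp add: b_def c_norm)
  qed
  have divb: "(\<Oplus>i. pd i (b i) x) = 0" for x unfolding pb by (simp add: div0 flip: sum_distrib_left)
  have CN: "C / N \<le> C" using C N by (simp add: divide_le_eq mult_le_cancel_left1)
  have nb: "fnorm b \<le> C / N"
  proof -
   have "fnorm b = \<epsilon> * fnorm b0" unfolding b_eq fnorm_cmult using \<epsilon> by simp
   also have "\<dots> \<le> 1 * (C / N)" using \<epsilon> n0 by (intro mult_mono) auto
   finally show ?thesis by simp
  qed
  have nb\<kappa>: "fnorm b \<le> \<kappa>" "fnorm (\<lambda>i. pd j (b i)) \<le> \<kappa>" for j
  proof -
   have "fnorm b = \<epsilon> * fnorm b0" unfolding b_eq fnorm_cmult using \<epsilon> by simp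
   also have "\<dots> \<le> \<epsilon> * C" using \<epsilon> n0 CN by (intro mult_left_mono) auto
   finally show "fnorm b \<le> \<kappa>" using \<epsilon> by simp
   have "fnorm (\<lambda>i. pd j (b i)) = \<epsilon> * fnorm (\<lambda>i. pd j (b0 i))" unfolding pb fnorm_cmult using \<epsilon> by simp
   also have "\<dots> \<le> \<epsilon> * C" using \<epsilon> nd0 by (intro mult_left_mono) auto
   finally show "fnorm (\<lambda>i. pd j (b i)) \<le> \<kappa>" using \<epsilon> by simp
  qed
  have bc: "cont (b i)" for i by (rule Ck_cont[OF Cb])
  have bb: "bsupp (b i)" for i by (rule bsuppI) (rule bout)
  have bL: "L2_field b" by (rule L2_field_cs) (rule bc bb)+
  \<comment> \<open>The same number serves as observation time and as tolerance
    \<open>\<delta>\<close>: an error \<open>t\<close> in the datum is of the order of the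
    comparison error.\<close>
  define t where "t = 1 / N^2"
  have t: "0 < t" "t \<le> 1 / N" "N^2 * t = 1" using N0 NN by (auto simp: t_def intro: divide_left_mono)
  have final: "t < fnorm (\<lambda>i x. U i 0 x - (V i x + b i x))"
   if sol: "nse_solution U Ut p T E" and nT: "1 \<le> n * T" and nE: "E \<le> n"
    and sd: "\<And>t. 0 \<le> t \<Longrightarrow> 2 * t \<le> T \<Longrightarrow> \<bar>bform kernel (\<lambda>i. U i 0) (\<lambda>i. U i 0) - 2 * bform kernel (\<lambda>i. U i t) (\<lambda>i. U i t)
     + bform kernel (\<lambda>i. U i (2 * t)) (\<lambda>i. U i (2 * t))\<bar> \<le> n * t^2"
   for U Ut p T E
  proof (rule ccontr)
   interpret nse_solution U Ut p T E by (rule sol)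
   assume "\<not> t < fnorm (\<lambda>i x. U i 0 x - (V i x + b i x))"
   then have \<delta>: "fnorm (\<lambda>i x. U i 0 x - (V i x + b i x)) \<le> t" by simp
   have tT: "2 * t \<le> T"
   proof -
    have "2 * n * t \<le> N^2 * t" using N(3) NN t by (intro mult_right_mono) auto
    then have "n * (2 * t) \<le> n * T" using t(3) nT by linarith
    then show ?thesis using n by simp
   qed
   define e where "e s = exp (- N\<^sup>2 * s)" for s
   have e01: "0 \<le> e s" "e s \<le> 1" if "0 \<le> s" for s using that by (auto simp: e_def)
   define w where "w s i x = U i s x - (V i x + e s * b i x)" for s i x
   have mem: "s \<in> {0..T}" if "s \<in> {0..2 * t}" for s using that tT by auto
   have nw: "fnorm (w s) \<le> Y * t" if s: "s \<in> {0..2 * t}" for s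
   proof -
    have "fnorm (\<lambda>i x. U i s x - (V i x + exp (- N\<^sup>2 * s) * b i x)) \<le> 4 * M * (2 * t) + 2 * t"
    proof (rule weak_strong[where R = "a + 1" and \<delta> = t])
     show "2 * t \<in> {0..T}" using t tT by auto
     show "0 \<le> a + 1" using a3 by simp
     show "V i x = 0 \<and> b i x = 0" if "a + 1 < norm x" for i x using bout[OF that] R(2)[of x i] that by (simp add: a_def)
     have "36 * M * (2 * t) = (72 * M) * t" by simp
     also have "\<dots> \<le> N^2 * t" using N(2) NN t by (intro mult_right_mono) auto
     finally show "36 * M * (2 * t) \<le> 1" using t(3) by simp
     show "\<bar>pd j (\<lambda>x. V i x + exp (- N\<^sup>2 * s) * b i x) x\<bar> \<le> M" if "s \<in> {0..2 * t}" for s i j x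
      using bounds[OF b0 N(1), of "exp (- N\<^sup>2 * s)" \<epsilon> j i x] that \<epsilon> by (simp add: b_def)
     show "fnorm (\<lambda>i x. lap (\<lambda>x. V i x + exp (- N\<^sup>2 * s) * b i x) x
       - (\<Oplus>j. (V j x + exp (- N\<^sup>2 * s) * b j x) * pd j (\<lambda>x. V i x + exp (- N\<^sup>2 * s) * b i x) x)
       - - N\<^sup>2 * exp (- N\<^sup>2 * s) * b i x) \<le> M" if "s \<in> {0..2 * t}" for s
      using bounds[OF b0 N(1), of "exp (- N\<^sup>2 * s)" \<epsilon>] that \<epsilon> by (simp add: b_def)
     show "fnorm (\<lambda>i x. U i 0 x - (V i x + exp (- N\<^sup>2 * 0) * b i x)) \<le> t" using \<delta> by simp
    qed (use V Cb divV divb M s in auto)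
    then show ?thesis by (simp add: w_def[abs_def] e_def Y_def algebra_simps)
   qed
   have wL: "L2_field (w s)" if "s \<in> {0..2 * t}" for s
    unfolding w_def[abs_def] by (intro L2_field_diff[OF U_L2(1)[OF mem[OF that]]] L2_field_add VL L2_field_cmult bL)
   let ?D = "(C + 2 * Y) / N"
   have Yt: "Y * t \<le> Y / N" using mult_left_mono[OF t(2), of Y] Y by simp
   have diff: "fnorm (\<lambda>i x. U i s x - U i s' x) \<le> ?D" if s: "s \<in> {0..2 * t}" "s' \<in> {0..2 * t}" for s s'
   proof -
    have "(\<lambda>i x. U i s x - U i s' x) = (\<lambda>i x. (e s - e s') * b i x + (w s i x - w s' i x))"
     by (simp add: w_def fun_eq_iff algebra_simps)
    then have "fnorm (\<lambda>i x. U i s x - U i s' x) \<le> fnorm (\<lambda>i x. (e s - e s') * b i x) + fnorm (\<lambda>i x. w s i x - w s' i x)"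
     using fnorm_triangle[OF L2_field_cmult[OF bL] L2_field_diff[OF wL[OF s(1)] wL[OF s(2)]]] by simp
    also have "\<dots> \<le> C / N + (Y / N + Y / N)"
    proof (rule add_mono)
     have "\<bar>e s - e s'\<bar> \<le> 1" using e01[of s] e01[of s'] s by auto
     then show "fnorm (\<lambda>i x. (e s - e s') * b i x) \<le> C / N"
      unfolding fnorm_cmult using mult_mono[OF _ nb, of "\<bar>e s - e s'\<bar>" 1] by simp
     show "fnorm (\<lambda>i x. w s i x - w s' i x) \<le> Y / N + Y / N"
      using fnorm_triangle_diff[OF wL[OF s(1)] wL[OF s(2)]] nw[OF s(1)] nw[OF s(2)] Yt by linarith
    qed
    also have "\<dots> = ?D" by (simp add: add_divide_distrib)
    finally show ?thesis .
   qed
   let ?F = "\<lambda>s. bform kernel V (\<lambda>i. U i s)" and ?P = "\<lambda>s. bform kernel (\<lambda>i. U i s) (\<lambda>i. U i s)"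
   let ?N3 = "1 / N ^ 3"
   have in3: "0 \<in> {0..2 * t}" "t \<in> {0..2 * t}" "2 * t \<in> {0..2 * t}" using t by auto
   have "\<bar>?F 0 - 2 * ?F t + ?F (2 * t)\<bar> \<le> B * (1 + E) * ?D * t"
    unfolding test[OF contU[OF mem[OF in3(1)]]] test[OF contU[OF mem[OF in3(2)]]] test[OF contU[OF mem[OF in3(3)]]]
    by (rule lin[rule_format, OF sol]) (use t tT diff in auto)
   also have "\<dots> \<le> B * (1 + n) * ?D * t"
    using nE B C Y t N0 by (intro mult_right_mono mult_left_mono) auto
   also have "\<dots> = B * (1 + n) * (C + 2 * Y) * ?N3" unfolding t_def by (simp add: power2_eq_square power3_eq_cube)
   finally have SF: "\<bar>?F 0 - 2 * ?F t + ?F (2 * t)\<bar> \<le> B * (1 + n) * (C + 2 * Y) * ?N3" .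
   define err where "err = 9 * K * (2 * C * Y + Y^2) * ?N3"
   have ex: "\<bar>?P s - (2 * ?F s - bform kernel V V + (e s)^2 * bform kernel b b)\<bar> \<le> err" if s: "s \<in> {0..2 * t}" for s
   proof -
    have "\<bar>?P s - (2 * ?F s - bform kernel V V + (e s)^2 * bform kernel b b)\<bar> \<le> 9 * K * (2 * (C / N) * (Y * t) + (Y * t)^2)"
     by (rule bform_expansion[OF K(2) VL bL wL[OF s] _ nb nw[OF s]]) (use e01[of s] s in \<open>auto simp: w_def\<close>)
    also have "\<dots> \<le> 9 * K * ((2 * C * Y + Y^2) * ?N3)"
    proof (rule mult_left_mono)
     have 1: "2 * (C / N) * (Y * t) = 2 * C * Y * ?N3" unfolding t_def by (simp add: power2_eq_square power3_eq_cube)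
     have "t^2 \<le> t * (1 / N)" unfolding power2_eq_square by (rule mult_left_mono[OF t(2)]) (use t in simp)
     also have "\<dots> = ?N3" unfolding t_def by (simp add: power2_eq_square power3_eq_cube)
     finally have "(Y * t)^2 \<le> Y^2 * ?N3" unfolding power_mult_distrib by (rule mult_left_mono) simp
     then show "2 * (C / N) * (Y * t) + (Y * t)^2 \<le> (2 * C * Y + Y^2) * ?N3" unfolding 1 distrib_right by simp
    qed (use K in simp)
    finally show ?thesis by (simp add: err_def mult.assoc)
   qed
   have e_vals: "e 0 = 1" "(e t)^2 = exp (- 2)" "(e (2 * t))^2 = (exp (- 2))^2"
   proof -
    show "e 0 = 1" by (simp add: e_def)
    have "- N\<^sup>2 * t = - 1" "- N\<^sup>2 * (2 * t) = - 2" using t(3) by auto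
    then have et: "e t = exp (- 1)" "e (2 * t) = exp (- 2)" by (simp_all only: e_def)
    show "(e t)^2 = exp (- 2)" unfolding et power2_eq_square by (simp flip: exp_add)
    show "(e (2 * t))^2 = (exp (- 2))^2" unfolding et ..
   qed
   have SP: "\<bar>?P 0 - 2 * ?P t + ?P (2 * t)\<bar> \<le> n * ?N3"
   proof -
    have "\<bar>?P 0 - 2 * ?P t + ?P (2 * t)\<bar> \<le> n * t^2" by (rule sd) (use t tT in auto)
    also have "n * t^2 \<le> n * (t * (1 / N))"
     unfolding power2_eq_square using n t by (intro mult_left_mono) auto
    also have "\<dots> = n * ?N3" unfolding t_def by (simp add: power2_eq_square power3_eq_cube)
    finally show ?thesis .
   qed
   \<comment> \<open>Second difference of the expansions: the term \<open>form(V, V)\<close>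
     cancels, the linear functional enters with factor 2, and the three errors with weights 1, 2 and
     1.\<close>
   have alg: "- (\<gamma> * bb) \<le> p + 2 * f + 4 * r"
    if "\<bar>P0 - 2 * P1 + P2\<bar> \<le> p" "\<bar>F0 - 2 * F1 + F2\<bar> \<le> f"
     "\<bar>P0 - (2 * F0 - v + 1 * bb)\<bar> \<le> r" "\<bar>P1 - (2 * F1 - v + x * bb)\<bar> \<le> r" "\<bar>P2 - (2 * F2 - v + x^2 * bb)\<bar> \<le> r" "\<gamma> = (1 - x)^2"
    for P0 P1 P2 F0 F1 F2 p f r v x bb :: real
   proof -
    have "\<gamma> * bb = 1 * bb - 2 * (x * bb) + x^2 * bb" unfolding that(6) by (simp add: power2_eq_square algebra_simps)
    then show ?thesis using that(1-5) by (simp add: abs_le_iff)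
   qed
   have main: "- (\<gamma> * bform kernel b b) \<le> n * ?N3 + 2 * (B * (1 + n) * (C + 2 * Y) * ?N3) + 4 * err"
    by (rule alg[OF SP SF _ ex[OF in3(2), unfolded e_vals] ex[OF in3(3), unfolded e_vals] \<gamma>_def])
     (use ex[OF in3(1)] in \<open>simp add: e_vals\<close>)
   have bbq: "bform kernel b b = \<epsilon>\<^sup>2 * bform kernel b0 b0"
    unfolding b_eq bform_cmult by (simp add: power2_eq_square)
   have "L * (1 / N^2) - \<epsilon>\<^sup>2 * \<gamma> * C * ?N3 = - (\<gamma> * (\<epsilon>\<^sup>2 * (- q / N^2 + C / N ^ 3)))"
    by (simp add: L_def algebra_simps)
   also have "\<dots> \<le> - (\<gamma> * bform kernel b b)"
    unfolding bbq using Q0 \<gamma> \<epsilon> by (intro le_imp_neg_le mult_left_mono) auto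
   also note main
   finally have "L * (1 / N^2) \<le> \<epsilon>\<^sup>2 * \<gamma> * C * ?N3 + (n * ?N3 + 2 * (B * (1 + n) * (C + 2 * Y) * ?N3) + 4 * err)" by linarith
   also have "\<dots> = X * ?N3" unfolding X_def err_def by (simp add: algebra_simps)
   finally have "L * (1 / N^2) * N ^ 3 \<le> X * ?N3 * N ^ 3" using N0 by (intro mult_right_mono) auto
   then have "L * N \<le> X" using N0 by (simp add: power2_eq_square power3_eq_cube)
   then show False using N(4) L by (simp add: field_simps)
  qed
  show ?thesis
  proof (rule exI[of _ b], rule exI[of _ t], rule exI[of _ "a + 1"], intro conjI allI impI)
   show "t < fnorm (\<lambda>i x. U i 0 x - (V i x + b i x))"
    if "nse_solution U Ut p T E" "1 \<le> n * T" "E \<le> n"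
     "\<forall>t\<ge>0. 2 * t \<le> T \<longrightarrow> \<bar>bform kernel (\<lambda>i. U i 0) (\<lambda>i. U i 0) - 2 * bform kernel (\<lambda>i. U i t) (\<lambda>i. U i t)
     + bform kernel (\<lambda>i. U i (2 * t)) (\<lambda>i. U i (2 * t))\<bar> \<le> n * t^2"
    for U Ut p T E
    by (rule final[OF that(1-3)]) (use that(4) in blast)
  qed (use t Cb bin bout divb nb\<kappa> in auto)
 qed
qed

section \<open>The initial datum\<close>

lemma slab_integral_derivative:
 fixes f :: "real \<Rightarrow> real^3 \<Rightarrow> real"
 assumes f: "smooth_slab T f" and g: "cont g" "bsupp g" and t: "t \<in> {0..T}"
 shows "((\<lambda>s. LBINT x. f s x * g x) has_real_derivative (LBINT x. slab_derivative T f (t, x) (1, 0) * g x)) (at t within {0..T})"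
proof -
 obtain R where R: "\<And>x. R < norm x \<Longrightarrow> g x = 0" using bsuppE[OF g(2)] by blast
 let ?f' = "\<lambda>s x. slab_derivative T f (s, x) (1, 0)"
 show ?thesis
 proof (rule leibniz_lborel[where R = R])
  show "((\<lambda>s. f s x * g x) has_real_derivative ?f' s x * g x) (at s within {0..T})" if "s \<in> {0..T}" for s x
   using slab_time_derivative[OF f that] by (intro DERIV_cmult_right) (simp add: has_real_derivative_iff_has_vector_derivative)
  show "cont (\<lambda>x. f s x * g x)" if "s \<in> {0..T}" for s
   by (intro continuous_intros Ck_cont[OF smooth_slab_Ck[OF f that]] g)
  have "continuous_on ({0..T} \<times> UNIV) (\<lambda>z. (case z of (s, x) \<Rightarrow> ?f' s x) * g (snd z))"
   by (intro continuous_intros smooth_slab_continuous[OF smooth_slab_direction[OF f]] continuous_on_compose2[OF g(1)]) auto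
  then show "continuous_on ({0..T} \<times> UNIV) (\<lambda>(s, x). ?f' s x * g x)" by (simp add: case_prod_beta')
 qed (use R t in auto)
qed

text \<open>Smoothness up to \<open>t = 0\<close> makes two time derivatives of the observable
  continuous on the compact interval. The constant \<open>c\<close> depends on the solution; it only
  has to be finite, because every integer \<open>n\<close> is eventually tried.\<close>

lemma slab_second_difference:
 fixes f :: "real \<Rightarrow> real^3 \<Rightarrow> real"
 assumes T: "0 < T" and f: "smooth_slab T f" and g: "cont g" "bsupp g"
 defines "q \<equiv> \<lambda>t. LBINT x. f t x * g x"
 obtains c where "\<And>t. 0 \<le> t \<Longrightarrow> 2 * t \<le> T \<Longrightarrow> \<bar>q 0 - 2 * q t + q (2 * t)\<bar> \<le> c * t^2"
proof -
 define f1 where "f1 t x = slab_derivative T f (t, x) (1, 0)" for t x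
 have f1: "smooth_slab T f1" unfolding f1_def by (rule smooth_slab_direction[OF f])
 define f2 where "f2 t x = slab_derivative T f1 (t, x) (1, 0)" for t x
 have f2: "smooth_slab T f2" unfolding f2_def by (rule smooth_slab_direction[OF f1])
 define q1 where "q1 t = (LBINT x. f1 t x * g x)" for t
 define q2 where "q2 t = (LBINT x. f2 t x * g x)" for t
 have d: "(q has_real_derivative q1 t) (at t within {0..T})" if "t \<in> {0..T}" for t
  unfolding q_def q1_def f1_def by (rule slab_integral_derivative[OF f g that])
 have d1: "(q1 has_real_derivative q2 t) (at t within {0..T})" if "t \<in> {0..T}" for t
  unfolding q1_def q2_def f2_def by (rule slab_integral_derivative[OF f1 g that])
 have "continuous_on {0..T} q2"
  unfolding q2_def by (rule DERIV_continuous_on[OF slab_integral_derivative[OF f2 g]])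
 then have "bounded (q2 ` {0..T})" by (intro compact_imp_bounded compact_continuous_image) auto
 then obtain c where "\<forall>y\<in>q2 ` {0..T}. norm y \<le> c" unfolding bounded_iff by blast
 then have c: "\<bar>q2 t\<bar> \<le> c" if "t \<in> {0..T}" for t using that by simp
 have c0: "0 \<le> c" using c[of 0] T by auto
 show thesis
 proof (rule that)
  fix t :: real assume t: "0 \<le> t" "2 * t \<le> T"
  have "\<bar>q 0 - 2 * q t + q (2 * t)\<bar> \<le> (c * (2 * t)) * t"
  proof (rule second_difference_le[OF t d])
   fix s s' assume s: "s \<in> {0..2 * t}" "s' \<in> {0..2 * t}"
   have "norm (q1 s - q1 s') \<le> c * norm (s - s')"
    by (rule field_differentiable_bound[of "{0..2 * t}" q1 q2])
     (use s t c in \<open>auto intro!: DERIV_subset[OF d1]\<close>)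
   also have "\<dots> \<le> c * (2 * t)" using s c0 by (intro mult_left_mono) auto
   finally show "\<bar>q1 s - q1 s'\<bar> \<le> c * (2 * t)" by simp
  qed
  then show "\<bar>q 0 - 2 * q t + q (2 * t)\<bar> \<le> (2 * c) * t^2" by (simp add: power2_eq_square mult_ac)
 qed
qed

lemma L2_field_limit:
 fixes f :: "nat \<Rightarrow> 'i::finite \<Rightarrow> real^3 \<Rightarrow> real"
 assumes f: "\<And>n. L2_field (f n)" "\<And>n. fnorm (f n) \<le> c"
  and g: "\<And>i. cont (g i)" "\<And>i x. (\<lambda>n. f n i x) \<longlonglongrightarrow> g i x"
 shows "L2_field g" "fnorm g \<le> c"
proof -
 have c0: "0 \<le> c" using f(2)[of 0] fnorm_nonneg order_trans by blast
 have 1: "(\<lambda>x. \<Oplus>i. (f n i x)^2) \<in> borel_measurable lborel" "integ (\<lambda>x. \<Oplus>i. (f n i x)^2)" for n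
  using f(1)[of n] by (auto simp: L2_field_def)
 have 2: "(\<lambda>x. \<Oplus>i. (g i x)^2) \<in> borel_measurable lborel"
  by (simp add: cont_borel continuous_on_sum continuous_on_power g)
 have 3: "0 \<le> (\<Oplus>i. (f n i x)^2)" for n x by (intro sum_nonneg) auto
 have 4: "(LBINT x. (\<Oplus>i. (f n i x)^2)) \<le> c^2" for n
  unfolding fnorm_sq[symmetric] by (rule power_mono[OF f(2)]) simp
 have 5: "(\<lambda>n. \<Oplus>i. (f n i x)^2) \<longlonglongrightarrow> (\<Oplus>i. (g i x)^2)" for x
  by (intro tendsto_sum tendsto_power g)
 note * = fatou_L2[OF 1(1) 2 1(2) 3 4 5]
 show "L2_field g" using * g(1) by (simp add: L2_field_def)
 show "fnorm g \<le> c" unfolding fnorm_def using *(2) c0 by (intro real_le_lsqrt) auto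
qed

text \<open>
 With \<open>\<delta>\<close> from \<open>perturbation\<close>: no solution starting \<open>\<delta>\<close>-close to \<open>V\<close> has lifespan at least \<open>1 / n\<close> and energy
 and pressure bounds at most \<open>n\<close>.
\<close>

definition refutes :: "real \<Rightarrow> real \<Rightarrow> (3 \<Rightarrow> real^3 \<Rightarrow> real) \<Rightarrow> bool" where
 "refutes n \<delta> V \<longleftrightarrow> (\<forall>U Ut p T E. nse_solution U Ut p T E \<longrightarrow> 1 \<le> n * T \<longrightarrow> E \<le> n \<longrightarrow>
   (\<forall>t\<ge>0. 2 * t \<le> T \<longrightarrow> \<bar>bform kernel (\<lambda>i. U i 0) (\<lambda>i. U i 0) - 2 * bform kernel (\<lambda>i. U i t) (\<lambda>i. U i t)
    + bform kernel (\<lambda>i. U i (2 * t)) (\<lambda>i. U i (2 * t))\<bar> \<le> n * t^2) \<longrightarrow>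
   \<delta> < fnorm (\<lambda>i x. U i 0 x - V i x))"

text \<open>\<open>R\<close> confines the support of the field built so far, and
  \<open>\<kappa>\<close> is the budget for the next change. The condition
  \<open>real m \<le> R\<close> makes the balls exhaust the space, whence the sum of all packets is
  locally finite.\<close>

definition stage :: "nat \<Rightarrow> (3 \<Rightarrow> real^3 \<Rightarrow> real) \<times> real \<times> real \<Rightarrow> bool" where
 "stage m = (\<lambda>(V, R, \<kappa>). (\<forall>i k. Ck k (V i)) \<and> real m \<le> R \<and> (\<forall>i x. R < norm x \<longrightarrow> V i x = 0) \<and>
  (\<forall>x. (\<Oplus>i. pd i (V i) x) = 0) \<and> 0 < \<kappa>)"

text \<open>Budgets at least halve, so all changes after the new stage add up to at most
  \<open>2 * \<kappa>'\<close>. With \<open>2 * \<kappa>' \<le> \<delta>\<close> the final field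
  stays within the tolerance of the refutation obtained here.\<close>

definition next_stage :: "nat \<Rightarrow> (3 \<Rightarrow> real^3 \<Rightarrow> real) \<times> real \<times> real \<Rightarrow> (3 \<Rightarrow> real^3 \<Rightarrow> real) \<times> real \<times> real \<Rightarrow> bool" where
 "next_stage m = (\<lambda>(V, R, \<kappa>) (V', R', \<kappa>'). \<exists>\<delta>. (\<forall>i x. norm x \<le> R \<longrightarrow> V' i x = V i x) \<and> R \<le> R' \<and>
  fnorm (\<lambda>i x. V' i x - V i x) \<le> \<kappa> \<and> (\<forall>j. fnorm (\<lambda>i x. pd j (V' i) x - pd j (V i) x) \<le> \<kappa>) \<and>
  2 * \<kappa>' \<le> \<kappa> \<and> 2 * \<kappa>' \<le> \<delta> \<and> refutes (real (Suc m)) \<delta> V')"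

lemma next_stage_exists:
 assumes "stage m s" shows "\<exists>s'. stage (Suc m) s' \<and> next_stage m s s'"
proof -
 obtain V R \<kappa> where s: "s = (V, R, \<kappa>)" by (cases s)
 have V: "Ck k (V i)" and mR: "real m \<le> R" and VR: "R < norm x \<Longrightarrow> V i x = 0"
  and divV: "(\<Oplus>i. pd i (V i) x) = 0" and \<kappa>: "0 < \<kappa>" for i k x
  using assms by (auto simp: stage_def s)
 have R0: "0 \<le> R" using mR by (rule order_trans[rotated]) simp
 have "\<exists>b \<delta> R'. 0 < \<delta> \<and> (\<forall>i k. Ck k (b i)) \<and> (\<forall>i x. norm x \<le> R \<longrightarrow> b i x = 0) \<and>
  (\<forall>i x. R' < norm x \<longrightarrow> b i x = 0) \<and> (\<forall>x. (\<Oplus>i. pd i (b i) x) = 0) \<and>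
  fnorm b \<le> \<kappa> \<and> (\<forall>j. fnorm (\<lambda>i. pd j (b i)) \<le> \<kappa>) \<and> refutes (real (Suc m)) \<delta> (\<lambda>i x. V i x + b i x)"
  unfolding refutes_def by (rule perturbation[OF V R0 VR divV _ \<kappa>]) simp_all
 then obtain b \<delta> R' where \<delta>: "0 < \<delta>" and b: "\<And>i k. Ck k (b i)" and bR: "\<And>i x. norm x \<le> R \<Longrightarrow> b i x = 0"
  and bR': "\<And>i x. R' < norm x \<Longrightarrow> b i x = 0" and divb: "\<And>x. (\<Oplus>i. pd i (b i) x) = 0"
  and nb: "fnorm b \<le> \<kappa>" "\<And>j. fnorm (\<lambda>i. pd j (b i)) \<le> \<kappa>" and ref: "refutes (real (Suc m)) \<delta> (\<lambda>i x. V i x + b i x)"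
  by blast
 have pb: "pd j (\<lambda>x. V i x + b i x) = (\<lambda>x. pd j (V i) x + pd j (b i) x)" for i j
  by (rule partial_add[OF V b])
 let ?s = "(\<lambda>i x. V i x + b i x, max (R + 1) R', min \<kappa> \<delta> / 2)"
 have "stage (Suc m) ?s"
  unfolding stage_def using V b mR VR bR' divV divb \<kappa> \<delta> by (auto simp: pb sum.distrib intro!: Ck_add)
 moreover have "next_stage m s ?s"
  unfolding next_stage_def s using bR nb ref by (auto simp: pb intro!: exI[of _ \<delta>])
 ultimately show ?thesis by blast
qed

text \<open>Near each point the stages are eventually constant, which gives smoothness and vanishing
  divergence of the limit. The L^2 bounds for the field and its gradient pass to the limit by
  Fatou's lemma.\<close>

lemma initial_datum:
 obtains w :: "3 \<Rightarrow> real^3 \<Rightarrow> real" where "\<And>i k. Ck k (w i)" "\<And>x. (\<Oplus>i. pd i (w i) x) = 0"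
  "L2_field w" "\<And>j. L2_field (\<lambda>i. pd j (w i))"
  "\<And>N. \<exists>n\<ge>N. \<exists>\<delta> V. refutes (real n) \<delta> V \<and> fnorm (\<lambda>i x. w i x - V i x) \<le> \<delta>"
proof -
 have "stage 0 (\<lambda>i x. 0, 0, 1)" by (simp add: stage_def)
 then have "\<exists>f. \<forall>m. stage m (f m) \<and> next_stage m (f m) (f (Suc m))"
  by (intro dependent_nat_choice[of stage next_stage]) (use next_stage_exists in blast)+
 then obtain f where f: "\<And>m. stage m (f m)" "\<And>m. next_stage m (f m) (f (Suc m))" by blast
 define V where "V m = fst (f m)" for m
 define R where "R m = fst (snd (f m))" for m
 define \<kappa> where "\<kappa> m = snd (snd (f m))" for m
 have fm: "f m = (V m, R m, \<kappa> m)" for m by (simp add: V_def R_def \<kappa>_def)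
 have CV: "Ck k (V m i)" and mR: "real m \<le> R m" and VR: "R m < norm x \<Longrightarrow> V m i x = 0"
  and divV: "(\<Oplus>i. pd i (V m i) x) = 0" and \<kappa>: "0 < \<kappa> m" for i k x m
  using f(1)[of m] unfolding fm stage_def by auto
 have Vsame: "norm x \<le> R m \<Longrightarrow> V (Suc m) i x = V m i x" and Rinc: "R m \<le> R (Suc m)"
  and d0: "fnorm (\<lambda>i x. V (Suc m) i x - V m i x) \<le> \<kappa> m"
  and d1: "fnorm (\<lambda>i x. pd j (V (Suc m) i) x - pd j (V m i) x) \<le> \<kappa> m"
  and \<kappa>2: "2 * \<kappa> (Suc m) \<le> \<kappa> m" and \<delta>: "\<exists>\<delta>. 2 * \<kappa> (Suc m) \<le> \<delta> \<and> refutes (real (Suc m)) \<delta> (V (Suc m))"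
  for i x m j
  using f(2)[of m] unfolding fm next_stage_def by auto
 have Rmono: "R m \<le> R n" if "m \<le> n" for m n using lift_Suc_mono_le[of R, OF Rinc that] .
 have Veq: "V n i x = V m i x" if "m \<le> n" "norm x \<le> R m" for m n i x
  using that(1)
 proof (induction n rule: dec_induct)
  case (step n)
  then have "norm x \<le> R n" using that(2) Rmono[of m n] by simp
  then show ?case using Vsame step by simp
 qed simp
 \<comment> \<open>The stage with index at least \<open>norm x\<close> is already final at
   \<open>x\<close>, since its radius is at least its index.\<close>
 define w where "w i x = V (nat \<lceil>norm x\<rceil>) i x" for i x
 have w_eq: "w i x = V m i x" if "norm x \<le> R m" for i x m
 proof -
  let ?m = "nat \<lceil>norm x\<rceil>"
  have "norm x \<le> real ?m" by (rule real_nat_ceiling_ge)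
  then have "norm x \<le> R ?m" using mR[of ?m] by linarith
  then have "V (max m ?m) i x = V ?m i x" by (intro Veq) auto
  moreover have "V (max m ?m) i x = V m i x" by (intro Veq that) auto
  ultimately show ?thesis by (simp add: w_def)
 qed
 have ball: "\<exists>m S. open S \<and> x \<in> S \<and> (\<forall>n\<ge>m. \<forall>i. \<forall>y\<in>S. w i y = V n i y)" for x
 proof -
  obtain m :: nat where m: "norm x < real m" using reals_Archimedean2 by blast
  have "w i y = V n i y" if "m \<le> n" "norm y < real m" for i y n
   by (rule w_eq) (use that mR[of n] in auto)
  then show ?thesis
   using m by (intro exI[of _ m] exI[of _ "{y. norm y < real m}"]) (auto intro!: open_Collect_less continuous_intros)
 qed
 have Cw: "Ck k (w i)" for i k
 proof (rule Ck_on_local)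
  fix x
  obtain m S where mS: "open S" "x \<in> S" "\<forall>n\<ge>m. \<forall>i. \<forall>y\<in>S. w i y = V n i y" using ball[of x] by (elim exE conjE)
  have "\<forall>y\<in>S. w i y = V m i y" using mS(3) by simp
  then show "\<exists>S. open S \<and> x \<in> S \<and> (\<exists>g. Ck k g \<and> (\<forall>y\<in>S. w i y = g y))"
   by (intro exI[of _ S] exI[of _ "V m i"] conjI mS CV)
 qed
 have ev: "\<forall>\<^sub>F n in sequentially. V n i x = w i x" "\<forall>\<^sub>F n in sequentially. pd j (V n i) x = pd j (w i) x" for i j x
 proof -
  obtain m S where S: "open S" "x \<in> S" "\<forall>n\<ge>m. \<forall>i. \<forall>y\<in>S. w i y = V n i y" using ball[of x] by (elim exE conjE)
  have "V n i x = w i x" if "m \<le> n" for n using S that by simp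
  then show "\<forall>\<^sub>F n in sequentially. V n i x = w i x"
   unfolding eventually_sequentially by blast
  have "pd j (V n i) x = pd j (w i) x" if "m \<le> n" for n
   by (rule partial_cong_open[OF S(1,2)]) (use S(3) that in simp)
  then show "\<forall>\<^sub>F n in sequentially. pd j (V n i) x = pd j (w i) x"
   unfolding eventually_sequentially by blast
 qed
 have divw: "(\<Oplus>i. pd i (w i) x) = 0" for x
 proof -
  obtain m S where S: "open S" "x \<in> S" "\<forall>n\<ge>m. \<forall>i. \<forall>y\<in>S. w i y = V n i y" using ball[of x] by (elim exE conjE)
  have "pd i (w i) x = pd i (V m i) x" for i by (rule partial_cong_open[OF S(1,2)]) (use S(3) in simp)
  then show ?thesis using divV by simp
 qed
 have Vb: "bsupp (V m i)" for m i by (rule bsuppI) (rule VR)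
 have CV1: "cont (V m i)" "cont (pd j (V m i))" for m i j
  by (rule Ck_cont[OF CV], rule Ck_cont[OF Ck_partial[OF CV]])
 \<comment> \<open>As \<open>2 * \<kappa> (Suc m) \<le> \<kappa> m\<close>, each change is at most
   \<open>2 * \<kappa> m - 2 * \<kappa> (Suc m)\<close>, which telescopes.\<close>
 have tele: "fnorm (\<lambda>i x. G (m + k) i x - G m i x) \<le> 2 * \<kappa> m - 2 * \<kappa> (m + k)"
  if G: "\<And>m. L2_field (G m)" "\<And>m. fnorm (\<lambda>i x. G (Suc m) i x - G m i x) \<le> \<kappa> m" for G :: "nat \<Rightarrow> 3 \<Rightarrow> real^3 \<Rightarrow> real" and m k
 proof (induction k)
  case (Suc k)
  have eq: "G (m + Suc k) i x - G m i x = (G (Suc (m + k)) i x - G (m + k) i x) + (G (m + k) i x - G m i x)" for i x by simp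
  have "fnorm (\<lambda>i x. G (m + Suc k) i x - G m i x) \<le> fnorm (\<lambda>i x. G (Suc (m + k)) i x - G (m + k) i x) + fnorm (\<lambda>i x. G (m + k) i x - G m i x)"
   unfolding eq by (rule fnorm_triangle[OF L2_field_diff[OF G(1) G(1)] L2_field_diff[OF G(1) G(1)]])
  then show ?case using Suc G(2)[of "m + k"] \<kappa>2[of "m + k"] by simp
 qed (simp add: fnorm_def)
 have lim: "L2_field (\<lambda>i x. g i x - G m i x)" "fnorm (\<lambda>i x. g i x - G m i x) \<le> 2 * \<kappa> m"
  if G: "\<And>m. L2_field (G m)" "\<And>m. fnorm (\<lambda>i x. G (Suc m) i x - G m i x) \<le> \<kappa> m"
   and g: "\<And>i. cont (g i)" "\<And>i x. \<forall>\<^sub>F n in sequentially. G n i x = g i x" for G :: "nat \<Rightarrow> 3 \<Rightarrow> real^3 \<Rightarrow> real" and g m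
 proof -
  have le: "fnorm (\<lambda>i x. G (m + k) i x - G m i x) \<le> 2 * \<kappa> m" for k
   using tele[of G m k, OF G] \<kappa>[of "m + k"] by linarith
  have c: "(\<lambda>k. G (m + k) i x - G m i x) \<longlonglongrightarrow> g i x - G m i x" for i x
  proof -
   have "(\<lambda>n. G n i x) \<longlonglongrightarrow> g i x" by (rule tendsto_eventually[OF g(2)])
   then have "(\<lambda>k. G (k + m) i x) \<longlonglongrightarrow> g i x" by (rule LIMSEQ_ignore_initial_segment)
   then show ?thesis by (intro tendsto_diff tendsto_const) (simp add: add.commute)
  qed
  have cc: "cont (\<lambda>x. g i x - G m i x)" for i
   by (intro continuous_intros g L2_field_cont G)
  show "L2_field (\<lambda>i x. g i x - G m i x)" "fnorm (\<lambda>i x. g i x - G m i x) \<le> 2 * \<kappa> m"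
   using L2_field_limit[where f = "\<lambda>k i x. G (m + k) i x - G m i x" and g = "\<lambda>i x. g i x - G m i x", OF L2_field_diff[OF G(1) G(1)] le cc c] by auto
 qed
 have VL: "L2_field (V m)" "L2_field (\<lambda>i. pd j (V m i))" for m j
  by (rule L2_field_cs; intro CV1 Vb bsupp_partial)+
 have wc: "cont (w i)" "cont (pd j (w i))" for i j
  by (rule Ck_cont[OF Cw], rule Ck_cont[OF Ck_partial[OF Cw]])
 have wV: "L2_field (\<lambda>i x. w i x - V m i x)" "fnorm (\<lambda>i x. w i x - V m i x) \<le> 2 * \<kappa> m" for m
  using lim[of V w m, OF VL(1) d0 wc(1) ev(1)] by auto
 have pwV: "L2_field (\<lambda>i x. pd j (w i) x - pd j (V m i) x)" for j m
  using lim(1)[of "\<lambda>m i. pd j (V m i)" "\<lambda>i. pd j (w i)" m, OF VL(2) d1 wc(2) ev(2)] .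
 show thesis
 proof (rule that[of w])
  show "L2_field w" using L2_field_add[OF wV(1)[of 0] VL(1)[of 0]] by simp
  show "L2_field (\<lambda>i. pd j (w i))" for j using L2_field_add[OF pwV[of j 0] VL(2)[of j 0]] by simp
  show "\<exists>n\<ge>N. \<exists>\<delta> V. refutes (real n) \<delta> V \<and> fnorm (\<lambda>i x. w i x - V i x) \<le> \<delta>" for N
  proof -
   obtain \<delta> where \<delta>: "2 * \<kappa> (Suc N) \<le> \<delta>" "refutes (real (Suc N)) \<delta> (V (Suc N))" using \<delta> by blast
   have "fnorm (\<lambda>i x. w i x - V (Suc N) i x) \<le> \<delta>" using wV(2)[of "Suc N"] \<delta>(1) by linarith
   then show ?thesis using \<delta>(2) by (intro exI[of _ "Suc N"]) auto
  qed
 qed (rule Cw divw)+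
qed

text \<open>A given solution has a finite energy bound, a positive lifespan and a finite constant in
  its second differences. Some \<open>n\<close> with a refutation exceeds \<open>E\<close>,
  \<open>1 / T\<close> and that constant, and then the datum would have to be farther than
  \<open>\<delta>\<close> from a field within distance \<open>\<delta>\<close>.\<close>

lemma refutes_solution:
 assumes w: "\<And>N. \<exists>n\<ge>N. \<exists>\<delta> V. refutes (real n) \<delta> V \<and> fnorm (\<lambda>i x. w i x - V i x) \<le> \<delta>"
  and sol: "nse_solution U Ut p T E"
 shows "(\<lambda>i. U i 0) \<noteq> w"
proof
 interpret nse_solution U Ut p T E by (rule sol)
 assume U0: "(\<lambda>i. U i 0) = w"
 let ?q = "\<lambda>t. bform kernel (\<lambda>i. U i t) (\<lambda>i. U i t)"
 let ?r = "\<lambda>t. LBINT x. pd 1 (p t) x * bump_density x"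
 have q: "?q t = - ?r t" if "t \<in> {0..T}" for t using pressure_probe[OF that] by simp
 obtain c where c: "\<And>t. 0 \<le> t \<Longrightarrow> 2 * t \<le> T \<Longrightarrow> \<bar>?r 0 - 2 * ?r t + ?r (2 * t)\<bar> \<le> c * t^2"
  using slab_second_difference[OF T smooth_slab_partial[OF p] Ck_cont[OF Ck_bump_density] bump_density_bsupp, of 1] by blast
 obtain N :: nat where N: "max c (max E (1 / T)) \<le> real N" using real_arch_simple by blast
 obtain n \<delta> V where n: "N \<le> n" and ref: "refutes (real n) \<delta> V" and le: "fnorm (\<lambda>i x. w i x - V i x) \<le> \<delta>"
  using w[of N] by blast
 have nN: "real N \<le> real n" using n by simp
 have "1 / T \<le> real n" "E \<le> real n" "c \<le> real n" using N nN by auto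
 have "\<delta> < fnorm (\<lambda>i x. U i 0 x - V i x)"
 proof (rule ref[unfolded refutes_def, rule_format, OF sol])
  show "1 \<le> real n * T" using \<open>1 / T \<le> real n\<close> T by (simp add: divide_le_eq)
  show "E \<le> real n" by fact
  fix t :: real assume t: "0 \<le> t" "2 * t \<le> T"
  then have m: "0 \<in> {0..T}" "t \<in> {0..T}" "2 * t \<in> {0..T}" by auto
  have "?q 0 - 2 * ?q t + ?q (2 * t) = - (?r 0 - 2 * ?r t + ?r (2 * t))" unfolding q[OF m(1)] q[OF m(2)] q[OF m(3)] by simp
  then have "\<bar>?q 0 - 2 * ?q t + ?q (2 * t)\<bar> \<le> c * t^2" using c[OF t] by simp
  also have "\<dots> \<le> real n * t^2" using \<open>c \<le> real n\<close> by (intro mult_right_mono) auto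
  finally show "\<bar>?q 0 - 2 * ?q t + ?q (2 * t)\<bar> \<le> real n * t^2" .
 qed
 moreover have "U i 0 x = w i x" for i x using fun_cong[OF fun_cong[OF U0, of i], of x] .
 ultimately show False using le by simp
qed

section \<open>Weak derivatives and the conclusion\<close>

lemma weak_partial_smooth:
 fixes f :: "real^'n::finite \<Rightarrow> real^'m::finite"
 assumes f: "Ck (Suc 0) f"
 shows "weak_partial i f (pd i f)"
 unfolding weak_partial_def
proof (intro allI impI)
 fix \<phi> :: "real^'n \<Rightarrow> real" assume "test_function \<phi>"
 then have \<phi>: "Ck k \<phi>" and cl: "compact (closure {x. \<phi> x \<noteq> 0})" for k by (auto simp: test_function_def smooth_on_def)
 have "bounded (closure {x. \<phi> x \<noteq> 0})" by (rule compact_imp_bounded[OF cl])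
 then have b: "bsupp \<phi>" unfolding bsupp_def by (rule bounded_subset) (rule closure_subset)
 have f1: "Ck 1 f" using f by simp
 have c: "cont f" "cont (pd i f)" "cont \<phi>" "cont (pd i \<phi>)"
  by (rule Ck_cont[OF f] Ck_cont[OF Ck_partial[OF f]] Ck_cont[OF \<phi>[of 0]] Ck_cont[OF Ck_partial[OF \<phi>[of "Suc 0"]]])+
 have I: "integ (\<lambda>x. \<psi> x *\<^sub>R h x)" "(\<lambda>x. \<psi> x *\<^sub>R h x) \<in> borel_measurable lborel"
  if \<psi>: "cont \<psi>" "bsupp \<psi>" and h: "cont h" for \<psi> :: "real^'n \<Rightarrow> real" and h :: "real^'n \<Rightarrow> real^'m"
 proof -
  have ch: "cont (\<lambda>x. \<psi> x *\<^sub>R h x)" by (intro continuous_intros \<psi> h)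
  obtain R where R: "\<And>x. R < norm x \<Longrightarrow> \<psi> x = 0" using bsuppE[OF \<psi>(2)] by blast
  have "integ (\<lambda>x. indicator (cball 0 R) x *\<^sub>R (\<psi> x *\<^sub>R h x))"
   by (rule borel_integrable_compact[OF compact_cball continuous_on_subset[OF ch]]) simp
  also have "(\<lambda>x. indicator (cball 0 R) x *\<^sub>R (\<psi> x *\<^sub>R h x)) = (\<lambda>x. \<psi> x *\<^sub>R h x)"
   using R by (auto simp: fun_eq_iff indicator_def intro: leI)
  finally show "integ (\<lambda>x. \<psi> x *\<^sub>R h x)" .
  show "(\<lambda>x. \<psi> x *\<^sub>R h x) \<in> borel_measurable lborel" using cont_borel[OF ch] by simp
 qed
 have comp: "(\<integral>x. \<psi> x *\<^sub>R h x \<partial>lebesgue) $ j = (LBINT x. \<psi> x * h x $ j)"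
  if \<psi>: "cont \<psi>" "bsupp \<psi>" and h: "cont h" for \<psi> :: "real^'n \<Rightarrow> real" and h :: "real^'n \<Rightarrow> real^'m" and j
  using integral_bounded_linear[OF bounded_linear_vec_nth I(1)[OF that], of j] I(2)[OF that]
  by (simp add: integral_completion)
 show "(\<integral>x. pd i \<phi> x *\<^sub>R f x \<partial>lebesgue) = - (\<integral>x. \<phi> x *\<^sub>R pd i f x \<partial>lebesgue)"
 proof (rule vec_eq_iff[THEN iffD2], rule allI)
  fix j
  have "(\<integral>x. pd i \<phi> x *\<^sub>R f x \<partial>lebesgue) $ j = (LBINT x. pd i \<phi> x * f x $ j)"
   by (rule comp[OF c(4) bsupp_partial[OF b] c(1)])
  also have "\<dots> = - (LBINT x. \<phi> x * pd i f x $ j)"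
   using integral_by_parts[OF \<phi> Ck_nth[OF f1], of j i] b by (simp add: partial_nth[OF f1])
  also have "\<dots> = (- (\<integral>x. \<phi> x *\<^sub>R pd i f x \<partial>lebesgue)) $ j"
   by (simp add: comp[OF c(3) b c(2)])
  finally show "(\<integral>x. pd i \<phi> x *\<^sub>R f x \<partial>lebesgue) $ j = (- (\<integral>x. \<phi> x *\<^sub>R pd i f x \<partial>lebesgue)) $ j" .
 qed
qed

lemma in_L2_field:
 fixes f :: "real^3 \<Rightarrow> real^'m::finite"
 assumes c: "cont f" and L: "L2_field (\<lambda>i x. f x $ i)"
 shows "in_L2 f"
 using L by (simp add: in_L2_continuous(1)[OF c] norm_vec_sq L2_field_def)

theorem theorem1p12:
  shows "\<exists>u0 :: real^3 \<Rightarrow> real^3.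
           smooth_on UNIV u0 \<and> divergence_free u0 \<and> in_H1 u0 \<and>
           (\<forall>T>0. \<not> (\<exists>u p. smooth_finite_energy_solution u p u0 T))"
proof (rule initial_datum)
 fix w :: "3 \<Rightarrow> real^3 \<Rightarrow> real"
 assume Cw: "\<And>i k. Ck k (w i)" and divw: "\<And>x. (\<Oplus>i. pd i (w i) x) = 0"
  and L: "L2_field w" "\<And>j. L2_field (\<lambda>i. pd j (w i))"
  and ref: "\<And>N. \<exists>n\<ge>N. \<exists>\<delta> V. refutes (real n) \<delta> V \<and> fnorm (\<lambda>i x. w i x - V i x) \<le> \<delta>"
 define u0 :: "real^3 \<Rightarrow> real^3" where "u0 x = (\<chi> i. w i x)" for x
 have nth: "(\<lambda>x. u0 x $ i) = w i" for i by (simp add: u0_def)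
 have Cu: "Ck k u0" for k unfolding u0_def by (rule Ck_vec[OF Cw])
 have pn: "(\<lambda>x. pd j u0 x $ i) = pd j (w i)" for i j
  using partial_nth[OF Cu[of 1], of j i] unfolding nth by simp
 have "smooth_on UNIV u0" using Cu by (simp add: smooth_on_def)
 moreover have "divergence_free u0" by (simp add: divergence_free_def divergence_def nth divw)
 moreover have "in_H1 u0"
  unfolding in_H1_def
 proof (intro conjI allI exI)
  show "in_L2 u0" by (rule in_L2_field[OF Ck_cont[OF Cu]]) (simp add: nth L)
  show "in_L2 (pd i u0)" for i by (rule in_L2_field[OF Ck_cont[OF Ck_partial[OF Cu]]]) (simp add: pn L)
  show "weak_partial i u0 (pd i u0)" for i by (rule weak_partial_smooth[OF Cu])
 qed
 moreover have False if sol: "smooth_finite_energy_solution u p u0 T" for u p T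
 proof -
  obtain E Ut where n: "nse_solution (\<lambda>i t x. u t x $ i) Ut p T E" by (rule nse_solution_of_smooth[OF sol])
  have "u 0 x = u0 x" for x using sol by (simp add: smooth_finite_energy_solution_def)
  then have "(\<lambda>i x. u 0 x $ i) = w" by (simp add: u0_def fun_eq_iff)
  then show False using refutes_solution[OF ref n] by simp
 qed
 ultimately show ?thesis by blast
qed

end
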